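(* Let $N\ge 2$, let $\Omega\subset\mathbb{R}^N$ be a bounded domain, and let $F$ and $Q$ be as in the context. There exists a constant $\lambda_0>0$ such that for every $0<\lambda<\lambda_0$ the problem $$-Qu=\lambda e^{u}\ \text{in }\Omega,\qquad u=0\ \text{on }\partial\Omega$$ has a minimal solution $\underline{u}$, and $\underline{u}$ is regular and stable.
   Context: Standing assumptions on $F$: $F:\mathbb{R}^N\to[0,\infty)$ is convex, $F\in C^2(\mathbb{R}^N\setminus\{0\})$, $F(t\xi)=|t|F(\xi)$ for all $t\in\mathbb{R}$, $\xi\in\mathbb{R}^N$, $F(\xi)>0$ for $\xi\neq 0$; there are constants $0<a\le b<\infty$ with $a|\xi|\le F(\xi)\le b|\xi|$ for all $\xi$, and constants $0<\mu\le\Lambda<\infty$ with $\mu^2|V|^2\le\sum_{i,j}F_{\xi_i\xi_j}(\xi)V_iV_j\le\Lambda|V|^2$ for all $\xi$ with $|\xi|=1$ and all $V\in\mathbb{R}^N$ with $\langle V,\xi\rangle=0$. The Finsler (anisotropic) Laplacian is $Qu:=\sum_{i=1}^N\partial_{x_i}\big(F(\nabla u)F_{\xi_i}(\nabla u)\big)$, where $F_{\xi_i}=\partial F/\partial\xi_i$ (with $F(\nabla u)F_\xi(\nabla u):=0$ where $\nabla u=0$). A (weak) solution of the problem is $u\in W_0^{1,2}(\Omega)$ with $e^u\in L^1_{loc}(\Omega)$ and $\int_\Omega F(\nabla u)F_\xi(\nabla u)\cdot\nabla\phi\,dx=\lambda\int_\Omega e^u\phi\,dx$ for all $\phi\in C_c^\infty(\Omega)$.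 A supersolution is $u$ with $-Qu\ge\lambda e^u$ in $\Omega$ (weakly) and $u\ge0$ on $\partial\Omega$. A solution $\underline u$ is minimal if $u\ge\underline u$ for every supersolution $u$. A solution is regular if $e^u\in L^\infty(\Omega)$. A solution $u$ is stable if for all $\phi\in C_c^\infty(\Omega)$: $\int_\Omega \big[F_{\xi_i}(\nabla u)F_{\xi_j}(\nabla u)\phi_{x_i}\phi_{x_j}+F(\nabla u)F_{\xi_i\xi_j}(\nabla u)\phi_{x_i}\phi_{x_j}-\lambda e^u\phi^2\big]dx\ge0$ (summation over $i,j$). *)

theory Defs
  imports "HOL-Analysis.Analysis"
begin

definition pd :: "'n::finite \<Rightarrow> (real^'n \<Rightarrow> real) \<Rightarrow> real^'n \<Rightarrow> real" where
  "pd i f x = frechet_derivative f (at x) (axis i 1)"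

definition grad :: "(real^'n::finite \<Rightarrow> real) \<Rightarrow> real^'n \<Rightarrow> real^'n" where
  "grad f x = (\<chi> i. pd i f x)"

fun iter_pd :: "'n::finite list \<Rightarrow> (real^'n \<Rightarrow> real) \<Rightarrow> real^'n \<Rightarrow> real" where
  "iter_pd [] f = f"
| "iter_pd (i # is) f = pd i (iter_pd is f)"

text \<open>C^infinity: all iterated partial derivatives exist and are differentiable everywhere
  (hence all of them are continuous).\<close>
definition smooth :: "(real^'n::finite \<Rightarrow> real) \<Rightarrow> bool" where
  "smooth f \<longleftrightarrow> (\<forall>is x. iter_pd is f differentiable (at x))"

definition test_fun :: "(real^'n::finite) set \<Rightarrow> (real^'n \<Rightarrow> real) \<Rightarrow> bool" where
  "test_fun \<Omega> \<phi> \<longleftrightarrow> smooth \<phi> \<and> compact (closure {x. \<phi> x \<noteq> 0})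
      \<and> closure {x. \<phi> x \<noteq> 0} \<subseteq> \<Omega>"

definition L1_loc :: "(real^'n::finite) set \<Rightarrow> (real^'n \<Rightarrow> real) \<Rightarrow> bool" where
  "L1_loc \<Omega> f \<longleftrightarrow> (\<forall>K. compact K \<and> K \<subseteq> \<Omega> \<longrightarrow> set_integrable lborel K f)"

definition weak_grad :: "(real^'n::finite) set \<Rightarrow> (real^'n \<Rightarrow> real) \<Rightarrow> (real^'n \<Rightarrow> real^'n) \<Rightarrow> bool" where
  "weak_grad \<Omega> u g \<longleftrightarrow> L1_loc \<Omega> u \<and> (\<forall>i. L1_loc \<Omega> (\<lambda>x. g x $ i)) \<and>
     (\<forall>\<phi> i. test_fun \<Omega> \<phi> \<longrightarrow>
        (LINT x:\<Omega>|lborel. u x * pd i \<phi> x) = - (LINT x:\<Omega>|lborel. g x $ i * \<phi> x))"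

definition W12 :: "(real^'n::finite) set \<Rightarrow> (real^'n \<Rightarrow> real) \<Rightarrow> (real^'n \<Rightarrow> real^'n) \<Rightarrow> bool" where
  "W12 \<Omega> u g \<longleftrightarrow> weak_grad \<Omega> u g \<and>
     set_integrable lborel \<Omega> (\<lambda>x. (u x)\<^sup>2) \<and> set_integrable lborel \<Omega> (\<lambda>x. (norm (g x))\<^sup>2)"

definition W012 :: "(real^'n::finite) set \<Rightarrow> (real^'n \<Rightarrow> real) \<Rightarrow> (real^'n \<Rightarrow> real^'n) \<Rightarrow> bool" where
  "W012 \<Omega> u g \<longleftrightarrow> W12 \<Omega> u g \<and>
     (\<exists>\<psi> :: nat \<Rightarrow> real^'n \<Rightarrow> real. (\<forall>k. test_fun \<Omega> (\<psi> k)) \<and>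
        (\<lambda>k. LINT x:\<Omega>|lborel. (\<psi> k x - u x)\<^sup>2 + (norm (grad (\<psi> k) x - g x))\<^sup>2) \<longlonglongrightarrow> 0)"

definition Fgrad :: "(real^'n::finite \<Rightarrow> real) \<Rightarrow> real^'n \<Rightarrow> real^'n" where
  "Fgrad F \<xi> = (if \<xi> = 0 then 0 else (\<chi> i. frechet_derivative F (at \<xi>) (axis i 1)))"

definition Fhess :: "(real^'n::finite \<Rightarrow> real) \<Rightarrow> real^'n \<Rightarrow> real^'n^'n" where
  "Fhess F \<xi> = (if \<xi> = 0 then 0 else
     (\<chi> i j. frechet_derivative (\<lambda>\<eta>. Fgrad F \<eta> $ j) (at \<xi>) (axis i 1)))"

definition C2_away_from_0 :: "(real^'n::finite \<Rightarrow> real) \<Rightarrow> bool" where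
  "C2_away_from_0 F \<longleftrightarrow>
     (\<forall>\<xi>. \<xi> \<noteq> 0 \<longrightarrow> F differentiable (at \<xi>) \<and> (\<forall>j. (\<lambda>\<eta>. Fgrad F \<eta> $ j) differentiable (at \<xi>)))
     \<and> continuous_on (- {0}) (Fhess F)"

definition finsler_norm :: "(real^'n::finite \<Rightarrow> real) \<Rightarrow> bool" where
  "finsler_norm F \<longleftrightarrow> convex_on UNIV F \<and> (\<forall>\<xi>. F \<xi> \<ge> 0) \<and> C2_away_from_0 F \<and>
     (\<forall>t \<xi>. F (t *\<^sub>R \<xi>) = \<bar>t\<bar> * F \<xi>) \<and> (\<forall>\<xi>. \<xi> \<noteq> 0 \<longrightarrow> F \<xi> > 0) \<and>
     (\<exists>a b. 0 < a \<and> a \<le> b \<and> (\<forall>\<xi>. a * norm \<xi> \<le> F \<xi> \<and> F \<xi> \<le> b * norm \<xi>)) \<and>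
     (\<exists>\<mu> \<Lambda>. 0 < \<mu> \<and> \<mu> \<le> \<Lambda> \<and>
        (\<forall>\<xi> V. norm \<xi> = 1 \<and> V \<bullet> \<xi> = 0 \<longrightarrow>
           \<mu>\<^sup>2 * (norm V)\<^sup>2 \<le> V \<bullet> (Fhess F \<xi> *v V) \<and> V \<bullet> (Fhess F \<xi> *v V) \<le> \<Lambda> * (norm V)\<^sup>2))"

text \<open>Weak solution u in W_0^{1,2}, with (a.e. unique) weak gradient g; F(0)F_xi(0) := 0.\<close>
definition weak_solution ::
  "(real^'n::finite \<Rightarrow> real) \<Rightarrow> (real^'n) set \<Rightarrow> real \<Rightarrow> (real^'n \<Rightarrow> real) \<Rightarrow> (real^'n \<Rightarrow> real^'n) \<Rightarrow> bool" where
  "weak_solution F \<Omega> lam u g \<longleftrightarrow> W012 \<Omega> u g \<and> L1_loc \<Omega> (\<lambda>x. exp (u x)) \<and>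
     (\<forall>\<phi>. test_fun \<Omega> \<phi> \<longrightarrow>
        (LINT x:\<Omega>|lborel. F (g x) * (Fgrad F (g x) \<bullet> grad \<phi> x)) = lam * (LINT x:\<Omega>|lborel. exp (u x) * \<phi> x))"

text \<open>Supersolution: u in W^{1,2}(Omega), e^u in L^1_loc, -Qu >= lambda e^u weakly
  (tested with nonnegative test functions), and u >= 0 on the boundary in the sense
  min(u,0) in W_0^{1,2}(Omega).\<close>
definition supersolution :: "(real^'n::finite \<Rightarrow> real) \<Rightarrow> (real^'n) set \<Rightarrow> real \<Rightarrow> (real^'n \<Rightarrow> real) \<Rightarrow> bool" where
  "supersolution F \<Omega> lam u \<longleftrightarrow> (\<exists>g. W12 \<Omega> u g \<and> L1_loc \<Omega> (\<lambda>x. exp (u x)) \<and>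
     (\<forall>\<phi>. test_fun \<Omega> \<phi> \<and> (\<forall>x. \<phi> x \<ge> 0) \<longrightarrow>
        (LINT x:\<Omega>|lborel. F (g x) * (Fgrad F (g x) \<bullet> grad \<phi> x)) \<ge> lam * (LINT x:\<Omega>|lborel. exp (u x) * \<phi> x))
     \<and> (\<exists>h. W012 \<Omega> (\<lambda>x. min (u x) 0) h))"

definition minimal_solution ::
  "(real^'n::finite \<Rightarrow> real) \<Rightarrow> (real^'n) set \<Rightarrow> real \<Rightarrow> (real^'n \<Rightarrow> real) \<Rightarrow> (real^'n \<Rightarrow> real^'n) \<Rightarrow> bool" where
  "minimal_solution F \<Omega> lam u g \<longleftrightarrow> weak_solution F \<Omega> lam u g \<and>
     (\<forall>v. supersolution F \<Omega> lam v \<longrightarrow> (AE x in lborel. x \<in> \<Omega> \<longrightarrow> u x \<le> v x))"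

definition regular_sol :: "(real^'n::finite) set \<Rightarrow> (real^'n \<Rightarrow> real) \<Rightarrow> bool" where
  "regular_sol \<Omega> u \<longleftrightarrow> set_borel_measurable lborel \<Omega> (\<lambda>x. exp (u x)) \<and>
     (\<exists>C. AE x in lborel. x \<in> \<Omega> \<longrightarrow> exp (u x) \<le> C)"

definition stable_sol ::
  "(real^'n::finite \<Rightarrow> real) \<Rightarrow> (real^'n) set \<Rightarrow> real \<Rightarrow> (real^'n \<Rightarrow> real) \<Rightarrow> (real^'n \<Rightarrow> real^'n) \<Rightarrow> bool" where
  "stable_sol F \<Omega> lam u g \<longleftrightarrow> (\<forall>\<phi>. test_fun \<Omega> \<phi> \<longrightarrow>
     (let I = (\<lambda>x. (Fgrad F (g x) \<bullet> grad \<phi> x)\<^sup>2 + F (g x) * (grad \<phi> x \<bullet> (Fhess F (g x) *v grad \<phi> x))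
                 - lam * exp (u x) * (\<phi> x)\<^sup>2)
      in set_integrable lborel \<Omega> I \<and> (LINT x:\<Omega>|lborel. I x) \<ge> 0))"

end

theory Submission
  imports Defs
begin

text \<open>
  Write \<open>A(\<xi>) = F(\<xi>) F\<^sub>\<xi>(\<xi>)\<close>, the gradient of \<open>F\<^sup>2/2\<close>. The bounds on the Hessian of \<open>F\<close>, together with
  homogeneity, make \<open>A\<close> Lipschitz and strongly monotone with some constant \<open>c\<close>. Replace \<open>\<lambda> e\<^sup>u\<close> by
  \<open>f(u) = \<lambda> exp(min u M)\<close>, whose Lipschitz constant \<open>\<lambda> e\<^sup>M\<close> is, for small \<open>\<lambda>\<close>, dominated by \<open>c\<close> divided by
  the Poincare constant. Then the energy is strongly convex on \<open>W\<^sub>0\<^sup>1\<^sup>,\<^sup>2\<close>, so minimising sequences are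
  Cauchy and converge to a solution \<open>u\<close> of the truncated problem, and weak comparison holds: \<open>u\<close> lies
  below every supersolution of the truncated problem, hence below every supersolution of the original one.
  Since \<open>A\<close> is linear on lines, \<open>R\<^sup>2 - x\<^sub>1\<^sup>2\<close> is an explicit supersolution with values at most \<open>M = R\<^sup>2\<close>;
  hence \<open>u \<le> M\<close> and \<open>u\<close> solves the original problem.

  Stability follows from the ellipticity of the second variation and the Poincare inequality once
  \<open>\<nabla>u \<noteq> 0\<close> almost everywhere, because the quadratic form is set to zero on \<open>{\<nabla>u = 0}\<close>. Difference quotients
  show that \<open>B = A(\<nabla>u)\<close> has increments of order \<open>\<bar>y\<bar>\<close> in \<open>L\<^sup>2\<close> locally, which forces \<open>div B = 0\<close> almost
  everywhere on \<open>{B = 0}\<close>; but \<open>- div B = f(u) > 0\<close>.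
\<close>

section \<open>Square-integrable functions\<close>

text \<open>The level \<open>M = R\<^sup>2\<close> depends on the domain alone, so
  \<open>lam\<close> is chosen after it. With \<open>K = lam * exp M\<close>, which bounds the
  truncated nonlinearity and also its Lipschitz constant, the two entries of \<open>lam0\<close>
  ensure \<open>K \<le> 2 * (F e)\<^sup>2\<close>, which makes the quadratic barrier a
  supersolution, and \<open>K * (4 * R\<^sup>2) \<le> c / 8\<close>, by which gradients dominate the
  zero-order term. The second bound serves three times: for existence, for comparison and for
  stability. Two obstacles shape the rest. A supersolution need not vanish on the boundary and test
  functions are smooth, so the positive part of \<open>u - v\<close> cannot be inserted directly;
  mollified substitutes are built whose supports stay inside the domain. And A need not be
  differentiable at 0, so the equation is not differentiated: the regularity of \<open>B\<close> is
  read off from its translation increments. What finally makes the leading error on the zero set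
  disappear is purely measure-theoretic: within a fixed ball the sets where
  \<open>0 < norm (B x) \<le> 2 * \<epsilon>\<close> shrink to the empty set.\<close>

definition L2 :: "('a::euclidean_space \<Rightarrow> 'b::euclidean_space) \<Rightarrow> bool" where
  "L2 f \<longleftrightarrow> f \<in> borel_measurable borel \<and> integrable lborel (\<lambda>x. (norm (f x))\<^sup>2)"

definition n2 :: "('a::euclidean_space \<Rightarrow> 'b::euclidean_space) \<Rightarrow> real" where
  "n2 f = (\<integral>x. (norm (f x))\<^sup>2 \<partial>lborel)"

text \<open>A non-integrable square has Bochner integral 0, so smallness of \<open>n2\<close> says
  something only for functions already known to be in \<open>L2\<close>; this is why
  \<open>L2\<close> hypotheses accompany \<open>L2lim\<close> throughout.\<close>

definition L2lim :: "(nat \<Rightarrow> 'a::euclidean_space \<Rightarrow> 'b::euclidean_space) \<Rightarrow> ('a \<Rightarrow> 'b) \<Rightarrow> bool" where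
  "L2lim s f \<longleftrightarrow> (\<lambda>k. n2 (\<lambda>x. s k x - f x)) \<longlonglongrightarrow> 0"

lemma L2_measurable [measurable_dest]: "L2 f \<Longrightarrow> f \<in> borel_measurable borel"
  and L2_integrable: "L2 f \<Longrightarrow> integrable lborel (\<lambda>x. (norm (f x))\<^sup>2)"
  by (auto simp: L2_def)

lemma n2_nonneg [simp]: "0 \<le> n2 f"
  by (simp add: n2_def)

lemma integrable_dominated_real:
  fixes g :: "'a::euclidean_space \<Rightarrow> real" and f :: "'a \<Rightarrow> 'b::euclidean_space"
  assumes "integrable lborel g" "f \<in> borel_measurable borel" "\<And>x. norm (f x) \<le> g x"
  shows "integrable lborel f"
  by (rule Bochner_Integration.integrable_bound[OF assms(1)])
     (use assms in \<open>auto intro!: AE_I2 order_trans[OF assms(3)]\<close>)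

lemma norm_add_sq_le: "(norm (a + b))\<^sup>2 \<le> 2 * (norm a)\<^sup>2 + 2 * (norm (b::'b::real_normed_vector))\<^sup>2"
proof -
  have "(norm (a + b))\<^sup>2 \<le> (norm a + norm b)\<^sup>2" by (intro power_mono norm_triangle_ineq) auto
  also have "\<dots> \<le> 2 * (norm a)\<^sup>2 + 2 * (norm b)\<^sup>2"
    using zero_le_power2[of "norm a - norm b"] by (simp add: power2_eq_square algebra_simps)
  finally show ?thesis .
qed

lemma L2_dominated:
  fixes f :: "'a::euclidean_space \<Rightarrow> 'b::euclidean_space" and g :: "'a \<Rightarrow> 'c::euclidean_space"
  assumes "L2 g" "f \<in> borel_measurable borel" "\<And>x. norm (f x) \<le> C * norm (g x)"
  shows "L2 f"
  unfolding L2_def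
proof
  show "integrable lborel (\<lambda>x. (norm (f x))\<^sup>2)"
  proof (rule integrable_dominated_real)
    show "integrable lborel (\<lambda>x. C\<^sup>2 * (norm (g x))\<^sup>2)" using L2_integrable[OF assms(1)] by simp
    show "norm ((norm (f x))\<^sup>2) \<le> C\<^sup>2 * (norm (g x))\<^sup>2" for x
      using power_mono[OF assms(3)[of x], of 2] by (simp add: power_mult_distrib)
  qed (use assms(2) in measurable)
qed fact

lemma n2_dominated:
  fixes f :: "'a::euclidean_space \<Rightarrow> 'b::euclidean_space" and g :: "'a \<Rightarrow> 'c::euclidean_space"
  assumes "L2 g" "\<And>x. norm (f x) \<le> C * norm (g x)"
  shows "n2 f \<le> C\<^sup>2 * n2 g"
proof -
  have "n2 f \<le> (\<integral>x. C\<^sup>2 * (norm (g x))\<^sup>2 \<partial>lborel)"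
    unfolding n2_def
  proof (rule integral_mono_AE')
    show "AE x in lborel. (norm (f x))\<^sup>2 \<le> C\<^sup>2 * (norm (g x))\<^sup>2"
      using power_mono[OF assms(2), where n=2] by (simp add: power_mult_distrib)
  qed (use L2_integrable[OF assms(1)] in auto)
  then show ?thesis by (simp add: n2_def)
qed

lemma L2_add: assumes "L2 f" "L2 g" shows "L2 (\<lambda>x. f x + g x)"
  unfolding L2_def
proof
  show "integrable lborel (\<lambda>x. (norm (f x + g x))\<^sup>2)"
  proof (rule integrable_dominated_real)
    show "integrable lborel (\<lambda>x. 2 * (norm (f x))\<^sup>2 + 2 * (norm (g x))\<^sup>2)"
      using L2_integrable[OF assms(1)] L2_integrable[OF assms(2)] by simp
  qed (use assms norm_add_sq_le in \<open>auto intro: L2_measurable\<close>)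
qed (use assms in \<open>auto intro: L2_measurable\<close>)

lemma L2_scaleR: "L2 f \<Longrightarrow> L2 (\<lambda>x. c *\<^sub>R f x)"
  by (rule L2_dominated[where C="\<bar>c\<bar>"]) (auto intro: L2_measurable)

lemma L2_cmult: "L2 (f::_\<Rightarrow>real) \<Longrightarrow> L2 (\<lambda>x. c * f x)"
  using L2_scaleR[of f c] by simp

lemma L2_minus: "L2 f \<Longrightarrow> L2 (\<lambda>x. - f x)"
  using L2_scaleR[of f "-1"] by simp

lemma L2_diff: "L2 f \<Longrightarrow> L2 g \<Longrightarrow> L2 (\<lambda>x. f x - g x)"
  using L2_add[of f "\<lambda>x. - g x"] L2_minus[of g] by simp

lemma L2_zero [simp]: "L2 (\<lambda>x. 0)" by (simp add: L2_def)

lemma L2_bounded_scaleR: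
  assumes "L2 f" "h \<in> borel_measurable borel" "\<And>x. \<bar>h x\<bar> \<le> C"
  shows "L2 (\<lambda>x. h x *\<^sub>R f x)"
  by (rule L2_dominated[OF assms(1), where C=C])
     (use assms in \<open>auto intro!: borel_measurable_scaleR L2_measurable mult_right_mono\<close>)

lemma L2_norm: "L2 f \<Longrightarrow> L2 (\<lambda>x. norm (f x))"
  by (rule L2_dominated[where C=1]) (auto intro: L2_measurable)

lemma borel_measurable_vec_nth [measurable]:
  fixes f :: "'a \<Rightarrow> real^'n"
  shows "f \<in> borel_measurable M \<Longrightarrow> (\<lambda>x. f x $ i) \<in> borel_measurable M"
  using borel_measurable_inner[of f M "\<lambda>_. axis i 1"] by (simp add: inner_axis)

lemma L2_nth: "L2 f \<Longrightarrow> L2 (\<lambda>x. f x $ i)" for f :: "_ \<Rightarrow> real^'n"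
  by (rule L2_dominated[where C=1]) (auto intro: borel_measurable_vec_nth L2_measurable component_le_norm_cart)

lemma L2_inner_integrable: assumes "L2 f" "L2 g" shows "integrable lborel (\<lambda>x. f x \<bullet> g x)"
proof (rule integrable_dominated_real)
  show "integrable lborel (\<lambda>x. (norm (f x))\<^sup>2 + (norm (g x))\<^sup>2)"
    using assms by (simp add: L2_integrable)
  fix x
  have "norm (f x \<bullet> g x) \<le> norm (f x) * norm (g x)" by (simp add: Cauchy_Schwarz_ineq2)
  also have "\<dots> \<le> (norm (f x))\<^sup>2 + (norm (g x))\<^sup>2"
    using zero_le_power2[of "norm (f x) - norm (g x)"] mult_nonneg_nonneg[OF norm_ge_zero[of "f x"] norm_ge_zero[of "g x"]]
    unfolding power2_diff by linarith
  finally show "norm (f x \<bullet> g x) \<le> (norm (f x))\<^sup>2 + (norm (g x))\<^sup>2" .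
qed (use assms in \<open>auto dest: L2_measurable\<close>)

lemma L2_mult_integrable: "L2 f \<Longrightarrow> L2 g \<Longrightarrow> integrable lborel (\<lambda>x. f x * g x :: real)"
  using L2_inner_integrable[of f g] by simp

lemma n2_eq_inner: "n2 f = (\<integral>x. f x \<bullet> f x \<partial>lborel)"
  by (simp add: n2_def power2_norm_eq_inner)

lemma n2_uminus [simp]: "n2 (\<lambda>x. - f x) = n2 f" by (simp add: n2_def)

lemma n2_diff_commute: "n2 (\<lambda>x. f x - g x) = n2 (\<lambda>x. g x - f x)"
  by (simp add: n2_def norm_minus_commute)

lemma n2_scaleR: "n2 (\<lambda>x. c *\<^sub>R f x) = c\<^sup>2 * n2 f"
  by (simp add: n2_def power_mult_distrib)

lemma n2_add_le: assumes "L2 f" "L2 g"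
  shows "n2 (\<lambda>x. f x + g x) \<le> 2 * n2 f + 2 * n2 g"
proof -
  have "n2 (\<lambda>x. f x + g x) \<le> (\<integral>x. 2 * (norm (f x))\<^sup>2 + 2 * (norm (g x))\<^sup>2 \<partial>lborel)"
    unfolding n2_def by (rule integral_mono)
      (use L2_integrable[OF assms(1)] L2_integrable[OF assms(2)] L2_integrable[OF L2_add[OF assms]] norm_add_sq_le in auto)
  then show ?thesis using assms by (simp add: n2_def L2_integrable)
qed

lemma L2_Cauchy_Schwarz: assumes f: "L2 f" and g: "L2 g"
  shows "(\<integral>x. f x \<bullet> g x \<partial>lborel)\<^sup>2 \<le> n2 f * n2 g"
proof -
  define b where "b = (\<integral>x. f x \<bullet> g x \<partial>lborel)"
  have q: "0 \<le> n2 f - 2 * t * b + t\<^sup>2 * n2 g" for t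
  proof -
    have "0 \<le> n2 (\<lambda>x. f x - t *\<^sub>R g x)" by simp
    also have "\<dots> = (\<integral>x. f x \<bullet> f x - 2 * t * (f x \<bullet> g x) + t\<^sup>2 * (g x \<bullet> g x) \<partial>lborel)"
      unfolding n2_eq_inner by (rule Bochner_Integration.integral_cong)
        (auto simp: inner_diff_left inner_diff_right inner_commute power2_eq_square algebra_simps)
    also have "\<dots> = n2 f - 2 * t * b + t\<^sup>2 * n2 g"
      using L2_inner_integrable[OF f g] L2_inner_integrable[OF f f] L2_inner_integrable[OF g g]
      by (simp add: n2_eq_inner b_def)
    finally show ?thesis .
  qed
  show ?thesis unfolding b_def[symmetric]
  proof (cases "n2 g = 0")
    case True
    have "b = 0"
    proof (rule ccontr)
      assume "b \<noteq> 0"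
      \<comment> \<open>With \<open>n2 g = 0\<close> the quadratic is affine in t, and this t gives
        it the value -1.\<close>
      then show False using q[of "(n2 f + 1) / (2 * b)"] True by simp
    qed
    then show "b\<^sup>2 \<le> n2 f * n2 g" by simp
  next
    case False
    then have pos: "n2 g > 0" using n2_nonneg[of g] by linarith
    \<comment> \<open>\<open>b / n2 g\<close> is the minimiser of the quadratic in t.\<close>
    have "0 \<le> n2 f - b\<^sup>2 / n2 g"
      using q[of "b / n2 g"] pos by (simp add: power2_eq_square field_simps)
    then show "b\<^sup>2 \<le> n2 f * n2 g" using pos by (simp add: field_simps)
  qed
qed

lemma L2_Cauchy_Schwarz_abs: "L2 f \<Longrightarrow> L2 g \<Longrightarrow> \<bar>\<integral>x. f x \<bullet> g x \<partial>lborel\<bar> \<le> sqrt (n2 f) * sqrt (n2 g)"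
  using real_sqrt_le_mono[OF L2_Cauchy_Schwarz[of f g]] by (simp add: real_sqrt_mult)

lemma n2_triangle: assumes "L2 f" "L2 g"
  shows "sqrt (n2 (\<lambda>x. f x + g x)) \<le> sqrt (n2 f) + sqrt (n2 g)"
proof -
  have "n2 (\<lambda>x. f x + g x) = (\<integral>x. f x \<bullet> f x + 2 * (f x \<bullet> g x) + g x \<bullet> g x \<partial>lborel)"
    unfolding n2_eq_inner by (rule Bochner_Integration.integral_cong)
      (auto simp: inner_add_left inner_add_right inner_commute)
  also have "\<dots> = n2 f + 2 * (\<integral>x. f x \<bullet> g x \<partial>lborel) + n2 g"
    using L2_inner_integrable[OF assms] L2_inner_integrable[OF assms(1,1)] L2_inner_integrable[OF assms(2,2)]
    by (simp add: n2_eq_inner)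
  also have "\<dots> \<le> n2 f + 2 * (sqrt (n2 f) * sqrt (n2 g)) + n2 g"
    using L2_Cauchy_Schwarz_abs[OF assms] by simp
  also have "\<dots> = (sqrt (n2 f) + sqrt (n2 g))\<^sup>2" by (simp add: power2_sum)
  finally show ?thesis by (simp add: real_le_lsqrt)
qed

section \<open>Convergence in L2\<close>

lemma L2limI_bound:
  assumes "\<And>k. n2 (\<lambda>x. s k x - f x) \<le> b k" "b \<longlonglongrightarrow> 0" shows "L2lim s f"
  unfolding L2lim_def
  by (rule tendsto_sandwich[OF _ _ tendsto_const assms(2)]) (use assms(1) in auto)

lemma L2lim_add:
  assumes "L2lim s f" "L2lim t g" "\<And>k. L2 (s k)" "\<And>k. L2 (t k)" "L2 f" "L2 g"
  shows "L2lim (\<lambda>k x. s k x + t k x) (\<lambda>x. f x + g x)"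
proof (rule L2limI_bound)
  show "n2 (\<lambda>x. s k x + t k x - (f x + g x)) \<le> 2 * n2 (\<lambda>x. s k x - f x) + 2 * n2 (\<lambda>x. t k x - g x)" for k
    using n2_add_le[OF L2_diff[OF assms(3)[of k] assms(5)] L2_diff[OF assms(4)[of k] assms(6)]]
    by (simp add: algebra_simps)
  show "(\<lambda>k. 2 * n2 (\<lambda>x. s k x - f x) + 2 * n2 (\<lambda>x. t k x - g x)) \<longlonglongrightarrow> 0"
    using assms(1,2) unfolding L2lim_def by (auto intro!: tendsto_eq_intros)
qed

lemma L2lim_scaleR: "L2lim s f \<Longrightarrow> L2lim (\<lambda>k x. c *\<^sub>R s k x) (\<lambda>x. c *\<^sub>R f x)"
  unfolding L2lim_def scaleR_diff_right[symmetric] n2_scaleR by (rule tendsto_mult_right_zero)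

lemma L2lim_diff:
  assumes "L2lim s f" "L2lim t g" "\<And>k. L2 (s k)" "\<And>k. L2 (t k)" "L2 f" "L2 g"
  shows "L2lim (\<lambda>k x. s k x - t k x) (\<lambda>x. f x - g x)"
  using L2lim_add[OF assms(1) L2lim_scaleR[OF assms(2), of "-1"]] assms(3-6) by (simp add: L2_minus)

lemma L2lim_Lipschitz:
  fixes s :: "nat \<Rightarrow> 'a::euclidean_space \<Rightarrow> 'b::euclidean_space" and h :: "'b \<Rightarrow> 'c::euclidean_space"
  assumes "L2lim s f" "\<And>k. L2 (s k)" "L2 f" "\<And>a b. norm (h a - h b) \<le> C * norm (a - b)"
  shows "L2lim (\<lambda>k x. h (s k x)) (\<lambda>x. h (f x))"
proof (rule L2limI_bound)
  show "n2 (\<lambda>x. h (s k x) - h (f x)) \<le> C\<^sup>2 * n2 (\<lambda>x. s k x - f x)" for k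
    by (rule n2_dominated) (use assms in \<open>auto intro: L2_diff\<close>)
  show "(\<lambda>k. C\<^sup>2 * n2 (\<lambda>x. s k x - f x)) \<longlonglongrightarrow> 0"
    using assms(1) unfolding L2lim_def by (rule tendsto_mult_right_zero)
qed

lemma L2lim_subseq: "L2lim s f \<Longrightarrow> strict_mono r \<Longrightarrow> L2lim (\<lambda>k. s (r k)) f"
  unfolding L2lim_def by (drule (1) LIMSEQ_subseq_LIMSEQ) (simp add: o_def)

lemma L2lim_const [simp]: "L2lim (\<lambda>k. f) f" by (simp add: L2lim_def n2_def)

lemma L2lim_n2:
  assumes "L2lim s f" "\<And>k. L2 (s k)" "L2 f"
  shows "(\<lambda>k. n2 (s k)) \<longlonglongrightarrow> n2 f"
proof -
  have "(\<lambda>k. sqrt (n2 (s k))) \<longlonglongrightarrow> sqrt (n2 f)"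
  proof (rule LIMSEQ_I)
    fix e :: real assume "e > 0"
    have "(\<lambda>k. sqrt (n2 (\<lambda>x. s k x - f x))) \<longlonglongrightarrow> 0"
      using assms(1) unfolding L2lim_def by (auto intro: tendsto_eq_intros)
    from LIMSEQ_D[OF this \<open>e > 0\<close>] obtain N where N: "\<And>k. k \<ge> N \<Longrightarrow> sqrt (n2 (\<lambda>x. s k x - f x)) < e" by auto
    have "norm (sqrt (n2 (s k)) - sqrt (n2 f)) < e" if "k \<ge> N" for k
      using N[OF that] n2_triangle[OF L2_diff[OF assms(2)[of k] assms(3)] assms(3)]
        n2_triangle[OF L2_diff[OF assms(3) assms(2)[of k]] assms(2)[of k]]
      by (simp add: n2_diff_commute[of f "s k"] abs_le_iff real_norm_def abs_less_iff)
    then show "\<exists>N. \<forall>k\<ge>N. norm (sqrt (n2 (s k)) - sqrt (n2 f)) < e" by blast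
  qed
  from tendsto_power[OF this, of 2] show ?thesis by simp
qed

lemma L2lim_inner:
  assumes "L2lim s f" "L2lim t g" "\<And>k. L2 (s k)" "\<And>k. L2 (t k)" "L2 f" "L2 g"
  shows "(\<lambda>k. \<integral>x. s k x \<bullet> t k x \<partial>lborel) \<longlonglongrightarrow> (\<integral>x. f x \<bullet> g x \<partial>lborel)"
proof -
  have "(\<lambda>k. sqrt (n2 (\<lambda>x. s k x - f x)) * sqrt (n2 (t k)) + sqrt (n2 f) * sqrt (n2 (\<lambda>x. t k x - g x))) \<longlonglongrightarrow>
     sqrt 0 * sqrt (n2 g) + sqrt (n2 f) * sqrt 0"
    using assms(1,2) L2lim_n2[OF assms(2,4,6)] unfolding L2lim_def
    by (intro tendsto_intros)
  then have z: "(\<lambda>k. sqrt (n2 (\<lambda>x. s k x - f x)) * sqrt (n2 (t k)) + sqrt (n2 f) * sqrt (n2 (\<lambda>x. t k x - g x))) \<longlonglongrightarrow> 0"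
    by simp
  have "(\<lambda>k. (\<integral>x. s k x \<bullet> t k x \<partial>lborel) - (\<integral>x. f x \<bullet> g x \<partial>lborel)) \<longlonglongrightarrow> 0"
  proof (rule Lim_null_comparison[OF _ z], intro always_eventually allI)
    fix k
    note d1 = L2_diff[OF assms(3)[of k] assms(5)] and d2 = L2_diff[OF assms(4)[of k] assms(6)]
    have "(\<integral>x. s k x \<bullet> t k x \<partial>lborel) - (\<integral>x. f x \<bullet> g x \<partial>lborel)
      = (\<integral>x. (s k x - f x) \<bullet> t k x + f x \<bullet> (t k x - g x) \<partial>lborel)"
      using L2_inner_integrable[OF assms(3)[of k] assms(4)[of k]] L2_inner_integrable[OF assms(5,6)]
      by (simp add: inner_diff_left inner_diff_right flip: Bochner_Integration.integral_diff)
    also have "\<dots> = (\<integral>x. (s k x - f x) \<bullet> t k x \<partial>lborel) + (\<integral>x. f x \<bullet> (t k x - g x) \<partial>lborel)"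
      using L2_inner_integrable[OF d1 assms(4)[of k]] L2_inner_integrable[OF assms(5) d2] by simp
    finally show "norm ((\<integral>x. s k x \<bullet> t k x \<partial>lborel) - (\<integral>x. f x \<bullet> g x \<partial>lborel))
      \<le> sqrt (n2 (\<lambda>x. s k x - f x)) * sqrt (n2 (t k)) + sqrt (n2 f) * sqrt (n2 (\<lambda>x. t k x - g x))"
      using L2_Cauchy_Schwarz_abs[OF d1 assms(4)[of k]] L2_Cauchy_Schwarz_abs[OF assms(5) d2] by simp
  qed
  then show ?thesis by (simp add: LIM_zero_iff)
qed

lemma L2lim_mult:
  fixes s :: "nat \<Rightarrow> 'a::euclidean_space \<Rightarrow> real"
  assumes "L2lim s f" "L2lim t g" "\<And>k. L2 (s k)" "\<And>k. L2 (t k)" "L2 f" "L2 g"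
  shows "(\<lambda>k. \<integral>x. s k x * t k x \<partial>lborel) \<longlonglongrightarrow> (\<integral>x. f x * g x \<partial>lborel)"
  using L2lim_inner[OF assms] by simp

lemma L2lim_AE_subseq:
  assumes "L2lim s f" "\<And>k. L2 (s k)" "L2 f"
  obtains r :: "nat \<Rightarrow> nat" where "strict_mono r" "AE x in lborel. (\<lambda>k. s (r k) x) \<longlonglongrightarrow> f x"
proof -
  have "\<exists>r::nat\<Rightarrow>nat. strict_mono r \<and> (AE x in lborel. (\<lambda>n. (norm (s (r n) x - f x))\<^sup>2) \<longlonglongrightarrow> 0)"
    by (rule tendsto_L1_AE_subseq)
      (use assms in \<open>auto simp: L2lim_def n2_def intro!: L2_integrable L2_diff\<close>)
  then obtain r where r: "strict_mono r" "AE x in lborel. (\<lambda>n. (norm (s (r n) x - f x))\<^sup>2) \<longlonglongrightarrow> 0" by blast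
  have "AE x in lborel. (\<lambda>k. s (r k) x) \<longlonglongrightarrow> f x"
    using r(2)
  proof eventually_elim
    case (elim x)
    from tendsto_real_sqrt[OF elim] have "(\<lambda>n. norm (s (r n) x - f x)) \<longlonglongrightarrow> 0" by simp
    then show ?case using LIM_zero_cancel tendsto_norm_zero_iff by blast
  qed
  with r(1) show ?thesis by (rule that)
qed

lemma n2_zero_AE: assumes "L2 f" "n2 f = 0" shows "AE x in lborel. f x = 0"
  using integral_nonneg_eq_0_iff_AE[OF L2_integrable[OF assms(1)]] assms(2) by (simp add: n2_def)

lemma nn_integral_n2: "L2 f \<Longrightarrow> (\<integral>\<^sup>+x. ennreal ((norm (f x))\<^sup>2) \<partial>lborel) = ennreal (n2 f)"
  unfolding n2_def by (rule nn_integral_eq_integral) (auto dest: L2_integrable)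

section \<open>Completeness of L2\<close>

lemma L2_nn_bound:
  assumes "f \<in> borel_measurable borel" "(\<integral>\<^sup>+x. ennreal ((norm (f x))\<^sup>2) \<partial>lborel) \<le> ennreal C" "C \<ge> 0"
  shows "L2 f" "n2 f \<le> C"
proof -
  have fin: "(\<integral>\<^sup>+x. ennreal ((norm (f x))\<^sup>2) \<partial>lborel) < \<infinity>"
    using assms(2) by (rule le_less_trans) simp
  show L: "L2 f" unfolding L2_def using assms(1) fin by (auto intro!: integrableI_bounded)
  show "n2 f \<le> C" using assms(2,3) by (simp add: nn_integral_n2[OF L])
qed

text \<open>Riesz-Fischer: a rapidly converging subsequence converges almost everywhere, and Fatou's
  lemma identifies its pointwise limit as the L2 limit of the whole sequence.\<close>

theorem L2_complete:
  fixes s :: "nat \<Rightarrow> 'a::euclidean_space \<Rightarrow> 'b::euclidean_space"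
  assumes L: "\<And>k. L2 (s k)" and C: "\<And>e. e > 0 \<Longrightarrow> \<exists>N. \<forall>m\<ge>N. \<forall>n\<ge>N. n2 (\<lambda>x. s m x - s n x) \<le> e"
  shows "\<exists>f. L2 f \<and> L2lim s f"
proof -
  \<comment> \<open>The rate \<open>(1/8)^k\<close> leaves room for the weight \<open>2^k\<close>
    used below: the weighted squares still sum like \<open>(1/4)^k\<close>.\<close>
  have "\<exists>r::nat\<Rightarrow>nat. \<forall>k. (\<forall>m\<ge>r k. \<forall>n\<ge>r k. n2 (\<lambda>x. s m x - s n x) \<le> (1/8)^k) \<and> r k < r (Suc k)"
  proof (rule dependent_nat_choice)
    show "\<exists>x. \<forall>m\<ge>x. \<forall>n\<ge>x. n2 (\<lambda>xa. s m xa - s n xa) \<le> (1/8)^0" using C[of 1] by simp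
    fix x k
    obtain N where N: "\<forall>m\<ge>N. \<forall>n\<ge>N. n2 (\<lambda>x. s m x - s n x) \<le> (1/8)^(Suc k)" using C[of "(1/8)^Suc k"] by auto
    show "\<exists>y. (\<forall>m\<ge>y. \<forall>n\<ge>y. n2 (\<lambda>xa. s m xa - s n xa) \<le> (1/8)^Suc k) \<and> x < y"
      by (rule exI[of _ "max N (Suc x)"]) (use N in auto)
  qed
  then obtain r where r: "\<And>k m n. m \<ge> r k \<Longrightarrow> n \<ge> r k \<Longrightarrow> n2 (\<lambda>x. s m x - s n x) \<le> (1/8)^k"
    and mono: "strict_mono r" by (auto simp: strict_mono_Suc_iff)
  have [measurable]: "s k \<in> borel_measurable borel" for k using L by (rule L2_measurable)
  define d where "d k x = (norm (s (r (Suc k)) x - s (r k) x))\<^sup>2" for k x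
  have dL: "integrable lborel (d k)" for k
    unfolding d_def by (rule L2_integrable[OF L2_diff[OF L L]])
  have "(\<integral>\<^sup>+x. (\<Sum>k. ennreal (2^k * d k x)) \<partial>lborel) = (\<Sum>k. \<integral>\<^sup>+x. ennreal (2^k * d k x) \<partial>lborel)"
    by (rule nn_integral_suminf) (auto simp: d_def)
  also have "\<dots> \<le> (\<Sum>k. ennreal ((1/4)^k))"
  proof (rule suminf_le)
    fix k
    have "(\<integral>\<^sup>+x. ennreal (2^k * d k x) \<partial>lborel) = ennreal (\<integral>x. 2^k * d k x \<partial>lborel)"
      by (rule nn_integral_eq_integral) (use dL[of k] in \<open>auto simp: d_def[abs_def]\<close>)
    also have "\<dots> \<le> ennreal (2^k * (1/8)^k)"
      using r[of k "r (Suc k)" "r k"] strict_mono_less_eq[OF mono, of k "Suc k"]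
      by (intro ennreal_leI) (simp add: d_def n2_def)
    also have "2^k * (1/8)^k = ((1/4)^k :: real)" by (simp flip: power_mult_distrib)
    finally show "(\<integral>\<^sup>+x. ennreal (2^k * d k x) \<partial>lborel) \<le> ennreal ((1/4)^k)" .
  qed auto
  also have "\<dots> < \<infinity>" by (subst suminf_ennreal2) (auto intro!: summable_geometric)
  finally have "AE x in lborel. (\<Sum>k. ennreal (2^k * d k x)) \<noteq> \<infinity>"
    by (intro nn_integral_PInf_AE) (auto simp: d_def)
  then have conv: "AE x in lborel. convergent (\<lambda>k. s (r k) x)"
  proof eventually_elim
    case (elim x)
    have "summable (\<lambda>k. 2^k * d k x)"
      by (rule summable_suminf_not_top) (use elim in \<open>auto simp: d_def\<close>)
    then have sm: "summable (\<lambda>k. 2^k * d k x + (1/2)^k)" by (intro summable_add summable_geometric) auto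
    have "summable (\<lambda>k. s (r (Suc k)) x - s (r k) x)"
    proof (rule summable_comparison_test'[OF sm])
      fix k
      define a where "a = norm (s (r (Suc k)) x - s (r k) x)"
      \<comment> \<open>Either \<open>a\<close> is below \<open>(1/2)^k\<close>, or
        \<open>2^k * a \<ge> 1\<close> and one more factor \<open>a\<close> may be spent. Thus
        summable weighted squares give summable increments.\<close>
      have "a \<le> 2^k * a\<^sup>2 + (1/2)^k"
      proof (cases "2^k * a \<ge> 1")
        case True
        then have "1 * a \<le> (2^k * a) * a" by (intro mult_right_mono) (auto simp: a_def)
        then show ?thesis by (simp add: power2_eq_square mult.assoc add_increasing2)
      next
        case False
        then have "a \<le> (1/2)^k" by (simp add: field_simps power_one_over)
        then show ?thesis by (simp add: add_increasing)
      qed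
      then show "norm (s (r (Suc k)) x - s (r k) x) \<le> 2^k * d k x + (1/2)^k"
        by (simp add: a_def d_def)
    qed
    then have "convergent (\<lambda>n. \<Sum>k<n. s (r (Suc k)) x - s (r k) x)" by (simp add: summable_iff_convergent)
    then have "convergent (\<lambda>n. s (r n) x - s (r 0) x)" by (simp add: sum_lessThan_telescope[of "\<lambda>k. s (r k) x"])
    then have "convergent (\<lambda>n. (s (r n) x - s (r 0) x) + s (r 0) x)" by (intro convergent_add convergent_const)
    then show ?case by simp
  qed
  define f where "f x = lim (\<lambda>k. s (r k) x)" for x
  have [measurable]: "f \<in> borel_measurable borel"
    unfolding f_def[abs_def] by (rule borel_measurable_lim_metric) simp
  have lim: "AE x in lborel. (\<lambda>k. s (r k) x) \<longlonglongrightarrow> f x"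
    using conv by eventually_elim (simp add: f_def convergent_LIMSEQ_iff)
  \<comment> \<open>Fatou's lemma carries the Cauchy bound to the limit. Nonnegative integrals are
    used because integrability of \<open>s m - f\<close> is not yet known.\<close>
  have bd: "(\<integral>\<^sup>+x. ennreal ((norm (s m x - f x))\<^sup>2) \<partial>lborel) \<le> ennreal e"
    if m: "\<And>n. n \<ge> N \<Longrightarrow> n2 (\<lambda>x. s m x - s n x) \<le> e" for N m e
  proof -
    have "(\<integral>\<^sup>+x. ennreal ((norm (s m x - f x))\<^sup>2) \<partial>lborel) =
      (\<integral>\<^sup>+x. liminf (\<lambda>k. ennreal ((norm (s m x - s (r k) x))\<^sup>2)) \<partial>lborel)"
    proof (rule nn_integral_cong_AE)
      show "AE x in lborel. ennreal ((norm (s m x - f x))\<^sup>2) = liminf (\<lambda>k. ennreal ((norm (s m x - s (r k) x))\<^sup>2))"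
        using lim
      proof eventually_elim
        case (elim x)
        have "(\<lambda>k. ennreal ((norm (s m x - s (r k) x))\<^sup>2)) \<longlonglongrightarrow> ennreal ((norm (s m x - f x))\<^sup>2)"
          by (intro tendsto_ennrealI tendsto_intros elim)
        then show ?case by (intro lim_imp_Liminf[symmetric]) auto
      qed
    qed
    also have "\<dots> \<le> liminf (\<lambda>k. \<integral>\<^sup>+x. ennreal ((norm (s m x - s (r k) x))\<^sup>2) \<partial>lborel)"
      by (rule nn_integral_liminf) simp
    also have "\<dots> = liminf (\<lambda>k. ennreal (n2 (\<lambda>x. s m x - s (r k) x)))"
      by (simp add: nn_integral_n2 L2_diff L)
    also have "\<dots> \<le> ennreal e"
    proof (rule Liminf_le)
      have "eventually (\<lambda>k. r k \<ge> N) sequentially"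
        using filterlim_subseq[OF mono] by (auto simp: filterlim_at_top)
      then show "eventually (\<lambda>k. ennreal (n2 (\<lambda>x. s m x - s (r k) x)) \<le> ennreal e) sequentially"
        by eventually_elim (intro ennreal_leI m)
    qed simp
    finally show ?thesis .
  qed
  obtain N where N: "\<forall>m\<ge>N. \<forall>n\<ge>N. n2 (\<lambda>x. s m x - s n x) \<le> 1" using C[of 1] by auto
  have "L2 (\<lambda>x. s N x - f x)" by (rule L2_nn_bound[where C=1]) (use bd[of N N 1] N in auto)
  from L2_diff[OF L[of N] this] have f: "L2 f" by simp
  have "L2lim s f" unfolding L2lim_def
  proof (rule LIMSEQ_I)
    fix e :: real assume "e > 0"
    then obtain N where N: "\<forall>m\<ge>N. \<forall>n\<ge>N. n2 (\<lambda>x. s m x - s n x) \<le> e/2" using C[of "e/2"] by auto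
    have "norm (n2 (\<lambda>x. s m x - f x) - 0) < e" if "m \<ge> N" for m
    proof -
      have "n2 (\<lambda>x. s m x - f x) \<le> e/2"
        by (rule L2_nn_bound) (use bd[of N m "e/2"] N that \<open>e > 0\<close> in auto)
      then show ?thesis using \<open>e > 0\<close> by simp
    qed
    then show "\<exists>N. \<forall>m\<ge>N. norm (n2 (\<lambda>x. s m x - f x) - 0) < e" by blast
  qed
  with f show ?thesis by blast
qed

section \<open>Compactly supported \<open>C\<^sup>1\<close> functions\<close>

lemma has_derivative_grad:
  fixes f :: "real^'n \<Rightarrow> real"
  assumes "f differentiable (at x)"
  shows "(f has_derivative (\<lambda>h. grad f x \<bullet> h)) (at x)"
proof -
  let ?D = "frechet_derivative f (at x)"
  have D: "(f has_derivative ?D) (at x)" using assms by (simp add: frechet_derivative_works)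
  then have lin: "linear ?D" by (rule has_derivative_linear)
  have "?D h = grad f x \<bullet> h" for h
  proof -
    have "?D h = ?D (\<Sum>i\<in>UNIV. h $ i *\<^sub>R axis i 1)"
      by (simp add: basis_expansion flip: scalar_mult_eq_scaleR)
    also have "\<dots> = (\<Sum>i\<in>UNIV. h $ i * ?D (axis i 1))"
      by (simp add: linear_sum[OF lin] linear_scale[OF lin])
    finally show ?thesis by (simp add: inner_vec_def grad_def pd_def mult.commute)
  qed
  then have "?D = (\<lambda>h. grad f x \<bullet> h)" by (rule ext)
  with D show ?thesis by simp
qed

lemma grad_eqI:
  fixes f :: "real^'n \<Rightarrow> real"
  assumes "(f has_derivative (\<lambda>h. v \<bullet> h)) (at x)" shows "grad f x = v"
  using frechet_derivative_at[OF assms, symmetric] by (simp add: grad_def pd_def inner_axis vec_eq_iff)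

lemma pd_eqI:
  fixes f :: "real^'n \<Rightarrow> real"
  assumes "(f has_derivative D) (at x)" shows "pd i f x = D (axis i 1)"
  using frechet_derivative_at[OF assms, symmetric] by (simp add: pd_def)

lemma grad_nth: "grad f x $ i = pd i f x" by (simp add: grad_def)

text \<open>The working class of test functions. It contains \<open>test_fun\<close> and, unlike it,
  is stable under composition with C^1 functions of one variable vanishing at 0 and under products
  with C^1 functions; \<open>C1c_approx\<close> leads back to \<open>test_fun\<close>.\<close>

definition C1c :: "(real^'n) set \<Rightarrow> (real^'n \<Rightarrow> real) \<Rightarrow> bool" where
  "C1c \<Omega> \<phi> \<longleftrightarrow> (\<forall>x. \<phi> differentiable (at x)) \<and> continuous_on UNIV (grad \<phi>) \<and>
     (\<exists>K. compact K \<and> K \<subseteq> \<Omega> \<and> (\<forall>x. x \<notin> K \<longrightarrow> \<phi> x = 0))"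

lemma C1cI:
  assumes D: "\<And>x. (\<phi> has_derivative (\<lambda>h. G x \<bullet> h)) (at x)" and "continuous_on UNIV G"
    and "compact K" "K \<subseteq> \<Omega>" "\<And>x. x \<notin> K \<Longrightarrow> \<phi> x = 0"
  shows "C1c \<Omega> \<phi>" "grad \<phi> = G"
proof -
  show G: "grad \<phi> = G" using grad_eqI[OF D] by auto
  show "C1c \<Omega> \<phi>" unfolding C1c_def G using assms by (auto simp: differentiable_def)
qed

lemma C1c_has_derivative: "C1c \<Omega> \<phi> \<Longrightarrow> (\<phi> has_derivative (\<lambda>h. grad \<phi> x \<bullet> h)) (at x)"
  by (rule has_derivative_grad) (simp add: C1c_def)

lemma continuous_on_UNIV_has_derivative:
  "(\<And>x. (f has_derivative D x) (at x)) \<Longrightarrow> continuous_on UNIV f"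
  by (intro continuous_at_imp_continuous_on ballI) (rule has_derivative_continuous)

lemma C1c_continuous: "C1c \<Omega> \<phi> \<Longrightarrow> continuous_on UNIV \<phi>"
  by (rule continuous_on_UNIV_has_derivative) (rule C1c_has_derivative)

lemma C1c_continuous_grad: "C1c \<Omega> \<phi> \<Longrightarrow> continuous_on UNIV (grad \<phi>)"
  by (simp add: C1c_def)

lemma grad_zero_off:
  assumes "closed K" "\<And>x. x \<notin> K \<Longrightarrow> \<phi> x = 0" "x \<notin> K" shows "grad \<phi> x = 0"
proof (rule grad_eqI)
  have "((\<lambda>x. 0) has_derivative (\<lambda>h. 0)) (at x)" by simp
  then have "(\<phi> has_derivative (\<lambda>h. 0)) (at x)"
    by (rule has_derivative_transform_within_open[where s="- K"]) (use assms in auto)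
  then show "(\<phi> has_derivative (\<lambda>h. 0 \<bullet> h)) (at x)" by simp
qed

lemma C1c_supportE:
  assumes "C1c \<Omega> \<phi>"
  obtains K where "compact K" "K \<subseteq> \<Omega>" "\<And>x. x \<notin> K \<Longrightarrow> \<phi> x = 0" "\<And>x. x \<notin> K \<Longrightarrow> grad \<phi> x = 0"
proof -
  obtain K where K: "compact K" "K \<subseteq> \<Omega>" "\<And>x. x \<notin> K \<Longrightarrow> \<phi> x = 0" using assms by (auto simp: C1c_def)
  with grad_zero_off[of K \<phi>] compact_imp_closed[OF K(1)] that show ?thesis by blast
qed

lemma C1c_zero_off: "C1c \<Omega> \<phi> \<Longrightarrow> x \<notin> \<Omega> \<Longrightarrow> \<phi> x = 0" "C1c \<Omega> \<phi> \<Longrightarrow> x \<notin> \<Omega> \<Longrightarrow> grad \<phi> x = 0"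
  by (meson C1c_supportE subset_iff)+

lemma C1c_mono: "C1c \<Omega> \<phi> \<Longrightarrow> \<Omega> \<subseteq> \<Omega>' \<Longrightarrow> C1c \<Omega>' \<phi>"
  unfolding C1c_def by blast

lemma test_fun_C1c: assumes "test_fun \<Omega> \<phi>" shows "C1c \<Omega> \<phi>"
proof -
  have sm: "smooth \<phi>" using assms by (simp add: test_fun_def)
  have d: "\<phi> differentiable (at x)" for x using sm[unfolded smooth_def, rule_format, of "[]" x] by simp
  have "pd i \<phi> differentiable (at x)" for i x using sm[unfolded smooth_def, rule_format, of "[i]" x] by simp
  then have "continuous_on UNIV (pd i \<phi>)" for i
    by (intro continuous_at_imp_continuous_on ballI differentiable_imp_continuous_within)
  then have "continuous_on UNIV (grad \<phi>)" unfolding grad_def[abs_def] by (intro continuous_on_vec_lambda)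
  moreover have "\<phi> x = 0" if "x \<notin> closure {x. \<phi> x \<noteq> 0}" for x
    using that closure_subset[of "{x. \<phi> x \<noteq> 0}"] by auto
  ultimately show ?thesis using d assms unfolding C1c_def test_fun_def by blast
qed

lemma test_funI:
  assumes "smooth \<phi>" "compact K" "K \<subseteq> \<Omega>" "\<And>x. x \<notin> K \<Longrightarrow> \<phi> x = 0"
  shows "test_fun \<Omega> \<phi>"
proof -
  have "closure {x. \<phi> x \<noteq> 0} \<subseteq> K"
    by (rule closure_minimal) (use assms compact_imp_closed in auto)
  moreover from this have "compact (closure {x. \<phi> x \<noteq> 0})"
    using compact_Int_closed[OF assms(2) closed_closure[of "{x. \<phi> x \<noteq> 0}"]] by (simp add: Int_absorb1)
  ultimately show ?thesis unfolding test_fun_def using assms(1,3) by blast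
qed

lemma continuous_compact_support_bounded:
  fixes h :: "'a::euclidean_space \<Rightarrow> 'b::euclidean_space"
  assumes "continuous_on UNIV h" "compact K" "\<And>x. x \<notin> K \<Longrightarrow> h x = 0"
  obtains M where "M \<ge> 0" "\<And>x. norm (h x) \<le> M"
proof -
  have "bounded (h ` K)"
    using assms(1,2) by (meson compact_continuous_image compact_imp_bounded continuous_on_subset subset_UNIV)
  then obtain M where "\<And>x. x \<in> K \<Longrightarrow> norm (h x) \<le> M" by (auto simp: bounded_iff)
  then have "norm (h x) \<le> max M 0" for x using assms(3)[of x] by (cases "x \<in> K") (simp_all add: le_max_iff_disj)
  then show ?thesis using that[of "max M 0"] by auto
qed

lemma integrable_indicator_compact: "compact K \<Longrightarrow> integrable lborel (indicat_real K)"
  by (rule integrable_real_indicator) (auto intro: borel_compact dest: emeasure_compact_finite)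

lemma L2_bounded_compact_support:
  fixes h :: "'a::euclidean_space \<Rightarrow> 'b::euclidean_space"
  assumes "h \<in> borel_measurable borel" "compact K" "\<And>x. x \<notin> K \<Longrightarrow> h x = 0" "\<And>x. norm (h x) \<le> M"
  shows "L2 h" "integrable lborel h" "n2 h \<le> M\<^sup>2 * measure lborel K"
proof -
  have K: "K \<in> sets borel" using assms(2) by (rule borel_compact)
  have sq: "(\<lambda>x. (norm (indicat_real K x))\<^sup>2) = indicat_real K" by (auto simp: indicator_def)
  have L: "L2 (indicat_real K)" unfolding L2_def sq
    using integrable_indicator_compact[OF assms(2)] K by simp
  have b: "norm (h x) \<le> M * norm (indicat_real K x)" for x
    using assms(3,4)[of x] by (cases "x \<in> K") auto
  show "L2 h" by (rule L2_dominated[OF L assms(1) b])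
  show "integrable lborel h"
    by (rule integrable_dominated_real[where g="\<lambda>x. M * indicat_real K x"])
       (use b integrable_indicator_compact[OF assms(2)] assms(1) in auto)
  have "n2 h \<le> M\<^sup>2 * n2 (indicat_real K)" by (rule n2_dominated[OF L b])
  also have "n2 (indicat_real K) = measure lborel K"
    unfolding n2_def sq using K by simp
  finally show "n2 h \<le> M\<^sup>2 * measure lborel K" .
qed

lemma continuous_compact_support_L2:
  fixes h :: "'a::euclidean_space \<Rightarrow> 'b::euclidean_space"
  assumes "continuous_on UNIV h" "compact K" "\<And>x. x \<notin> K \<Longrightarrow> h x = 0"
  shows "L2 h" "integrable lborel h"
proof -
  obtain M where M: "\<And>x. norm (h x) \<le> M" using continuous_compact_support_bounded[OF assms] by blast
  have "h \<in> borel_measurable borel" using assms(1) by (rule borel_measurable_continuous_onI)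
  from L2_bounded_compact_support[OF this assms(2,3) M] show "L2 h" "integrable lborel h" by auto
qed

lemma C1c_L2: assumes "C1c \<Omega> \<phi>" shows "L2 \<phi>" "L2 (grad \<phi>)" "integrable lborel \<phi>" "integrable lborel (grad \<phi>)"
  using C1c_supportE[OF assms] continuous_compact_support_L2[OF C1c_continuous[OF assms]]
    continuous_compact_support_L2[OF C1c_continuous_grad[OF assms]] by metis+

lemma C1c_bounded: assumes "C1c \<Omega> \<phi>"
  obtains M where "M \<ge> 0" "\<And>x. \<bar>\<phi> x\<bar> \<le> M" "\<And>x. norm (grad \<phi> x) \<le> M"
proof -
  obtain K where K: "compact K" "\<And>x. x \<notin> K \<Longrightarrow> \<phi> x = 0" "\<And>x. x \<notin> K \<Longrightarrow> grad \<phi> x = 0"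
    using C1c_supportE[OF assms] by metis
  obtain M1 M2 where "M1 \<ge> 0" "\<And>x. norm (\<phi> x) \<le> M1" "M2 \<ge> 0" "\<And>x. norm (grad \<phi> x) \<le> M2"
    using continuous_compact_support_bounded[OF C1c_continuous[OF assms] K(1,2)]
     continuous_compact_support_bounded[OF C1c_continuous_grad[OF assms] K(1,3)] by metis
  then show ?thesis using that[of "max M1 M2"] by (simp add: le_max_iff_disj)
qed

lemma C1c_measurable [measurable_dest]: "C1c \<Omega> \<phi> \<Longrightarrow> \<phi> \<in> borel_measurable borel"
   "C1c \<Omega> \<phi> \<Longrightarrow> grad \<phi> \<in> borel_measurable borel"
  by (auto intro: borel_measurable_continuous_onI C1c_continuous C1c_continuous_grad)

lemma compact_support_uniformly_continuous:
  fixes h :: "'a::euclidean_space \<Rightarrow> 'b::euclidean_space"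
  assumes "continuous_on UNIV h" "compact K" "\<And>x. x \<notin> K \<Longrightarrow> h x = 0" "e > 0"
  obtains d where "d > 0" "\<And>x y. norm (y - x) < d \<Longrightarrow> norm (h y - h x) < e"
proof -
  \<comment> \<open>Closed unit neighbourhood of the support: two points at distance less than 1
    either both lie in \<open>K2\<close> or both lie outside \<open>K\<close>.\<close>
  define K2 where "K2 = {x + y | x y. x \<in> K \<and> y \<in> cball 0 1}"
  have "compact K2" unfolding K2_def by (rule compact_sums[OF assms(2) compact_cball])
  then have "uniformly_continuous_on K2 h"
    using assms(1) compact_uniformly_continuous continuous_on_subset by blast
  then obtain d where d: "d > 0" "\<And>x y. x \<in> K2 \<Longrightarrow> y \<in> K2 \<Longrightarrow> dist y x < d \<Longrightarrow> dist (h y) (h x) < e"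
    using assms(4) unfolding uniformly_continuous_on_def by metis
  have K2I: "y \<in> K2" if "x \<in> K" "norm (y - x) \<le> 1" for x y
  proof -
    have "y = x + (y - x)" "y - x \<in> cball 0 1" using that by simp_all
    then show ?thesis unfolding K2_def using that by blast
  qed
  show ?thesis
  proof (rule that[of "min d 1"])
    show "min d 1 > 0" using d by simp
    fix x y :: 'a assume yx: "norm (y - x) < min d 1"
    show "norm (h y - h x) < e"
    proof (cases "x \<in> K \<or> y \<in> K")
      case True
      then have "x \<in> K2" "y \<in> K2" using K2I[of x] K2I[of y] yx by (auto simp: norm_minus_commute)
      then show ?thesis using d(2)[of x y] yx by (simp add: dist_norm)
    qed (use assms in auto)
  qed
qed

lemma C1c_mean_value:
  assumes "C1c \<Omega> \<phi>"
  shows "\<exists>t\<in>{0<..<1}. \<phi> (x + h) - \<phi> x = grad \<phi> (x + t *\<^sub>R h) \<bullet> h"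
proof -
  have "((\<lambda>t. \<phi> (x + t *\<^sub>R h)) has_real_derivative grad \<phi> (x + t *\<^sub>R h) \<bullet> h) (at t)" for t
  proof -
    have "((\<lambda>t. \<phi> (x + t *\<^sub>R h)) has_derivative (\<lambda>s. grad \<phi> (x + t *\<^sub>R h) \<bullet> (s *\<^sub>R h))) (at t)"
      by (rule has_derivative_compose[OF _ C1c_has_derivative[OF assms]]) (auto intro!: derivative_eq_intros)
    moreover have "(\<lambda>s. grad \<phi> (x + t *\<^sub>R h) \<bullet> (s *\<^sub>R h)) = (*) (grad \<phi> (x + t *\<^sub>R h) \<bullet> h)" by auto
    ultimately show ?thesis by (simp only: has_field_derivative_def)
  qed
  then have "\<exists>z>0. z < 1 \<and> \<phi> (x + 1 *\<^sub>R h) - \<phi> (x + 0 *\<^sub>R h) = (1 - 0) * (grad \<phi> (x + z *\<^sub>R h) \<bullet> h)"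
    by (intro MVT2) auto
  then show ?thesis by auto
qed

lemma C1c_Lipschitz:
  assumes "C1c \<Omega> \<phi>" "\<And>x. norm (grad \<phi> x) \<le> M"
  shows "\<bar>\<phi> x - \<phi> y\<bar> \<le> M * norm (x - y)"
proof -
  obtain t where "\<phi> (y + (x - y)) - \<phi> y = grad \<phi> (y + t *\<^sub>R (x - y)) \<bullet> (x - y)"
    using C1c_mean_value[OF assms(1), of y "x - y"] by blast
  then have "\<bar>\<phi> x - \<phi> y\<bar> \<le> norm (grad \<phi> (y + t *\<^sub>R (x - y))) * norm (x - y)"
    using Cauchy_Schwarz_ineq2 by simp
  also have "\<dots> \<le> M * norm (x - y)" by (intro mult_right_mono assms) auto
  finally show ?thesis .
qed

text \<open>A compactly supported continuous gradient is uniformly continuous, so the mean value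
  theorem bounds the first-order remainder uniformly in x. This is what permits differentiation
  under integrals later on.\<close>

lemma C1c_uniform_derivative:
  assumes "C1c \<Omega> \<phi>" "e > 0"
  obtains d where "d > 0" "\<And>x h. norm h < d \<Longrightarrow> \<bar>\<phi> (x + h) - \<phi> x - grad \<phi> x \<bullet> h\<bar> \<le> e * norm h"
proof -
  obtain K where K: "compact K" "\<And>x. x \<notin> K \<Longrightarrow> grad \<phi> x = 0"
    using C1c_supportE[OF assms(1)] by metis
  obtain d where d: "d > 0" "\<And>x y. norm (y - x) < d \<Longrightarrow> norm (grad \<phi> y - grad \<phi> x) < e"
    using compact_support_uniformly_continuous[OF C1c_continuous_grad[OF assms(1)] K assms(2)] by blast
  show ?thesis
  proof (rule that[OF d(1)])
    fix x h :: "real^'a" assume h: "norm h < d"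
    obtain t where t: "t \<in> {0<..<1}" "\<phi> (x + h) - \<phi> x = grad \<phi> (x + t *\<^sub>R h) \<bullet> h"
      using C1c_mean_value[OF assms(1)] by blast
    have "norm (t *\<^sub>R h) \<le> 1 * norm h" using t(1) by (simp add: mult_left_le_one_le)
    then have g: "norm (grad \<phi> (x + t *\<^sub>R h) - grad \<phi> x) < e" using d(2)[of "x + t *\<^sub>R h" x] h by simp
    have "\<bar>\<phi> (x + h) - \<phi> x - grad \<phi> x \<bullet> h\<bar> = \<bar>(grad \<phi> (x + t *\<^sub>R h) - grad \<phi> x) \<bullet> h\<bar>"
      using t(2) by (simp add: inner_diff_left)
    also have "\<dots> \<le> norm (grad \<phi> (x + t *\<^sub>R h) - grad \<phi> x) * norm h" by (rule Cauchy_Schwarz_ineq2)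
    also have "\<dots> \<le> e * norm h" using g by (intro mult_right_mono) auto
    finally show "\<bar>\<phi> (x + h) - \<phi> x - grad \<phi> x \<bullet> h\<bar> \<le> e * norm h" .
  qed
qed

lemma C1c_add: assumes "C1c \<Omega> \<phi>" "C1c \<Omega> \<psi>"
  shows "C1c \<Omega> (\<lambda>x. \<phi> x + \<psi> x)" "grad (\<lambda>x. \<phi> x + \<psi> x) = (\<lambda>x. grad \<phi> x + grad \<psi> x)"
proof -
  obtain K1 K2 where K: "compact K1" "K1 \<subseteq> \<Omega>" "\<And>x. x \<notin> K1 \<Longrightarrow> \<phi> x = 0"
    "compact K2" "K2 \<subseteq> \<Omega>" "\<And>x. x \<notin> K2 \<Longrightarrow> \<psi> x = 0"
    using C1c_supportE[OF assms(1)] C1c_supportE[OF assms(2)] by metis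
  have D: "((\<lambda>x. \<phi> x + \<psi> x) has_derivative (\<lambda>h. (grad \<phi> x + grad \<psi> x) \<bullet> h)) (at x)" for x
    unfolding inner_add_left by (intro has_derivative_add C1c_has_derivative[OF assms(1)] C1c_has_derivative[OF assms(2)])
  have c: "continuous_on UNIV (\<lambda>x. grad \<phi> x + grad \<psi> x)"
    using assms by (intro continuous_intros C1c_continuous_grad)
  show "C1c \<Omega> (\<lambda>x. \<phi> x + \<psi> x)" "grad (\<lambda>x. \<phi> x + \<psi> x) = (\<lambda>x. grad \<phi> x + grad \<psi> x)"
    using C1cI[OF D c compact_Un[OF K(1,4)]] K by auto
qed

lemma C1c_cmult: assumes "C1c \<Omega> \<phi>"
  shows "C1c \<Omega> (\<lambda>x. c * \<phi> x)" "grad (\<lambda>x. c * \<phi> x) = (\<lambda>x. c *\<^sub>R grad \<phi> x)"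
proof -
  obtain K where K: "compact K" "K \<subseteq> \<Omega>" "\<And>x. x \<notin> K \<Longrightarrow> \<phi> x = 0"
    using C1c_supportE[OF assms(1)] by metis
  have D: "((\<lambda>x. c * \<phi> x) has_derivative (\<lambda>h. (c *\<^sub>R grad \<phi> x) \<bullet> h)) (at x)" for x
    using has_derivative_mult_right[OF C1c_has_derivative[OF assms], of c] by simp
  have c: "continuous_on UNIV (\<lambda>x. c *\<^sub>R grad \<phi> x)"
    using assms by (intro continuous_intros C1c_continuous_grad)
  show "C1c \<Omega> (\<lambda>x. c * \<phi> x)" "grad (\<lambda>x. c * \<phi> x) = (\<lambda>x. c *\<^sub>R grad \<phi> x)"
    using C1cI[OF D c K(1)] K by auto
qed

lemma C1c_diff: assumes "C1c \<Omega> \<phi>" "C1c \<Omega> \<psi>"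
  shows "C1c \<Omega> (\<lambda>x. \<phi> x - \<psi> x)" "grad (\<lambda>x. \<phi> x - \<psi> x) = (\<lambda>x. grad \<phi> x - grad \<psi> x)"
  using C1c_add[OF assms(1) C1c_cmult(1)[OF assms(2), of "-1"]] C1c_cmult(2)[OF assms(2), of "-1"] by simp_all

lemma C1_mult_C1c:
  assumes U: "\<And>x. (u has_derivative (\<lambda>h. gu x \<bullet> h)) (at x)" "continuous_on UNIV gu" and "C1c \<Omega> \<phi>"
  shows "C1c \<Omega> (\<lambda>x. u x * \<phi> x)" "grad (\<lambda>x. u x * \<phi> x) = (\<lambda>x. u x *\<^sub>R grad \<phi> x + \<phi> x *\<^sub>R gu x)"
proof -
  obtain K where K: "compact K" "K \<subseteq> \<Omega>" "\<And>x. x \<notin> K \<Longrightarrow> \<phi> x = 0"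
    using C1c_supportE[OF assms(3)] by metis
  have D: "((\<lambda>x. u x * \<phi> x) has_derivative (\<lambda>h. (u x *\<^sub>R grad \<phi> x + \<phi> x *\<^sub>R gu x) \<bullet> h)) (at x)" for x
    using has_derivative_mult[OF U(1)[of x] C1c_has_derivative[OF assms(3), of x]]
    by (simp add: inner_add_left mult.commute)
  have "continuous_on UNIV u" by (rule continuous_on_UNIV_has_derivative[OF U(1)])
  then have c: "continuous_on UNIV (\<lambda>x. u x *\<^sub>R grad \<phi> x + \<phi> x *\<^sub>R gu x)"
    using C1c_continuous_grad[OF assms(3)] C1c_continuous[OF assms(3)] assms(2) by (intro continuous_intros) auto
  show "C1c \<Omega> (\<lambda>x. u x * \<phi> x)" "grad (\<lambda>x. u x * \<phi> x) = (\<lambda>x. u x *\<^sub>R grad \<phi> x + \<phi> x *\<^sub>R gu x)"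
    using C1cI[OF D c K(1)] K by auto
qed

lemma C1c_mult: assumes "C1c \<Omega>' \<psi>" "C1c \<Omega> \<phi>"
  shows "C1c \<Omega> (\<lambda>x. \<psi> x * \<phi> x)" "grad (\<lambda>x. \<psi> x * \<phi> x) = (\<lambda>x. \<psi> x *\<^sub>R grad \<phi> x + \<phi> x *\<^sub>R grad \<psi> x)"
  using C1_mult_C1c[OF C1c_has_derivative[OF assms(1)] C1c_continuous_grad[OF assms(1)] assms(2)] by auto

lemma C1c_translate: assumes "C1c \<Omega> \<phi>" 
  shows "C1c ((\<lambda>x. x - y) ` \<Omega>) (\<lambda>x. \<phi> (x + y))" "grad (\<lambda>x. \<phi> (x + y)) = (\<lambda>x. grad \<phi> (x + y))"
proof -
  obtain K where K: "compact K" "K \<subseteq> \<Omega>" "\<And>x. x \<notin> K \<Longrightarrow> \<phi> x = 0"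
    using C1c_supportE[OF assms(1)] by metis
  have D: "((\<lambda>x. \<phi> (x + y)) has_derivative (\<lambda>h. grad \<phi> (x + y) \<bullet> h)) (at x)" for x
    by (rule has_derivative_compose[OF _ C1c_has_derivative[OF assms]]) (auto intro!: derivative_eq_intros)
  have c: "continuous_on UNIV (\<lambda>x. grad \<phi> (x + y))"
    by (rule continuous_on_compose2[OF C1c_continuous_grad[OF assms]]) (auto intro!: continuous_intros)
  have K': "compact ((\<lambda>x. x - y) ` K)"
    by (rule compact_continuous_image[OF _ K(1)]) (intro continuous_intros)
  have z: "\<phi> (x + y) = 0" if "x \<notin> (\<lambda>x. x - y) ` K" for x
    using K(3)[of "x + y"] that by (metis add_diff_cancel_right' image_eqI)
  show "C1c ((\<lambda>x. x - y) ` \<Omega>) (\<lambda>x. \<phi> (x + y))" "grad (\<lambda>x. \<phi> (x + y)) = (\<lambda>x. grad \<phi> (x + y))"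
    using C1cI[OF D c K' _ z] K(2) by (auto simp: image_mono)
qed

section \<open>Translations, integration by parts and the Poincare inequality\<close>

lemma
  fixes f :: "'a::euclidean_space \<Rightarrow> 'b::euclidean_space"
  assumes [measurable]: "f \<in> borel_measurable borel"
  shows integral_translate: "(\<integral>x. f (x + y) \<partial>lborel) = (\<integral>x. f x \<partial>lborel)"
    and integrable_translate: "integrable lborel (\<lambda>x. f (x + y)) \<longleftrightarrow> integrable lborel f"
proof -
  show "(\<integral>x. f (x + y) \<partial>lborel) = (\<integral>x. f x \<partial>lborel)"
    by (subst (2) lborel_distr_plus[of y, symmetric]) (simp add: integral_distr add.commute)
  show "integrable lborel (\<lambda>x. f (x + y)) \<longleftrightarrow> integrable lborel f"
    by (subst (2) lborel_distr_plus[of y, symmetric]) (simp add: integrable_distr_eq add.commute)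
qed

lemma nn_integral_translate:
  assumes [measurable]: "f \<in> borel_measurable borel"
  shows "(\<integral>\<^sup>+x. f (x + y) \<partial>lborel) = (\<integral>\<^sup>+x. f x \<partial>(lborel::'a::euclidean_space measure))"
  by (subst (2) lborel_distr_plus[of y, symmetric]) (simp add: nn_integral_distr add.commute)

lemma L2_translate: assumes "L2 f" shows "L2 (\<lambda>x. f (x + y))" "n2 (\<lambda>x. f (x + y)) = n2 f"
proof -
  have [measurable]: "f \<in> borel_measurable borel" using assms by (rule L2_measurable)
  show "L2 (\<lambda>x. f (x + y))"
    using assms integrable_translate[of "\<lambda>x. (norm (f x))\<^sup>2" y] by (simp add: L2_def)
  show "n2 (\<lambda>x. f (x + y)) = n2 f"
    using integral_translate[of "\<lambda>x. (norm (f x))\<^sup>2" y] by (simp add: n2_def)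
qed

lemma L2lim_translate:
  assumes "L2lim s f" "\<And>k. L2 (s k)" "L2 f" shows "L2lim (\<lambda>k x. s k (x + y)) (\<lambda>x. f (x + y))"
  using assms(1) L2_translate(2)[OF L2_diff[OF assms(2,3)]] by (simp add: L2lim_def)

text \<open>A single compact set carries all increments with \<open>norm h \<le> 1\<close>, so that
  uniform pointwise errors turn into errors of the integral with a fixed factor
  \<open>measure lborel K\<close>.\<close>

lemma C1c_increment_support:
  assumes "C1c \<Omega> \<phi>"
  obtains K where "compact K" "\<And>x h. norm h \<le> 1 \<Longrightarrow> x \<notin> K \<Longrightarrow> \<phi> (x + h) = 0 \<and> \<phi> x = 0 \<and> grad \<phi> x = 0"
proof -
  obtain K where K: "compact K" "\<And>x. x \<notin> K \<Longrightarrow> \<phi> x = 0" "\<And>x. x \<notin> K \<Longrightarrow> grad \<phi> x = 0"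
    using C1c_supportE[OF assms(1)] by metis
  define K2 where "K2 = {x + y | x y. x \<in> K \<and> y \<in> cball 0 1}"
  have c: "compact K2" unfolding K2_def by (rule compact_sums[OF K(1) compact_cball])
  have K2: "x \<in> K2" if "x + h \<in> K" "norm h \<le> 1" for x h
  proof -
    have "x = (x + h) + (- h)" "- h \<in> cball 0 1" using that by simp_all
    then show ?thesis unfolding K2_def using that by blast
  qed
  have K3: "x \<in> K2" if "x \<in> K" for x using K2[of x 0] that by simp
  show ?thesis by (rule that[OF c]) (use K(2,3) K2 K3 in blast)
qed

text \<open>By translation invariance the increments of \<open>\<phi>\<close> have integral 0, and
  the integral of the directional derivative differs from that of a difference quotient by an
  arbitrarily small amount.\<close>

lemma integral_grad_zero:
  assumes \<phi>: "C1c \<Omega> \<phi>" shows "(\<integral>x. grad \<phi> x \<bullet> v \<partial>lborel) = 0"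
proof (cases "v = 0")
  case False
  obtain K where K: "compact K" "\<And>x h. norm h \<le> 1 \<Longrightarrow> x \<notin> K \<Longrightarrow> \<phi> (x + h) = 0 \<and> \<phi> x = 0 \<and> grad \<phi> x = 0"
    using C1c_increment_support[OF assms] by blast
  note [measurable] = C1c_measurable[OF \<phi>]
  define m where "m = measure lborel K"
  have Kb: "K \<in> sets borel" using K(1) by (rule borel_compact)
  have m: "m \<ge> 0" by (simp add: m_def)
  define I where "I = \<bar>\<integral>x. grad \<phi> x \<bullet> v \<partial>lborel\<bar>"
  have "I \<le> e * (norm v * m)" if e: "e > 0" for e
  proof -
    obtain d where d: "d > 0" "\<And>x h. norm h < d \<Longrightarrow> \<bar>\<phi> (x + h) - \<phi> x - grad \<phi> x \<bullet> h\<bar> \<le> e * norm h"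
      using C1c_uniform_derivative[OF \<phi> e] by blast
    \<comment> \<open>The factor 2 makes \<open>norm (t *\<^sub>R v)\<close> strictly smaller than
      \<open>d\<close>.\<close>
    define t where "t = min d 1 / (2 * norm v)"
    have t: "t > 0" "norm (t *\<^sub>R v) < d" "norm (t *\<^sub>R v) \<le> 1"
      using d(1) False by (auto simp: t_def min_def field_simps)
    have i1: "integrable lborel (\<lambda>x. \<phi> (x + t *\<^sub>R v) - \<phi> x)"
      using C1c_L2(3)[OF \<phi>] by (simp add: integrable_translate)
    have i2: "integrable lborel (\<lambda>x. grad \<phi> x \<bullet> (t *\<^sub>R v))"
      using C1c_L2(4)[OF \<phi>] by (intro integrable_inner_left) auto
    have "t * I = \<bar>\<integral>x. (\<phi> (x + t *\<^sub>R v) - \<phi> x) - grad \<phi> x \<bullet> (t *\<^sub>R v) \<partial>lborel\<bar>"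
      using t(1) C1c_L2(3)[OF \<phi>] i1 i2 
      by (subst Bochner_Integration.integral_diff[OF i1 i2])
        (simp add: I_def integral_translate integrable_translate abs_mult)
    also have "\<dots> \<le> (\<integral>x. e * norm (t *\<^sub>R v) * indicat_real K x \<partial>lborel)"
    proof (rule order_trans[OF integral_abs_bound integral_mono_AE])
      show "integrable lborel (\<lambda>x. \<bar>\<phi> (x + t *\<^sub>R v) - \<phi> x - grad \<phi> x \<bullet> (t *\<^sub>R v)\<bar>)"
        using i1 i2 by (intro integrable_abs Bochner_Integration.integrable_diff[of _ "\<lambda>x. \<phi> (x + t *\<^sub>R v) - \<phi> x"])
      show "AE x in lborel. \<bar>\<phi> (x + t *\<^sub>R v) - \<phi> x - grad \<phi> x \<bullet> (t *\<^sub>R v)\<bar> \<le> e * norm (t *\<^sub>R v) * indicat_real K x"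
        using d(2)[OF t(2)] K(2)[OF t(3)] by (intro AE_I2) (auto simp: indicator_def)
    qed (use integrable_indicator_compact[OF K(1)] in auto)
    also have "\<dots> = t * (e * (norm v * m))" using t(1) Kb by (simp add: m_def)
    finally show ?thesis using t(1) by simp
  qed
  note bd = this
  have "I \<le> 0"
  proof (rule field_le_epsilon)
    fix e :: real assume "e > 0"
    have p: "norm v * m + 1 > 0" using m by (simp add: add_nonneg_pos)
    have "e / (norm v * m + 1) * (norm v * m) \<le> e" using p \<open>e > 0\<close> m by (simp add: field_simps)
    then show "I \<le> 0 + e" using bd[of "e / (norm v * m + 1)"] \<open>e > 0\<close> p by simp
  qed
  then show ?thesis by (simp add: I_def)
qed simp

lemma integration_by_parts:
  assumes U: "\<And>x. (u has_derivative (\<lambda>h. gu x \<bullet> h)) (at x)" "continuous_on UNIV gu" and \<phi>: "C1c \<Omega> \<phi>"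
  shows "(\<integral>x. u x * (grad \<phi> x \<bullet> v) \<partial>lborel) = - (\<integral>x. \<phi> x * (gu x \<bullet> v) \<partial>lborel)"
proof -
  obtain K where K: "compact K" "\<And>x. x \<notin> K \<Longrightarrow> \<phi> x = 0" "\<And>x. x \<notin> K \<Longrightarrow> grad \<phi> x = 0"
    using C1c_supportE[OF \<phi>] by metis
  have cu: "continuous_on UNIV u" by (rule continuous_on_UNIV_has_derivative[OF U(1)])
  have i1: "integrable lborel (\<lambda>x. u x * (grad \<phi> x \<bullet> v))"
    by (rule continuous_compact_support_L2(2)[OF _ K(1)])
      (auto intro!: continuous_intros cu C1c_continuous_grad[OF \<phi>] simp: K)
  have i2: "integrable lborel (\<lambda>x. \<phi> x * (gu x \<bullet> v))"
    by (rule continuous_compact_support_L2(2)[OF _ K(1)])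
      (auto intro!: continuous_intros U(2) C1c_continuous[OF \<phi>] simp: K)
  from integral_grad_zero[OF C1_mult_C1c(1)[OF U \<phi>], of v]
  show ?thesis using i1 i2 by (simp add: C1_mult_C1c(2)[OF U \<phi>] inner_add_left)
qed

text \<open>The field \<open>(x \<bullet> e) *\<^sub>R e\<close> has divergence 1. Integrating
  \<open>\<phi>\<^sup>2\<close> by parts against it and applying Cauchy-Schwarz gives
  \<open>2 * R\<close> as the factor between the norms, hence \<open>4 * R\<^sup>2\<close> for their
  squares.\<close>

theorem Poincare:
  assumes \<phi>: "C1c \<Omega> \<phi>" and R: "\<And>x. x \<in> \<Omega> \<Longrightarrow> norm x \<le> R" "R > 0"
  shows "n2 \<phi> \<le> 4 * R\<^sup>2 * n2 (grad \<phi>)"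
proof -
  define e :: "real^'a" where "e = axis undefined 1"
  have e: "norm e = 1" by (simp add: e_def)
  have D: "((\<lambda>x. x \<bullet> e) has_derivative (\<lambda>h. e \<bullet> h)) (at x)" for x
    by (auto intro!: derivative_eq_intros simp: inner_commute)
  have pp: "C1c \<Omega> (\<lambda>x. \<phi> x * \<phi> x)" "grad (\<lambda>x. \<phi> x * \<phi> x) = (\<lambda>x. (2 * \<phi> x) *\<^sub>R grad \<phi> x)"
    using C1c_mult[OF \<phi> \<phi>] by (simp_all only: mult_2 scaleR_left_distrib)
  have "n2 \<phi> = (\<integral>x. (\<phi> x * \<phi> x) * (e \<bullet> e) \<partial>lborel)"
    using e by (simp add: n2_def power2_eq_square flip: power2_norm_eq_inner)
  also have "\<dots> = - (\<integral>x. (x \<bullet> e) * (grad (\<lambda>x. \<phi> x * \<phi> x) x \<bullet> e) \<partial>lborel)"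
    using integration_by_parts[OF D _ pp(1), of e] by simp
  also have "\<dots> = - (\<integral>x. ((2 * (x \<bullet> e) * \<phi> x) *\<^sub>R e) \<bullet> grad \<phi> x \<partial>lborel)"
    by (intro arg_cong[where f=uminus] Bochner_Integration.integral_cong) 
       (simp_all add: pp inner_commute)
  finally have eq: "n2 \<phi> = - (\<integral>x. ((2 * (x \<bullet> e) * \<phi> x) *\<^sub>R e) \<bullet> grad \<phi> x \<partial>lborel)" .
  have b: "norm ((2 * (x \<bullet> e) * \<phi> x) *\<^sub>R e) \<le> (2 * R) * norm (\<phi> x)" for x
  proof (cases "x \<in> \<Omega>")
    case True
    have "\<bar>x \<bullet> e\<bar> \<le> R" using Cauchy_Schwarz_ineq2[of x e] R(1)[OF True] e by simp
    then show ?thesis by (auto simp: e abs_mult intro!: mult_right_mono)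
  qed (simp add: C1c_zero_off(1)[OF \<phi>])
  have L: "L2 (\<lambda>x. (2 * (x \<bullet> e) * \<phi> x) *\<^sub>R e)"
    by (rule L2_dominated[OF C1c_L2(1)[OF \<phi>] _ b]) (use C1c_measurable[OF \<phi>] in simp)
  have "(n2 \<phi>)\<^sup>2 \<le> n2 (\<lambda>x. (2 * (x \<bullet> e) * \<phi> x) *\<^sub>R e) * n2 (grad \<phi>)"
    using L2_Cauchy_Schwarz[OF L C1c_L2(2)[OF \<phi>]] eq by simp
  also have "\<dots> \<le> ((2 * R)\<^sup>2 * n2 \<phi>) * n2 (grad \<phi>)"
    by (intro mult_right_mono n2_dominated[OF C1c_L2(1)[OF \<phi>] b]) auto
  finally have *: "n2 \<phi> * n2 \<phi> \<le> n2 \<phi> * (4 * R\<^sup>2 * n2 (grad \<phi>))" by (simp add: power2_eq_square ac_simps)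
  show ?thesis
  proof (cases "n2 \<phi> = 0")
    case False
    then have "n2 \<phi> > 0" using n2_nonneg[of \<phi>] by linarith
    with * show ?thesis by simp
  qed simp
qed

text \<open>The translation by \<open>y\<close> is cut into \<open>k\<close> equal steps.
  Translations preserve \<open>n2\<close>, so the steps contribute equally; each obeys the uniform
  first-order expansion, and since \<open>k\<close> times the step length is \<open>norm y\<close>,
  the total remainder stays proportional to \<open>e\<close>.\<close>

theorem translation_estimate:
  assumes \<phi>: "C1c \<Omega> \<phi>"
  shows "n2 (\<lambda>x. \<phi> (x + y) - \<phi> x) \<le> (norm y)\<^sup>2 * n2 (grad \<phi>)"
proof -
  obtain K where K: "compact K" "\<And>x h. norm h \<le> 1 \<Longrightarrow> x \<notin> K \<Longrightarrow> \<phi> (x + h) = 0 \<and> \<phi> x = 0 \<and> grad \<phi> x = 0"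
    using C1c_increment_support[OF assms] by blast
  note [measurable] = C1c_measurable[OF \<phi>]
  define m where "m = sqrt (measure lborel K)"
  have m: "m \<ge> 0" by (simp add: m_def)
  note L = C1c_L2[OF \<phi>]
  define N where "N h = sqrt (n2 (\<lambda>x. \<phi> (x + h) - \<phi> x))" for h
  have Ld: "L2 (\<lambda>x. \<phi> (x + h) - \<phi> x)" for h by (intro L2_diff L2_translate L)
  have sub: "N (real k *\<^sub>R h) \<le> real k * N h" for k h
  proof (induction k)
    case 0 show ?case by (simp add: N_def n2_def)
  next
    case (Suc k)
    have "N (real (Suc k) *\<^sub>R h) = sqrt (n2 (\<lambda>x. (\<phi> ((x + real k *\<^sub>R h) + h) - \<phi> (x + real k *\<^sub>R h)) + (\<phi> (x + real k *\<^sub>R h) - \<phi> x)))"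
      by (simp add: N_def algebra_simps)
    also have "\<dots> \<le> sqrt (n2 (\<lambda>x. \<phi> ((x + real k *\<^sub>R h) + h) - \<phi> (x + real k *\<^sub>R h))) + N (real k *\<^sub>R h)"
      unfolding N_def using L2_translate(1)[OF Ld[of h]] by (intro n2_triangle Ld) auto
    also have "\<dots> = N h + N (real k *\<^sub>R h)"
      using L2_translate(2)[OF Ld[of h], of "real k *\<^sub>R h"] by (simp add: N_def)
    finally show ?case using Suc by (simp add: algebra_simps)
  qed
  have bd: "N y \<le> norm y * sqrt (n2 (grad \<phi>)) + e * (norm y * m)" if e: "e > 0" for e
  proof -
    obtain d where d: "d > 0" "\<And>x h. norm h < d \<Longrightarrow> \<bar>\<phi> (x + h) - \<phi> x - grad \<phi> x \<bullet> h\<bar> \<le> e * norm h"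
      using C1c_uniform_derivative[OF \<phi> e] by blast
    \<comment> \<open>So many steps that each is shorter than \<open>d\<close>, where the expansion
      is valid, and than 1, where \<open>K\<close> contains the increment.\<close>
    obtain k :: nat where k: "real k > norm y / min d 1" using reals_Archimedean2 by blast
    have "norm y / min d 1 \<ge> 0" using d(1) by simp
    then have kp: "real k > 0" using k by linarith
    define h where "h = y /\<^sub>R real k"
    have kh: "real k *\<^sub>R h = y" "real k * norm h = norm y" using kp by (auto simp: h_def)
    have "norm y < real k * min d 1" using k d(1) by (simp add: field_simps)
    then have "norm y / real k < min d 1" using kp by (metis pos_divide_less_eq mult.commute)
    then have "norm h < min d 1" using kp by (simp only: h_def norm_scaleR) (simp add: divide_inverse mult.commute)
    then have h: "norm h < d" "norm h \<le> 1" by auto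
    have b1: "norm (grad \<phi> x \<bullet> h) \<le> norm h * norm (grad \<phi> x)" for x
      using Cauchy_Schwarz_ineq2[of "grad \<phi> x" h] by (simp add: mult.commute)
    have L1: "L2 (\<lambda>x. grad \<phi> x \<bullet> h)" by (rule L2_dominated[OF L(2) _ b1]) simp
    have L3: "L2 (\<lambda>x. \<phi> (x + h) - \<phi> x - grad \<phi> x \<bullet> h)" by (rule L2_diff[OF Ld L1])
    have n3: "n2 (\<lambda>x. \<phi> (x + h) - \<phi> x - grad \<phi> x \<bullet> h) \<le> (e * norm h)\<^sup>2 * measure lborel K"
      by (rule L2_bounded_compact_support[OF L2_measurable[OF L3] K(1)]) (use K(2)[OF h(2)] d(2)[OF h(1)] in auto)
    have "N h = sqrt (n2 (\<lambda>x. (grad \<phi> x \<bullet> h) + (\<phi> (x + h) - \<phi> x - grad \<phi> x \<bullet> h)))" by (simp add: N_def)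
    also have "\<dots> \<le> sqrt (n2 (\<lambda>x. grad \<phi> x \<bullet> h)) + sqrt (n2 (\<lambda>x. \<phi> (x + h) - \<phi> x - grad \<phi> x \<bullet> h))"
      by (rule n2_triangle[OF L1 L3])
    also have "\<dots> \<le> sqrt ((norm h)\<^sup>2 * n2 (grad \<phi>)) + sqrt ((e * norm h)\<^sup>2 * measure lborel K)"
      by (intro add_mono real_sqrt_le_mono n3 n2_dominated[OF L(2) b1])
    also have "\<dots> = norm h * sqrt (n2 (grad \<phi>)) + e * norm h * m"
      using e by (simp add: real_sqrt_mult m_def)
    finally have "real k * N h \<le> real k * (norm h * sqrt (n2 (grad \<phi>)) + e * norm h * m)"
      using kp by simp
    also have "\<dots> = norm y * sqrt (n2 (grad \<phi>)) + e * (norm y * m)" unfolding kh(2)[symmetric] by (simp add: algebra_simps)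
    finally show ?thesis using sub[of k h] kh(1) by simp
  qed
  have "N y \<le> norm y * sqrt (n2 (grad \<phi>))"
  proof (rule field_le_epsilon)
    fix e :: real assume "e > 0"
    have p: "norm y * m + 1 > 0" using m by (simp add: add_nonneg_pos)
    have "e / (norm y * m + 1) * (norm y * m) \<le> e" using p \<open>e > 0\<close> m by (simp add: field_simps)
    then show "N y \<le> norm y * sqrt (n2 (grad \<phi>)) + e" using bd[of "e / (norm y * m + 1)"] \<open>e > 0\<close> p by simp
  qed
  then have "(N y)\<^sup>2 \<le> (norm y * sqrt (n2 (grad \<phi>)))\<^sup>2" by (intro power_mono) (auto simp: N_def)
  then show ?thesis by (simp add: N_def power_mult_distrib)
qed

section \<open>Smooth kernels and continuity of translations\<close>

text \<open>The flat function \<open>exp (- 1 / t)\<close> divided by powers of t and extended by 0.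
  Keeping the power as an index makes the family closed under differentiation up to linear
  combinations.\<close>

definition bump_gen :: "nat \<Rightarrow> real \<Rightarrow> real" where
  "bump_gen k t = (if t > 0 then exp (- (1 / t)) / t ^ k else 0)"

text \<open>From \<open>exp (1 / t) \<ge> (1 / (n * t)) ^ n\<close> with \<open>n = k + 2\<close>:
  this power beats the denominator \<open>t ^ k\<close> and leaves \<open>t\<^sup>2\<close>, which
  is what makes the derivative at 0 vanish.\<close>

lemma bump_gen_bound: "\<bar>bump_gen k t\<bar> \<le> real (k + 2) ^ (k + 2) * t\<^sup>2"
proof (cases "t > 0")
  case True
  let ?n = "k + 2"
  have "(1 / (real ?n * t)) ^ ?n \<le> (1 + (1 / t) / real ?n) ^ ?n"
    using True by (intro power_mono) (auto simp: field_simps)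
  also have "\<dots> \<le> exp (1 / t)"
    using exp_ge_one_plus_x_over_n_power_n[of ?n "1/t"] True
    by (smt (verit) divide_nonneg_pos of_nat_0_le_iff zero_less_Suc add_2_eq_Suc')
  finally have "1 / (real ?n * t) ^ ?n \<le> exp (1 / t)" by (simp only: power_one_over)
  moreover have "(real ?n * t) ^ ?n > 0" using True by (intro zero_less_power mult_pos_pos) auto
  ultimately have "exp (- (1 / t)) \<le> (real ?n * t) ^ ?n"
    by (simp only: exp_minus) (metis divide_inverse inverse_inverse_eq inverse_le_imp_le inverse_positive_iff_positive exp_gt_zero mult_1 le_imp_inverse_le)
  then have "exp (- (1 / t)) / t ^ k \<le> (real ?n * t) ^ ?n / t ^ k"
    using True by (intro divide_right_mono) auto
  also have "\<dots> = real ?n ^ ?n * t\<^sup>2" using True by (simp only: power_mult_distrib power_add) simp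
  finally show ?thesis using True by (simp add: bump_gen_def)
qed (simp add: bump_gen_def)

lemma DERIV_bump_gen:
  "(bump_gen k has_real_derivative bump_gen (k + 2) t - real k * bump_gen (k + 1) t) (at t)"
proof (cases t "0::real" rule: linorder_cases)
  case greater
  have "((\<lambda>t. exp (- (1 / t)) / t ^ k) has_real_derivative bump_gen (k + 2) t - real k * bump_gen (k + 1) t) (at t)"
  proof (cases k)
    case 0
    with greater show ?thesis
      by (auto intro!: derivative_eq_intros simp: bump_gen_def power2_eq_square)
  next
    case (Suc j)
    with greater show ?thesis
      by (auto intro!: derivative_eq_intros simp: bump_gen_def field_simps power_eq_if[of t j])
  qed
  then show ?thesis
    by (rule has_field_derivative_transform_within_open[where S="{0<..}"]) (use greater in \<open>auto simp: bump_gen_def\<close>)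
next
  case less
  have "((\<lambda>t. 0) has_real_derivative 0) (at t)" by simp
  then have "(bump_gen k has_real_derivative 0) (at t)"
    by (rule has_field_derivative_transform_within_open[where S="{..<0}"]) (use less in \<open>auto simp: bump_gen_def\<close>)
  then show ?thesis using less by (simp add: bump_gen_def)
next
  case equal
  define C where "C = real (k + 2) ^ (k + 2)"
  have bd: "\<bar>bump_gen k h\<bar> \<le> C * h\<^sup>2" for h unfolding C_def by (rule bump_gen_bound)
  have lim: "((\<lambda>h::real. C * \<bar>h\<bar>) \<longlongrightarrow> 0) (at 0)" by (auto intro!: tendsto_eq_intros)
  have "(\<lambda>h. (bump_gen k (0 + h) - bump_gen k 0) / h) \<midarrow>0\<rightarrow> 0"
  proof (rule Lim_null_comparison[OF _ lim])
    have "norm ((bump_gen k (0 + h) - bump_gen k 0) / h) \<le> C * \<bar>h\<bar>" if "h \<noteq> 0" for h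
    proof -
      have "\<bar>bump_gen k h\<bar> / \<bar>h\<bar> \<le> C * h\<^sup>2 / \<bar>h\<bar>" by (intro divide_right_mono bd) auto
      also have "C * h\<^sup>2 / \<bar>h\<bar> = C * \<bar>h\<bar>" using that by (auto simp: power2_eq_square abs_if)
      finally have "\<bar>bump_gen k h / h\<bar> \<le> C * \<bar>h\<bar>" by simp
      moreover have "bump_gen k 0 = 0" by (simp add: bump_gen_def)
      ultimately show ?thesis by simp
    qed
    then show "\<forall>\<^sub>F h in at 0. norm ((bump_gen k (0 + h) - bump_gen k 0) / h) \<le> C * \<bar>h\<bar>"
      by (auto simp: eventually_at_filter)
  qed
  then show ?thesis using equal by (simp add: DERIV_def bump_gen_def)
qed

text \<open>An algebra containing the radial bumps and closed under partial derivatives, so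
  smoothness needs only first-order rules. The coordinates are generators because the chain rule
  produces a factor \<open>x $ i\<close>.\<close>

inductive_set bump_algebra :: "real \<Rightarrow> (real^'n \<Rightarrow> real) set" for a :: real where
  const: "(\<lambda>x. c) \<in> bump_algebra a"
| coord: "(\<lambda>x. x $ i) \<in> bump_algebra a"
| bump: "(\<lambda>x. bump_gen k (1 - a * (x \<bullet> x))) \<in> bump_algebra a"
| add: "f \<in> bump_algebra a \<Longrightarrow> g \<in> bump_algebra a \<Longrightarrow> (\<lambda>x. f x + g x) \<in> bump_algebra a"
| mult: "f \<in> bump_algebra a \<Longrightarrow> g \<in> bump_algebra a \<Longrightarrow> (\<lambda>x. f x * g x) \<in> bump_algebra a"

lemma has_derivative_bump:
  "((\<lambda>x. bump_gen k (1 - a * (x \<bullet> x))) has_derivative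
     (\<lambda>h. ((- 2 * a * (bump_gen (k + 2) (1 - a * (x \<bullet> x)) - real k * bump_gen (k + 1) (1 - a * (x \<bullet> x)))) *\<^sub>R x) \<bullet> h)) (at x)"
  for x :: "real^'n"
proof -
  have 1: "((\<lambda>x. 1 - a * (x \<bullet> x)) has_derivative (\<lambda>h. - (a * (2 * (x \<bullet> h))))) (at x)"
    by (auto intro!: derivative_eq_intros simp: inner_commute)
  show ?thesis
    using has_derivative_compose[OF 1 DERIV_bump_gen[of k "1 - a * (x \<bullet> x)", unfolded has_field_derivative_def]]
    by (simp add: algebra_simps)
qed

lemma bump_algebra_diff:
  fixes f :: "real^'n \<Rightarrow> real"
  assumes "f \<in> bump_algebra a"
  shows "(\<forall>x. f differentiable (at x)) \<and> (\<forall>i. pd i f \<in> bump_algebra a)"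
  using assms
proof induction
  case (const c)
  have "pd i (\<lambda>x. c) = (\<lambda>x. 0)" for i :: 'n by (rule ext) (simp add: pd_def)
  then show ?case by (simp add: bump_algebra.const)
next
  case (coord j)
  have D: "((\<lambda>x. x $ j) has_derivative (\<lambda>h. h $ j)) (at x)" for x :: "real^'n"
    by (rule bounded_linear_imp_has_derivative) (rule bounded_linear_vec_nth)
  have "pd i (\<lambda>x. x $ j) = (\<lambda>x. axis i 1 $ j)" for i :: 'n by (rule ext) (rule pd_eqI[OF D])
  then show ?case using D by (auto intro: bump_algebra.const simp: differentiable_def)
next
  case (bump k)
  have D: "((\<lambda>x. bump_gen k (1 - a * (x \<bullet> x))) has_derivative
     (\<lambda>h. ((- 2 * a * (bump_gen (k + 2) (1 - a * (x \<bullet> x)) - real k * bump_gen (k + 1) (1 - a * (x \<bullet> x)))) *\<^sub>R x) \<bullet> h)) (at x)"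
    for x :: "real^'n" by (rule has_derivative_bump)
  have "pd i (\<lambda>x. bump_gen k (1 - a * (x \<bullet> x))) =
    (\<lambda>x. (- 2 * a) * ((bump_gen (k + 2) (1 - a * (x \<bullet> x)) + (- real k) * bump_gen (k + 1) (1 - a * (x \<bullet> x))) * (x $ i)))" for i :: 'n
    by (rule ext) (subst pd_eqI[OF D], simp add: inner_axis)
  moreover have "(\<lambda>x. (- 2 * a) * ((bump_gen (k + 2) (1 - a * (x \<bullet> x)) + (- real k) * bump_gen (k + 1) (1 - a * (x \<bullet> x))) * (x $ i)))
     \<in> bump_algebra a" for i :: 'n
    by (intro bump_algebra.intros)
  ultimately show ?case using D by (auto simp: differentiable_def)
next
  case (add f g)
  have "pd i (\<lambda>x. f x + g x) = (\<lambda>x. pd i f x + pd i g x)" for i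
  proof
    fix x
    show "pd i (\<lambda>x. f x + g x) x = pd i f x + pd i g x"
      by (subst pd_eqI[OF has_derivative_add[OF has_derivative_grad has_derivative_grad]])
         (use add in \<open>auto simp: inner_axis grad_def\<close>)
  qed
  then show ?case using add by (auto intro: bump_algebra.add)
next
  case (mult f g)
  have "pd i (\<lambda>x. f x * g x) = (\<lambda>x. f x * pd i g x + pd i f x * g x)" for i
  proof
    fix x
    show "pd i (\<lambda>x. f x * g x) x = f x * pd i g x + pd i f x * g x"
      by (subst pd_eqI[OF has_derivative_mult[OF has_derivative_grad has_derivative_grad]])
         (use mult in \<open>auto simp: inner_axis grad_def\<close>)
  qed
  then show ?case using mult by (auto intro!: bump_algebra.add bump_algebra.mult)
qed

lemma bump_algebra_smooth: assumes "f \<in> bump_algebra a" shows "smooth f"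
proof -
  have "iter_pd is f \<in> bump_algebra a" for "is" using assms
    by (induction "is") (auto dest: bump_algebra_diff)
  then show ?thesis unfolding smooth_def using bump_algebra_diff by blast
qed

lemma integral_dilate:
  fixes f :: "'a::euclidean_space \<Rightarrow> 'b::euclidean_space"
  assumes [measurable]: "f \<in> borel_measurable borel" and h: "h > 0"
  shows "(\<integral>x. f (x /\<^sub>R h) \<partial>lborel) = h ^ DIM('a) *\<^sub>R (\<integral>x. f x \<partial>lborel)"
proof -
  have "(\<integral>x. f (x /\<^sub>R h) \<partial>lborel) = (\<integral>x. f (x /\<^sub>R h) \<partial>(density (distr lborel borel (\<lambda>x::'a. 0 + h *\<^sub>R x)) (\<lambda>_. ennreal \<bar>h\<bar>^DIM('a))))"
    using lborel_affine[of h "0::'a"] h by (simp flip: ennreal_power)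
  also have "\<dots> = (\<integral>x. f (x /\<^sub>R h) \<partial>(density (distr lborel borel (\<lambda>x::'a. 0 + h *\<^sub>R x)) (\<lambda>_. ennreal (h^DIM('a)))))"
    using h by (simp add: ennreal_power)
  also have "\<dots> = h ^ DIM('a) *\<^sub>R (\<integral>x. f x \<partial>lborel)"
    using h by (subst integral_density) (auto simp: integral_distr)
  finally show ?thesis .
qed

text \<open>Dilations of one normalised bump. Beyond the usual properties, two are recorded for the
  study of critical points: strict positivity in the open ball, for use as a cutoff, and the growth
  \<open>C / h\<close> of the L1 norm of the gradient.\<close>

theorem mollifier_family:
  obtains C :: real and \<rho> :: "real \<Rightarrow> real^'n \<Rightarrow> real" where "C > 0"
    "\<And>h. h > 0 \<Longrightarrow> smooth (\<rho> h)" "\<And>h. h > 0 \<Longrightarrow> C1c UNIV (\<rho> h)"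
    "\<And>h x. \<rho> h x \<ge> 0" "\<And>h x. h > 0 \<Longrightarrow> h \<le> norm x \<Longrightarrow> \<rho> h x = 0" 
    "\<And>h x. h > 0 \<Longrightarrow> norm x < h \<Longrightarrow> \<rho> h x > 0" 
    "\<And>h. h > 0 \<Longrightarrow> (\<integral>x. \<rho> h x \<partial>lborel) = 1"
    "\<And>h. h > 0 \<Longrightarrow> (\<integral>x. norm (grad (\<rho> h) x) \<partial>lborel) \<le> C / h"
proof -
  define b where "b h = (\<lambda>x::real^'n. bump_gen 0 (1 - (1 / h\<^sup>2) * (x \<bullet> x)))" for h
  have nn: "b h x \<ge> 0" for h x by (simp add: b_def bump_gen_def)
  have D: "(b h has_derivative (\<lambda>v. ((- 2 * (1 / h\<^sup>2) * bump_gen 2 (1 - (1 / h\<^sup>2) * (x \<bullet> x))) *\<^sub>R x) \<bullet> v)) (at x)" for h x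
    unfolding b_def using has_derivative_bump[of 0 "1 / h\<^sup>2" x] by (simp only: of_nat_0 mult_zero_left diff_zero add_0)
  define gb where "gb h = (\<lambda>x::real^'n. (- 2 * (1 / h\<^sup>2) * bump_gen 2 (1 - (1 / h\<^sup>2) * (x \<bullet> x))) *\<^sub>R x)" for h
  have cb: "continuous_on UNIV (bump_gen k)" for k
    using DERIV_bump_gen DERIV_isCont continuous_at_imp_continuous_on by blast
  have cgb: "continuous_on UNIV (gb h)" for h
    unfolding gb_def by (intro continuous_intros continuous_on_compose2[OF cb]) auto
  have off: "b h x = 0" if "h > 0" "h \<le> norm x" for h x
  proof -
    have "h\<^sup>2 \<le> x \<bullet> x" using power_mono[OF that(2), of 2] that(1) by (simp add: power2_norm_eq_inner)
    then have "1 - (1 / h\<^sup>2) * (x \<bullet> x) \<le> 0" using that(1) by (simp add: field_simps)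
    then show ?thesis by (simp add: b_def bump_gen_def)
  qed
  have pos: "b h x > 0" if "h > 0" "norm x < h" for h x
  proof -
    have "x \<bullet> x < h\<^sup>2" using power_strict_mono[OF that(2), of 2] that(1) by (simp add: power2_norm_eq_inner)
    then have "1 - (1 / h\<^sup>2) * (x \<bullet> x) > 0" using that(1) by (simp add: field_simps)
    then show ?thesis by (simp add: b_def bump_gen_def)
  qed
  have C1: "C1c UNIV (b h)" "grad (b h) = gb h" if "h > 0" for h
    using C1cI[of "b h" "gb h" "cball 0 h" UNIV] D[of h] cgb off[OF that] by (auto simp: gb_def)
  have scale: "b h x = b 1 (x /\<^sub>R h)" "gb h x = (1 / h) *\<^sub>R gb 1 (x /\<^sub>R h)" if "h > 0" for h x
    using that by (auto simp: b_def gb_def power2_eq_square field_simps)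
  define Z where "Z = (\<integral>x. b 1 x \<partial>lborel)"
  have ib: "integrable lborel (b 1)" using C1c_L2(3)[OF C1(1)] by simp
  have Zp: "Z > 0"
  proof -
    have "Z \<noteq> 0"
    proof
      assume "Z = 0"
      then have "AE x in lborel. b 1 x = 0"
        using integral_nonneg_eq_0_iff_AE[OF ib] nn by (simp add: Z_def)
      then have "AE x in lborel. x \<notin> ball (0::real^'n) 1"
        by eventually_elim (use pos[of 1] in force)
      then have "ball (0::real^'n) 1 \<in> null_sets lborel" by (simp add: AE_iff_null_sets)
      then have "measure lborel (ball (0::real^'n) 1) = 0" by (simp add: null_sets_def measure_def)
      then show False using content_ball_pos[of 1 "0::real^'n"] by simp
    qed
    moreover have "Z \<ge> 0" unfolding Z_def using nn by simp
    ultimately show ?thesis by simp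
  qed
  have [measurable]: "b h \<in> borel_measurable borel" "gb h \<in> borel_measurable borel" if "h > 0" for h
    using C1c_measurable[OF C1(1)[OF that]] C1(2)[OF that] by auto
  \<comment> \<open>The value 0 for nonpositive \<open>h\<close> makes nonnegativity hold without a
    condition on \<open>h\<close>.\<close>
  define \<rho> where "\<rho> h x = (if h > 0 then b h x / (h ^ CARD('n) * Z) else 0)" for h x
  have \<rho>: "\<rho> h = (\<lambda>x. (1 / (h ^ CARD('n) * Z)) * b h x)" if "h > 0" for h
    using that by (auto simp: \<rho>_def)
  define G where "G = (\<integral>x. norm (gb 1 x) \<partial>lborel)"
  have intb: "(\<integral>x. b h x \<partial>lborel) = h ^ CARD('n) * Z" if "h > 0" for h
    using integral_dilate[of "b 1" h] that by (simp add: scale(1)[OF that] Z_def)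
  have intg: "(\<integral>x. norm (gb h x) \<partial>lborel) = h ^ CARD('n) * G / h" if "h > 0" for h
  proof -
    have "(\<integral>x. norm (gb h x) \<partial>lborel) = (\<integral>x. (1/h) * norm (gb 1 (x /\<^sub>R h)) \<partial>lborel)"
      using that by (intro Bochner_Integration.integral_cong) (simp_all add: scale(2)[OF that])
    then show ?thesis using integral_dilate[of "\<lambda>x. norm (gb 1 x)" h] that by (simp add: G_def)
  qed
  show thesis
  \<comment> \<open>The natural constant is \<open>G / Z\<close>; adding 1 makes it positive without
    an argument that \<open>G\<close> is.\<close>
  proof (rule that[of "G / Z + 1" \<rho>])
    have "G \<ge> 0" by (simp add: G_def)
    then show "G / Z + 1 > 0" using Zp by (simp add: add_nonneg_pos)
    fix h :: real and x assume h: "h > 0"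
    show "smooth (\<rho> h)"
      by (rule bump_algebra_smooth[of _ "1 / h\<^sup>2"]) (unfold \<rho>[OF h] b_def, intro bump_algebra.intros)
    show "C1c UNIV (\<rho> h)" unfolding \<rho>[OF h] by (rule C1c_cmult(1)[OF C1(1)[OF h]])
    show "(\<integral>x. \<rho> h x \<partial>lborel) = 1" using intb[OF h] h Zp by (simp add: \<rho>)
    have "(\<integral>x. norm (grad (\<rho> h) x) \<partial>lborel) = (1 / (h ^ CARD('n) * Z)) * (h ^ CARD('n) * G / h)"
      unfolding \<rho>[OF h] C1c_cmult(2)[OF C1(1)[OF h]] C1(2)[OF h] intg[OF h, symmetric] using h Zp by simp
    also have "\<dots> = (G / Z) / h" using h Zp by simp
    also have "\<dots> \<le> (G / Z + 1) / h" using h by (intro divide_right_mono) auto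
    finally show "(\<integral>x. norm (grad (\<rho> h) x) \<partial>lborel) \<le> (G / Z + 1) / h" .
    show "h \<le> norm x \<Longrightarrow> \<rho> h x = 0" using off[OF h] by (simp add: \<rho>_def)
    show "norm x < h \<Longrightarrow> \<rho> h x > 0" using pos[OF h] h Zp by (simp add: \<rho>_def)
  next
    fix h x show "\<rho> h x \<ge> 0" using nn Zp by (simp add: \<rho>_def)
  qed
qed

section \<open>Density of continuous functions and continuity of translations in L2\<close>

lemma L2lim_dominated:
  fixes s :: "nat \<Rightarrow> 'a::euclidean_space \<Rightarrow> 'b::euclidean_space" and w :: "'a \<Rightarrow> real"
  assumes [measurable]: "\<And>k. s k \<in> borel_measurable borel" "f \<in> borel_measurable borel"
    and lim: "AE x in lborel. (\<lambda>k. s k x) \<longlonglongrightarrow> f x" and w: "L2 w" "\<And>k x. norm (s k x - f x) \<le> w x"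
  shows "L2lim s f"
proof -
  have "(\<lambda>k. \<integral>x. (norm (s k x - f x))\<^sup>2 \<partial>lborel) \<longlonglongrightarrow> (\<integral>x. (0::real) \<partial>(lborel::'a measure))"
  proof (rule integral_dominated_convergence[where w="\<lambda>x. (norm (w x))\<^sup>2"])
    show "AE x in lborel. (\<lambda>k. (norm (s k x - f x))\<^sup>2) \<longlonglongrightarrow> 0"
      using lim
    proof eventually_elim
      case (elim x)
      have "(\<lambda>k. (norm (s k x - f x))\<^sup>2) \<longlonglongrightarrow> (norm (f x - f x))\<^sup>2" by (intro tendsto_intros elim)
      then show ?case by simp
    qed
    show "AE x in lborel. norm ((norm (s k x - f x))\<^sup>2) \<le> (norm (w x))\<^sup>2" for k
    proof (intro AE_I2)
      fix x
      have "norm (s k x - f x) \<le> norm (w x)" using w(2)[of k x] by simp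
      then have "(norm (s k x - f x))\<^sup>2 \<le> (norm (w x))\<^sup>2" by (rule power_mono) simp
      then show "norm ((norm (s k x - f x))\<^sup>2) \<le> (norm (w x))\<^sup>2" by simp
    qed
  qed (use L2_integrable[OF w(1)] in auto)
  then show ?thesis by (simp add: L2lim_def n2_def)
qed

lemma L2lim_ev_le: "L2lim s f \<Longrightarrow> e > 0 \<Longrightarrow> \<exists>N. \<forall>k\<ge>N. n2 (\<lambda>x. s k x - f x) < e"
  unfolding L2lim_def by (drule (1) order_tendstoD(2)) (simp add: eventually_sequentially)

lemma L2_dense_continuous:
  fixes f :: "'a::euclidean_space \<Rightarrow> real"
  assumes f: "L2 f" and e: "e > 0"
  obtains g K where "continuous_on UNIV g" "compact K" "\<And>x. x \<notin> K \<Longrightarrow> g x = 0" "n2 (\<lambda>x. g x - f x) \<le> e"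
proof -
  have [measurable]: "f \<in> borel_measurable borel" using f by (rule L2_measurable)
  define cl where "cl M s = max (- M) (min M s)" for M s :: real
  define ch where "ch M x = max 0 (min 1 (M + 1 - norm x))" for M and x :: 'a
  \<comment> \<open>Cutting \<open>f\<close> in height by \<open>cl\<close> and in space by
    \<open>ch\<close> gives a bounded function of bounded support that is L2-close to
    \<open>f\<close> for large \<open>M\<close>.\<close>
  define T where "T M x = ch M x * cl M (f x)" for M x
  have [measurable]: "ch M \<in> borel_measurable borel" for M unfolding ch_def by measurable
  have [measurable]: "cl M \<in> borel_measurable borel" for M unfolding cl_def by measurable
  have [measurable]: "T M \<in> borel_measurable borel" for M unfolding T_def by measurable
  have ch1: "0 \<le> ch M x" "ch M x \<le> 1" for M x by (auto simp: ch_def)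
  have clb: "M \<ge> 0 \<Longrightarrow> \<bar>cl M s\<bar> \<le> M" "M \<ge> 0 \<Longrightarrow> \<bar>cl M s\<bar> \<le> \<bar>s\<bar>" for M s by (auto simp: cl_def)
  have Tb: "\<bar>T (real k) x\<bar> \<le> 1 * \<bar>f x\<bar>" for k x
    unfolding T_def abs_mult using ch1[of "real k" x] clb(2)[of "real k" "f x"] by (intro mult_mono) auto
  have "L2lim (\<lambda>k. T (real k)) f"
  proof (rule L2lim_dominated[where w="\<lambda>x. 2 * norm (f x)"])
    show "AE x in lborel. (\<lambda>k. T (real k) x) \<longlonglongrightarrow> f x"
    proof (intro AE_I2)
      fix x
      obtain N :: nat where N: "real N \<ge> max \<bar>f x\<bar> (norm x)" using real_arch_simple by blast
      have "T (real k) x = f x" if "k \<ge> N" for k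
      proof -
        have "real N \<le> real k" using that by simp
        then have "\<bar>f x\<bar> \<le> real k" "norm x \<le> real k" using N by linarith+
        then have "cl (real k) (f x) = f x" "ch (real k) x = 1" by (auto simp: cl_def ch_def)
        then show ?thesis by (simp add: T_def)
      qed
      then show "(\<lambda>k. T (real k) x) \<longlonglongrightarrow> f x"
        by (intro tendsto_eventually) (auto simp: eventually_sequentially)
    qed
    show "L2 (\<lambda>x. 2 * norm (f x))" by (rule L2_dominated[OF f, where C=2]) auto
    fix k x
    show "norm (T (real k) x - f x) \<le> 2 * norm (f x)" using Tb[of k x] by simp
  qed (auto simp: T_def)
  then obtain M :: nat where M: "n2 (\<lambda>x. T (real M) x - f x) < e / 4" using L2lim_ev_le[of _ f "e/4"] e by auto
  \<comment> \<open>A measurable function is an almost everywhere limit of continuous functions.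
    These are uncontrolled in size, so the same two cutoffs are applied to them, which supplies the
    majorant for dominated convergence.\<close>
  have "f measurable_on UNIV" by (rule lebesgue_measurable_imp_measurable_on_real) (auto intro: measurable_completion)
  then obtain N g where Ng: "negligible N" "\<And>n. continuous_on UNIV (g n)" "\<And>x. x \<notin> N \<Longrightarrow> (\<lambda>n. g n x) \<longlonglongrightarrow> f x"
    by (auto simp: measurable_on_def)
  have [measurable]: "g n \<in> borel_measurable borel" for n using Ng(2) by (rule borel_measurable_continuous_onI)
  have "AE x in lebesgue. x \<notin> N" using Ng(1) by (auto simp: negligible_iff_null_sets intro: AE_not_in)
  then have AE: "AE x in lborel. x \<notin> N" by (simp add: AE_completion_iff)
  define s where "s n x = ch (real M) x * cl (real M) (g n x)" for n x
  have [measurable]: "s n \<in> borel_measurable borel" for n unfolding s_def by measurable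
  let ?K = "cball (0::'a) (real M + 1)"
  have LK: "L2 (\<lambda>x. 2 * real M * indicat_real ?K x)"
    by (rule L2_bounded_compact_support(1)[where K="?K" and M="2 * real M"]) (auto simp: indicator_def)
  have off: "ch (real M) x = 0" if "x \<notin> ?K" for x using that by (auto simp: ch_def)
  have "L2lim s (T (real M))"
  proof (rule L2lim_dominated[OF _ _ _ LK])
    show "AE x in lborel. (\<lambda>k. s k x) \<longlonglongrightarrow> T (real M) x"
      using AE
    proof eventually_elim
      case (elim x)
      show ?case unfolding s_def T_def cl_def by (intro tendsto_intros Ng(3)[OF elim])
    qed
    fix k x
    have "\<bar>cl (real M) (g k x) - cl (real M) (f x)\<bar> \<le> 2 * real M" by (auto simp: cl_def)
    then have "ch (real M) x * \<bar>cl (real M) (g k x) - cl (real M) (f x)\<bar> \<le> 1 * (2 * real M)"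
      using ch1 by (intro mult_mono) auto
    then show "norm (s k x - T (real M) x) \<le> 2 * real M * indicat_real ?K x"
      using off[of x] ch1[of "real M" x] by (cases "x \<in> ?K") (auto simp: s_def T_def abs_mult simp flip: right_diff_distrib)
  qed (auto simp: s_def T_def)
  then obtain n where n: "n2 (\<lambda>x. s n x - T (real M) x) < e / 4" using L2lim_ev_le[of _ _ "e/4"] e by fastforce
  have cs: "continuous_on UNIV (s n)"
    unfolding s_def ch_def cl_def by (intro continuous_intros Ng(2))
  have Ls: "L2 (s n)" by (rule continuous_compact_support_L2[OF cs, of ?K]) (use off in \<open>auto simp: s_def\<close>)
  have LT: "L2 (T (real M))"
    by (rule L2_dominated[OF f, where C=1])
      (use Tb in \<open>auto simp: T_def\<close>)
  have "n2 (\<lambda>x. s n x - f x) \<le> 2 * n2 (\<lambda>x. s n x - T (real M) x) + 2 * n2 (\<lambda>x. T (real M) x - f x)"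
    using n2_add_le[OF L2_diff[OF Ls LT] L2_diff[OF LT f]] by simp
  then have "n2 (\<lambda>x. s n x - f x) \<le> e" using n M by linarith
  then show thesis using that[of "s n" ?K] cs off by (auto simp: s_def)
qed

lemma L2_translation_continuous_real:
  fixes f :: "'a::euclidean_space \<Rightarrow> real"
  assumes f: "L2 f" and e: "e > 0"
  obtains d where "d > 0" "\<And>y. norm y < d \<Longrightarrow> n2 (\<lambda>x. f (x + y) - f x) \<le> e"
proof -
  \<comment> \<open>The budget: two applications of \<open>n2_add_le\<close> give
    \<open>2 * (e/6) + 2 * (2 * (e/12) + 2 * (e/12)) = e\<close>.\<close>
  obtain g K where g: "continuous_on UNIV g" "compact K" "\<And>x. x \<notin> K \<Longrightarrow> g x = 0" "n2 (\<lambda>x. g x - f x) \<le> e / 12"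
    using L2_dense_continuous[OF f, of "e/12"] e by auto
  have Lg: "L2 g" by (rule continuous_compact_support_L2[OF g(1-3)])
  define K2 where "K2 = {x + y | x y. x \<in> K \<and> y \<in> cball 0 1}"
  have c: "compact K2" unfolding K2_def by (rule compact_sums[OF g(2) compact_cball])
  have K2: "x \<in> K2" if "x + h \<in> K" "norm h \<le> 1" for x h
  proof -
    have "x = (x + h) + (- h)" "- h \<in> cball 0 1" using that by simp_all
    then show ?thesis unfolding K2_def using that by blast
  qed
  define m where "m = measure lborel K2 + 1"
  have m: "m > 0" "measure lborel K2 \<le> m" by (auto simp: m_def add_nonneg_pos)
  define e' where "e' = sqrt (e / (6 * m))"
  have e': "e' > 0" "e'\<^sup>2 * m = e / 6" using e m by (auto simp: e'_def)
  obtain d where d: "d > 0" "\<And>x y. norm (y - x) < d \<Longrightarrow> norm (g y - g x) < e'"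
    using compact_support_uniformly_continuous[OF g(1-3) e'(1)] by blast
  show thesis
  proof (rule that[of "min d 1"])
    show "min d 1 > 0" using d by simp
    fix y :: 'a assume y: "norm y < min d 1"
    have Lt: "L2 (\<lambda>x. f (x + y))" "L2 (\<lambda>x. g (x + y))" using L2_translate f Lg by auto
    have "n2 (\<lambda>x. g (x + y) - g x) \<le> e'\<^sup>2 * measure lborel K2"
    proof (rule L2_bounded_compact_support(3)[OF _ c])
      show "(\<lambda>x. g (x + y) - g x) \<in> borel_measurable borel" using L2_diff[OF Lt(2) Lg] by (rule L2_measurable)
      show "g (x + y) - g x = 0" if "x \<notin> K2" for x
      proof -
        have "x + y \<notin> K" "x \<notin> K" using K2[of x y] K2[of x 0] that y by auto
        then show ?thesis using g(3) by simp
      qed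
      show "norm (g (x + y) - g x) \<le> e'" for x using d(2)[of "x + y" x] y by simp
    qed
    also have "\<dots> \<le> e / 6" using mult_left_mono[OF m(2), of "e'\<^sup>2"] e'(2) by simp
    finally have 1: "n2 (\<lambda>x. g (x + y) - g x) \<le> e / 6" .
    have 2: "n2 (\<lambda>x. f (x + y) - g (x + y)) \<le> e / 12"
      using L2_translate(2)[OF L2_diff[OF f Lg], of y] g(4) by (simp add: n2_diff_commute[of f g])
    have "n2 (\<lambda>x. f (x + y) - f x) = n2 (\<lambda>x. (g (x + y) - g x) + ((f (x + y) - g (x + y)) + (g x - f x)))" by simp
    also have "\<dots> \<le> 2 * n2 (\<lambda>x. g (x + y) - g x) + 2 * n2 (\<lambda>x. (f (x + y) - g (x + y)) + (g x - f x))"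
      by (intro n2_add_le L2_add L2_diff Lt f Lg)
    also have "n2 (\<lambda>x. (f (x + y) - g (x + y)) + (g x - f x)) \<le> 2 * n2 (\<lambda>x. f (x + y) - g (x + y)) + 2 * n2 (\<lambda>x. g x - f x)"
      by (intro n2_add_le L2_add L2_diff Lt f Lg)
    finally show "n2 (\<lambda>x. f (x + y) - f x) \<le> e" using 1 2 g(4) by simp
  qed
qed

lemma n2_Basis: assumes "L2 f" shows "n2 f = (\<Sum>b\<in>Basis. n2 (\<lambda>x. f x \<bullet> b))"
proof -
  have [measurable]: "f \<in> borel_measurable borel" using assms by (rule L2_measurable)
  have L: "L2 (\<lambda>x. f x \<bullet> b)" if "b \<in> Basis" for b
    by (rule L2_dominated[OF assms, where C=1]) (use that Basis_le_norm in auto)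
  have "n2 f = (\<integral>x. (\<Sum>b\<in>Basis. (norm (f x \<bullet> b))\<^sup>2) \<partial>lborel)"
    unfolding n2_eq_inner by (subst euclidean_inner) (simp add: power2_eq_square)
  also have "\<dots> = (\<Sum>b\<in>Basis. n2 (\<lambda>x. f x \<bullet> b))"
    unfolding n2_def by (rule Bochner_Integration.integral_sum) (rule L2_integrable[OF L])
  finally show ?thesis .
qed

theorem L2_translation_continuous:
  fixes f :: "'a::euclidean_space \<Rightarrow> 'b::euclidean_space"
  assumes f: "L2 f" and e: "e > 0"
  shows "\<exists>d>0. \<forall>y. norm y < d \<longrightarrow> n2 (\<lambda>x. f (x + y) - f x) \<le> e"
proof -
  have [measurable]: "f \<in> borel_measurable borel" using f by (rule L2_measurable)
  have "\<exists>d>0. \<forall>y. norm y < d \<longrightarrow> n2 (\<lambda>x. f (x + y) \<bullet> b - f x \<bullet> b) \<le> e / DIM('b)" if "b \<in> Basis" for b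
  proof -
    have "L2 (\<lambda>x. f x \<bullet> b)" by (rule L2_dominated[OF f, where C=1]) (use that Basis_le_norm in auto)
    moreover have "e / DIM('b) > 0" using e by simp
    ultimately obtain d where "d > 0" "\<And>y. norm y < d \<Longrightarrow> n2 (\<lambda>x. f (x + y) \<bullet> b - f x \<bullet> b) \<le> e / DIM('b)"
      using L2_translation_continuous_real[of "\<lambda>x. f x \<bullet> b"] by blast
    then show ?thesis by blast
  qed
  then obtain d where d: "\<And>b. b \<in> Basis \<Longrightarrow> d b > 0"
    "\<And>b y. b \<in> Basis \<Longrightarrow> norm y < d b \<Longrightarrow> n2 (\<lambda>x. f (x + y) \<bullet> b - f x \<bullet> b) \<le> e / DIM('b)" by metis
  have "n2 (\<lambda>x. f (x + y) - f x) \<le> e" if "norm y < Min (d ` Basis)" for y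
  proof -
    have "n2 (\<lambda>x. f (x + y) - f x) = (\<Sum>b\<in>Basis. n2 (\<lambda>x. f (x + y) \<bullet> b - f x \<bullet> b))"
      by (subst n2_Basis[OF L2_diff[OF L2_translate(1)[OF f] f]]) (simp add: inner_diff_left)
    also have "\<dots> \<le> (\<Sum>b\<in>(Basis::'b set). e / DIM('b))" using that by (intro sum_mono d(2)) auto
    finally show ?thesis by simp
  qed
  moreover have "Min (d ` Basis) > 0" using d(1) by auto
  ultimately show ?thesis by blast
qed

section \<open>Mollification\<close>

definition conv :: "(real^'n \<Rightarrow> real) \<Rightarrow> (real^'n \<Rightarrow> 'b::euclidean_space) \<Rightarrow> real^'n \<Rightarrow> 'b" where
  "conv \<rho> f x = (\<integral>y. \<rho> (x - y) *\<^sub>R f y \<partial>lborel)"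

lemma lborel_reflect: "distr lborel borel (\<lambda>y. x - y) = (lborel :: 'a::euclidean_space measure)"
  using lborel_affine[of "-1" x] by (simp add: density_1)

lemma
  fixes f :: "'a::euclidean_space \<Rightarrow> 'b::euclidean_space"
  assumes [measurable]: "f \<in> borel_measurable borel"
  shows integral_reflect_lborel: "(\<integral>y. f (x - y) \<partial>lborel) = (\<integral>y. f y \<partial>lborel)"
    and integrable_reflect_lborel: "integrable lborel (\<lambda>y. f (x - y)) \<longleftrightarrow> integrable lborel f"
proof -
  show "(\<integral>y. f (x - y) \<partial>lborel) = (\<integral>y. f y \<partial>lborel)"
    by (subst (2) lborel_reflect[of x, symmetric]) (simp add: integral_distr)
  show "integrable lborel (\<lambda>y. f (x - y)) \<longleftrightarrow> integrable lborel f"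
    by (subst (2) lborel_reflect[of x, symmetric]) (simp add: integrable_distr_eq)
qed

lemma conv_integrable:
  fixes f :: "real^'n \<Rightarrow> real" and \<sigma> :: "real^'n \<Rightarrow> 'b::euclidean_space"
  assumes "integrable lborel f" and [measurable]: "\<sigma> \<in> borel_measurable borel" and M: "\<And>x. norm (\<sigma> x) \<le> M"
  shows "integrable lborel (\<lambda>y. f y *\<^sub>R \<sigma> (x - y))"
proof (rule integrable_dominated_real[where g="\<lambda>y. M * norm (f y)"])
  have [measurable]: "f \<in> borel_measurable borel" using assms(1) by (auto dest: borel_measurable_integrable)
  show "(\<lambda>y. f y *\<^sub>R \<sigma> (x - y)) \<in> borel_measurable borel" by simp
  show "norm (f y *\<^sub>R \<sigma> (x - y)) \<le> M * norm (f y)" for y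
    using mult_right_mono[OF M[of "x - y"], of "norm (f y)"] by (simp add: mult.commute)
qed (use assms(1) in simp)

lemma conv_integrable_vec:
  fixes f :: "real^'n \<Rightarrow> 'b::euclidean_space" 
  assumes "integrable lborel f" and [measurable]: "\<sigma> \<in> borel_measurable borel" and M: "\<And>x. \<bar>\<sigma> x\<bar> \<le> M"
  shows "integrable lborel (\<lambda>y. \<sigma> (x - y) *\<^sub>R f y)"
proof (rule integrable_dominated_real[where g="\<lambda>y. M * norm (f y)"])
  have [measurable]: "f \<in> borel_measurable borel" using assms(1) by (auto dest: borel_measurable_integrable)
  show "(\<lambda>y. \<sigma> (x - y) *\<^sub>R f y) \<in> borel_measurable borel" by simp
  show "norm (\<sigma> (x - y) *\<^sub>R f y) \<le> M * norm (f y)" for y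
    using mult_right_mono[OF M[of "x - y"], of "norm (f y)"] by simp
qed (use assms(1) in simp)

lemma conv_continuous:
  fixes f :: "real^'n \<Rightarrow> real" and \<sigma> :: "real^'n \<Rightarrow> 'b::euclidean_space"
  assumes f: "integrable lborel f" and \<sigma>: "continuous_on UNIV \<sigma>" "compact K" "\<And>x. x \<notin> K \<Longrightarrow> \<sigma> x = 0"
  shows "continuous_on UNIV (\<lambda>x. \<integral>y. f y *\<^sub>R \<sigma> (x - y) \<partial>lborel)"
proof (rule continuous_onI)
  have [measurable]: "\<sigma> \<in> borel_measurable borel" using \<sigma>(1) by (rule borel_measurable_continuous_onI)
  obtain M where M: "\<And>x. norm (\<sigma> x) \<le> M" using continuous_compact_support_bounded[OF \<sigma>] by blast
  have int: "integrable lborel (\<lambda>y. f y *\<^sub>R \<sigma> (x - y))" for x by (rule conv_integrable[OF f _ M]) simp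
  fix x :: "real^'n" and e :: real assume e: "e > 0"
  define I where "I = (\<integral>y. norm (f y) \<partial>lborel) + 1"
  have I: "I > 0" by (simp add: I_def add_nonneg_pos)
  obtain d where d: "d > 0" "\<And>x y. norm (y - x) < d \<Longrightarrow> norm (\<sigma> y - \<sigma> x) < e / I"
    using compact_support_uniformly_continuous[OF \<sigma>, of "e / I"] e I by auto
  have "dist (\<integral>y. f y *\<^sub>R \<sigma> (x' - y) \<partial>lborel) (\<integral>y. f y *\<^sub>R \<sigma> (x - y) \<partial>lborel) \<le> e" if x': "dist x' x < d" for x'
  proof -
    have "dist (\<integral>y. f y *\<^sub>R \<sigma> (x' - y) \<partial>lborel) (\<integral>y. f y *\<^sub>R \<sigma> (x - y) \<partial>lborel) = norm (\<integral>y. f y *\<^sub>R \<sigma> (x' - y) - f y *\<^sub>R \<sigma> (x - y) \<partial>lborel)"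
      using int[of x] int[of x'] by (simp add: dist_norm)
    also have "\<dots> \<le> (\<integral>y. (e / I) * norm (f y) \<partial>lborel)"
    proof (rule order_trans[OF integral_norm_bound integral_mono])
      fix y
      have "norm (\<sigma> (x' - y) - \<sigma> (x - y)) \<le> e / I" using d(2)[of "x' - y" "x - y"] x' by (simp add: dist_norm)
      then have "norm (f y) * norm (\<sigma> (x' - y) - \<sigma> (x - y)) \<le> norm (f y) * (e / I)" by (intro mult_left_mono) auto
      then show "norm (f y *\<^sub>R \<sigma> (x' - y) - f y *\<^sub>R \<sigma> (x - y)) \<le> (e / I) * norm (f y)"
        by (simp add: mult.commute flip: scaleR_diff_right)
    qed (use int[of x] int[of x'] f in auto)
    also have "\<dots> = (e / I) * (I - 1)" by (simp add: I_def)
    also have "\<dots> \<le> e" using e I by (simp add: field_simps)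
    finally show ?thesis .
  qed
  with d(1) show "\<exists>d>0. \<forall>x'\<in>UNIV. dist x' x < d \<longrightarrow>
      dist (\<integral>y. f y *\<^sub>R \<sigma> (x' - y) \<partial>lborel) (\<integral>y. f y *\<^sub>R \<sigma> (x - y) \<partial>lborel) \<le> e" by blast
qed

text \<open>The kernel is differentiable uniformly in its argument, so its remainder integrates
  against \<open>f\<close> with the factor of the L1 norm of \<open>f\<close>.\<close>

lemma conv_has_derivative:
  fixes f :: "real^'n \<Rightarrow> real"
  assumes f: "integrable lborel f" and \<rho>: "C1c UNIV \<rho>"
  shows "(conv \<rho> f has_derivative (\<lambda>h. (\<integral>y. f y *\<^sub>R grad \<rho> (x - y) \<partial>lborel) \<bullet> h)) (at x)"
  unfolding has_derivative_within_alt
proof (intro conjI allI impI)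
  note [measurable] = C1c_measurable[OF \<rho>]
  obtain M where M: "\<And>x. norm (\<rho> x) \<le> M" "\<And>x. norm (grad \<rho> x) \<le> M" using C1c_bounded[OF \<rho>] by (metis real_norm_def)
  have i1: "integrable lborel (\<lambda>y. f y *\<^sub>R \<rho> (x - y))" for x by (rule conv_integrable[OF f _ M(1)]) simp
  have i2: "integrable lborel (\<lambda>y. f y *\<^sub>R grad \<rho> (x - y))" for x by (rule conv_integrable[OF f _ M(2)]) simp
  show "bounded_linear (\<lambda>h. (\<integral>y. f y *\<^sub>R grad \<rho> (x - y) \<partial>lborel) \<bullet> h)" by (rule bounded_linear_inner_right)
  fix e :: real assume e: "e > 0"
  define I where "I = (\<integral>y. norm (f y) \<partial>lborel) + 1"
  have I: "I > 0" by (simp add: I_def add_nonneg_pos)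
  then have eI: "e / I > 0" using e by simp
  obtain d where d: "d > 0" "\<And>x h. norm h < d \<Longrightarrow> \<bar>\<rho> (x + h) - \<rho> x - grad \<rho> x \<bullet> h\<bar> \<le> (e / I) * norm h"
    using C1c_uniform_derivative[OF \<rho> eI] by blast
  have "norm (conv \<rho> f x' - conv \<rho> f x - (\<integral>y. f y *\<^sub>R grad \<rho> (x - y) \<partial>lborel) \<bullet> (x' - x)) \<le> e * norm (x' - x)"
    if x': "norm (x' - x) < d" for x'
  proof -
    have c: "conv \<rho> f x = (\<integral>y. f y * \<rho> (x - y) \<partial>lborel)" for x by (simp add: conv_def mult.commute)
    have j1: "integrable lborel (\<lambda>y. f y * \<rho> (x - y))" for x using i1[of x] by simp
    have j2: "integrable lborel (\<lambda>y. f y * (grad \<rho> (x - y) \<bullet> (x' - x)))" 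
      using integrable_inner_left[OF i2[of x], of "x' - x"] by simp
    have "conv \<rho> f x' - conv \<rho> f x - (\<integral>y. f y *\<^sub>R grad \<rho> (x - y) \<partial>lborel) \<bullet> (x' - x)
      = (\<integral>y. f y * \<rho> (x' - y) - f y * \<rho> (x - y) - f y * (grad \<rho> (x - y) \<bullet> (x' - x)) \<partial>lborel)"
      using j1[of x] j1[of x'] j2 i2[of x] unfolding c by (simp flip: integral_inner_left)
    also have "norm \<dots> \<le> (\<integral>y. (e / I * norm (x' - x)) * norm (f y) \<partial>lborel)"
    proof (rule order_trans[OF integral_norm_bound integral_mono])
      fix y
      have *: "x - y + (x' - x) = x' - y" by simp
      have "norm (f y) * \<bar>\<rho> (x' - y) - \<rho> (x - y) - grad \<rho> (x - y) \<bullet> (x' - x)\<bar> \<le> norm (f y) * (e / I * norm (x' - x))"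
        using d(2)[OF x', of "x - y"] unfolding * by (intro mult_left_mono) auto
      moreover have "f y * \<rho> (x' - y) - f y * \<rho> (x - y) - f y * (grad \<rho> (x - y) \<bullet> (x' - x))
        = f y * (\<rho> (x' - y) - \<rho> (x - y) - grad \<rho> (x - y) \<bullet> (x' - x))" by (simp add: algebra_simps)
      ultimately show "norm (f y * \<rho> (x' - y) - f y * \<rho> (x - y) - f y * (grad \<rho> (x - y) \<bullet> (x' - x))) \<le> (e / I * norm (x' - x)) * norm (f y)"
        by (simp only: real_norm_def abs_mult) (simp only: mult.commute)
    qed (use j1[of x] j1[of x'] j2 f in auto)
    also have "\<dots> = (e / I) * (I - 1) * norm (x' - x)" by (simp add: I_def)
    also have "\<dots> \<le> e * norm (x' - x)" using e I by (intro mult_right_mono) (simp_all add: field_simps)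
    finally show ?thesis .
  qed
  with d(1) show "\<exists>d>0. \<forall>x'\<in>UNIV. norm (x' - x) < d \<longrightarrow> norm (conv \<rho> f x' - conv \<rho> f x -
       (\<integral>y. f y *\<^sub>R grad \<rho> (x - y) \<partial>lborel) \<bullet> (x' - x)) \<le> e * norm (x' - x)" by blast
qed

lemma conv_grad:
  fixes f :: "real^'n \<Rightarrow> real"
  assumes f: "integrable lborel f" and \<rho>: "C1c UNIV \<rho>"
  shows "grad (conv \<rho> f) x = (\<integral>y. f y *\<^sub>R grad \<rho> (x - y) \<partial>lborel)"
    and "continuous_on UNIV (grad (conv \<rho> f))"
    and "(conv \<rho> f has_derivative (\<lambda>h. grad (conv \<rho> f) x \<bullet> h)) (at x)"
proof -
  have g: "grad (conv \<rho> f) = (\<lambda>x. \<integral>y. f y *\<^sub>R grad \<rho> (x - y) \<partial>lborel)"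
    by (rule ext) (rule grad_eqI[OF conv_has_derivative[OF assms]])
  show "grad (conv \<rho> f) x = (\<integral>y. f y *\<^sub>R grad \<rho> (x - y) \<partial>lborel)" by (simp add: g)
  obtain K where K: "compact K" "\<And>x. x \<notin> K \<Longrightarrow> grad \<rho> x = 0" using C1c_supportE[OF \<rho>] by metis
  show "continuous_on UNIV (grad (conv \<rho> f))"
    unfolding g by (rule conv_continuous[OF f C1c_continuous_grad[OF \<rho>] K])
  show "(conv \<rho> f has_derivative (\<lambda>h. grad (conv \<rho> f) x \<bullet> h)) (at x)"
    unfolding g by (rule conv_has_derivative[OF assms])
qed

lemma iter_pd_append: "iter_pd (is @ js) f = iter_pd is (iter_pd js f)"
  by (induction "is") auto

lemma test_fun_zero_off: "test_fun \<Omega> \<phi> \<Longrightarrow> x \<notin> closure {x. \<phi> x \<noteq> 0} \<Longrightarrow> \<phi> x = 0"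
  using closure_subset[of "{x. \<phi> x \<noteq> 0}"] by auto

lemma test_fun_pd: assumes "test_fun \<Omega> \<phi>" shows "test_fun \<Omega> (pd i \<phi>)"
proof (rule test_funI)
  show "smooth (pd i \<phi>)"
    using assms iter_pd_append[of _ "[i]" \<phi>] by (simp add: test_fun_def smooth_def) metis
  show "compact (closure {x. \<phi> x \<noteq> 0})" "closure {x. \<phi> x \<noteq> 0} \<subseteq> \<Omega>" using assms by (auto simp: test_fun_def)
  show "pd i \<phi> x = 0" if "x \<notin> closure {x. \<phi> x \<noteq> 0}" for x
    using arg_cong[OF grad_zero_off[OF closed_closure test_fun_zero_off[OF assms] that], where f="\<lambda>v. v $ i"]
    by (simp add: grad_nth)
qed

text \<open>Each derivative falls on the kernel, and iterated derivatives of the kernel are again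
  test functions, so the first-order formula can be repeated.\<close>

lemma conv_smooth:
  fixes f :: "real^'n \<Rightarrow> real"
  assumes f: "integrable lborel f" and \<rho>: "test_fun UNIV \<rho>"
  shows "smooth (conv \<rho> f)"
proof -
  have t: "test_fun UNIV (iter_pd is \<rho>)" for "is" by (induction "is") (auto intro: \<rho> test_fun_pd)
  have "iter_pd is (conv \<rho> f) = conv (iter_pd is \<rho>) f" for "is"
  proof (induction "is")
    case (Cons i "is")
    define \<sigma> where "\<sigma> = iter_pd is \<rho>"
    have \<sigma>: "C1c UNIV \<sigma>" unfolding \<sigma>_def by (rule test_fun_C1c[OF t])
    obtain M where M: "\<And>x. norm (grad \<sigma> x) \<le> M" using C1c_bounded[OF \<sigma>] by metis
    note i2 = conv_integrable[OF f C1c_measurable(2)[OF \<sigma>] M]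
    have "pd i (conv \<sigma> f) x = conv (pd i \<sigma>) f x" for x
    proof -
      have "pd i (conv \<sigma> f) x = (\<integral>y. f y *\<^sub>R grad \<sigma> (x - y) \<partial>lborel) \<bullet> axis i 1"
        by (rule pd_eqI[OF conv_has_derivative[OF f \<sigma>]])
      also have "\<dots> = (\<integral>y. (f y *\<^sub>R grad \<sigma> (x - y)) \<bullet> axis i 1 \<partial>lborel)"
        using i2 by (intro integral_inner_left[symmetric]) auto
      finally show ?thesis by (simp add: conv_def inner_axis grad_nth mult.commute)
    qed
    then show ?case using Cons by (auto simp: \<sigma>_def)
  qed simp
  moreover have "conv (iter_pd is \<rho>) f differentiable (at x)" for "is" x
    using conv_has_derivative[OF f test_fun_C1c[OF t]] unfolding differentiable_def by blast
  ultimately show ?thesis unfolding smooth_def by simp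
qed

lemma conv_alt:
  fixes f :: "real^'n \<Rightarrow> 'b::euclidean_space"
  assumes [measurable]: "f \<in> borel_measurable borel" "\<rho> \<in> borel_measurable borel"
  shows "conv \<rho> f x = (\<integral>y. \<rho> y *\<^sub>R f (x - y) \<partial>lborel)"
  unfolding conv_def using integral_reflect_lborel[of "\<lambda>y. \<rho> y *\<^sub>R f (x - y)" x] by simp

lemma conv_zero_off:
  assumes "\<And>y. h \<le> norm y \<Longrightarrow> \<rho> y = 0" "\<And>y. dist x y < h \<Longrightarrow> f y = 0"
  shows "conv \<rho> f x = 0"
proof -
  have "(\<lambda>y. \<rho> (x - y) *\<^sub>R f y) = (\<lambda>y. 0)"
    using assms by (auto simp: dist_norm fun_eq_iff not_less) (metis not_less)
  then show ?thesis by (simp add: conv_def)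
qed

lemma conv_nonneg: "(\<And>x. \<rho> x \<ge> 0) \<Longrightarrow> (\<And>x. f x \<ge> 0) \<Longrightarrow> conv \<rho> f x \<ge> (0::real)"
  by (simp add: conv_def)

text \<open>The mollification error at x is an average of translation increments with weight
  \<open>\<rho>\<close>. Jensen's inequality for this probability density and Fubini bound its L2
  norm by the worst increment over shifts shorter than \<open>h\<close>.\<close>

lemma conv_L2_bound:
  fixes f :: "real^'n \<Rightarrow> 'b::euclidean_space"
  assumes f: "L2 f" "integrable lborel f" and \<rho>: "C1c UNIV \<rho>" "\<And>x. \<rho> x \<ge> 0" "(\<integral>x. \<rho> x \<partial>lborel) = 1"
    "\<And>x. h \<le> norm x \<Longrightarrow> \<rho> x = 0" and S: "\<And>y. norm y < h \<Longrightarrow> n2 (\<lambda>x. f (x + y) - f x) \<le> S" "S \<ge> 0"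
  shows "L2 (\<lambda>x. conv \<rho> f x - f x)" "n2 (\<lambda>x. conv \<rho> f x - f x) \<le> S"
proof -
  have [measurable]: "f \<in> borel_measurable borel" using f(1) by (rule L2_measurable)
  note [measurable] = C1c_measurable[OF \<rho>(1)]
  obtain M where M: "\<And>x. \<bar>\<rho> x\<bar> \<le> M" using C1c_bounded[OF \<rho>(1)] by metis
  have i\<rho>: "integrable lborel \<rho>" by (rule C1c_L2[OF \<rho>(1)])
  have n\<rho>: "(\<integral>\<^sup>+y. ennreal (\<rho> y) \<partial>lborel) = 1"
    using nn_integral_eq_integral[OF i\<rho>] \<rho>(2,3) by simp
  have cm [measurable]: "conv \<rho> f \<in> borel_measurable borel"
    unfolding conv_def[abs_def] by measurable
  have pw: "ennreal ((norm (conv \<rho> f x - f x))\<^sup>2) \<le> (\<integral>\<^sup>+y. ennreal (\<rho> y * (norm (f (x - y) - f x))\<^sup>2) \<partial>lborel)" for x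
  proof -
    have i1: "integrable lborel (\<lambda>y. \<rho> y *\<^sub>R f (x - y))"
      using conv_integrable_vec[OF f(2) C1c_measurable(1)[OF \<rho>(1)] M, of x]
        integrable_reflect_lborel[of "\<lambda>y. \<rho> y *\<^sub>R f (x - y)" x] by simp
    have i2: "integrable lborel (\<lambda>y. \<rho> y *\<^sub>R f x)" using i\<rho> by simp
    have "conv \<rho> f x - f x = (\<integral>y. \<rho> y *\<^sub>R (f (x - y) - f x) \<partial>lborel)"
      using i1 i2 \<rho>(3) i\<rho> by (simp add: conv_alt scaleR_diff_right)
    moreover have "integrable lborel (\<lambda>y. \<rho> y *\<^sub>R (f (x - y) - f x))"
      using i1 i2 by (simp add: scaleR_diff_right)
    ultimately have "ennreal (norm (conv \<rho> f x - f x)) \<le> (\<integral>\<^sup>+y. ennreal (norm (\<rho> y *\<^sub>R (f (x - y) - f x))) \<partial>lborel)"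
      using integral_norm_bound_ennreal by metis
    \<comment> \<open>Splitting \<open>\<rho>\<close> into two square roots lets Cauchy-Schwarz play
      the role of Jensen's inequality.\<close>
    also have "\<dots> = (\<integral>\<^sup>+y. ennreal (sqrt (\<rho> y)) * ennreal (sqrt (\<rho> y) * norm (f (x - y) - f x)) \<partial>lborel)"
      by (intro nn_integral_cong) (simp add: \<rho>(2) mult.assoc[symmetric] flip: ennreal_mult)
    finally have "(ennreal (norm (conv \<rho> f x - f x)))\<^sup>2 \<le> (\<integral>\<^sup>+y. ennreal (sqrt (\<rho> y)) * ennreal (sqrt (\<rho> y) * norm (f (x - y) - f x)) \<partial>lborel)\<^sup>2"
      by (rule power_mono) simp
    also have "\<dots> \<le> (\<integral>\<^sup>+y. (ennreal (sqrt (\<rho> y)))\<^sup>2 \<partial>lborel) * (\<integral>\<^sup>+y. (ennreal (sqrt (\<rho> y) * norm (f (x - y) - f x)))\<^sup>2 \<partial>lborel)"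
      by (rule Cauchy_Schwarz_nn_integral) auto
    also have "\<dots> = 1 * (\<integral>\<^sup>+y. ennreal (\<rho> y * (norm (f (x - y) - f x))\<^sup>2) \<partial>lborel)"
      using n\<rho> by (simp add: ennreal_power \<rho>(2) power_mult_distrib)
    finally show ?thesis by (simp add: ennreal_power)
  qed
  have inner: "(\<integral>\<^sup>+x. ennreal ((norm (f (x - y) - f x))\<^sup>2) \<partial>lborel) \<le> ennreal S" if "norm y < h" for y
  proof -
    have "L2 (\<lambda>x. f (x + (- y)) - f x)" by (intro L2_diff L2_translate f)
    from nn_integral_n2[OF this] S(1)[of "- y"] that show ?thesis by (simp add: ennreal_leI)
  qed
  have "(\<integral>\<^sup>+x. ennreal ((norm (conv \<rho> f x - f x))\<^sup>2) \<partial>lborel) \<le> (\<integral>\<^sup>+x. \<integral>\<^sup>+y. ennreal (\<rho> y * (norm (f (x - y) - f x))\<^sup>2) \<partial>lborel \<partial>lborel)"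
    by (rule nn_integral_mono) (rule pw)
  also have "\<dots> = (\<integral>\<^sup>+y. \<integral>\<^sup>+x. ennreal (\<rho> y * (norm (f (x - y) - f x))\<^sup>2) \<partial>lborel \<partial>lborel)"
    by (rule lborel_pair.Fubini') simp
  also have "\<dots> \<le> (\<integral>\<^sup>+y. ennreal (\<rho> y) * ennreal S \<partial>lborel)"
  proof (rule nn_integral_mono)
    fix y
    have "(\<integral>\<^sup>+x. ennreal (\<rho> y * (norm (f (x - y) - f x))\<^sup>2) \<partial>lborel) = ennreal (\<rho> y) * (\<integral>\<^sup>+x. ennreal ((norm (f (x - y) - f x))\<^sup>2) \<partial>lborel)"
      by (simp add: ennreal_mult \<rho>(2) nn_integral_cmult)
    also have "\<dots> \<le> ennreal (\<rho> y) * ennreal S"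
      using inner[of y] \<rho>(4)[of y] by (cases "norm y < h") (auto intro: mult_left_mono)
    finally show "(\<integral>\<^sup>+x. ennreal (\<rho> y * (norm (f (x - y) - f x))\<^sup>2) \<partial>lborel) \<le> ennreal (\<rho> y) * ennreal S" .
  qed
  also have "\<dots> = ennreal S" using n\<rho> by (simp add: nn_integral_multc)
  finally have fin: "(\<integral>\<^sup>+x. ennreal ((norm (conv \<rho> f x - f x))\<^sup>2) \<partial>lborel) \<le> ennreal S" .
  have m: "(\<lambda>x. conv \<rho> f x - f x) \<in> borel_measurable borel" by measurable
  show "L2 (\<lambda>x. conv \<rho> f x - f x)" "n2 (\<lambda>x. conv \<rho> f x - f x) \<le> S"
    using L2_nn_bound[OF m fin S(2)] by auto
qed

lemma conv_L2lim:
  fixes f :: "real^'n \<Rightarrow> 'b::euclidean_space"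
  assumes f: "L2 f" "integrable lborel f" and \<rho>: "\<And>k. C1c UNIV (\<rho> k)" "\<And>k x. \<rho> k x \<ge> 0" "\<And>k. (\<integral>x. \<rho> k x \<partial>lborel) = 1"
    "\<And>k x. h k \<le> norm x \<Longrightarrow> \<rho> k x = 0" and h: "h \<longlonglongrightarrow> 0"
  shows "L2 (conv (\<rho> k) f)" "L2lim (\<lambda>k. conv (\<rho> k) f) f"
proof -
  have "n2 (\<lambda>x. f (x + y) - f x) \<le> 4 * n2 f" for y
    using n2_add_le[OF L2_translate(1)[OF f(1), of y] L2_minus[OF f(1)]] L2_translate(2)[OF f(1), of y] by simp
  then have "L2 (\<lambda>x. conv (\<rho> k) f x - f x)"
    by (intro conv_L2_bound(1)[OF f \<rho>(1-3) \<rho>(4)]) auto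
  from L2_add[OF this f(1)] show "L2 (conv (\<rho> k) f)" by simp
  show "L2lim (\<lambda>k. conv (\<rho> k) f) f" unfolding L2lim_def
  proof (rule LIMSEQ_I)
    fix e :: real assume e: "e > 0"
    then obtain d where d: "d > 0" "\<And>y. norm y < d \<Longrightarrow> n2 (\<lambda>x. f (x + y) - f x) \<le> e / 2"
      using L2_translation_continuous[OF f(1), of "e/2"] by auto
    from order_tendstoD(2)[OF h d(1)] obtain N where N: "\<And>k. k \<ge> N \<Longrightarrow> h k < d"
      by (auto simp: eventually_sequentially)
    have "norm (n2 (\<lambda>x. conv (\<rho> k) f x - f x) - 0) < e" if "k \<ge> N" for k
    proof -
      have "n2 (\<lambda>x. conv (\<rho> k) f x - f x) \<le> e / 2"
        by (rule conv_L2_bound(2)[OF f \<rho>(1-3) \<rho>(4)]) (use d(2) N[OF that] e in auto)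
      then show ?thesis using e by simp
    qed
    then show "\<exists>N. \<forall>k\<ge>N. norm (n2 (\<lambda>x. conv (\<rho> k) f x - f x) - 0) < e" by blast
  qed
qed

lemma C1c_reflect:
  assumes \<rho>: "C1c UNIV \<rho>" "\<And>y. h \<le> norm y \<Longrightarrow> \<rho> y = 0" and x: "cball x h \<subseteq> \<Omega>"
  shows "C1c \<Omega> (\<lambda>y. \<rho> (x - y))" "grad (\<lambda>y. \<rho> (x - y)) = (\<lambda>y. - grad \<rho> (x - y))"
proof -
  have D: "((\<lambda>y. \<rho> (x - y)) has_derivative (\<lambda>v. (- grad \<rho> (x - y)) \<bullet> v)) (at y)" for y
  proof -
    have "((\<lambda>y. \<rho> (x - y)) has_derivative (\<lambda>v. grad \<rho> (x - y) \<bullet> (- v))) (at y)"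
      by (rule has_derivative_compose[OF _ C1c_has_derivative[OF \<rho>(1)]]) (auto intro!: derivative_eq_intros)
    then show ?thesis by simp
  qed
  have c: "continuous_on UNIV (\<lambda>y. - grad \<rho> (x - y))"
    by (intro continuous_intros continuous_on_compose2[OF C1c_continuous_grad[OF \<rho>(1)]]) auto
  show "C1c \<Omega> (\<lambda>y. \<rho> (x - y))" "grad (\<lambda>y. \<rho> (x - y)) = (\<lambda>y. - grad \<rho> (x - y))"
    using C1cI[OF D c compact_cball[of x h] x] \<rho>(2) by (auto simp: dist_norm)
qed

lemma integral_vec_nth:
  fixes f :: "'a::euclidean_space \<Rightarrow> real^'n"
  shows "integrable lborel f \<Longrightarrow> (\<integral>x. f x \<partial>lborel) $ i = (\<integral>x. f x $ i \<partial>lborel)"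
  by (rule integral_bounded_linear[OF bounded_linear_vec_nth, symmetric])

text \<open>The reflected kernel \<open>\<lambda>y. \<rho> (x - y)\<close> is an admissible test
  function exactly because the ball around x stays in \<open>\<Omega>\<close>; nearer to the
  boundary mollification and weak gradient need not commute.\<close>

lemma conv_weak_grad:
  fixes u :: "real^'n \<Rightarrow> real" and g :: "real^'n \<Rightarrow> real^'n"
  assumes u: "integrable lborel u" and g: "integrable lborel g"
    and w: "\<And>\<phi> i. C1c \<Omega> \<phi> \<Longrightarrow> (\<integral>y. u y * grad \<phi> y $ i \<partial>lborel) = - (\<integral>y. g y $ i * \<phi> y \<partial>lborel)"
    and \<rho>: "C1c UNIV \<rho>" "\<And>y. h \<le> norm y \<Longrightarrow> \<rho> y = 0" and x: "cball x h \<subseteq> \<Omega>"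
  shows "grad (conv \<rho> u) x = conv \<rho> g x"
proof -
  obtain M where M: "\<And>x. \<bar>\<rho> x\<bar> \<le> M" "\<And>x. norm (grad \<rho> x) \<le> M" using C1c_bounded[OF \<rho>(1)] by metis
  note i1 = conv_integrable[OF u C1c_measurable(2)[OF \<rho>(1)] M(2), of x]
  note i2 = conv_integrable_vec[OF g C1c_measurable(1)[OF \<rho>(1)] M(1), of x]
  note r = C1c_reflect[OF \<rho> x]
  have "grad (conv \<rho> u) x $ i = conv \<rho> g x $ i" for i
  proof -
    have "grad (conv \<rho> u) x $ i = (\<integral>y. (u y *\<^sub>R grad \<rho> (x - y)) $ i \<partial>lborel)"
      using integral_vec_nth[OF i1] by (simp add: conv_grad[OF u \<rho>(1)])
    also have "\<dots> = - (\<integral>y. u y * grad (\<lambda>y. \<rho> (x - y)) y $ i \<partial>lborel)"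
      by (simp add: r(2))
    also have "\<dots> = (\<integral>y. g y $ i * \<rho> (x - y) \<partial>lborel)" using w[OF r(1), of i] by simp
    also have "\<dots> = conv \<rho> g x $ i" using integral_vec_nth[OF i2] by (simp add: conv_def mult.commute)
    finally show ?thesis .
  qed
  then show ?thesis by (simp add: vec_eq_iff)
qed

lemma C1c_weak_grad:
  assumes \<phi>: "C1c \<Omega>' \<phi>" and u: "C1c \<Omega> u"
  shows "(\<integral>y. u y * grad \<phi> y $ i \<partial>lborel) = - (\<integral>y. grad u y $ i * \<phi> y \<partial>lborel)"
  using integration_by_parts[OF C1c_has_derivative[OF u] C1c_continuous_grad[OF u] \<phi>, of "axis i 1"]
  by (simp add: inner_axis mult.commute)

lemma compact_open_margin:
  fixes K :: "(real^'n) set"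
  assumes "compact K" "open \<Omega>" "K \<subseteq> \<Omega>"
  obtains d where "d > 0" "\<And>x. x \<in> K \<Longrightarrow> cball x d \<subseteq> \<Omega>"
  using compact_subset_open_imp_cball_epsilon_subset[OF assms] by (metis UN_subset_iff)

text \<open>Mollification with radii below the distance from the support to the boundary.
  Nonnegativity is preserved because supersolutions are tested only with nonnegative
  functions.\<close>

theorem C1c_approx:
  assumes \<Omega>: "open \<Omega>" and \<phi>: "C1c \<Omega> \<phi>"
  obtains \<psi> where "\<And>k. test_fun \<Omega> (\<psi> k)" "\<And>k x. (\<And>x. \<phi> x \<ge> 0) \<Longrightarrow> \<psi> k x \<ge> 0"
    "L2lim \<psi> \<phi>" "L2lim (\<lambda>k. grad (\<psi> k)) (grad \<phi>)"
proof -
  obtain K where K: "compact K" "K \<subseteq> \<Omega>" "\<And>x. x \<notin> K \<Longrightarrow> \<phi> x = 0" using C1c_supportE[OF \<phi>] by metis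
  obtain d where d: "d > 0" "\<And>x. x \<in> K \<Longrightarrow> cball x d \<subseteq> \<Omega>" using compact_open_margin[OF K(1) \<Omega> K(2)] by blast
  obtain C and \<rho> :: "real \<Rightarrow> real^'a \<Rightarrow> real" where \<rho>: "\<And>h. h > 0 \<Longrightarrow> smooth (\<rho> h)" "\<And>h. h > 0 \<Longrightarrow> C1c UNIV (\<rho> h)"
    "\<And>h x. \<rho> h x \<ge> 0" "\<And>h x. h > 0 \<Longrightarrow> h \<le> norm x \<Longrightarrow> \<rho> h x = 0" "\<And>h. h > 0 \<Longrightarrow> (\<integral>x. \<rho> h x \<partial>lborel) = 1"
    using mollifier_family by (metis (no_types))
  define h where "h k = d / real (Suc k)" for k
  have h: "h k > 0" "h k \<le> d" for k using d(1) by (auto simp: h_def field_simps)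
  have h0: "h \<longlonglongrightarrow> 0" unfolding h_def by (rule lim_const_over_n[THEN LIMSEQ_Suc])
  define \<psi> where "\<psi> k = conv (\<rho> (h k)) \<phi>" for k
  have test\<rho>: "test_fun UNIV (\<rho> (h k))" for k
    by (rule test_funI[where K="cball 0 (h k)"]) (use \<rho>(1,4) h in auto)
  define K2 where "K2 = {x + y | x y. x \<in> K \<and> y \<in> cball 0 d}"
  have cK2: "compact K2" unfolding K2_def by (rule compact_sums[OF K(1) compact_cball])
  have sK2: "K2 \<subseteq> \<Omega>" using d(2) by (force simp: K2_def dist_norm)
  have test: "test_fun \<Omega> (\<psi> k)" for k
  proof (rule test_funI[OF _ cK2 sK2])
    show "smooth (\<psi> k)" unfolding \<psi>_def by (rule conv_smooth[OF C1c_L2(3)[OF \<phi>] test\<rho>])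
    show "\<psi> k x = 0" if "x \<notin> K2" for x
      unfolding \<psi>_def
    proof (rule conv_zero_off[where h="h k"])
      show "h k \<le> norm y \<Longrightarrow> \<rho> (h k) y = 0" for y using \<rho>(4) h by simp
      show "\<phi> y = 0" if "dist x y < h k" for y
      proof (rule K(3), rule notI)
        assume "y \<in> K"
        moreover have "x = y + (x - y)" "x - y \<in> cball 0 d" using \<open>dist x y < h k\<close> h(2)[of k] by (auto simp: dist_norm norm_minus_commute)
        ultimately have "x \<in> K2" unfolding K2_def by blast
        with \<open>x \<notin> K2\<close> show False by simp
      qed
    qed
  qed
  have grad: "grad (\<psi> k) = conv (\<rho> (h k)) (grad \<phi>)" for k
    unfolding \<psi>_def by (rule ext, rule conv_weak_grad[where \<Omega>=UNIV and h="h k"])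
      (use C1c_L2[OF \<phi>] C1c_weak_grad[OF _ \<phi>] \<rho>(2,4) h in auto)
  show thesis
  proof (rule that[of \<psi>])
    show "test_fun \<Omega> (\<psi> k)" for k by (rule test)
    show "\<psi> k x \<ge> 0" if "\<And>x. \<phi> x \<ge> 0" for k x unfolding \<psi>_def using that \<rho>(3) by (intro conv_nonneg)
    show "L2lim \<psi> \<phi>" unfolding \<psi>_def
      by (rule conv_L2lim(2)[where h=h]) (use C1c_L2[OF \<phi>] \<rho> h h0 in auto)
    show "L2lim (\<lambda>k. grad (\<psi> k)) (grad \<phi>)" unfolding grad
      by (rule conv_L2lim(2)[where h=h]) (use C1c_L2[OF \<phi>] \<rho> h h0 in auto)
  qed
qed

section \<open>The operator \<open>F F\<^sub>\<xi>\<close>\<close>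

lemma increment_ge_open:
  fixes k :: "real \<Rightarrow> real"
  assumes "x \<le> y" "continuous_on {x..y} k" "\<And>t. x < t \<Longrightarrow> t < y \<Longrightarrow> \<exists>D\<ge>m. (k has_real_derivative D) (at t)"
  shows "k y - k x \<ge> m * (y - x)"
proof (cases "x = y")
  case False
  then have "x < y" using assms(1) by simp
  have "\<And>t. x < t \<Longrightarrow> t < y \<Longrightarrow> k differentiable (at t)"
    using assms(3) by (auto simp: real_differentiable_def)
  from MVT[OF \<open>x < y\<close> assms(2) this] obtain l z where z: "x < z" "z < y" "DERIV k z :> l" "k y - k x = (y - x) * l" by blast
  then have "l \<ge> m" using assms(3)[OF z(1,2)] DERIV_unique by blast
  then show ?thesis using z(4) \<open>x < y\<close> by (simp add: mult.commute mult_left_mono)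
qed simp

text \<open>The exceptional point \<open>s\<close> is the parameter at which a segment may pass
  through the origin, where \<open>FA F\<close> is only known to be continuous; the increments on
  the two sides are added.\<close>

lemma increment_ge_except:
  fixes k :: "real \<Rightarrow> real"
  assumes "continuous_on {0..1} k" "\<And>t. 0 < t \<Longrightarrow> t < 1 \<Longrightarrow> t \<noteq> s \<Longrightarrow> \<exists>D\<ge>m. (k has_real_derivative D) (at t)"
  shows "k 1 - k 0 \<ge> m"
proof (cases "0 < s \<and> s < 1")
  case True
  have "k s - k 0 \<ge> m * (s - 0)" "k 1 - k s \<ge> m * (1 - s)"
    by (rule increment_ge_open; (use True assms in \<open>auto intro: continuous_on_subset\<close>))+
  then show ?thesis by (simp add: algebra_simps)
next
  case False
  then have "k 1 - k 0 \<ge> m * (1 - 0)"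
    by (intro increment_ge_open) (use assms in auto)
  then show ?thesis by simp
qed

definition FA :: "(real^'n \<Rightarrow> real) \<Rightarrow> real^'n \<Rightarrow> real^'n" where
  "FA F \<xi> = F \<xi> *\<^sub>R Fgrad F \<xi>"

locale finsler =
  fixes F :: "real^'n \<Rightarrow> real"
  assumes finsler: "finsler_norm F"
begin

lemma F_homogeneous: "F (t *\<^sub>R \<xi>) = \<bar>t\<bar> * F \<xi>" and F_nonneg: "F \<xi> \<ge> 0"
  and F_pos: "\<xi> \<noteq> 0 \<Longrightarrow> F \<xi> > 0"
  using finsler by (auto simp: finsler_norm_def)

lemma F_0 [simp]: "F 0 = 0" using F_homogeneous[of 0 0] by simp

lemma F_minus [simp]: "F (- \<xi>) = F \<xi>" using F_homogeneous[of "-1" \<xi>] by simp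

lemma F_bounds: obtains a b where "0 < a" "a \<le> b" "\<And>\<xi>. a * norm \<xi> \<le> F \<xi>" "\<And>\<xi>. F \<xi> \<le> b * norm \<xi>"
  using finsler unfolding finsler_norm_def by metis

lemma F_has_derivative: "\<xi> \<noteq> 0 \<Longrightarrow> (F has_derivative (\<lambda>h. Fgrad F \<xi> \<bullet> h)) (at \<xi>)"
  using has_derivative_grad[of F \<xi>] finsler
  by (simp add: finsler_norm_def C2_away_from_0_def Fgrad_def grad_def pd_def[abs_def])

lemma Fgrad_0 [simp]: "Fgrad F 0 = 0" by (simp add: Fgrad_def)

lemma FA_0 [simp]: "FA F 0 = 0" by (simp add: FA_def)

text \<open>The first index of \<open>Fhess\<close> is the direction of differentiation, hence the
  row-vector product \<open>h v* Fhess F \<xi>\<close>.\<close>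

lemma Fgrad_has_derivative:
  assumes "\<xi> \<noteq> 0" shows "(Fgrad F has_derivative (\<lambda>h. h v* Fhess F \<xi>)) (at \<xi>)"
  unfolding has_derivative_componentwise_within[of "Fgrad F"]
proof
  fix b :: "real^'n" assume "b \<in> Basis"
  then obtain j where b: "b = axis j 1" by (auto simp: Basis_vec_def)
  have "(\<lambda>\<eta>. Fgrad F \<eta> $ j) differentiable (at \<xi>)"
    using finsler assms by (simp add: finsler_norm_def C2_away_from_0_def)
  from has_derivative_grad[OF this]
  have D: "((\<lambda>\<eta>. Fgrad F \<eta> $ j) has_derivative (\<lambda>h. grad (\<lambda>\<eta>. Fgrad F \<eta> $ j) \<xi> \<bullet> h)) (at \<xi>)" .
  have "grad (\<lambda>\<eta>. Fgrad F \<eta> $ j) \<xi> \<bullet> h = (h v* Fhess F \<xi>) \<bullet> b" for h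
  proof -
    have "(h v* Fhess F \<xi>) \<bullet> b = (h v* Fhess F \<xi>) $ j" by (simp add: b inner_axis)
    then show ?thesis
      using assms by (simp add: inner_vec_def vector_matrix_mult_def Fhess_def grad_def pd_def mult.commute)
  qed
  with D show "((\<lambda>x. Fgrad F x \<bullet> b) has_derivative (\<lambda>x. (x v* Fhess F \<xi>) \<bullet> b)) (at \<xi>)"
    by (simp add: b inner_axis)
qed

lemma Fgrad_inner_has_derivative:
  assumes "\<xi> \<noteq> 0" shows "((\<lambda>\<eta>. Fgrad F \<eta> \<bullet> V) has_derivative (\<lambda>h. h \<bullet> (Fhess F \<xi> *v V))) (at \<xi>)"
  using has_derivative_inner_left[OF Fgrad_has_derivative[OF assms], of V] by (simp add: dot_lmul_matrix)

section \<open>Consequences of homogeneity\<close>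

lemma Fgrad_scale: assumes "\<xi> \<noteq> 0" "t \<noteq> 0" shows "t *\<^sub>R Fgrad F (t *\<^sub>R \<xi>) = \<bar>t\<bar> *\<^sub>R Fgrad F \<xi>"
proof -
  have 1: "((\<lambda>\<eta>. F (t *\<^sub>R \<eta>)) has_derivative (\<lambda>h. Fgrad F (t *\<^sub>R \<xi>) \<bullet> (t *\<^sub>R h))) (at \<xi>)"
    by (rule has_derivative_compose[OF _ F_has_derivative]) (use assms in \<open>auto intro!: derivative_eq_intros\<close>)
  have "((\<lambda>\<eta>. \<bar>t\<bar> * F \<eta>) has_derivative (\<lambda>h. \<bar>t\<bar> * (Fgrad F \<xi> \<bullet> h))) (at \<xi>)"
    by (intro has_derivative_mult_right F_has_derivative assms)
  then have 2: "((\<lambda>\<eta>. F (t *\<^sub>R \<eta>)) has_derivative (\<lambda>h. \<bar>t\<bar> * (Fgrad F \<xi> \<bullet> h))) (at \<xi>)"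
    by (simp add: F_homogeneous)
  from has_derivative_unique[OF 1 2] have "(t *\<^sub>R Fgrad F (t *\<^sub>R \<xi>)) \<bullet> h = (\<bar>t\<bar> *\<^sub>R Fgrad F \<xi>) \<bullet> h" for h
    by (simp add: fun_eq_iff)
  then show ?thesis by (metis vector_eq_rdot)
qed

lemma Fgrad_scale_pos: assumes "\<xi> \<noteq> 0" "t > 0" shows "Fgrad F (t *\<^sub>R \<xi>) = Fgrad F \<xi>"
  using Fgrad_scale[of \<xi> t] assms by simp

text \<open>Valid for every real t, negative ones included, because \<open>F\<close> is even. This
  linearity on lines through 0 is what makes the quadratic barrier computable.\<close>

lemma FA_scale: "FA F (t *\<^sub>R \<xi>) = t *\<^sub>R FA F \<xi>"
proof (cases "\<xi> = 0 \<or> t = 0")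
  case False
  then have "\<bar>t\<bar> *\<^sub>R Fgrad F (t *\<^sub>R \<xi>) = t *\<^sub>R Fgrad F \<xi>"
    using Fgrad_scale[of \<xi> t] by (cases "t > 0") (auto simp: minus_equation_iff)
  then have "F \<xi> *\<^sub>R (\<bar>t\<bar> *\<^sub>R Fgrad F (t *\<^sub>R \<xi>)) = F \<xi> *\<^sub>R (t *\<^sub>R Fgrad F \<xi>)" by simp
  then show ?thesis by (simp add: FA_def F_homogeneous mult.commute)
qed (auto simp: FA_def)

lemma Euler_identity: "Fgrad F \<xi> \<bullet> \<xi> = F \<xi>"
proof (cases "\<xi> = 0")
  case False
  have 1: "((\<lambda>t. F (t *\<^sub>R \<xi>)) has_derivative (\<lambda>s. Fgrad F (1 *\<^sub>R \<xi>) \<bullet> (s *\<^sub>R \<xi>))) (at 1)"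
    by (rule has_derivative_compose[OF _ F_has_derivative]) (use False in \<open>auto intro!: derivative_eq_intros\<close>)
  have "((\<lambda>t. t * F \<xi>) has_derivative (\<lambda>s. s * F \<xi>)) (at (1::real))" by (auto intro!: derivative_eq_intros)
  then have 2: "((\<lambda>t. F (t *\<^sub>R \<xi>)) has_derivative (\<lambda>s. s * F \<xi>)) (at 1)"
    by (rule has_derivative_transform_within_open[where s="{0<..}"]) (auto simp: F_homogeneous)
  from fun_cong[OF has_derivative_unique[OF 1 2], of 1] show ?thesis by simp
qed simp

lemma FA_inner_self: "FA F \<xi> \<bullet> \<xi> = (F \<xi>)\<^sup>2"
  by (simp add: FA_def Euler_identity power2_eq_square)

text \<open>\<open>Fgrad F\<close> is constant along the ray through \<open>\<xi>\<close>, so its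
  derivative in the direction \<open>\<xi>\<close> vanishes.\<close>

lemma Fhess_left_null: assumes "\<xi> \<noteq> 0" shows "\<xi> \<bullet> (Fhess F \<xi> *v V) = 0"
proof -
  have "((\<lambda>t. Fgrad F (t *\<^sub>R \<xi>) \<bullet> V) has_derivative (\<lambda>s. (s *\<^sub>R \<xi>) \<bullet> (Fhess F (1 *\<^sub>R \<xi>) *v V))) (at 1)"
    by (rule has_derivative_compose[OF _ Fgrad_inner_has_derivative]) (use assms in \<open>auto intro!: derivative_eq_intros\<close>)
  moreover have "((\<lambda>t. Fgrad F (t *\<^sub>R \<xi>) \<bullet> V) has_derivative (\<lambda>s. 0)) (at 1)"
    by (rule has_derivative_transform_within_open[where s="{0<..}" and f="\<lambda>t. Fgrad F \<xi> \<bullet> V"])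
      (use assms in \<open>auto simp: Fgrad_scale_pos\<close>)
  ultimately have "(\<lambda>s. (s *\<^sub>R \<xi>) \<bullet> (Fhess F (1 *\<^sub>R \<xi>) *v V)) = (\<lambda>s. 0)" by (rule has_derivative_unique)
  from fun_cong[OF this, of 1] show ?thesis by simp
qed

text \<open>Differentiating the Euler identity gives the gradient of \<open>F\<close> on both sides;
  what remains is this term.\<close>

lemma Fhess_right_null: assumes "\<xi> \<noteq> 0" shows "V \<bullet> (Fhess F \<xi> *v \<xi>) = 0"
proof -
  have "((\<lambda>\<eta>. Fgrad F \<eta> \<bullet> \<eta>) has_derivative (\<lambda>h. Fgrad F \<xi> \<bullet> h + (h v* Fhess F \<xi>) \<bullet> \<xi>)) (at \<xi>)"
    by (intro has_derivative_inner Fgrad_has_derivative assms has_derivative_ident)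
  then have "(F has_derivative (\<lambda>h. Fgrad F \<xi> \<bullet> h + (h v* Fhess F \<xi>) \<bullet> \<xi>)) (at \<xi>)"
    by (simp add: Euler_identity)
  from fun_cong[OF has_derivative_unique[OF this F_has_derivative[OF assms]], of V]
  show ?thesis by (simp add: dot_lmul_matrix)
qed

lemma Fhess_scale: assumes "\<xi> \<noteq> 0" "t > 0" shows "t * (h \<bullet> (Fhess F (t *\<^sub>R \<xi>) *v V)) = h \<bullet> (Fhess F \<xi> *v V)"
proof -
  have 1: "((\<lambda>\<eta>. Fgrad F (t *\<^sub>R \<eta>) \<bullet> V) has_derivative (\<lambda>h. (t *\<^sub>R h) \<bullet> (Fhess F (t *\<^sub>R \<xi>) *v V))) (at \<xi>)"
    by (rule has_derivative_compose[OF _ Fgrad_inner_has_derivative]) (use assms in \<open>auto intro!: derivative_eq_intros\<close>)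
  have 2: "((\<lambda>\<eta>. Fgrad F (t *\<^sub>R \<eta>) \<bullet> V) has_derivative (\<lambda>h. h \<bullet> (Fhess F \<xi> *v V))) (at \<xi>)"
    by (rule has_derivative_transform_within_open[OF Fgrad_inner_has_derivative[OF assms(1)], where s="- {0}"])
      (use assms in \<open>auto simp: Fgrad_scale_pos\<close>)
  from fun_cong[OF has_derivative_unique[OF 1 2], of h] show ?thesis by simp
qed

lemma F_triangle: "F (\<xi> + \<eta>) \<le> F \<xi> + F \<eta>"
proof -
  have "F ((1 - 1/2) *\<^sub>R (2 *\<^sub>R \<xi>) + (1/2) *\<^sub>R (2 *\<^sub>R \<eta>)) \<le> (1 - 1/2) * F (2 *\<^sub>R \<xi>) + (1/2) * F (2 *\<^sub>R \<eta>)"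
    by (rule convex_onD[where A=UNIV]) (use finsler in \<open>auto simp: finsler_norm_def\<close>)
  then show ?thesis by (simp only: F_homogeneous scaleR_scaleR) (simp add: F_homogeneous)
qed

text \<open>Subadditivity and evenness make \<open>F\<close> Lipschitz with respect to itself, which
  bounds the difference quotients by \<open>F V\<close>. At 0 the default value of
  \<open>Fgrad\<close> is 0.\<close>

lemma Fgrad_bound: assumes "\<And>\<xi>. F \<xi> \<le> b * norm \<xi>" shows "\<bar>Fgrad F \<xi> \<bullet> V\<bar> \<le> b * norm V"
proof (cases "\<xi> = 0")
  case True
  then show ?thesis using assms[of V] F_nonneg[of V] by simp
next
  case False
  have "((\<lambda>t. F (\<xi> + t *\<^sub>R V)) has_derivative (\<lambda>s. Fgrad F (\<xi> + 0 *\<^sub>R V) \<bullet> (s *\<^sub>R V))) (at 0)"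
    by (rule has_derivative_compose[OF _ F_has_derivative]) (use False in \<open>auto intro!: derivative_eq_intros\<close>)
  moreover have "(\<lambda>s. Fgrad F (\<xi> + 0 *\<^sub>R V) \<bullet> (s *\<^sub>R V)) = (*) (Fgrad F \<xi> \<bullet> V)" by auto
  ultimately have "DERIV (\<lambda>t. F (\<xi> + t *\<^sub>R V)) 0 :> Fgrad F \<xi> \<bullet> V" by (simp only: has_field_derivative_def)
  then have lim: "((\<lambda>t. (F (\<xi> + t *\<^sub>R V) - F \<xi>) / t) \<longlongrightarrow> Fgrad F \<xi> \<bullet> V) (at 0)" by (simp add: DERIV_def)
  have "norm (Fgrad F \<xi> \<bullet> V) \<le> b * norm V"
  proof (rule Lim_norm_ubound[OF _ lim])
    have "norm ((F (\<xi> + t *\<^sub>R V) - F \<xi>) / t) \<le> b * norm V" if "t \<noteq> 0" for t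
    proof -
      have "F (\<xi> + t *\<^sub>R V) - F \<xi> \<le> F (t *\<^sub>R V)" using F_triangle[of \<xi> "t *\<^sub>R V"] by simp
      moreover have "F \<xi> - F (\<xi> + t *\<^sub>R V) \<le> F (t *\<^sub>R V)" using F_triangle[of "\<xi> + t *\<^sub>R V" "- (t *\<^sub>R V)"] by simp
      ultimately have "\<bar>F (\<xi> + t *\<^sub>R V) - F \<xi>\<bar> \<le> \<bar>t\<bar> * F V" by (simp add: F_homogeneous abs_le_iff)
      also have "\<dots> \<le> \<bar>t\<bar> * (b * norm V)" by (intro mult_left_mono assms) auto
      finally show ?thesis using that by (simp add: field_simps)
    qed
    then show "\<forall>\<^sub>F t in at 0. norm ((F (\<xi> + t *\<^sub>R V) - F \<xi>) / t) \<le> b * norm V"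
      by (auto simp: eventually_at_filter)
  qed simp
  then show ?thesis by simp
qed

section \<open>Ellipticity: strong monotonicity and Lipschitz continuity of
  \<open>FA F\<close>\<close>

definition DA :: "real^'n \<Rightarrow> real^'n \<Rightarrow> real^'n \<Rightarrow> real" where
  "DA \<xi> h V = (Fgrad F \<xi> \<bullet> h) * (Fgrad F \<xi> \<bullet> V) + F \<xi> * (h \<bullet> (Fhess F \<xi> *v V))"

lemma DA_has_derivative:
  assumes "\<xi> \<noteq> 0" shows "((\<lambda>\<eta>. FA F \<eta> \<bullet> V) has_derivative (\<lambda>h. DA \<xi> h V)) (at \<xi>)"
  using has_derivative_mult[OF F_has_derivative[OF assms] Fgrad_inner_has_derivative[OF assms, of V]]
  by (simp add: FA_def DA_def add.commute)

lemma DA_scale: assumes "\<xi> \<noteq> 0" "t > 0" shows "DA (t *\<^sub>R \<xi>) h V = DA \<xi> h V"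
proof -
  have "F (t *\<^sub>R \<xi>) * (h \<bullet> (Fhess F (t *\<^sub>R \<xi>) *v V)) = F \<xi> * (t * (h \<bullet> (Fhess F (t *\<^sub>R \<xi>) *v V)))"
    using assms by (simp add: F_homogeneous)
  then show ?thesis unfolding DA_def using assms by (simp add: Fhess_scale Fgrad_scale_pos)
qed

text \<open>\<open>DA\<close> is invariant under positive scaling of \<open>\<xi>\<close>: the
  degree 1 of \<open>F\<close> cancels the degree -1 of its Hessian. All bounds thus reduce to the
  unit sphere.\<close>

lemma DA_unit: assumes "\<xi> \<noteq> 0" obtains \<zeta> where "norm \<zeta> = 1" "\<And>h V. DA \<xi> h V = DA \<zeta> h V"
proof (rule that[of "\<xi> /\<^sub>R norm \<xi>"])
  show "norm (\<xi> /\<^sub>R norm \<xi>) = 1" using assms by simp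
  show "DA \<xi> h V = DA (\<xi> /\<^sub>R norm \<xi>) h V" for h V
    using DA_scale[OF assms, of "inverse (norm \<xi>)" h V] assms by simp
qed

text \<open>Split \<open>V\<close> into a radial part \<open>s *\<^sub>R \<xi>\<close> and an
  orthogonal part \<open>W\<close>. The Hessian term sees and controls only \<open>W\<close>; the
  squared first-order term controls \<open>s\<close>, up to the contribution \<open>q\<close> of
  \<open>W\<close>, which the Hessian term has to absorb.\<close>

lemma DA_lower: obtains c where "c > 0" "\<And>\<xi> V. \<xi> \<noteq> 0 \<Longrightarrow> DA \<xi> V V \<ge> c * (norm V)\<^sup>2"
proof -
  obtain a b where ab: "0 < a" "a \<le> b" "\<And>\<xi>. a * norm \<xi> \<le> F \<xi>" "\<And>\<xi>. F \<xi> \<le> b * norm \<xi>" by (rule F_bounds) blast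
  obtain \<mu> where \<mu>: "0 < \<mu>" "\<And>\<xi> V. norm \<xi> = 1 \<Longrightarrow> V \<bullet> \<xi> = 0 \<Longrightarrow> \<mu>\<^sup>2 * (norm V)\<^sup>2 \<le> V \<bullet> (Fhess F \<xi> *v V)"
    using finsler unfolding finsler_norm_def by metis
  have b: "b > 0" using ab by simp
  \<comment> \<open>Only the fraction \<open>\<theta>\<close> of the square is used: its loss
    \<open>\<theta> * b\<^sup>2\<close> in \<open>W\<close> is then at most half of the gain
    \<open>a * \<mu>\<^sup>2\<close> from the Hessian.\<close>
  define \<theta> where "\<theta> = min 1 (a * \<mu>\<^sup>2 / (2 * b\<^sup>2))"
  have \<theta>: "\<theta> > 0" "\<theta> \<le> 1" "\<theta> * b\<^sup>2 \<le> a * \<mu>\<^sup>2 / 2"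
  proof -
    show "\<theta> > 0" "\<theta> \<le> 1" using ab \<mu> b by (auto simp: \<theta>_def)
    have "\<theta> * b\<^sup>2 \<le> (a * \<mu>\<^sup>2 / (2 * b\<^sup>2)) * b\<^sup>2" by (intro mult_right_mono) (auto simp: \<theta>_def)
    then show "\<theta> * b\<^sup>2 \<le> a * \<mu>\<^sup>2 / 2" using b by simp
  qed
  define c where "c = min (\<theta> * a\<^sup>2 / 2) (a * \<mu>\<^sup>2 / 2)"
  have "c > 0" using \<theta> ab \<mu> by (simp add: c_def)
  moreover have "DA \<xi> V V \<ge> c * (norm V)\<^sup>2" if n: "norm \<xi> = 1" for \<xi> V
  proof -
    have nz: "\<xi> \<noteq> 0" using n by auto
    define s where "s = V \<bullet> \<xi>"
    define W where "W = V - s *\<^sub>R \<xi>"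
    have V: "V = s *\<^sub>R \<xi> + W" by (simp add: W_def)
    have x1: "\<xi> \<bullet> \<xi> = 1" using n by (simp flip: power2_norm_eq_inner)
    have W: "W \<bullet> \<xi> = 0" by (simp add: W_def inner_diff_left s_def x1)
    have nV: "(norm V)\<^sup>2 = s\<^sup>2 + (norm W)\<^sup>2"
      unfolding V power2_norm_eq_inner using W x1 by (simp add: inner_add_left inner_add_right inner_commute power2_eq_square)
    have H: "V \<bullet> (Fhess F \<xi> *v V) = W \<bullet> (Fhess F \<xi> *v W)"
      unfolding V matrix_vector_right_distrib matrix_vector_mult_scaleR inner_add_left inner_add_right
      using Fhess_left_null[OF nz] Fhess_right_null[OF nz] by simp
    define q where "q = Fgrad F \<xi> \<bullet> W"
    have "\<bar>q\<bar> \<le> b * norm W" unfolding q_def by (rule Fgrad_bound[OF ab(4)])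
    then have q: "q\<^sup>2 \<le> b\<^sup>2 * (norm W)\<^sup>2" using power_mono[of "\<bar>q\<bar>" "b * norm W" 2] by (simp add: power_mult_distrib)
    have p: "Fgrad F \<xi> \<bullet> V = s * F \<xi> + q" by (simp add: V inner_add_right Euler_identity q_def)
    have Fa: "F \<xi> \<ge> a" using ab(3)[of \<xi>] n by simp
    have "(s * F \<xi> + q)\<^sup>2 \<ge> (s * F \<xi>)\<^sup>2 / 2 - q\<^sup>2"
      using zero_le_power2[of "s * F \<xi> + 2 * q"] by (simp add: power2_eq_square algebra_simps)
    moreover have "(s * F \<xi>)\<^sup>2 \<ge> a\<^sup>2 * s\<^sup>2"
      using mult_right_mono[OF power_mono[OF Fa, of 2], of "s\<^sup>2"] ab(1) by (simp add: power_mult_distrib mult.commute)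
    ultimately have "(s * F \<xi> + q)\<^sup>2 \<ge> a\<^sup>2 * s\<^sup>2 / 2 - b\<^sup>2 * (norm W)\<^sup>2" using q by linarith
    then have "\<theta> * (a\<^sup>2 * s\<^sup>2 / 2 - b\<^sup>2 * (norm W)\<^sup>2) \<le> \<theta> * (s * F \<xi> + q)\<^sup>2" using \<theta>(1) by (intro mult_left_mono) auto
    also have "\<dots> \<le> 1 * (s * F \<xi> + q)\<^sup>2" using \<theta> by (intro mult_right_mono) auto
    finally have 1: "(Fgrad F \<xi> \<bullet> V)\<^sup>2 \<ge> (\<theta> * a\<^sup>2 / 2) * s\<^sup>2 - (\<theta> * b\<^sup>2) * (norm W)\<^sup>2" by (simp add: p algebra_simps)
    have "a * (\<mu>\<^sup>2 * (norm W)\<^sup>2) \<le> F \<xi> * (W \<bullet> (Fhess F \<xi> *v W))"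
      using Fa ab(1) \<mu>(2)[OF n W] by (intro mult_mono) auto
    then have "DA \<xi> V V \<ge> (\<theta> * a\<^sup>2 / 2) * s\<^sup>2 + (a * \<mu>\<^sup>2 - \<theta> * b\<^sup>2) * (norm W)\<^sup>2"
      using 1 by (simp add: DA_def H power2_eq_square algebra_simps)
    moreover have "(a * \<mu>\<^sup>2 - \<theta> * b\<^sup>2) * (norm W)\<^sup>2 \<ge> c * (norm W)\<^sup>2"
      using \<theta>(3) by (intro mult_right_mono) (auto simp: c_def min_def)
    moreover have "(\<theta> * a\<^sup>2 / 2) * s\<^sup>2 \<ge> c * s\<^sup>2" by (intro mult_right_mono) (auto simp: c_def)
    ultimately show ?thesis by (simp add: nV algebra_simps)
  qed
  ultimately show thesis using that DA_unit by metis
qed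

text \<open>The bound concerns arbitrary pairs \<open>h\<close>, \<open>V\<close>, not just a
  quadratic form, so it is taken from the continuity of \<open>Fhess\<close> on the compact unit
  sphere.\<close>

lemma DA_upper: obtains L where "L > 0" "\<And>\<xi> h V. \<xi> \<noteq> 0 \<Longrightarrow> \<bar>DA \<xi> h V\<bar> \<le> L * norm h * norm V"
proof -
  obtain a b where ab: "0 < a" "a \<le> b" "\<And>\<xi>. a * norm \<xi> \<le> F \<xi>" "\<And>\<xi>. F \<xi> \<le> b * norm \<xi>" by (rule F_bounds) blast
  have "continuous_on (sphere 0 1) (Fhess F)"
    using finsler unfolding finsler_norm_def C2_away_from_0_def by (auto elim!: continuous_on_subset)
  then have "bounded (Fhess F ` sphere 0 1)" by (intro compact_imp_bounded compact_continuous_image) auto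
  then obtain B where "\<forall>x\<in>sphere 0 1. norm (Fhess F x) \<le> B" unfolding bounded_iff by blast
  then have B: "norm (Fhess F \<xi>) \<le> B" if "norm \<xi> = 1" for \<xi> using that by simp
  obtain e :: "real^'n" where "norm e = 1" using norm_axis_1[of undefined] by blast
  then have B0: "B \<ge> 0" using B[of e] norm_ge_zero order_trans by blast
  define N where "N = real CARD('n)"
  have mv: "norm (M *v V) \<le> N * (norm M * norm V)" for M :: "real^'n^'n" and V
  proof -
    have "norm (M *v V) \<le> (\<Sum>i\<in>UNIV. \<bar>(M *v V) $ i\<bar>)" by (rule norm_le_l1_cart)
    also have "\<dots> \<le> (\<Sum>i\<in>(UNIV::'n set). norm M * norm V)"
    proof (rule sum_mono)
      fix i
      have "\<bar>(M *v V) $ i\<bar> \<le> norm (M $ i) * norm V" by (simp add: matrix_vector_mul_component Cauchy_Schwarz_ineq2)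
      also have "\<dots> \<le> norm M * norm V" by (intro mult_right_mono Finite_Cartesian_Product.norm_nth_le) auto
      finally show "\<bar>(M *v V) $ i\<bar> \<le> norm M * norm V" .
    qed
    finally show ?thesis by (simp add: N_def)
  qed
  define L where "L = b\<^sup>2 + b * (N * B) + 1"
  have N0: "N \<ge> 0" by (simp add: N_def)
  have b0: "b > 0" using ab by simp
  have "L > 0" using b0 N0 B0 by (simp add: L_def add_nonneg_pos)
  moreover have "\<bar>DA \<xi> h V\<bar> \<le> L * norm h * norm V" if n: "norm \<xi> = 1" for \<xi> h V
  proof -
    have "\<bar>Fgrad F \<xi> \<bullet> h\<bar> * \<bar>Fgrad F \<xi> \<bullet> V\<bar> \<le> (b * norm h) * (b * norm V)"
      using b0 by (intro mult_mono Fgrad_bound ab) auto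
    moreover have "F \<xi> * \<bar>h \<bullet> (Fhess F \<xi> *v V)\<bar> \<le> b * (norm h * (N * (B * norm V)))"
    proof (intro mult_mono)
      show "F \<xi> \<le> b" using ab(4)[of \<xi>] n by simp
      have "\<bar>h \<bullet> (Fhess F \<xi> *v V)\<bar> \<le> norm h * norm (Fhess F \<xi> *v V)" by (rule Cauchy_Schwarz_ineq2)
      also have "\<dots> \<le> norm h * (N * (norm (Fhess F \<xi>) * norm V))" by (intro mult_left_mono mv) auto
      also have "\<dots> \<le> norm h * (N * (B * norm V))" using B[OF n] N0 by (intro mult_left_mono mult_right_mono) auto
      finally show "\<bar>h \<bullet> (Fhess F \<xi> *v V)\<bar> \<le> norm h * (N * (B * norm V))" .
    qed (use b0 in auto)
    moreover have "\<bar>DA \<xi> h V\<bar> \<le> \<bar>Fgrad F \<xi> \<bullet> h\<bar> * \<bar>Fgrad F \<xi> \<bullet> V\<bar> + F \<xi> * \<bar>h \<bullet> (Fhess F \<xi> *v V)\<bar>"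
      unfolding DA_def using F_nonneg[of \<xi>] by (intro order_trans[OF abs_triangle_ineq]) (simp add: abs_mult)
    moreover have "norm h * norm V \<ge> 0" by simp
    moreover have "L * norm h * norm V = (b * norm h) * (b * norm V) + b * (norm h * (N * (B * norm V))) + norm h * norm V"
      by (simp add: L_def algebra_simps power2_eq_square)
    ultimately show ?thesis by linarith
  qed
  ultimately show thesis using that DA_unit by metis
qed

text \<open>Away from 0 both factors are continuous. At 0 the growth
  \<open>b\<^sup>2 * norm \<eta>\<close> suffices, although \<open>Fgrad F\<close> itself may jump
  there.\<close>

lemma FA_continuous: "continuous_on UNIV (FA F)"
proof (intro continuous_at_imp_continuous_on ballI)
  obtain a b where ab: "0 < a" "a \<le> b" "\<And>\<xi>. a * norm \<xi> \<le> F \<xi>" "\<And>\<xi>. F \<xi> \<le> b * norm \<xi>" by (rule F_bounds) blast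
  fix \<xi> :: "real^'n"
  show "isCont (FA F) \<xi>"
  proof (cases "\<xi> = 0")
    case False
    have "isCont F \<xi>" "isCont (Fgrad F) \<xi>"
      using has_derivative_continuous[OF F_has_derivative[OF False]] has_derivative_continuous[OF Fgrad_has_derivative[OF False]] by auto
    then show ?thesis unfolding FA_def[abs_def] by (intro continuous_intros)
  next
    case True
    have "norm (FA F \<eta>) \<le> b\<^sup>2 * norm \<eta>" for \<eta>
    proof -
      have "norm (Fgrad F \<eta>) * norm (Fgrad F \<eta>) \<le> b * norm (Fgrad F \<eta>)"
        using Fgrad_bound[OF ab(4), of \<eta> "Fgrad F \<eta>"] by (simp flip: power2_norm_eq_inner power2_eq_square)
      then have "norm (Fgrad F \<eta>) \<le> b" using ab by (cases "norm (Fgrad F \<eta>) = 0") auto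
      then have "F \<eta> * norm (Fgrad F \<eta>) \<le> (b * norm \<eta>) * b" using ab F_nonneg[of \<eta>] by (intro mult_mono) auto
      then show ?thesis using F_nonneg[of \<eta>] by (simp add: FA_def power2_eq_square mult_ac)
    qed
    moreover have "((\<lambda>\<eta>::real^'n. b\<^sup>2 * norm \<eta>) \<longlongrightarrow> 0) (at 0)" by (auto intro!: tendsto_eq_intros)
    ultimately have "(FA F \<longlongrightarrow> 0) (at 0)" by (intro Lim_null_comparison[of "FA F"] always_eventually) auto
    then show ?thesis by (simp add: True isCont_def)
  qed
qed

text \<open>For \<open>V \<noteq> 0\<close> the segment meets the origin for at most one parameter,
  so the derivative bound holds at all other points. Monotonicity takes \<open>U = V\<close>;
  Lipschitz continuity takes for \<open>U\<close> the negative of the increment of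
  \<open>FA F\<close>.\<close>

lemma FA_increment:
  assumes m: "\<And>\<xi>. \<xi> \<noteq> 0 \<Longrightarrow> DA \<xi> V U \<ge> m"
  shows "FA F (\<eta> + V) \<bullet> U - FA F \<eta> \<bullet> U \<ge> m \<or> V = 0"
proof (cases "V = 0")
  case False
  obtain s where s: "\<And>t. \<eta> + t *\<^sub>R V = 0 \<Longrightarrow> t = s"
  proof (cases "\<exists>s. \<eta> + s *\<^sub>R V = 0")
    case True
    then obtain s where "\<eta> + s *\<^sub>R V = 0" by blast
    then have "t = s" if "\<eta> + t *\<^sub>R V = 0" for t
      using that False by (metis add_left_cancel scaleR_cancel_right)
    then show ?thesis using that by blast
  qed (use that[of 0] in blast)
  define k where "k t = FA F (\<eta> + t *\<^sub>R V) \<bullet> U" for t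
  have "k 1 - k 0 \<ge> m"
  proof (rule increment_ge_except[where s=s])
    show "continuous_on {0..1} k" unfolding k_def
      by (intro continuous_intros continuous_on_compose2[OF FA_continuous]) auto
    fix t assume "t \<noteq> s"
    then have nz: "\<eta> + t *\<^sub>R V \<noteq> 0" using s by blast
    have "(k has_derivative (\<lambda>r. DA (\<eta> + t *\<^sub>R V) (r *\<^sub>R V) U)) (at t)"
      unfolding k_def
      by (rule has_derivative_compose[of "\<lambda>t. \<eta> + t *\<^sub>R V" "\<lambda>r. r *\<^sub>R V" t UNIV "\<lambda>\<eta>. FA F \<eta> \<bullet> U"])
        (auto intro!: derivative_eq_intros DA_has_derivative nz)
    moreover have "(\<lambda>r. DA (\<eta> + t *\<^sub>R V) (r *\<^sub>R V) U) = (*) (DA (\<eta> + t *\<^sub>R V) V U)"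
      by (auto simp: DA_def algebra_simps)
    ultimately have "(k has_real_derivative DA (\<eta> + t *\<^sub>R V) V U) (at t)" by (simp only: has_field_derivative_def)
    then show "\<exists>D\<ge>m. (k has_real_derivative D) (at t)" using m[OF nz] by blast
  qed
  then show ?thesis by (simp add: k_def)
qed simp

lemma FA_strongly_monotone:
  assumes "\<And>\<xi> V. \<xi> \<noteq> 0 \<Longrightarrow> DA \<xi> V V \<ge> c * (norm V)\<^sup>2"
  shows "(FA F \<xi> - FA F \<eta>) \<bullet> (\<xi> - \<eta>) \<ge> c * (norm (\<xi> - \<eta>))\<^sup>2"
  using FA_increment[where V="\<xi> - \<eta>" and U="\<xi> - \<eta>" and m="c * (norm (\<xi> - \<eta>))\<^sup>2" and \<eta>=\<eta>] assms
  by (auto simp: inner_diff_left)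

lemma FA_Lipschitz:
  assumes "\<And>\<xi> h V. \<xi> \<noteq> 0 \<Longrightarrow> \<bar>DA \<xi> h V\<bar> \<le> L * norm h * norm V" "L \<ge> 0"
  shows "norm (FA F \<xi> - FA F \<eta>) \<le> L * norm (\<xi> - \<eta>)"
proof (cases "\<xi> = \<eta>")
  case False
  define d where "d = FA F \<xi> - FA F \<eta>"
  have "DA \<zeta> (\<xi> - \<eta>) (- d) \<ge> - (L * norm (\<xi> - \<eta>) * norm d)" if "\<zeta> \<noteq> 0" for \<zeta>
    using assms(1)[OF that, of "\<xi> - \<eta>" "- d"] by simp
  from FA_increment[OF this, of \<eta>] False have "d \<bullet> (- d) \<ge> - (L * norm (\<xi> - \<eta>) * norm d)"
    by (simp add: d_def inner_diff_left)
  then have "norm d * norm d \<le> L * norm (\<xi> - \<eta>) * norm d" by (simp flip: power2_norm_eq_inner power2_eq_square)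
  then show ?thesis using assms(2) unfolding d_def[symmetric] by (cases "norm d = 0") auto
qed simp

section \<open>The energy density and measurability\<close>

lemma energy_has_derivative: "((\<lambda>\<xi>. (F \<xi>)\<^sup>2 / 2) has_derivative (\<lambda>h. FA F \<xi> \<bullet> h)) (at \<xi>)"
proof (cases "\<xi> = 0")
  case False
  show ?thesis
    using has_derivative_mult_right[OF has_derivative_power[OF F_has_derivative[OF False], of 2], of "1/2"]
    by (simp add: FA_def mult.commute)
next
  case True
  obtain a b where ab: "0 < a" "a \<le> b" "\<And>\<xi>. a * norm \<xi> \<le> F \<xi>" "\<And>\<xi>. F \<xi> \<le> b * norm \<xi>" by (rule F_bounds) blast
  have "((\<lambda>\<xi>. (F \<xi>)\<^sup>2 / 2) has_derivative (\<lambda>h. 0)) (at 0)"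
    unfolding has_derivative_within_alt
  proof (intro conjI allI impI)
    fix e :: real assume e: "e > 0"
    have "norm ((F y)\<^sup>2 / 2 - (F 0)\<^sup>2 / 2 - 0) \<le> e * norm (y - 0)" if y: "norm (y - 0) < e / b\<^sup>2" for y
    proof -
      have "(F y)\<^sup>2 \<le> (b * norm y)\<^sup>2" by (intro power_mono ab F_nonneg)
      also have "\<dots> = (b\<^sup>2 * norm y) * norm y" by (simp add: power2_eq_square mult_ac)
      also have "\<dots> \<le> e * norm y" using y ab by (intro mult_right_mono) (auto simp: field_simps)
      moreover have "e * norm y \<ge> 0" using e by simp
      ultimately show ?thesis by simp
    qed
    then show "\<exists>d>0. \<forall>y\<in>UNIV. norm (y - 0) < d \<longrightarrow> norm ((F y)\<^sup>2 / 2 - (F 0)\<^sup>2 / 2 - 0) \<le> e * norm (y - 0)"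
      using e ab by (intro exI[of _ "e / b\<^sup>2"]) auto
  qed simp
  then show ?thesis using True by simp
qed

text \<open>Along the segment the derivative of the energy minus its linear part is compared with
  that of \<open>c * t\<^sup>2 / 2\<close> and \<open>L * t\<^sup>2 / 2\<close>, scaled by the
  squared length; no second derivative of the energy is taken, so passing through 0 does no
  harm.\<close>

lemma energy_bounds:
  assumes c: "\<And>\<xi> \<eta>. (FA F \<xi> - FA F \<eta>) \<bullet> (\<xi> - \<eta>) \<ge> c * (norm (\<xi> - \<eta>))\<^sup>2"
    and L: "\<And>\<xi> \<eta>. norm (FA F \<xi> - FA F \<eta>) \<le> L * norm (\<xi> - \<eta>)"
  shows "(F \<xi>)\<^sup>2 / 2 \<ge> (F \<eta>)\<^sup>2 / 2 + FA F \<eta> \<bullet> (\<xi> - \<eta>) + c / 2 * (norm (\<xi> - \<eta>))\<^sup>2"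
    and "(F \<xi>)\<^sup>2 / 2 \<le> (F \<eta>)\<^sup>2 / 2 + FA F \<eta> \<bullet> (\<xi> - \<eta>) + L / 2 * (norm (\<xi> - \<eta>))\<^sup>2"
proof -
  define V where "V = \<xi> - \<eta>"
  have D: "((\<lambda>t. (F (\<eta> + t *\<^sub>R V))\<^sup>2 / 2) has_real_derivative FA F (\<eta> + t *\<^sub>R V) \<bullet> V) (at t)" for t
  proof -
    have "((\<lambda>t. (F (\<eta> + t *\<^sub>R V))\<^sup>2 / 2) has_derivative (\<lambda>r. FA F (\<eta> + t *\<^sub>R V) \<bullet> (r *\<^sub>R V))) (at t)"
      by (rule has_derivative_compose[OF _ energy_has_derivative]) (auto intro!: derivative_eq_intros)
    moreover have "(\<lambda>r. FA F (\<eta> + t *\<^sub>R V) \<bullet> (r *\<^sub>R V)) = (*) (FA F (\<eta> + t *\<^sub>R V) \<bullet> V)" by auto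
    ultimately show ?thesis by (simp only: has_field_derivative_def)
  qed
  have lin: "((\<lambda>t. t * (FA F \<eta> \<bullet> V) + k / 2 * (norm V)\<^sup>2 * t\<^sup>2) has_real_derivative (FA F \<eta> \<bullet> V + k * t * (norm V)\<^sup>2)) (at t)" for k t
    by (auto intro!: derivative_eq_intros)
  define f where "f = (\<lambda>t. (F (\<eta> + t *\<^sub>R V))\<^sup>2 / 2 - (t * (FA F \<eta> \<bullet> V) + c / 2 * (norm V)\<^sup>2 * t\<^sup>2))"
  define g where "g = (\<lambda>t. (t * (FA F \<eta> \<bullet> V) + L / 2 * (norm V)\<^sup>2 * t\<^sup>2) - (F (\<eta> + t *\<^sub>R V))\<^sup>2 / 2)"
  have Df: "(f has_real_derivative (FA F (\<eta> + t *\<^sub>R V) \<bullet> V - (FA F \<eta> \<bullet> V + c * t * (norm V)\<^sup>2))) (at t)" for t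
    unfolding f_def by (intro DERIV_diff D lin)
  have Dg: "(g has_real_derivative ((FA F \<eta> \<bullet> V + L * t * (norm V)\<^sup>2) - FA F (\<eta> + t *\<^sub>R V) \<bullet> V)) (at t)" for t
    unfolding g_def by (intro DERIV_diff D lin)
  have cf: "continuous_on {0..1} f" "continuous_on {0..1} g"
    using Df Dg DERIV_isCont continuous_at_imp_continuous_on by blast+
  have "f 1 - f 0 \<ge> 0 * (1 - 0)"
  proof (rule increment_ge_open[OF _ cf(1)])
    fix t :: real assume t: "0 < t"
    have "t * ((FA F (\<eta> + t *\<^sub>R V) - FA F \<eta>) \<bullet> V) \<ge> t * (c * t * (norm V)\<^sup>2)"
      using c[of "\<eta> + t *\<^sub>R V" \<eta>] by (simp add: power2_eq_square mult_ac)
    then have "(FA F (\<eta> + t *\<^sub>R V) - FA F \<eta>) \<bullet> V \<ge> c * t * (norm V)\<^sup>2" using t by simp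
    then show "\<exists>D\<ge>0. (f has_real_derivative D) (at t)" using Df[of t] by (intro exI conjI) (auto simp: inner_diff_left)
  qed simp
  then show "(F \<xi>)\<^sup>2 / 2 \<ge> (F \<eta>)\<^sup>2 / 2 + FA F \<eta> \<bullet> (\<xi> - \<eta>) + c / 2 * (norm (\<xi> - \<eta>))\<^sup>2"
    by (simp add: f_def V_def)
  have "g 1 - g 0 \<ge> 0 * (1 - 0)"
  proof (rule increment_ge_open[OF _ cf(2)])
    fix t :: real assume t: "0 < t"
    have "(FA F (\<eta> + t *\<^sub>R V) - FA F \<eta>) \<bullet> V \<le> norm (FA F (\<eta> + t *\<^sub>R V) - FA F \<eta>) * norm V"
      by (rule norm_cauchy_schwarz)
    also have "\<dots> \<le> (L * norm (t *\<^sub>R V)) * norm V"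
      using L[of "\<eta> + t *\<^sub>R V" \<eta>] by (intro mult_right_mono) auto
    also have "\<dots> = L * t * (norm V)\<^sup>2" using t by (simp add: power2_eq_square)
    finally show "\<exists>D\<ge>0. (g has_real_derivative D) (at t)" using Dg[of t] by (intro exI conjI) (auto simp: inner_diff_left)
  qed simp
  then show "(F \<xi>)\<^sup>2 / 2 \<le> (F \<eta>)\<^sup>2 / 2 + FA F \<eta> \<bullet> (\<xi> - \<eta>) + L / 2 * (norm (\<xi> - \<eta>))\<^sup>2"
    by (simp add: g_def V_def)
qed

lemma F_measurable [measurable]: "F \<in> borel_measurable borel"
  by (rule borel_measurable_continuous_countable_exceptions[of "{0}"])
    (auto intro!: continuous_at_imp_continuous_on has_derivative_continuous[OF F_has_derivative])

lemma Fgrad_measurable [measurable]: "Fgrad F \<in> borel_measurable borel"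
  by (rule borel_measurable_continuous_countable_exceptions[of "{0}"])
    (auto intro!: continuous_at_imp_continuous_on has_derivative_continuous[OF Fgrad_has_derivative])

lemma Fhess_measurable [measurable]: "Fhess F \<in> borel_measurable borel"
  by (rule borel_measurable_continuous_countable_exceptions[of "{0}"])
    (use finsler in \<open>auto simp: finsler_norm_def C2_away_from_0_def\<close>)

lemma FA_measurable [measurable]: "FA F \<in> borel_measurable borel"
  by (rule borel_measurable_continuous_onI[OF FA_continuous])

end

section \<open>The Sobolev space \<open>W\<^sub>0\<^sup>1\<^sup>,\<^sup>2\<close>\<close>

text \<open>Elements of \<open>W\<^sub>0\<^sup>1\<^sup>,\<^sup>2\<close> together with their gradient, extended by zero, so that all integrals are over the
  whole space.\<close>

definition H0 :: "(real^'n) set \<Rightarrow> (real^'n \<Rightarrow> real) \<Rightarrow> (real^'n \<Rightarrow> real^'n) \<Rightarrow> bool" where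
  "H0 \<Omega> u g \<longleftrightarrow> L2 u \<and> L2 g \<and> (\<forall>x. x \<notin> \<Omega> \<longrightarrow> u x = 0 \<and> g x = 0) \<and>
     (\<exists>\<psi>. (\<forall>k. C1c \<Omega> (\<psi> k)) \<and> L2lim \<psi> u \<and> L2lim (\<lambda>k. grad (\<psi> k)) g)"

lemma H0_D: assumes "H0 \<Omega> u g"
  shows "L2 u" "L2 g" "x \<notin> \<Omega> \<Longrightarrow> u x = 0" "x \<notin> \<Omega> \<Longrightarrow> g x = 0"
  using assms by (auto simp: H0_def)

lemma H0_seq: assumes "H0 \<Omega> u g"
  obtains \<psi> where "\<And>k. C1c \<Omega> (\<psi> k)" "L2lim \<psi> u" "L2lim (\<lambda>k. grad (\<psi> k)) g"
  using assms by (auto simp: H0_def)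

lemma H0_diff: assumes "H0 \<Omega> u g" "H0 \<Omega> v h" shows "H0 \<Omega> (\<lambda>x. u x - v x) (\<lambda>x. g x - h x)"
proof -
  obtain \<psi> where \<psi>: "\<And>k. C1c \<Omega> (\<psi> k)" "L2lim \<psi> u" "L2lim (\<lambda>k. grad (\<psi> k)) g" using H0_seq[OF assms(1)] by blast
  obtain \<zeta> where \<zeta>: "\<And>k. C1c \<Omega> (\<zeta> k)" "L2lim \<zeta> v" "L2lim (\<lambda>k. grad (\<zeta> k)) h" using H0_seq[OF assms(2)] by blast
  note L = H0_D(1,2)[OF assms(1)] H0_D(1,2)[OF assms(2)] C1c_L2[OF \<psi>(1)] C1c_L2[OF \<zeta>(1)]
  have 1: "L2lim (\<lambda>k x. \<psi> k x - \<zeta> k x) (\<lambda>x. u x - v x)" by (intro L2lim_diff \<psi> \<zeta> L)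
  have 2: "L2lim (\<lambda>k. grad (\<lambda>x. \<psi> k x - \<zeta> k x)) (\<lambda>x. g x - h x)"
    unfolding C1c_diff(2)[OF \<psi>(1) \<zeta>(1)] by (intro L2lim_diff \<psi> \<zeta> L)
  show ?thesis unfolding H0_def using 1 2 L2_diff L H0_D(3,4)[OF assms(1)] H0_D(3,4)[OF assms(2)]
    by (auto intro!: exI[of _ "\<lambda>k x. \<psi> k x - \<zeta> k x"] C1c_diff \<psi> \<zeta> L2_diff L)
qed

lemma H0_zero: "H0 \<Omega> (\<lambda>x. 0) (\<lambda>x. 0)"
proof -
  have c: "C1c \<Omega> (\<lambda>x. 0)" "grad (\<lambda>x. 0 :: real) = (\<lambda>x::real^'a. 0)"
    using C1cI[of "\<lambda>x::real^'a. 0::real" "\<lambda>x. 0" "{}" \<Omega>] by auto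
  show ?thesis unfolding H0_def by (auto intro!: exI[of _ "\<lambda>k x. 0"] c simp: c(2))
qed

lemma H0_minus: "H0 \<Omega> u g \<Longrightarrow> H0 \<Omega> (\<lambda>x. - u x) (\<lambda>x. - g x)"
  using H0_diff[OF H0_zero, of \<Omega> u g] by simp

lemma H0_translation_estimate:
  assumes "H0 \<Omega> u g" shows "n2 (\<lambda>x. u (x + y) - u x) \<le> (norm y)\<^sup>2 * n2 g"
proof -
  obtain \<psi> where \<psi>: "\<And>k. C1c \<Omega> (\<psi> k)" "L2lim \<psi> u" "L2lim (\<lambda>k. grad (\<psi> k)) g" using H0_seq[OF assms(1)] by blast
  note L = H0_D(1,2)[OF assms(1)] C1c_L2[OF \<psi>(1)]
  have d: "L2lim (\<lambda>k x. \<psi> k (x + y) - \<psi> k x) (\<lambda>x. u (x + y) - u x)"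
    by (intro L2lim_diff L2lim_translate \<psi> L2_translate L)
  show ?thesis
    by (rule LIMSEQ_le[OF L2lim_n2[OF d] tendsto_mult_left[OF L2lim_n2[OF \<psi>(3)]]])
      (use L translation_estimate[OF \<psi>(1)] in \<open>auto intro!: L2_diff L2_translate\<close>)
qed

lemma L2_indicator_compact: assumes "compact K" shows "L2 (indicat_real K)"
proof -
  have "(\<lambda>x. (norm (indicat_real K x))\<^sup>2) = indicat_real K" by (auto simp: indicator_def)
  then show ?thesis unfolding L2_def using integrable_indicator_compact[OF assms] borel_compact[OF assms] by simp
qed

lemma L2_integrable_bounded_support:
  fixes f :: "'a::euclidean_space \<Rightarrow> 'b::euclidean_space"
  assumes f: "L2 f" and R: "\<And>x. f x \<noteq> 0 \<Longrightarrow> norm x \<le> R" shows "integrable lborel f"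
proof -
  have [measurable]: "f \<in> borel_measurable borel" using f by (rule L2_measurable)
  have I: "L2 (indicat_real (cball (0::'a) R))"
    by (rule L2_indicator_compact[OF compact_cball])
  have "integrable lborel (\<lambda>x. indicat_real (cball (0::'a) R) x * norm (f x))"
    by (rule L2_mult_integrable[OF I L2_norm[OF f]])
  moreover have "(\<lambda>x. indicat_real (cball (0::'a) R) x * norm (f x)) = (\<lambda>x. norm (f x))"
    using R by (auto simp: indicator_def fun_eq_iff)
  ultimately show ?thesis by (simp add: integrable_norm_iff)
qed

section \<open>Passage between integrals over the domain and over the whole space\<close>

lemma L1_loc_measurable:
  fixes f :: "real^'n \<Rightarrow> real"
  assumes "open \<Omega>" "L1_loc \<Omega> f" shows "(\<lambda>x. indicat_real \<Omega> x * f x) \<in> borel_measurable borel"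
proof -
  \<comment> \<open>\<open>L1_loc\<close> gives measurability only on compact subsets; a compact
    exhaustion transfers it to the domain.\<close>
  obtain C where C: "\<And>n::nat. compact (C n)" "\<And>n. C n \<subseteq> \<Omega>" "\<And>n. C n \<subseteq> interior (C (Suc n))" "\<Union>(range C) = \<Omega>"
    using open_Union_compact_subsets[OF assms(1)] by metis
  have mono: "C m \<subseteq> C n" if "m \<le> n" for m n
    by (rule lift_Suc_mono_le[of C, OF _ that]) (use C(3) interior_subset in blast)
  have "(\<lambda>x. indicat_real (C n) x * f x) \<in> borel_measurable borel" for n
    using assms(2) C(1,2)[of n] by (auto simp: L1_loc_def set_integrable_def dest!: borel_measurable_integrable)
  moreover have "(\<lambda>n. indicat_real (C n) x * f x) \<longlonglongrightarrow> indicat_real \<Omega> x * f x" for x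
  proof (rule tendsto_eventually)
    show "\<forall>\<^sub>F n in sequentially. indicat_real (C n) x * f x = indicat_real \<Omega> x * f x"
    proof (cases "x \<in> \<Omega>")
      case True
      then obtain m where "x \<in> C m" using C(4) by auto
      then have "x \<in> C n" if "n \<ge> m" for n using mono[OF that] by auto
      then show ?thesis using True by (intro eventually_sequentiallyI[of m]) simp
    next
      case False
      then have "x \<notin> C n" for n using C(2) by blast
      then show ?thesis using False by auto
    qed
  qed
  ultimately show ?thesis by (rule borel_measurable_LIMSEQ_metric)
qed

lemma borel_measurable_vecI:
  fixes f :: "'a \<Rightarrow> real^'n"
  assumes "\<And>i. (\<lambda>x. f x $ i) \<in> borel_measurable M" shows "f \<in> borel_measurable M"
  unfolding borel_measurable_euclidean_space[of f]
  using assms by (auto simp: Basis_vec_def inner_axis)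

lemma W12_L2:
  assumes "open \<Omega>" "W12 \<Omega> u g"
  shows "L2 (\<lambda>x. indicat_real \<Omega> x * u x)" "L2 (\<lambda>x. indicat_real \<Omega> x *\<^sub>R g x)"
proof -
  have wg: "L1_loc \<Omega> u" "\<And>i. L1_loc \<Omega> (\<lambda>x. g x $ i)" using assms(2) by (auto simp: W12_def weak_grad_def)
  have 1: "(\<lambda>x. (norm (indicat_real \<Omega> x * u x))\<^sup>2) = (\<lambda>x. indicat_real \<Omega> x *\<^sub>R (u x)\<^sup>2)"
    by (auto simp: indicator_def fun_eq_iff)
  show "L2 (\<lambda>x. indicat_real \<Omega> x * u x)"
    unfolding L2_def 1 using L1_loc_measurable[OF assms(1) wg(1)] assms(2) by (auto simp: W12_def set_integrable_def)
  have 2: "(\<lambda>x. (norm (indicat_real \<Omega> x *\<^sub>R g x))\<^sup>2) = (\<lambda>x. indicat_real \<Omega> x *\<^sub>R (norm (g x))\<^sup>2)"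
    by (auto simp: indicator_def fun_eq_iff)
  have "(\<lambda>x. indicat_real \<Omega> x *\<^sub>R g x) \<in> borel_measurable borel"
    by (rule borel_measurable_vecI) (use L1_loc_measurable[OF assms(1) wg(2)] in simp)
  then show "L2 (\<lambda>x. indicat_real \<Omega> x *\<^sub>R g x)"
    unfolding L2_def 2 using assms(2) by (auto simp: W12_def set_integrable_def)
qed

lemma set_integral_zero_off:
  fixes f :: "_ \<Rightarrow> real"
  assumes "\<And>x. x \<notin> \<Omega> \<Longrightarrow> f x = 0" shows "(LINT x:\<Omega>|lborel. f x) = (\<integral>x. f x \<partial>lborel)"
  unfolding set_lebesgue_integral_def
  by (rule Bochner_Integration.integral_cong) (use assms in \<open>auto simp: indicator_def\<close>)

text \<open>The implication in the hypothesis makes one lemma serve both kinds of inequality: for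
  nonnegative \<open>\<phi>\<close> only nonnegative test functions have to be checked.\<close>

lemma L2lim_extend_test:
  assumes \<Omega>: "open \<Omega>" and B: "L2 B" and b: "L2 b" and \<phi>: "C1c \<Omega> \<phi>"
    and t: "\<And>\<psi>. test_fun \<Omega> \<psi> \<Longrightarrow> ((\<forall>x. \<phi> x \<ge> 0) \<longrightarrow> (\<forall>x. \<psi> x \<ge> 0)) \<Longrightarrow>
      (\<integral>x. B x \<bullet> grad \<psi> x \<partial>lborel) \<le> (\<integral>x. b x * \<psi> x \<partial>lborel)"
  shows "(\<integral>x. B x \<bullet> grad \<phi> x \<partial>lborel) \<le> (\<integral>x. b x * \<phi> x \<partial>lborel)"
proof -
  obtain \<psi> where \<psi>: "\<And>k. test_fun \<Omega> (\<psi> k)" "\<And>k x. (\<And>x. \<phi> x \<ge> 0) \<Longrightarrow> \<psi> k x \<ge> 0"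
    "L2lim \<psi> \<phi>" "L2lim (\<lambda>k. grad (\<psi> k)) (grad \<phi>)" using C1c_approx[OF \<Omega> \<phi>] by metis
  note L = C1c_L2[OF \<phi>] C1c_L2[OF test_fun_C1c[OF \<psi>(1)]]
  have "(\<lambda>k. \<integral>x. B x \<bullet> grad (\<psi> k) x \<partial>lborel) \<longlonglongrightarrow> (\<integral>x. B x \<bullet> grad \<phi> x \<partial>lborel)"
    by (rule L2lim_inner) (use L \<psi>(4) B in auto)
  moreover have "(\<lambda>k. \<integral>x. b x * \<psi> k x \<partial>lborel) \<longlonglongrightarrow> (\<integral>x. b x * \<phi> x \<partial>lborel)"
    by (rule L2lim_mult) (use L \<psi>(3) b in auto)
  ultimately show ?thesis by (rule LIMSEQ_le) (use t[OF \<psi>(1)] \<psi>(2) in blast)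
qed

lemma L2lim_extend_test_eq:
  assumes \<Omega>: "open \<Omega>" and B: "L2 B" and b: "L2 b" and \<phi>: "C1c \<Omega> \<phi>"
    and t: "\<And>\<psi>. test_fun \<Omega> \<psi> \<Longrightarrow> (\<integral>x. B x \<bullet> grad \<psi> x \<partial>lborel) = (\<integral>x. b x * \<psi> x \<partial>lborel)"
  shows "(\<integral>x. B x \<bullet> grad \<phi> x \<partial>lborel) = (\<integral>x. b x * \<phi> x \<partial>lborel)"
proof (rule antisym)
  show "(\<integral>x. B x \<bullet> grad \<phi> x \<partial>lborel) \<le> (\<integral>x. b x * \<phi> x \<partial>lborel)"
    by (rule L2lim_extend_test[OF \<Omega> B b \<phi>]) (simp add: t)
  have "(\<integral>x. (- B x) \<bullet> grad \<phi> x \<partial>lborel) \<le> (\<integral>x. (- b x) * \<phi> x \<partial>lborel)"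
    by (rule L2lim_extend_test[OF \<Omega> L2_minus[OF B] L2_minus[OF b] \<phi>]) (simp add: t)
  then show "(\<integral>x. b x * \<phi> x \<partial>lborel) \<le> (\<integral>x. B x \<bullet> grad \<phi> x \<partial>lborel)" by simp
qed

lemma weak_grad_C1c:
  assumes \<Omega>: "open \<Omega>" and "weak_grad \<Omega> u g"
    and L: "L2 (\<lambda>x. indicat_real \<Omega> x * u x)" "L2 (\<lambda>x. indicat_real \<Omega> x *\<^sub>R g x)" and \<phi>: "C1c \<Omega> \<phi>"
  shows "(\<integral>x. (indicat_real \<Omega> x * u x) * grad \<phi> x $ i \<partial>lborel) = - (\<integral>x. (indicat_real \<Omega> x *\<^sub>R g x) $ i * \<phi> x \<partial>lborel)"
proof -
  define B :: "real^'a \<Rightarrow> real^'a" where "B x = (indicat_real \<Omega> x * u x) *\<^sub>R axis i 1" for x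
  define b where "b x = - ((indicat_real \<Omega> x *\<^sub>R g x) $ i)" for x
  have LB: "L2 B" by (rule L2_dominated[OF L(1), where C=1]) (use borel_measurable_scaleR[OF L2_measurable[OF L(1)] borel_measurable_const, of "axis i 1"] in \<open>auto simp: B_def[abs_def]\<close>)
  have Lb: "L2 b" unfolding b_def by (rule L2_minus[OF L2_nth[OF L(2)]])
  have "(\<integral>x. B x \<bullet> grad \<phi> x \<partial>lborel) = (\<integral>x. b x * \<phi> x \<partial>lborel)"
  proof (rule L2lim_extend_test_eq[OF \<Omega> LB Lb \<phi>])
    fix \<psi> assume t: "test_fun \<Omega> \<psi>"
    have "(\<integral>x. B x \<bullet> grad \<psi> x \<partial>lborel) = (LINT x:\<Omega>|lborel. u x * pd i \<psi> x)"
      unfolding set_lebesgue_integral_def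
      by (intro Bochner_Integration.integral_cong) (auto simp: B_def inner_axis' grad_nth)
    also have "\<dots> = - (LINT x:\<Omega>|lborel. g x $ i * \<psi> x)" using assms(2) t by (auto simp: weak_grad_def)
    also have "\<dots> = (\<integral>x. b x * \<psi> x \<partial>lborel)"
      unfolding set_lebesgue_integral_def by (simp add: b_def mult.assoc)
    finally show "(\<integral>x. B x \<bullet> grad \<psi> x \<partial>lborel) = (\<integral>x. b x * \<psi> x \<partial>lborel)" .
  qed
  then show ?thesis by (simp add: B_def b_def inner_axis')
qed

lemma W012_H0:
  assumes \<Omega>: "open \<Omega>" and W: "W012 \<Omega> u g"
  shows "H0 \<Omega> (\<lambda>x. indicat_real \<Omega> x * u x) (\<lambda>x. indicat_real \<Omega> x *\<^sub>R g x)"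
proof -
  let ?u = "\<lambda>x. indicat_real \<Omega> x * u x" and ?g = "\<lambda>x. indicat_real \<Omega> x *\<^sub>R g x"
  have L: "L2 ?u" "L2 ?g" using W12_L2[OF \<Omega>] W by (auto simp: W012_def)
  obtain \<psi> where \<psi>: "\<And>k. test_fun \<Omega> (\<psi> k)"
    "(\<lambda>k. LINT x:\<Omega>|lborel. (\<psi> k x - u x)\<^sup>2 + (norm (grad (\<psi> k) x - g x))\<^sup>2) \<longlonglongrightarrow> 0"
    using W by (auto simp: W012_def)
  note c = test_fun_C1c[OF \<psi>(1)]
  have eq: "(LINT x:\<Omega>|lborel. (\<psi> k x - u x)\<^sup>2 + (norm (grad (\<psi> k) x - g x))\<^sup>2) =
     n2 (\<lambda>x. \<psi> k x - ?u x) + n2 (\<lambda>x. grad (\<psi> k) x - ?g x)" for k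
  proof -
    have "(LINT x:\<Omega>|lborel. (\<psi> k x - u x)\<^sup>2 + (norm (grad (\<psi> k) x - g x))\<^sup>2) =
      (\<integral>x. (norm (\<psi> k x - ?u x))\<^sup>2 + (norm (grad (\<psi> k) x - ?g x))\<^sup>2 \<partial>lborel)"
      unfolding set_lebesgue_integral_def
      by (intro Bochner_Integration.integral_cong) (auto simp: indicator_def C1c_zero_off[OF c])
    also have "\<dots> = n2 (\<lambda>x. \<psi> k x - ?u x) + n2 (\<lambda>x. grad (\<psi> k) x - ?g x)"
      unfolding n2_def by (intro Bochner_Integration.integral_add L2_integrable L2_diff C1c_L2[OF c] L)
    finally show ?thesis .
  qed
  have "L2lim \<psi> ?u" by (rule L2limI_bound[OF _ \<psi>(2)[unfolded eq]]) simp
  moreover have "L2lim (\<lambda>k. grad (\<psi> k)) ?g" by (rule L2limI_bound[OF _ \<psi>(2)[unfolded eq]]) simp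
  ultimately show ?thesis unfolding H0_def using L c by (auto simp: indicator_def)
qed

text \<open>Functions of W_0^{1,2} extended by zero have a weak gradient on the whole space, so the
  support of \<open>\<phi>\<close> may leave \<open>\<Omega>\<close>; the approximating functions
  take care of the boundary.\<close>

lemma H0_weak_grad:
  assumes H: "H0 \<Omega> u g" and \<phi>: "C1c \<Omega>' \<phi>"
  shows "(\<integral>x. u x * grad \<phi> x $ i \<partial>lborel) = - (\<integral>x. g x $ i * \<phi> x \<partial>lborel)"
proof -
  obtain \<psi> where \<psi>: "\<And>k. C1c \<Omega> (\<psi> k)" "L2lim \<psi> u" "L2lim (\<lambda>k. grad (\<psi> k)) g" using H0_seq[OF H] by blast
  note L = H0_D(1,2)[OF H] C1c_L2[OF \<psi>(1)] C1c_L2[OF \<phi>]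
  have "(\<lambda>k. \<integral>x. \<psi> k x * grad \<phi> x $ i \<partial>lborel) \<longlonglongrightarrow> (\<integral>x. u x * grad \<phi> x $ i \<partial>lborel)"
    by (rule L2lim_mult) (use L \<psi>(2) L2_nth[OF C1c_L2(2)[OF \<phi>]] in auto)
  moreover have "(\<lambda>k. \<integral>x. grad (\<psi> k) x $ i * \<phi> x \<partial>lborel) \<longlonglongrightarrow> (\<integral>x. g x $ i * \<phi> x \<partial>lborel)"
  proof (rule L2lim_mult)
    show "L2lim (\<lambda>k x. grad (\<psi> k) x $ i) (\<lambda>x. g x $ i)"
      by (rule L2lim_Lipschitz[OF \<psi>(3), where C=1])
        (use L component_le_norm_cart in \<open>auto simp flip: vector_minus_component\<close>)
  qed (intro L2lim_const L2_nth L)+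
  ultimately show ?thesis
    using LIMSEQ_unique tendsto_minus unfolding C1c_weak_grad[OF \<phi> \<psi>(1)] by blast
qed

lemma H0_W012:
  assumes \<Omega>: "open \<Omega>" and H: "H0 \<Omega> u g" shows "W012 \<Omega> u g"
proof -
  note L = H0_D(1,2)[OF H]
  have [measurable]: "u \<in> borel_measurable borel" "g \<in> borel_measurable borel" using L by (auto intro: L2_measurable)
  have [measurable]: "\<Omega> \<in> sets borel" using \<Omega> by auto
  have loc: "L1_loc \<Omega> f" if "L2 f" for f :: "real^'a \<Rightarrow> real"
    unfolding L1_loc_def set_integrable_def using L2_mult_integrable[OF L2_indicator_compact that] by auto
  have wg: "weak_grad \<Omega> u g"
    unfolding weak_grad_def
  proof (intro conjI allI impI)
    fix \<phi> i assume t: "test_fun \<Omega> \<phi>"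
    note c = test_fun_C1c[OF t]
    have "(LINT x:\<Omega>|lborel. u x * pd i \<phi> x) = (\<integral>x. u x * grad \<phi> x $ i \<partial>lborel)"
      by (subst set_integral_zero_off) (use H0_D(3)[OF H] in \<open>auto simp: grad_nth\<close>)
    moreover have "(LINT x:\<Omega>|lborel. g x $ i * \<phi> x) = (\<integral>x. g x $ i * \<phi> x \<partial>lborel)"
      by (rule set_integral_zero_off) (use H0_D(4)[OF H] in auto)
    ultimately show "(LINT x:\<Omega>|lborel. u x * pd i \<phi> x) = - (LINT x:\<Omega>|lborel. g x $ i * \<phi> x)"
      using H0_weak_grad[OF H c] by simp
  qed (use loc L L2_nth in auto)
  have "set_integrable lborel \<Omega> (\<lambda>x. (u x)\<^sup>2)" "set_integrable lborel \<Omega> (\<lambda>x. (norm (g x))\<^sup>2)"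
    unfolding set_integrable_def using L2_integrable[OF L(1)] L2_integrable[OF L(2)]
    by (auto intro!: integrable_real_mult_indicator simp: mult.commute[of "indicator _ _"])
  then have W: "W12 \<Omega> u g" using wg by (simp add: W12_def)
  obtain \<psi> where \<psi>: "\<And>k. C1c \<Omega> (\<psi> k)" "L2lim \<psi> u" "L2lim (\<lambda>k. grad (\<psi> k)) g" using H0_seq[OF H] by blast
  \<comment> \<open>A diagonal choice: each C^1 approximant is replaced by a smooth one within
    \<open>inverse (real (Suc k))\<close>.\<close>
  have "\<exists>\<zeta>. test_fun \<Omega> \<zeta> \<and> n2 (\<lambda>x. \<zeta> x - \<psi> k x) < inverse (real (Suc k)) \<and> n2 (\<lambda>x. grad \<zeta> x - grad (\<psi> k) x) < inverse (real (Suc k))" for k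
  proof -
    obtain \<zeta> where \<zeta>: "\<And>j. test_fun \<Omega> (\<zeta> j)" "L2lim \<zeta> (\<psi> k)" "L2lim (\<lambda>j. grad (\<zeta> j)) (grad (\<psi> k))"
      using C1c_approx[OF \<Omega> \<psi>(1)[of k]] by metis
    obtain N1 N2 where "\<forall>j\<ge>N1. n2 (\<lambda>x. \<zeta> j x - \<psi> k x) < inverse (real (Suc k))"
      "\<forall>j\<ge>N2. n2 (\<lambda>x. grad (\<zeta> j) x - grad (\<psi> k) x) < inverse (real (Suc k))"
      using L2lim_ev_le[OF \<zeta>(2), of "inverse (real (Suc k))"] L2lim_ev_le[OF \<zeta>(3), of "inverse (real (Suc k))"] by auto
    then show ?thesis using \<zeta>(1)[of "max N1 N2"] by (intro exI[of _ "\<zeta> (max N1 N2)"]) simp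
  qed
  then obtain \<zeta> where \<zeta>: "\<And>k. test_fun \<Omega> (\<zeta> k)" "\<And>k. n2 (\<lambda>x. \<zeta> k x - \<psi> k x) < inverse (real (Suc k))"
    "\<And>k. n2 (\<lambda>x. grad (\<zeta> k) x - grad (\<psi> k) x) < inverse (real (Suc k))" by metis
  note c = test_fun_C1c[OF \<zeta>(1)]
  define q where "q k = 4 * inverse (real (Suc k)) + 2 * n2 (\<lambda>x. \<psi> k x - u x) + 2 * n2 (\<lambda>x. grad (\<psi> k) x - g x)" for k
  have q0: "q \<longlonglongrightarrow> 0"
  proof -
    have "q \<longlonglongrightarrow> 4 * 0 + 2 * 0 + 2 * 0" unfolding q_def
      by (intro tendsto_intros LIMSEQ_inverse_real_of_nat \<psi>(2,3)[unfolded L2lim_def])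
    then show ?thesis by simp
  qed
  have le: "(LINT x:\<Omega>|lborel. (\<zeta> k x - u x)\<^sup>2 + (norm (grad (\<zeta> k) x - g x))\<^sup>2) \<le> q k" for k
  proof -
    have "(LINT x:\<Omega>|lborel. (\<zeta> k x - u x)\<^sup>2 + (norm (grad (\<zeta> k) x - g x))\<^sup>2) =
      (\<integral>x. (norm (\<zeta> k x - u x))\<^sup>2 + (norm (grad (\<zeta> k) x - g x))\<^sup>2 \<partial>lborel)"
      by (subst set_integral_zero_off) (use H0_D(3,4)[OF H] C1c_zero_off[OF c] in auto)
    also have "\<dots> = n2 (\<lambda>x. \<zeta> k x - u x) + n2 (\<lambda>x. grad (\<zeta> k) x - g x)"
      unfolding n2_def by (intro Bochner_Integration.integral_add L2_integrable L2_diff C1c_L2[OF c] L)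
    also have "n2 (\<lambda>x. \<zeta> k x - u x) \<le> 2 * n2 (\<lambda>x. \<zeta> k x - \<psi> k x) + 2 * n2 (\<lambda>x. \<psi> k x - u x)"
      using n2_add_le[OF L2_diff[OF C1c_L2(1)[OF c] C1c_L2(1)[OF \<psi>(1)]] L2_diff[OF C1c_L2(1)[OF \<psi>(1)] L(1)], of k k k] by simp
    also have "n2 (\<lambda>x. grad (\<zeta> k) x - g x) \<le> 2 * n2 (\<lambda>x. grad (\<zeta> k) x - grad (\<psi> k) x) + 2 * n2 (\<lambda>x. grad (\<psi> k) x - g x)"
      using n2_add_le[OF L2_diff[OF C1c_L2(2)[OF c] C1c_L2(2)[OF \<psi>(1)]] L2_diff[OF C1c_L2(2)[OF \<psi>(1)] L(2)], of k k k] by simp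
    finally show ?thesis using \<zeta>(2,3)[of k] by (simp add: q_def)
  qed
  have "(\<lambda>k. LINT x:\<Omega>|lborel. (\<zeta> k x - u x)\<^sup>2 + (norm (grad (\<zeta> k) x - g x))\<^sup>2) \<longlonglongrightarrow> 0"
    by (rule tendsto_sandwich[OF _ _ tendsto_const q0])
      (use le in \<open>auto intro!: always_eventually simp: set_lebesgue_integral_def\<close>)
  then show ?thesis unfolding W012_def using W \<zeta>(1) by blast
qed

section \<open>Existence for Lipschitz nonlinearities\<close>

context finsler begin

text \<open>The direct method without weak compactness. \<open>K\<close> bounds both the Lipschitz
  constant of \<open>f\<close> and the second-order remainder of its primitive
  \<open>\<Phi>\<close>; the energy \<open>J\<close> is evaluated on compactly supported C^1
  functions only, never at the limit.\<close>

theorem semilinear_existence: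
  fixes f \<Phi> :: "real \<Rightarrow> real" and R c L K :: real and \<Omega> :: "(real^'n) set"
  assumes \<Omega>: "open \<Omega>" and R: "\<And>x. x \<in> \<Omega> \<Longrightarrow> norm x \<le> R" "R > 0"
    and c: "c > 0" "\<And>\<xi> \<eta>. (FA F \<xi> - FA F \<eta>) \<bullet> (\<xi> - \<eta>) \<ge> c * (norm (\<xi> - \<eta>))\<^sup>2"
    and L: "L > 0" "\<And>\<xi> \<eta>. norm (FA F \<xi> - FA F \<eta>) \<le> L * norm (\<xi> - \<eta>)"
    and \<Phi>: "\<Phi> 0 = 0" "\<And>s t. \<bar>\<Phi> t - \<Phi> s - f s * (t - s)\<bar> \<le> K * (t - s)\<^sup>2"
    and f: "\<And>s t. \<bar>f s - f t\<bar> \<le> K * \<bar>s - t\<bar>" and K: "K \<ge> 0" "K * (4 * R\<^sup>2) \<le> c / 8"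
  obtains u g where "H0 \<Omega> u g" "\<And>\<phi>. C1c \<Omega> \<phi> \<Longrightarrow> (\<integral>x. FA F (g x) \<bullet> grad \<phi> x \<partial>lborel) = (\<integral>x. f (u x) * \<phi> x \<partial>lborel)"
proof -
  define P where "P = 4 * R\<^sup>2"
  have P: "P > 0" using R(2) by (simp add: P_def)
  have KP: "K * P \<le> c / 8" using K(2) by (simp add: P_def)
  define G where "G \<xi> = (F \<xi>)\<^sup>2 / 2" for \<xi>
  have G1: "G \<xi> \<ge> G \<eta> + FA F \<eta> \<bullet> (\<xi> - \<eta>) + c / 2 * (norm (\<xi> - \<eta>))\<^sup>2" for \<xi> \<eta>
    unfolding G_def by (rule energy_bounds(1)[OF c(2) L(2)])
  have G2: "G \<xi> \<le> G \<eta> + FA F \<eta> \<bullet> (\<xi> - \<eta>) + L / 2 * (norm (\<xi> - \<eta>))\<^sup>2" for \<xi> \<eta>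
    unfolding G_def by (rule energy_bounds(2)[OF c(2) L(2)])
  have G0: "G 0 = 0" by (simp add: G_def)
  have [measurable]: "G \<in> borel_measurable borel" unfolding G_def by measurable
  have fc: "continuous_on UNIV f"
    by (rule lipschitz_on_continuous_on[of K]) (use f K in \<open>auto simp: lipschitz_on_def dist_real_def\<close>)
  then have [measurable]: "f \<in> borel_measurable borel" by (rule borel_measurable_continuous_onI)
  have "DERIV \<Phi> s :> f s" for s
    unfolding has_field_derivative_def has_derivative_within_alt
  proof (intro conjI allI impI)
    fix e :: real assume e: "e > 0"
    have "norm (\<Phi> y - \<Phi> s - f s * (y - s)) \<le> e * norm (y - s)" if "norm (y - s) < e / (K + 1)" for y
    proof -
      have "K * (y - s)\<^sup>2 \<le> (K * \<bar>y - s\<bar>) * \<bar>y - s\<bar>" by (simp add: power2_eq_square mult.assoc flip: abs_mult)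
      also have "\<dots> \<le> e * \<bar>y - s\<bar>"
      proof (rule mult_right_mono)
        have "(K + 1) * \<bar>y - s\<bar> \<le> e" using that K(1) by (simp add: field_simps)
        then show "K * \<bar>y - s\<bar> \<le> e" by (simp add: algebra_simps)
      qed simp
      finally show ?thesis using \<Phi>(2)[of y s] by simp
    qed
    then show "\<exists>d>0. \<forall>y\<in>UNIV. norm (y - s) < d \<longrightarrow> norm (\<Phi> y - \<Phi> s - f s * (y - s)) \<le> e * norm (y - s)"
      using e K(1) by (intro exI[of _ "e / (K + 1)"]) auto
  qed (rule bounded_linear_mult_right)
  then have "continuous_on UNIV \<Phi>" by (meson DERIV_continuous_on has_field_derivative_at_within)
  then have [measurable]: "\<Phi> \<in> borel_measurable borel" by (rule borel_measurable_continuous_onI)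
  have iG: "integrable lborel (\<lambda>x. G (grad \<psi> x))" if "C1c \<Omega> \<psi>" for \<psi>
  proof (rule integrable_dominated_real[where g="\<lambda>x. L / 2 * (norm (grad \<psi> x))\<^sup>2"])
    show "integrable lborel (\<lambda>x. L / 2 * (norm (grad \<psi> x))\<^sup>2)"
      using L2_integrable[OF C1c_L2(2)[OF that]] by simp
    show "norm (G (grad \<psi> x)) \<le> L / 2 * (norm (grad \<psi> x))\<^sup>2" for x
      using G2[of "grad \<psi> x" 0] G0 by (simp add: G_def)
  qed (use C1c_measurable[OF that] in measurable)
  have i\<Phi>: "integrable lborel (\<lambda>x. \<Phi> (\<psi> x))" if "C1c \<Omega> \<psi>" for \<psi>
  proof (rule integrable_dominated_real[where g="\<lambda>x. \<bar>f 0\<bar> * \<bar>\<psi> x\<bar> + K * (norm (\<psi> x))\<^sup>2"])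
    show "integrable lborel (\<lambda>x. \<bar>f 0\<bar> * \<bar>\<psi> x\<bar> + K * (norm (\<psi> x))\<^sup>2)"
      using L2_integrable[OF C1c_L2(1)[OF that]] C1c_L2(3)[OF that] by auto
    fix x
    have "\<bar>\<Phi> (\<psi> x) - f 0 * \<psi> x\<bar> \<le> K * (\<psi> x)\<^sup>2" using \<Phi>(2)[of "\<psi> x" 0] \<Phi>(1) by simp
    then have "\<bar>\<Phi> (\<psi> x)\<bar> \<le> \<bar>f 0 * \<psi> x\<bar> + K * (\<psi> x)\<^sup>2" by linarith
    then show "norm (\<Phi> (\<psi> x)) \<le> \<bar>f 0\<bar> * \<bar>\<psi> x\<bar> + K * (norm (\<psi> x))\<^sup>2" by (simp add: abs_mult)
  qed (use C1c_measurable[OF that] in measurable)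
  define J where "J \<psi> = (\<integral>x. G (grad \<psi> x) \<partial>lborel) - (\<integral>x. \<Phi> (\<psi> x) \<partial>lborel)" for \<psi>
  have Poin: "n2 \<psi> \<le> P * n2 (grad \<psi>)" if "C1c \<Omega> \<psi>" for \<psi>
    using Poincare[OF that R] by (simp add: P_def)
  \<comment> \<open>The weight of Young's inequality for the linear term
    \<open>f 0 * \<psi>\<close>, chosen so that after Poincare it costs \<open>c / 8\<close>.
    Together with \<open>K * P \<le> c / 8\<close> this remains below the coercivity
    \<open>c / 2\<close>.\<close>
  define \<kappa> where "\<kappa> = c / (8 * P)"
  have \<kappa>: "\<kappa> > 0" "\<kappa> * P = c / 8" using c(1) P by (auto simp: \<kappa>_def)
  define C0 where "C0 = (f 0)\<^sup>2 / (4 * \<kappa>) * measure lborel (cball (0::real^'n) R)"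
  have below: "J \<psi> \<ge> - C0" if t: "C1c \<Omega> \<psi>" for \<psi>
  proof -
    note s2 = L2_integrable[OF C1c_L2(1)[OF t]]
    have "(\<integral>x. \<Phi> (\<psi> x) \<partial>lborel) \<le> (\<integral>x. (f 0)\<^sup>2 / (4 * \<kappa>) * indicat_real (cball 0 R) x + (\<kappa> + K) * (norm (\<psi> x))\<^sup>2 \<partial>lborel)"
    proof (rule integral_mono[OF i\<Phi>[OF t]])
      show "integrable lborel (\<lambda>x. (f 0)\<^sup>2 / (4 * \<kappa>) * indicat_real (cball 0 R) x + (\<kappa> + K) * (norm (\<psi> x))\<^sup>2)"
        using s2 integrable_indicator_compact[OF compact_cball[of "0::real^'n" R]] by auto
      fix x
      show "\<Phi> (\<psi> x) \<le> (f 0)\<^sup>2 / (4 * \<kappa>) * indicat_real (cball 0 R) x + (\<kappa> + K) * (norm (\<psi> x))\<^sup>2"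
      proof (cases "x \<in> \<Omega>")
        case True
        then have "indicat_real (cball 0 R) x = 1" using R(1) by simp
        moreover have "f 0 * \<psi> x \<le> (f 0)\<^sup>2 / (4 * \<kappa>) + \<kappa> * (\<psi> x)\<^sup>2"
          using \<kappa>(1) zero_le_power2[of "2 * \<kappa> * \<psi> x - f 0"] by (simp add: field_simps power2_eq_square)
        moreover have "\<Phi> (\<psi> x) - f 0 * \<psi> x \<le> K * (\<psi> x)\<^sup>2" using \<Phi>(2)[of "\<psi> x" 0] \<Phi>(1) by simp
        ultimately show ?thesis by (simp add: algebra_simps)
      next
        case False
        then show ?thesis using \<Phi>(1) \<kappa>(1) by (simp add: C1c_zero_off[OF t])
      qed
    qed
    also have "\<dots> = C0 + (\<kappa> + K) * n2 \<psi>"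
      using s2 integrable_indicator_compact[OF compact_cball[of "0::real^'n" R]] by (simp add: C0_def n2_def)
    also have "\<dots> \<le> C0 + (\<kappa> + K) * (P * n2 (grad \<psi>))"
      using \<kappa>(1) K(1) Poin[OF t] by (intro add_left_mono mult_left_mono) auto
    also have "\<dots> = C0 + (\<kappa> * P + K * P) * n2 (grad \<psi>)" by (simp add: algebra_simps)
    also have "\<dots> \<le> C0 + (c / 2) * n2 (grad \<psi>)"
      using \<kappa>(2) KP c(1) by (intro add_left_mono mult_right_mono) auto
    finally have 1: "(\<integral>x. \<Phi> (\<psi> x) \<partial>lborel) \<le> C0 + (c / 2) * n2 (grad \<psi>)" .
    have "(\<integral>x. c / 2 * (norm (grad \<psi> x))\<^sup>2 \<partial>lborel) \<le> (\<integral>x. G (grad \<psi> x) \<partial>lborel)"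
      by (rule integral_mono[OF _ iG[OF t]])
        (use L2_integrable[OF C1c_L2(2)[OF t]] G1[of 0] G0 in auto)
    then have "c / 2 * n2 (grad \<psi>) \<le> (\<integral>x. G (grad \<psi> x) \<partial>lborel)" by (simp add: n2_def)
    with 1 show ?thesis by (simp add: J_def)
  qed
  define S where "S = {\<psi>. C1c \<Omega> \<psi>}"
  define m where "m = Inf (J ` S)"
  have "C1c \<Omega> (\<lambda>x. 0)" using C1cI[of "\<lambda>x::real^'n. 0::real" "\<lambda>x. 0" "{}" \<Omega>] by auto
  then have ne: "J ` S \<noteq> {}" by (auto simp: S_def)
  have bdd: "bdd_below (J ` S)" using below by (auto simp: S_def bdd_below_def)
  have m_le: "m \<le> J \<psi>" if "C1c \<Omega> \<psi>" for \<psi>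
    unfolding m_def by (rule cInf_lower[OF _ bdd]) (use that in \<open>auto simp: S_def\<close>)
  have "\<exists>\<psi>. C1c \<Omega> \<psi> \<and> J \<psi> < m + inverse (real (Suc k))" for k
  proof -
    have "Inf (J ` S) < m + inverse (real (Suc k))" unfolding m_def by simp
    from cInf_lessD[OF ne this] show ?thesis by (auto simp: S_def)
  qed
  then obtain \<psi> where \<psi>: "\<And>k. C1c \<Omega> (\<psi> k)" "\<And>k. J (\<psi> k) < m + inverse (real (Suc k))" by metis
  note L\<psi> = C1c_L2[OF \<psi>(1)]
  \<comment> \<open>The midpoint \<open>w\<close> competes with the infimum. Strong convexity gains
    \<open>c / 8\<close> there, the primitive loses at most \<open>K / 4\<close> in
    \<open>n2 d\<close>, that is \<open>c / 32\<close> after Poincare; the net gain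
    \<open>3 * c / 32\<close> exceeds \<open>c / 16\<close>.\<close>
  have mid: "c / 16 * n2 (\<lambda>x. grad (\<psi> k) x - grad (\<psi> l) x) \<le> (inverse (real (Suc k)) + inverse (real (Suc l))) / 2" for k l
  proof -
    define d where "d = (\<lambda>x. \<psi> k x - \<psi> l x)"
    have d: "C1c \<Omega> d" "grad d = (\<lambda>x. grad (\<psi> k) x - grad (\<psi> l) x)"
      unfolding d_def using C1c_diff[OF \<psi>(1) \<psi>(1)] by auto
    define w where "w = (\<lambda>x. (1/2) * (\<psi> k x + \<psi> l x))"
    have w: "C1c \<Omega> w" "grad w = (\<lambda>x. (1/2) *\<^sub>R (grad (\<psi> k) x + grad (\<psi> l) x))"
      unfolding w_def
      by (rule C1c_cmult(1)[OF C1c_add(1)[OF \<psi>(1) \<psi>(1)]])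
        (simp only: C1c_cmult(2)[OF C1c_add(1)[OF \<psi>(1) \<psi>(1)]] C1c_add(2)[OF \<psi>(1) \<psi>(1)])
    have pG: "G (grad w x) \<le> G (grad (\<psi> k) x) / 2 + G (grad (\<psi> l) x) / 2 - c / 8 * (norm (grad d x))\<^sup>2" for x
    proof -
      define a b where "a = grad (\<psi> k) x" and "b = grad (\<psi> l) x"
      have e: "a - (1/2) *\<^sub>R (a + b) = (1/2) *\<^sub>R (a - b)" "b - (1/2) *\<^sub>R (a + b) = - ((1/2) *\<^sub>R (a - b))"
        by (simp_all add: algebra_simps flip: scaleR_2)
      have n: "(norm ((1/2) *\<^sub>R (a - b)))\<^sup>2 = (norm (a - b))\<^sup>2 / 4" by (simp add: power_divide)
      have "G a \<ge> G ((1/2) *\<^sub>R (a + b)) + FA F ((1/2) *\<^sub>R (a + b)) \<bullet> ((1/2) *\<^sub>R (a - b)) + c / 2 * ((norm (a - b))\<^sup>2 / 4)"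
        using G1[of "(1/2) *\<^sub>R (a + b)" a] unfolding e n .
      moreover have "G b \<ge> G ((1/2) *\<^sub>R (a + b)) - FA F ((1/2) *\<^sub>R (a + b)) \<bullet> ((1/2) *\<^sub>R (a - b)) + c / 2 * ((norm (a - b))\<^sup>2 / 4)"
        using G1[of "(1/2) *\<^sub>R (a + b)" b] unfolding e inner_minus_right norm_minus_cancel n by simp
      ultimately have "G ((1/2) *\<^sub>R (a + b)) \<le> G a / 2 + G b / 2 - c / 8 * (norm (a - b))\<^sup>2" by argo
      then show ?thesis by (simp only: w d a_def b_def)
    qed
    have p\<Phi>: "\<Phi> (w x) \<ge> \<Phi> (\<psi> k x) / 2 + \<Phi> (\<psi> l x) / 2 - K / 4 * (norm (d x))\<^sup>2" for x
    proof -
      define a b where "a = \<psi> k x" and "b = \<psi> l x"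
      have "\<Phi> a \<le> \<Phi> ((a + b) / 2) + f ((a + b) / 2) * (a - (a + b) / 2) + K * (a - (a + b) / 2)\<^sup>2"
        using \<Phi>(2)[of a "(a + b) / 2"] by argo
      moreover have "\<Phi> b \<le> \<Phi> ((a + b) / 2) + f ((a + b) / 2) * (b - (a + b) / 2) + K * (b - (a + b) / 2)\<^sup>2"
        using \<Phi>(2)[of b "(a + b) / 2"] by argo
      moreover have "f ((a + b) / 2) * (a - (a + b) / 2) + f ((a + b) / 2) * (b - (a + b) / 2) = 0"
        by (simp add: field_simps)
      moreover have "K * (a - (a + b) / 2)\<^sup>2 + K * (b - (a + b) / 2)\<^sup>2 = K / 2 * (a - b)\<^sup>2"
        by (simp add: power2_eq_square field_simps)
      ultimately have "\<Phi> ((a + b) / 2) \<ge> \<Phi> a / 2 + \<Phi> b / 2 - K / 4 * (a - b)\<^sup>2" by argo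
      then show ?thesis by (simp add: w_def d_def a_def b_def)
    qed
    have "(\<integral>x. G (grad w x) \<partial>lborel) \<le> (\<integral>x. G (grad (\<psi> k) x) / 2 + G (grad (\<psi> l) x) / 2 - c / 8 * (norm (grad d x))\<^sup>2 \<partial>lborel)"
      by (rule integral_mono[OF iG[OF w(1)] _ pG])
        (use iG[OF \<psi>(1)] L2_integrable[OF C1c_L2(2)[OF d(1)]] in auto)
    then have 1: "(\<integral>x. G (grad w x) \<partial>lborel) \<le> (\<integral>x. G (grad (\<psi> k) x) \<partial>lborel) / 2 + (\<integral>x. G (grad (\<psi> l) x) \<partial>lborel) / 2 - c / 8 * n2 (grad d)"
      using iG[OF \<psi>(1)] L2_integrable[OF C1c_L2(2)[OF d(1)]] by (simp add: n2_def)
    have "(\<integral>x. \<Phi> (\<psi> k x) / 2 + \<Phi> (\<psi> l x) / 2 - K / 4 * (norm (d x))\<^sup>2 \<partial>lborel) \<le> (\<integral>x. \<Phi> (w x) \<partial>lborel)"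
      by (rule integral_mono[OF _ i\<Phi>[OF w(1)] p\<Phi>])
        (use i\<Phi>[OF \<psi>(1)] L2_integrable[OF C1c_L2(1)[OF d(1)]] in auto)
    then have 2: "(\<integral>x. \<Phi> (\<psi> k x) \<partial>lborel) / 2 + (\<integral>x. \<Phi> (\<psi> l x) \<partial>lborel) / 2 - K / 4 * n2 d \<le> (\<integral>x. \<Phi> (w x) \<partial>lborel)"
      using i\<Phi>[OF \<psi>(1)] L2_integrable[OF C1c_L2(1)[OF d(1)]] by (simp add: n2_def)
    have "K * n2 d \<le> K * (P * n2 (grad d))" by (intro mult_left_mono Poin d K)
    also have "\<dots> \<le> (c / 8) * n2 (grad d)" using mult_right_mono[OF KP, of "n2 (grad d)"] by (simp add: mult.assoc)
    finally have 3: "K * n2 d \<le> (c / 8) * n2 (grad d)" .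
    have "m \<le> J w" by (rule m_le[OF w(1)])
    also have "\<dots> \<le> J (\<psi> k) / 2 + J (\<psi> l) / 2 - c / 8 * n2 (grad d) + K / 4 * n2 d"
      using 1 2 by (simp add: J_def field_simps)
    finally have "m \<le> J (\<psi> k) / 2 + J (\<psi> l) / 2 - c / 8 * n2 (grad d) + (c / 32) * n2 (grad d)" using 3 by simp
    moreover have "c * n2 (grad d) \<ge> 0" using c(1) by simp
    ultimately have "c / 16 * n2 (grad d) \<le> (J (\<psi> k) + J (\<psi> l)) / 2 - m" by (simp add: field_simps)
    also have "\<dots> \<le> (inverse (real (Suc k)) + inverse (real (Suc l))) / 2" using \<psi>(2)[of k] \<psi>(2)[of l] by argo
    finally show ?thesis by (simp add: d(2))
  qed
  have Cauchy: "\<exists>N. \<forall>k\<ge>N. \<forall>l\<ge>N. n2 (\<lambda>x. grad (\<psi> k) x - grad (\<psi> l) x) \<le> e" if e: "e > 0" for e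
  proof -
    obtain N where N: "inverse (real (Suc N)) < c / 16 * e"
      using reals_Archimedean[of "c / 16 * e"] e c(1) by auto
    have "n2 (\<lambda>x. grad (\<psi> k) x - grad (\<psi> l) x) \<le> e" if "k \<ge> N" "l \<ge> N" for k l
    proof -
      have "inverse (real (Suc k)) \<le> inverse (real (Suc N))" "inverse (real (Suc l)) \<le> inverse (real (Suc N))"
        using that by (auto intro!: le_imp_inverse_le)
      then have "(inverse (real (Suc k)) + inverse (real (Suc l))) / 2 \<le> c / 16 * e" using N by argo
      then have "c / 16 * n2 (\<lambda>x. grad (\<psi> k) x - grad (\<psi> l) x) \<le> c / 16 * e" by (rule order_trans[OF mid])
      then show ?thesis using c(1) by simp
    qed
    then show ?thesis by blast
  qed
  obtain g0 where g0: "L2 g0" "L2lim (\<lambda>k. grad (\<psi> k)) g0"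
    using L2_complete[of "\<lambda>k. grad (\<psi> k)"] L\<psi>(2) Cauchy by blast
  have "\<exists>N. \<forall>k\<ge>N. \<forall>l\<ge>N. n2 (\<lambda>x. \<psi> k x - \<psi> l x) \<le> e" if e: "e > 0" for e
  proof -
    obtain N where N: "\<And>k l. k \<ge> N \<Longrightarrow> l \<ge> N \<Longrightarrow> n2 (\<lambda>x. grad (\<psi> k) x - grad (\<psi> l) x) \<le> e / P"
      using Cauchy[of "e / P"] e P by auto
    have "n2 (\<lambda>x. \<psi> k x - \<psi> l x) \<le> e" if "k \<ge> N" "l \<ge> N" for k l
    proof -
      have "n2 (\<lambda>x. \<psi> k x - \<psi> l x) \<le> P * n2 (\<lambda>x. grad (\<psi> k) x - grad (\<psi> l) x)"
        using Poin[OF C1c_diff(1)[OF \<psi>(1) \<psi>(1)]] C1c_diff(2)[OF \<psi>(1) \<psi>(1)] by metis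
      also have "\<dots> \<le> P * (e / P)" using P N[OF that] by (intro mult_left_mono) auto
      finally show ?thesis using P by simp
    qed
    then show ?thesis by blast
  qed
  then obtain u0 where u0: "L2 u0" "L2lim \<psi> u0" using L2_complete[of \<psi>] L\<psi>(1) by blast
  \<comment> \<open>\<open>H0\<close> asks for zero values everywhere off the domain, while L2
    limits are determined only almost everywhere. Since the \<open>\<psi> k\<close> vanish there,
    the cut does not increase distances.\<close>
  define u where "u x = indicat_real \<Omega> x * u0 x" for x
  define g where "g x = indicat_real \<Omega> x *\<^sub>R g0 x" for x
  have [measurable]: "\<Omega> \<in> sets borel" using \<Omega> by auto
  have Lu: "L2 u" "L2 g"
    using L2_bounded_scaleR[OF u0(1), of "indicat_real \<Omega>" 1] L2_bounded_scaleR[OF g0(1), of "indicat_real \<Omega>" 1]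
    by (auto simp: u_def[abs_def] g_def[abs_def])
  have lu: "L2lim \<psi> u"
  proof (rule L2limI_bound[OF _ u0(2)[unfolded L2lim_def]])
    show "n2 (\<lambda>x. \<psi> k x - u x) \<le> n2 (\<lambda>x. \<psi> k x - u0 x)" for k
      using n2_dominated[OF L2_diff[OF L\<psi>(1)[of k] u0(1)], of "\<lambda>x. \<psi> k x - u x" 1] C1c_zero_off[OF \<psi>(1)[of k]]
      by (auto simp: u_def indicator_def)
  qed
  have lg: "L2lim (\<lambda>k. grad (\<psi> k)) g"
  proof (rule L2limI_bound[OF _ g0(2)[unfolded L2lim_def]])
    show "n2 (\<lambda>x. grad (\<psi> k) x - g x) \<le> n2 (\<lambda>x. grad (\<psi> k) x - g0 x)" for k
      using n2_dominated[OF L2_diff[OF L\<psi>(2)[of k] g0(1)], of "\<lambda>x. grad (\<psi> k) x - g x" 1] C1c_zero_off[OF \<psi>(1)[of k]]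
      by (auto simp: g_def indicator_def)
  qed
  have H: "H0 \<Omega> u g" unfolding H0_def using Lu lu lg \<psi>(1) by (auto simp: u_def g_def)
  have LA: "L2 (\<lambda>x. FA F (h x))" if "L2 h" for h :: "real^'n \<Rightarrow> real^'n"
    by (rule L2_dominated[OF that, where C=L]) (use L2_measurable[OF that] L(2)[of _ 0] in auto)
  have Lf: "L2 (\<lambda>x. f (h x) - f 0)" if "L2 h" for h :: "real^'n \<Rightarrow> real"
    by (rule L2_dominated[OF that, where C=K]) (use L2_measurable[OF that] f[of _ 0] in auto)
  have EL: "(\<integral>x. FA F (g x) \<bullet> grad \<phi> x \<partial>lborel) = (\<integral>x. f (u x) * \<phi> x \<partial>lborel)" if \<phi>: "C1c \<Omega> \<phi>" for \<phi>
  proof -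
    note L\<phi> = C1c_L2[OF \<phi>]
    \<comment> \<open>\<open>f (h x)\<close> tends to be the constant \<open>f 0\<close> off the
      domain and need not be in L2; subtracting \<open>f 0\<close> gives a function dominated by
      \<open>h\<close>.\<close>
    have split: "integrable lborel (\<lambda>x. f (h x) * \<phi> x)"
      "(\<integral>x. f (h x) * \<phi> x \<partial>lborel) = (\<integral>x. (f (h x) - f 0) * \<phi> x \<partial>lborel) + f 0 * (\<integral>x. \<phi> x \<partial>lborel)" if "L2 h" for h
    proof -
      have "integrable lborel (\<lambda>x. (f (h x) - f 0) * \<phi> x + f 0 * \<phi> x)"
        using L2_mult_integrable[OF Lf[OF that] L\<phi>(1)] L\<phi>(3) by auto
      then show "integrable lborel (\<lambda>x. f (h x) * \<phi> x)" by (simp add: algebra_simps)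
      have "(\<integral>x. (f (h x) - f 0) * \<phi> x + f 0 * \<phi> x \<partial>lborel) = (\<integral>x. (f (h x) - f 0) * \<phi> x \<partial>lborel) + f 0 * (\<integral>x. \<phi> x \<partial>lborel)"
        using L2_mult_integrable[OF Lf[OF that] L\<phi>(1)] L\<phi>(3) by simp
      then show "(\<integral>x. f (h x) * \<phi> x \<partial>lborel) = (\<integral>x. (f (h x) - f 0) * \<phi> x \<partial>lborel) + f 0 * (\<integral>x. \<phi> x \<partial>lborel)"
        by (simp add: algebra_simps)
    qed
    define E where "E h q = (\<integral>x. FA F (q x) \<bullet> grad \<phi> x \<partial>lborel) - (\<integral>x. f (h x) * \<phi> x \<partial>lborel)" for h q
    have Elim: "(\<lambda>k. E (\<psi> k) (grad (\<psi> k))) \<longlonglongrightarrow> E u g"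
    proof -
      have "(\<lambda>k. \<integral>x. FA F (grad (\<psi> k) x) \<bullet> grad \<phi> x \<partial>lborel) \<longlonglongrightarrow> (\<integral>x. FA F (g x) \<bullet> grad \<phi> x \<partial>lborel)"
        by (rule L2lim_inner[OF L2lim_Lipschitz[OF lg _ _ L(2)]]) (use L\<psi> Lu LA L\<phi> in auto)
      moreover have "(\<lambda>k. \<integral>x. (f (\<psi> k x) - f 0) * \<phi> x \<partial>lborel) \<longlonglongrightarrow> (\<integral>x. (f (u x) - f 0) * \<phi> x \<partial>lborel)"
        by (rule L2lim_mult[OF L2lim_Lipschitz[OF lu, where h="\<lambda>s. f s - f 0" and C=K]]) (use L\<psi> Lu Lf L\<phi> f in auto)
      ultimately show ?thesis unfolding E_def split(2)[OF L\<psi>(1)] split(2)[OF Lu(1)]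
        by (intro tendsto_intros)
    qed
    define C1 where "C1 = L / 2 * n2 (grad \<phi>) + K * n2 \<phi>"
    have C1: "C1 \<ge> 0" using L(1) K(1) by (simp add: C1_def)
    \<comment> \<open>The first variation is taken at the almost minimal \<open>\<psi> k\<close>
      with an explicit quadratic remainder. Only afterwards does k tend to infinity, which yields
      the equation for the limit.\<close>
    have var: "0 \<le> inverse (real (Suc k)) + t * E (\<psi> k) (grad (\<psi> k)) + t\<^sup>2 * C1" for t k
    proof -
      define w where "w = (\<lambda>x. \<psi> k x + t * \<phi> x)"
      have w: "C1c \<Omega> w" "grad w = (\<lambda>x. grad (\<psi> k) x + t *\<^sub>R grad \<phi> x)"
        unfolding w_def using C1c_add[OF \<psi>(1) C1c_cmult(1)[OF \<phi>]] C1c_cmult(2)[OF \<phi>] by auto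
      have iA: "integrable lborel (\<lambda>x. FA F (grad (\<psi> k) x) \<bullet> grad \<phi> x)"
        by (rule L2_inner_integrable[OF LA[OF L\<psi>(2)] L\<phi>(2)])
      note if' = split(1)[OF L\<psi>(1), of k]
      have "(\<integral>x. G (grad w x) \<partial>lborel) \<le> (\<integral>x. G (grad (\<psi> k) x) + t * (FA F (grad (\<psi> k) x) \<bullet> grad \<phi> x) + t\<^sup>2 * (L / 2 * (norm (grad \<phi> x))\<^sup>2) \<partial>lborel)"
      proof (rule integral_mono[OF iG[OF w(1)]])
        show "G (grad w x) \<le> G (grad (\<psi> k) x) + t * (FA F (grad (\<psi> k) x) \<bullet> grad \<phi> x) + t\<^sup>2 * (L / 2 * (norm (grad \<phi> x))\<^sup>2)" for x
          using G2[of "grad w x" "grad (\<psi> k) x"] by (simp add: w(2) power_mult_distrib algebra_simps)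
      qed (use iG[OF \<psi>(1)] iA L2_integrable[OF L\<phi>(2)] in auto)
      then have 1: "(\<integral>x. G (grad w x) \<partial>lborel) \<le> (\<integral>x. G (grad (\<psi> k) x) \<partial>lborel) + t * (\<integral>x. FA F (grad (\<psi> k) x) \<bullet> grad \<phi> x \<partial>lborel) + t\<^sup>2 * (L / 2 * n2 (grad \<phi>))"
        using iG[OF \<psi>(1)] iA L2_integrable[OF L\<phi>(2)] by (simp add: n2_def)
      have "(\<integral>x. \<Phi> (\<psi> k x) + t * (f (\<psi> k x) * \<phi> x) - t\<^sup>2 * (K * (norm (\<phi> x))\<^sup>2) \<partial>lborel) \<le> (\<integral>x. \<Phi> (w x) \<partial>lborel)"
      proof (rule integral_mono[OF _ i\<Phi>[OF w(1)]])
        show "\<Phi> (\<psi> k x) + t * (f (\<psi> k x) * \<phi> x) - t\<^sup>2 * (K * (norm (\<phi> x))\<^sup>2) \<le> \<Phi> (w x)" for x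
          using \<Phi>(2)[of "w x" "\<psi> k x"] by (simp add: w_def power_mult_distrib algebra_simps abs_le_iff)
      qed (use i\<Phi>[OF \<psi>(1)] if' L2_integrable[OF L\<phi>(1)] in auto)
      then have 2: "(\<integral>x. \<Phi> (\<psi> k x) \<partial>lborel) + t * (\<integral>x. f (\<psi> k x) * \<phi> x \<partial>lborel) - t\<^sup>2 * (K * n2 \<phi>) \<le> (\<integral>x. \<Phi> (w x) \<partial>lborel)"
        using i\<Phi>[OF \<psi>(1)] if' L2_integrable[OF L\<phi>(1)] by (simp add: n2_def)
      have "m \<le> J w" by (rule m_le[OF w(1)])
      also have "\<dots> \<le> J (\<psi> k) + t * E (\<psi> k) (grad (\<psi> k)) + t\<^sup>2 * C1"
        using 1 2 unfolding J_def E_def C1_def by (simp add: algebra_simps)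
      finally show ?thesis using \<psi>(2)[of k] by linarith
    qed
    have q: "0 \<le> t * E u g + t\<^sup>2 * C1" for t
    proof -
      have "(\<lambda>k. inverse (real (Suc k)) + t * E (\<psi> k) (grad (\<psi> k)) + t\<^sup>2 * C1) \<longlonglongrightarrow> 0 + t * E u g + t\<^sup>2 * C1"
        by (intro tendsto_intros Elim LIMSEQ_inverse_real_of_nat)
      from LIMSEQ_le_const[OF this] show ?thesis using var by auto
    qed
    have "E u g = 0"
    proof (rule ccontr)
      assume nz: "E u g \<noteq> 0"
      define n where "n = C1 + 1"
      have n: "n > 0" "C1 = n - 1" using C1 by (auto simp: n_def)
      \<comment> \<open>With \<open>n = C1 + 1\<close> this t makes the quadratic equal to
        \<open>- (E u g)\<^sup>2 / n\<^sup>2\<close>; the added 1 makes the value strictly negative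
        and the denominator nonzero.\<close>
      define t where "t = - E u g / n"
      have "t * E u g + t\<^sup>2 * C1 = - (E u g)\<^sup>2 / n\<^sup>2"
        using n(1) unfolding n(2) by (simp add: t_def power2_eq_square field_simps)
      moreover have "(E u g)\<^sup>2 / n\<^sup>2 > 0" using nz n(1) by (intro divide_pos_pos) auto
      ultimately show False using q[of t] by simp
    qed
    then show ?thesis by (simp add: E_def)
  qed
  show thesis by (rule that[OF H EL])
qed

end

section \<open>Weak comparison\<close>

lemma DERIV_pos_part_power:
  "((\<lambda>s::real. (max 0 s) ^ (n + 2)) has_real_derivative real (n + 2) * (max 0 s) ^ (n + 1)) (at s)"
proof (cases s "0::real" rule: linorder_cases)
  case greater
  have "((\<lambda>s::real. s ^ (n + 2)) has_real_derivative real (n + 2) * s ^ (n + 1)) (at s)"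
    using DERIV_pow[of "n + 2" s UNIV] by simp
  then have "((\<lambda>s::real. (max 0 s) ^ (n + 2)) has_real_derivative real (n + 2) * s ^ (n + 1)) (at s)"
    by (rule has_field_derivative_transform_within_open[where S="{0<..}"]) (use greater in auto)
  then show ?thesis using greater by simp
next
  case less
  have "((\<lambda>s::real. 0) has_real_derivative 0) (at s)" by simp
  then have "((\<lambda>s::real. (max 0 s) ^ (n + 2)) has_real_derivative 0) (at s)"
    by (rule has_field_derivative_transform_within_open[where S="{..<0}"]) (use less in auto)
  then show ?thesis using less by simp
next
  case equal
  have lim: "((\<lambda>h::real. \<bar>h\<bar> ^ (n + 1)) \<longlongrightarrow> 0) (at 0)" by (auto intro!: tendsto_eq_intros)
  have "(\<lambda>h::real. ((max 0 (0 + h)) ^ (n + 2) - (max 0 0) ^ (n + 2)) / h) \<midarrow>0\<rightarrow> 0"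
  proof (rule Lim_null_comparison[OF always_eventually lim], rule allI)
    fix h :: real
    show "norm (((max 0 (0 + h)) ^ (n + 2) - (max 0 0) ^ (n + 2)) / h) \<le> \<bar>h\<bar> ^ (n + 1)"
    proof (cases "h > 0")
      case False
      then have e: "max 0 (0 + h) = 0" by simp
      show ?thesis unfolding e by simp
    qed (simp add: abs_mult)
  qed
  then show ?thesis using equal by (simp add: DERIV_def)
qed

lemma DERIV_pos_part_shift:
  "((\<lambda>s::real. (max 0 (s - 1)) ^ (n + 2)) has_real_derivative real (n + 2) * (max 0 (s - 1)) ^ (n + 1)) (at s)"
  using DERIV_shift[of "\<lambda>s. (max 0 s) ^ (n + 2)" "real (n + 2) * (max 0 (s - 1)) ^ (n + 1)" s "-1"]
    DERIV_pos_part_power[of n "s - 1"] by simp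

text \<open>Testing with \<open>ramp_sq_int (p - q)\<close> instead of the positive part of \<open>p - q\<close> stays within \<open>C\<^sup>1\<close>, and since
  \<open>(ramp_sq_int)' = ((ramp_int)')\<^sup>2\<close> the energy obtained is that of \<open>ramp_int (p - q)\<close>, to which the Poincare
  inequality applies.\<close>

definition ramp :: "real \<Rightarrow> real" where "ramp s = max 0 s - max 0 (s - 1)"
definition ramp_int :: "real \<Rightarrow> real" where "ramp_int s = ((max 0 s)\<^sup>2 - (max 0 (s - 1))\<^sup>2) / 2"
definition ramp_sq_int :: "real \<Rightarrow> real" where
  "ramp_sq_int s = ((max 0 s) ^ 3 - (max 0 (s - 1)) ^ 3) / 3 - (max 0 (s - 1))\<^sup>2"

lemma DERIV_ramp_int: "(ramp_int has_real_derivative ramp s) (at s)"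
proof -
  have 1: "((\<lambda>s. (max 0 (s - 1))\<^sup>2) has_real_derivative 2 * max 0 (s - 1)) (at s)"
    using DERIV_pos_part_shift[of 0 s] by (simp add: numeral_2_eq_2)
  have 2: "((\<lambda>s. (max 0 s)\<^sup>2) has_real_derivative 2 * max 0 s) (at s)"
    using DERIV_pos_part_power[of 0 s] by (simp add: numeral_2_eq_2)
  have "(ramp_int has_real_derivative (2 * max 0 s - 2 * max 0 (s - 1)) / 2) (at s)"
    unfolding ramp_int_def[abs_def] by (intro DERIV_diff DERIV_cdivide 1 2)
  then show ?thesis by (simp add: ramp_def diff_divide_distrib)
qed

lemma DERIV_ramp_sq_int: "(ramp_sq_int has_real_derivative (ramp s)\<^sup>2) (at s)"
proof -
  have 1: "((\<lambda>s. (max 0 (s - 1))\<^sup>2) has_real_derivative 2 * max 0 (s - 1)) (at s)"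
    using DERIV_pos_part_shift[of 0 s] by (simp add: numeral_2_eq_2)
  have 2: "((\<lambda>s. (max 0 (s - 1)) ^ 3) has_real_derivative 3 * (max 0 (s - 1))\<^sup>2) (at s)"
    using DERIV_pos_part_shift[of 1 s] by (simp add: numeral_3_eq_3 numeral_2_eq_2)
  have 3: "((\<lambda>s. (max 0 s) ^ 3) has_real_derivative 3 * (max 0 s)\<^sup>2) (at s)"
    using DERIV_pos_part_power[of 1 s] by (simp add: numeral_3_eq_3 numeral_2_eq_2)
  have "(ramp_sq_int has_real_derivative (3 * (max 0 s)\<^sup>2 - 3 * (max 0 (s - 1))\<^sup>2) / 3 - 2 * max 0 (s - 1)) (at s)"
    unfolding ramp_sq_int_def[abs_def] by (intro DERIV_diff DERIV_cdivide 1 2 3)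
  moreover have "(3 * (max 0 s)\<^sup>2 - 3 * (max 0 (s - 1))\<^sup>2) / 3 - 2 * max 0 (s - 1) = (ramp s)\<^sup>2"
    by (auto simp: ramp_def max_def power2_eq_square field_simps)
  ultimately show ?thesis by simp
qed

lemma ramp_range: "0 \<le> ramp s" "ramp s \<le> 1" "s \<le> 0 \<Longrightarrow> ramp s = 0"
  by (auto simp: ramp_def max_def)

lemma ramp_continuous: "continuous_on UNIV ramp"
  unfolding ramp_def[abs_def] by (intro continuous_intros)

lemma ramp_int_nonpos: "s \<le> 0 \<Longrightarrow> ramp_int s = 0" "s \<le> 0 \<Longrightarrow> ramp_sq_int s = 0"
  by (auto simp: ramp_int_def ramp_sq_int_def)

lemma Lipschitz_1_DERIV:
  fixes T :: "real \<Rightarrow> real"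
  assumes "\<And>s. (T has_real_derivative \<tau> s) (at s)" "\<And>s. \<bar>\<tau> s\<bar> \<le> 1"
  shows "norm (T a - T b) \<le> 1 * norm (a - b)"
  by (rule field_differentiable_bound[where S=UNIV and f'=\<tau>]) (use assms in auto)

text \<open>The first inequality turns the zero-order term, linear in \<open>p - q\<close> times the
  test function, into the square that Poincare controls. The factor 4/3 is attained for
  \<open>0 < s \<le> 1\<close>; beyond 1 the difference of the two sides is
  \<open>(s - 1)\<^sup>2 / 3\<close>.\<close>

lemma ramp_int_compare: "s > 0 \<Longrightarrow> s * ramp_sq_int s \<le> 4 / 3 * (ramp_int s)\<^sup>2" "ramp_sq_int s \<ge> 0" "s > 0 \<Longrightarrow> ramp_int s > 0"
proof -
  have eq: "ramp_int s = s - 1/2" "ramp_sq_int s = s - 2/3" if "s > 1"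
    using that by (auto simp: ramp_int_def ramp_sq_int_def power2_eq_square power3_eq_cube field_simps)
  have eq': "ramp_int s = s\<^sup>2 / 2" "ramp_sq_int s = s ^ 3 / 3" if "s \<le> 1" "s > 0"
    using that by (auto simp: ramp_int_def ramp_sq_int_def)
  show "s * ramp_sq_int s \<le> 4 / 3 * (ramp_int s)\<^sup>2" if s: "s > 0"
  proof (cases "s > 1")
    case True
    then show ?thesis unfolding eq[OF True] using zero_le_power2[of "s - 1"]
      by (simp add: power2_eq_square algebra_simps)
  next
    case False
    then have "s \<le> 1" by simp
    then show ?thesis unfolding eq'[OF \<open>s \<le> 1\<close> s] by (simp add: power2_eq_square power3_eq_cube)
  qed
  show "ramp_int s > 0" if s: "s > 0"
  proof (cases "s > 1")
    case False
    then have "s \<le> 1" by simp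
    show ?thesis unfolding eq'(1)[OF \<open>s \<le> 1\<close> s] using s by simp
  qed (simp add: eq)
  show "ramp_sq_int s \<ge> 0"
  proof (cases "s > 0")
    case True
    show ?thesis
    proof (cases "s > 1")
      case False
      then have "s \<le> 1" by simp
      show ?thesis unfolding eq'(2)[OF \<open>s \<le> 1\<close> True] using True by simp
    qed (simp add: eq)
  qed (simp add: ramp_int_nonpos)
qed

text \<open>The factors \<open>\<sigma> k\<close> converge only pointwise, but they are bounded: the
  strong convergence of \<open>r k\<close> handles one error term and domination by the fixed
  \<open>\<zeta>\<close> the other.\<close>

lemma L2lim_bounded_mult:
  fixes r :: "nat \<Rightarrow> 'a::euclidean_space \<Rightarrow> 'b::euclidean_space"
  assumes r: "L2lim r \<zeta>" "\<And>k. L2 (r k)" "L2 \<zeta>"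
    and \<sigma>: "AE x in lborel. (\<lambda>k. \<sigma> k x) \<longlonglongrightarrow> \<sigma>' x" "\<And>k x. \<bar>\<sigma> k x\<bar> \<le> 1" "\<And>x. \<bar>\<sigma>' x\<bar> \<le> (1::real)"
    and [measurable]: "\<And>k. \<sigma> k \<in> borel_measurable borel" "\<sigma>' \<in> borel_measurable borel"
  shows "L2lim (\<lambda>k x. \<sigma> k x *\<^sub>R r k x) (\<lambda>x. \<sigma>' x *\<^sub>R \<zeta> x)"
proof -
  have [measurable]: "\<zeta> \<in> borel_measurable borel" using r(3) by (rule L2_measurable)
  have L1: "L2 (\<lambda>x. \<sigma> k x *\<^sub>R (r k x - \<zeta> x))" for k
    by (rule L2_bounded_scaleR[OF L2_diff[OF r(2,3)], where C=1]) (use \<sigma> in auto)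
  have L2: "L2 (\<lambda>x. \<sigma> k x *\<^sub>R \<zeta> x)" "L2 (\<lambda>x. \<sigma>' x *\<^sub>R \<zeta> x)" for k
    by (rule L2_bounded_scaleR[OF r(3), where C=1]; use \<sigma> in auto)+
  have lim2: "L2lim (\<lambda>k x. \<sigma> k x *\<^sub>R \<zeta> x) (\<lambda>x. \<sigma>' x *\<^sub>R \<zeta> x)"
  proof (rule L2lim_dominated[where w="\<lambda>x. 2 * norm (\<zeta> x)"])
    show "AE x in lborel. (\<lambda>k. \<sigma> k x *\<^sub>R \<zeta> x) \<longlonglongrightarrow> \<sigma>' x *\<^sub>R \<zeta> x"
      using \<sigma>(1) by eventually_elim (intro tendsto_intros)
    show "L2 (\<lambda>x. 2 * norm (\<zeta> x))" by (intro L2_cmult L2_norm r)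
    fix k x
    have "\<bar>\<sigma> k x - \<sigma>' x\<bar> * norm (\<zeta> x) \<le> 2 * norm (\<zeta> x)"
      using \<sigma>(2)[of k x] \<sigma>(3)[of x] by (intro mult_right_mono) auto
    then show "norm (\<sigma> k x *\<^sub>R \<zeta> x - \<sigma>' x *\<^sub>R \<zeta> x) \<le> 2 * norm (\<zeta> x)" by (simp flip: scaleR_diff_left)
  qed auto
  show ?thesis
  proof (rule L2limI_bound)
    fix k
    have "n2 (\<lambda>x. \<sigma> k x *\<^sub>R r k x - \<sigma>' x *\<^sub>R \<zeta> x)
      = n2 (\<lambda>x. \<sigma> k x *\<^sub>R (r k x - \<zeta> x) + (\<sigma> k x *\<^sub>R \<zeta> x - \<sigma>' x *\<^sub>R \<zeta> x))"
      by (simp add: scaleR_diff_right)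
    also have "\<dots> \<le> 2 * n2 (\<lambda>x. \<sigma> k x *\<^sub>R (r k x - \<zeta> x)) + 2 * n2 (\<lambda>x. \<sigma> k x *\<^sub>R \<zeta> x - \<sigma>' x *\<^sub>R \<zeta> x)"
      by (rule n2_add_le[OF L1 L2_diff[OF L2(1,2)]])
    also have "n2 (\<lambda>x. \<sigma> k x *\<^sub>R (r k x - \<zeta> x)) \<le> 1\<^sup>2 * n2 (\<lambda>x. r k x - \<zeta> x)"
      by (rule n2_dominated[OF L2_diff[OF r(2,3)]]) (use mult_right_mono[OF \<sigma>(2)[of k] norm_ge_zero] in auto)
    finally show "n2 (\<lambda>x. \<sigma> k x *\<^sub>R r k x - \<sigma>' x *\<^sub>R \<zeta> x) \<le> 2 * n2 (\<lambda>x. r k x - \<zeta> x) + 2 * n2 (\<lambda>x. \<sigma> k x *\<^sub>R \<zeta> x - \<sigma>' x *\<^sub>R \<zeta> x)"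
      by simp
  next
    have "(\<lambda>k. 2 * n2 (\<lambda>x. r k x - \<zeta> x) + 2 * n2 (\<lambda>x. \<sigma> k x *\<^sub>R \<zeta> x - \<sigma>' x *\<^sub>R \<zeta> x)) \<longlonglongrightarrow> 2 * 0 + 2 * 0"
      using r(1) lim2 unfolding L2lim_def by (intro tendsto_intros)
    then show "(\<lambda>k. 2 * n2 (\<lambda>x. r k x - \<zeta> x) + 2 * n2 (\<lambda>x. \<sigma> k x *\<^sub>R \<zeta> x - \<sigma>' x *\<^sub>R \<zeta> x)) \<longlonglongrightarrow> 0" by simp
  qed
qed

text \<open>\<open>D\<close> is not tied to \<open>gp\<close> and \<open>gq\<close> by a formula,
  because in the application a common function is subtracted from solution and supersolution, which
  changes \<open>p\<close> and \<open>q\<close> but neither \<open>D\<close> nor \<open>b\<close>.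
  The roles are asymmetric: \<open>p\<close> has zero boundary values and \<open>q\<close> is only
  nonnegative, which suffices for the positive part of \<open>p - q\<close> to vanish at the
  boundary.\<close>

theorem weak_comparison:
  fixes \<Omega> :: "(real^'n) set" and p q :: "real^'n \<Rightarrow> real"
  assumes \<Omega>: "open \<Omega>" and R: "\<And>x. x \<in> \<Omega> \<Longrightarrow> norm x \<le> R" "R > 0"
    and p: "H0 \<Omega> p gp"
    and q: "L2 q" "L2 gq" "\<And>x. q x \<ge> 0" "\<And>x. x \<notin> \<Omega> \<Longrightarrow> q x = 0" "\<And>x. x \<notin> \<Omega> \<Longrightarrow> gq x = 0"
    and wq: "\<And>\<phi> i. C1c \<Omega> \<phi> \<Longrightarrow> (\<integral>y. q y * grad \<phi> y $ i \<partial>lborel) = - (\<integral>y. gq y $ i * \<phi> y \<partial>lborel)"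
    and D: "L2 D" and b: "L2 b"
    and ineq: "\<And>\<phi>. C1c \<Omega> \<phi> \<Longrightarrow> (\<And>x. \<phi> x \<ge> 0) \<Longrightarrow> (\<integral>x. D x \<bullet> grad \<phi> x \<partial>lborel) \<le> (\<integral>x. b x * \<phi> x \<partial>lborel)"
    and c: "c > 0" "AE x in lborel. D x \<bullet> (gp x - gq x) \<ge> c * (norm (gp x - gq x))\<^sup>2"
    and K: "K \<ge> 0" "AE x in lborel. p x > q x \<longrightarrow> b x \<le> K * (p x - q x)" "K * (4 * R\<^sup>2) \<le> c / 8"
  shows "AE x in lborel. p x \<le> q x"
proof -
  define P where "P = 4 * R\<^sup>2"
  obtain pk where pk: "\<And>k. C1c \<Omega> (pk k)" "L2lim pk p" "L2lim (\<lambda>k. grad (pk k)) gp" using H0_seq[OF p] by blast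
  note Lp = H0_D(1,2)[OF p] and Lpk = C1c_L2[OF pk(1)]
  have "\<exists>K d. compact K \<and> K \<subseteq> \<Omega> \<and> (\<forall>x. x \<notin> K \<longrightarrow> pk k x = 0) \<and> d > 0 \<and> (\<forall>x\<in>K. cball x d \<subseteq> \<Omega>)" for k
    by (metis C1c_supportE[OF pk(1)] compact_open_margin[OF _ \<Omega>])
  then obtain S d where S: "\<And>k. compact (S k)" "\<And>k. S k \<subseteq> \<Omega>" "\<And>k x. x \<notin> S k \<Longrightarrow> pk k x = 0"
    and d: "\<And>k. d k > 0" "\<And>k x. x \<in> S k \<Longrightarrow> cball x (d k) \<subseteq> \<Omega>" by metis
  obtain C and \<rho> :: "real \<Rightarrow> real^'n \<Rightarrow> real" where \<rho>: "\<And>h. h > 0 \<Longrightarrow> C1c UNIV (\<rho> h)"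
    "\<And>h x. \<rho> h x \<ge> 0" "\<And>h x. h > 0 \<Longrightarrow> h \<le> norm x \<Longrightarrow> \<rho> h x = 0" "\<And>h. h > 0 \<Longrightarrow> (\<integral>x. \<rho> h x \<partial>lborel) = 1"
    using mollifier_family by (metis (no_types))
  \<comment> \<open>The mollification radius for \<open>q\<close> stays below the margin
    \<open>d k\<close> of the support of \<open>pk k\<close>, so the gradient of the mollified
    \<open>q\<close> is correct on that support.\<close>
  define h where "h k = min (d k) (inverse (real (Suc k)))" for k
  have h: "h k > 0" "h k \<le> d k" "h k \<le> inverse (real (Suc k))" for k using d(1) by (auto simp: h_def)
  have h0: "h \<longlonglongrightarrow> 0"
    by (rule tendsto_sandwich[OF _ _ tendsto_const LIMSEQ_inverse_real_of_nat])
      (use h(1,3) in \<open>auto intro!: always_eventually less_imp_le\<close>)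
  have iq: "integrable lborel q" "integrable lborel gq"
    by (rule L2_integrable_bounded_support[OF q(1), of R], use q(4) R(1) in blast)
      (rule L2_integrable_bounded_support[OF q(2), of R], use q(5) R(1) in blast)
  define qk where "qk k = conv (\<rho> (h k)) q" for k
  define Qk where "Qk k = conv (\<rho> (h k)) gq" for k
  have Lqk: "L2 (qk k)" "L2 (Qk k)" "L2lim qk q" "L2lim Qk gq" for k
    unfolding qk_def Qk_def
    by (intro conv_L2lim[where \<rho>="\<lambda>k. \<rho> (h k)" and h=h] q iq \<rho> h h0; assumption)+
  have gqk: "grad (qk k) x = Qk k x" if "x \<in> S k" for k x
    unfolding qk_def Qk_def
  proof (rule conv_weak_grad[OF iq wq \<rho>(1)[OF h(1)] \<rho>(3)[OF h(1)]])
    show "cball x (h k) \<subseteq> \<Omega>" using d(2)[OF that] h(2)[of k] by (auto simp: subset_iff)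
  qed auto
  have qk0: "qk k x \<ge> 0" for k x unfolding qk_def by (intro conv_nonneg \<rho> q)
  define s where "s k x = pk k x - qk k x" for k x
  define r where "r k x = grad (pk k) x - Qk k x" for k x
  define z where "z x = p x - q x" for x
  define \<zeta> where "\<zeta> x = gp x - gq x" for x
  have Ls: "L2 (s k)" "L2 (r k)" "L2 z" "L2 \<zeta>" for k
    unfolding s_def[abs_def] r_def[abs_def] z_def[abs_def] \<zeta>_def[abs_def] by (intro L2_diff Lpk Lqk Lp q)+
  have lims: "L2lim s z" "L2lim r \<zeta>"
    unfolding s_def[abs_def] r_def[abs_def] z_def[abs_def] \<zeta>_def[abs_def] by (intro L2lim_diff pk Lpk Lqk Lp q)+
  \<comment> \<open>Off \<open>S k\<close> one has \<open>pk k = 0\<close> and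
    \<open>qk k \<ge> 0\<close>, hence \<open>s k \<le> 0\<close>. A function \<open>T\<close>
    vanishing for nonpositive arguments therefore gives compact support inside the domain, even
    though \<open>q\<close> has no boundary condition of its own, and \<open>Qk\<close> is needed as
    a gradient on \<open>S k\<close> only.\<close>
  have tst: "C1c \<Omega> (\<lambda>x. T (s k x))" "grad (\<lambda>x. T (s k x)) = (\<lambda>x. \<tau> (s k x) *\<^sub>R r k x)"
    if T: "\<And>t. (T has_real_derivative \<tau> t) (at t)" "continuous_on UNIV \<tau>" "\<And>t. t \<le> 0 \<Longrightarrow> T t = 0" "\<And>t. t \<le> 0 \<Longrightarrow> \<tau> t = 0" for T \<tau> k
  proof -
    note cg = conv_grad[OF iq(1) \<rho>(1)[OF h(1)], of k, folded qk_def]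
    have Ds: "(s k has_derivative (\<lambda>v. (grad (pk k) x - grad (qk k) x) \<bullet> v)) (at x)" for x
      unfolding s_def inner_diff_left by (intro has_derivative_diff C1c_has_derivative[OF pk(1)] cg(3))
    have off: "s k x \<le> 0" if "x \<notin> S k" for x using S(3)[OF that] qk0[of k x] by (simp add: s_def)
    have eq: "\<tau> (s k x) *\<^sub>R (grad (pk k) x - grad (qk k) x) = \<tau> (s k x) *\<^sub>R r k x" for x
      using gqk[of x k] T(4)[OF off, of x] by (cases "x \<in> S k") (auto simp: r_def)
    have D: "((\<lambda>x. T (s k x)) has_derivative (\<lambda>v. (\<tau> (s k x) *\<^sub>R (grad (pk k) x - grad (qk k) x)) \<bullet> v)) (at x)" for x
      using has_derivative_compose[OF Ds T(1)[unfolded has_field_derivative_def], of x] by simp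
    have "continuous_on UNIV (s k)" by (rule continuous_on_UNIV_has_derivative[OF Ds])
    then have c: "continuous_on UNIV (\<lambda>x. \<tau> (s k x) *\<^sub>R (grad (pk k) x - grad (qk k) x))"
      by (intro continuous_intros C1c_continuous_grad[OF pk(1)] cg(2) continuous_on_compose2[OF T(2)]) auto
    from C1cI[OF D c S(1,2)[of k]] T(3)[OF off]
    show "C1c \<Omega> (\<lambda>x. T (s k x))" "grad (\<lambda>x. T (s k x)) = (\<lambda>x. \<tau> (s k x) *\<^sub>R r k x)"
      unfolding eq by auto
  qed
  have c2: "continuous_on UNIV (\<lambda>s. (ramp s)\<^sup>2)" by (intro continuous_intros ramp_continuous)
  have t1: "C1c \<Omega> (\<lambda>x. ramp_int (s k x))" "grad (\<lambda>x. ramp_int (s k x)) = (\<lambda>x. ramp (s k x) *\<^sub>R r k x)" for k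
    using tst[OF DERIV_ramp_int ramp_continuous ramp_int_nonpos(1), of k] ramp_range(3) by auto
  have t2: "C1c \<Omega> (\<lambda>x. ramp_sq_int (s k x))" "grad (\<lambda>x. ramp_sq_int (s k x)) = (\<lambda>x. (ramp (s k x))\<^sup>2 *\<^sub>R r k x)" for k
    using tst[OF DERIV_ramp_sq_int c2 ramp_int_nonpos(2), of k] ramp_range(3) by auto
  \<comment> \<open>The factors \<open>ramp (s k x)\<close> must converge pointwise, which L2
    convergence supplies only along a subsequence.\<close>
  obtain \<nu> where \<nu>: "strict_mono \<nu>" "AE x in lborel. (\<lambda>k. s (\<nu> k) x) \<longlonglongrightarrow> z x"
    using L2lim_AE_subseq[OF lims(1) Ls(1,3)] by blast
  note lims' = L2lim_subseq[OF lims(1) \<nu>(1)] L2lim_subseq[OF lims(2) \<nu>(1)]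
  note [measurable] = L2_measurable[OF Ls(1)] L2_measurable[OF Ls(3)] L2_measurable[OF Ls(4)] L2_measurable[OF D] L2_measurable[OF b]
  have [measurable]: "ramp \<in> borel_measurable borel" by (rule borel_measurable_continuous_onI[OF ramp_continuous])
  have conv: "L2lim (\<lambda>k x. \<tau> (s (\<nu> k) x) *\<^sub>R r (\<nu> k) x) (\<lambda>x. \<tau> (z x) *\<^sub>R \<zeta> x)"
    if \<tau>: "continuous_on UNIV \<tau>" "\<And>t. \<bar>\<tau> t\<bar> \<le> (1::real)" for \<tau>
  proof -
    have [measurable]: "\<tau> \<in> borel_measurable borel" by (rule borel_measurable_continuous_onI[OF \<tau>(1)])
    show ?thesis
    proof (rule L2lim_bounded_mult[OF lims'(2) Ls(2,4)])
      show "AE x in lborel. (\<lambda>k. \<tau> (s (\<nu> k) x)) \<longlonglongrightarrow> \<tau> (z x)"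
        using \<nu>(2)
      proof eventually_elim
        case (elim x)
        have "isCont \<tau> (z x)" using \<tau>(1) by (simp add: continuous_on_eq_continuous_at)
        then show ?case using elim by (rule isCont_tendsto_compose)
      qed
    qed (use \<tau>(2) in auto)
  qed
  have ab1: "\<bar>ramp t\<bar> \<le> 1" and ab2: "\<bar>(ramp t)\<^sup>2\<bar> \<le> 1" for t
    using ramp_range[of t] by (auto intro: power_le_one)
  have Lk: "L2 (\<lambda>x. ramp (z x) *\<^sub>R \<zeta> x)" "L2 (\<lambda>x. (ramp (z x))\<^sup>2 *\<^sub>R \<zeta> x)"
    by (rule L2_bounded_scaleR[OF Ls(4), where C=1]; use ab1 ab2 in auto)+
  have Lks: "L2 (\<lambda>x. ramp (s k x) *\<^sub>R r k x)" "L2 (\<lambda>x. (ramp (s k x))\<^sup>2 *\<^sub>R r k x)" for k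
    by (rule L2_bounded_scaleR[OF Ls(2), where C=1]; use ab1 ab2 in auto)+
  note lip1 = Lipschitz_1_DERIV[OF DERIV_ramp_int ab1] and lip2 = Lipschitz_1_DERIV[OF DERIV_ramp_sq_int ab2]
  have [simp]: "ramp_int 0 = 0" "ramp_sq_int 0 = 0" using ramp_int_nonpos[of 0] by auto
  have "continuous_on UNIV ramp_int" "continuous_on UNIV ramp_sq_int"
    using DERIV_ramp_int DERIV_ramp_sq_int by (meson DERIV_continuous_on has_field_derivative_at_within)+
  then have [measurable]: "ramp_int \<in> borel_measurable borel" "ramp_sq_int \<in> borel_measurable borel"
    by (auto intro: borel_measurable_continuous_onI)
  have LT: "L2 (\<lambda>x. ramp_int (w x))" "L2 (\<lambda>x. ramp_sq_int (w x))" if "L2 w" for w :: "real^'n \<Rightarrow> real"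
    using L2_dominated[OF that, of "\<lambda>x. ramp_int (w x)" 1] L2_dominated[OF that, of "\<lambda>x. ramp_sq_int (w x)" 1]
      L2_measurable[OF that] lip1[of _ 0] lip2[of _ 0] by auto
  have I1: "n2 (\<lambda>x. ramp_int (z x)) \<le> P * n2 (\<lambda>x. ramp (z x) *\<^sub>R \<zeta> x)"
  proof (rule LIMSEQ_le)
    show "(\<lambda>k. n2 (\<lambda>x. ramp_int (s (\<nu> k) x))) \<longlonglongrightarrow> n2 (\<lambda>x. ramp_int (z x))"
      by (rule L2lim_n2[OF L2lim_Lipschitz[OF lims'(1) _ _ lip1]]) (use Ls LT in auto)
    show "(\<lambda>k. P * n2 (\<lambda>x. ramp (s (\<nu> k) x) *\<^sub>R r (\<nu> k) x)) \<longlonglongrightarrow> P * n2 (\<lambda>x. ramp (z x) *\<^sub>R \<zeta> x)"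
      by (rule tendsto_mult_left, rule L2lim_n2[OF conv[OF ramp_continuous ab1]]) (rule Lks(1), rule Lk(1))
    show "\<exists>N. \<forall>k\<ge>N. n2 (\<lambda>x. ramp_int (s (\<nu> k) x)) \<le> P * n2 (\<lambda>x. ramp (s (\<nu> k) x) *\<^sub>R r (\<nu> k) x)"
      using Poincare[OF t1(1) R] unfolding t1(2) P_def by auto
  qed
  have I2: "(\<integral>x. D x \<bullet> ((ramp (z x))\<^sup>2 *\<^sub>R \<zeta> x) \<partial>lborel) \<le> (\<integral>x. b x * ramp_sq_int (z x) \<partial>lborel)"
  proof (rule LIMSEQ_le)
    show "(\<lambda>k. \<integral>x. D x \<bullet> ((ramp (s (\<nu> k) x))\<^sup>2 *\<^sub>R r (\<nu> k) x) \<partial>lborel) \<longlonglongrightarrow> (\<integral>x. D x \<bullet> ((ramp (z x))\<^sup>2 *\<^sub>R \<zeta> x) \<partial>lborel)"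
      by (rule L2lim_inner[OF L2lim_const conv[OF c2 ab2]]) (use D Lk Lks in auto)
    show "(\<lambda>k. \<integral>x. b x * ramp_sq_int (s (\<nu> k) x) \<partial>lborel) \<longlonglongrightarrow> (\<integral>x. b x * ramp_sq_int (z x) \<partial>lborel)"
      by (rule L2lim_mult[OF L2lim_const L2lim_Lipschitz[OF lims'(1) _ _ lip2]]) (use b Ls LT in auto)
    show "\<exists>N. \<forall>k\<ge>N. (\<integral>x. D x \<bullet> ((ramp (s (\<nu> k) x))\<^sup>2 *\<^sub>R r (\<nu> k) x) \<partial>lborel) \<le> (\<integral>x. b x * ramp_sq_int (s (\<nu> k) x) \<partial>lborel)"
      using ineq[OF t2(1) ramp_int_compare(2)] unfolding t2(2) by blast
  qed
  have I3: "c * n2 (\<lambda>x. ramp (z x) *\<^sub>R \<zeta> x) \<le> (\<integral>x. D x \<bullet> ((ramp (z x))\<^sup>2 *\<^sub>R \<zeta> x) \<partial>lborel)"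
  proof -
    have "c * n2 (\<lambda>x. ramp (z x) *\<^sub>R \<zeta> x) = (\<integral>x. c * (norm (ramp (z x) *\<^sub>R \<zeta> x))\<^sup>2 \<partial>lborel)" by (simp add: n2_def)
    also have "\<dots> \<le> (\<integral>x. D x \<bullet> ((ramp (z x))\<^sup>2 *\<^sub>R \<zeta> x) \<partial>lborel)"
    proof (rule integral_mono_AE)
      show "integrable lborel (\<lambda>x. c * (norm (ramp (z x) *\<^sub>R \<zeta> x))\<^sup>2)" using L2_integrable[OF Lk(1)] by simp
      show "integrable lborel (\<lambda>x. D x \<bullet> ((ramp (z x))\<^sup>2 *\<^sub>R \<zeta> x))" by (rule L2_inner_integrable[OF D Lk(2)])
      show "AE x in lborel. c * (norm (ramp (z x) *\<^sub>R \<zeta> x))\<^sup>2 \<le> D x \<bullet> ((ramp (z x))\<^sup>2 *\<^sub>R \<zeta> x)"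
        using c(2)
      proof eventually_elim
        case (elim x)
        have "(ramp (z x))\<^sup>2 * (c * (norm (\<zeta> x))\<^sup>2) \<le> (ramp (z x))\<^sup>2 * (D x \<bullet> \<zeta> x)"
          using elim by (intro mult_left_mono) (auto simp: \<zeta>_def)
        then show ?case by (simp add: power_mult_distrib mult_ac)
      qed
    qed
    finally show ?thesis .
  qed
  have I4: "(\<integral>x. b x * ramp_sq_int (z x) \<partial>lborel) \<le> 4 / 3 * K * n2 (\<lambda>x. ramp_int (z x))"
  proof -
    have "(\<integral>x. b x * ramp_sq_int (z x) \<partial>lborel) \<le> (\<integral>x. 4 / 3 * K * (norm (ramp_int (z x)))\<^sup>2 \<partial>lborel)"
    proof (rule integral_mono_AE)
      show "integrable lborel (\<lambda>x. b x * ramp_sq_int (z x))" by (rule L2_mult_integrable[OF b LT(2)[OF Ls(3)]])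
      show "integrable lborel (\<lambda>x. 4 / 3 * K * (norm (ramp_int (z x)))\<^sup>2)" using L2_integrable[OF LT(1)[OF Ls(3)]] by simp
      show "AE x in lborel. b x * ramp_sq_int (z x) \<le> 4 / 3 * K * (norm (ramp_int (z x)))\<^sup>2"
        using K(2)
      proof eventually_elim
        case (elim x)
        show ?case
        proof (cases "z x > 0")
          case True
          then have "b x * ramp_sq_int (z x) \<le> (K * z x) * ramp_sq_int (z x)"
            using elim ramp_int_compare(2) by (intro mult_right_mono) (auto simp: z_def)
          also have "\<dots> \<le> K * (4 / 3 * (ramp_int (z x))\<^sup>2)"
            using mult_left_mono[OF ramp_int_compare(1)[OF True] K(1)] by (simp add: mult.assoc)
          finally show ?thesis by simp
        qed (simp add: ramp_int_nonpos)
      qed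
    qed
    then show ?thesis by (simp add: n2_def)
  qed
  define N where "N = n2 (\<lambda>x. ramp (z x) *\<^sub>R \<zeta> x)"
  \<comment> \<open>The loop closes with a contraction: \<open>4 / 3\<close> times
    \<open>c / 8\<close> is \<open>c / 6\<close>, smaller than \<open>c\<close>, so \<open>N\<close>
    must be 0.\<close>
  have "c * N \<le> 4 / 3 * K * n2 (\<lambda>x. ramp_int (z x))" using I2 I3 I4 by (simp add: N_def)
  also have "\<dots> \<le> 4 / 3 * K * (P * N)" using I1 K(1) unfolding N_def by (intro mult_left_mono) auto
  also have "\<dots> = 4 / 3 * ((K * P) * N)" by simp
  also have "\<dots> \<le> 4 / 3 * ((c / 8) * N)" using K(3) by (intro mult_left_mono mult_right_mono) (auto simp: P_def N_def)
  finally have "c * N \<le> c * N / 6" by simp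
  then have "c * N \<le> 0" by linarith
  then have "N \<le> 0" using c(1) by (simp add: mult_le_0_iff)
  then have "N = 0" by (simp add: N_def antisym)
  then have "n2 (\<lambda>x. ramp_int (z x)) = 0" using I1 n2_nonneg[of "\<lambda>x. ramp_int (z x)"] by (simp add: N_def)
  from n2_zero_AE[OF LT(1)[OF Ls(3)] this] show ?thesis
  proof eventually_elim
    case (elim x)
    then show ?case using ramp_int_compare(3)[of "z x"] by (force simp: z_def)
  qed
qed

section \<open>The critical set of a solution\<close>

context finsler begin

text \<open>A Caccioppoli inequality for the difference of the equation and its translate, tested
  with the increment \<open>w\<close> of \<open>u\<close> times a squared cutoff. Monotonicity
  bounds the increment of the gradient by that of \<open>u\<close>, which is of order
  \<open>norm y\<close>; Lipschitz continuity passes the bound on to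
  \<open>FA F (g x)\<close>.\<close>

lemma increment_estimate:
  fixes \<Omega> :: "(real^'n) set" and c L K r :: real and f :: "real \<Rightarrow> real"
  assumes \<Omega>: "open \<Omega>" and H: "H0 \<Omega> u g"
    and c: "c > 0" "\<And>\<xi> \<eta>. (FA F \<xi> - FA F \<eta>) \<bullet> (\<xi> - \<eta>) \<ge> c * (norm (\<xi> - \<eta>))\<^sup>2"
    and L: "L > 0" "\<And>\<xi> \<eta>. norm (FA F \<xi> - FA F \<eta>) \<le> L * norm (\<xi> - \<eta>)"
    and f: "K \<ge> 0" "\<And>s t. \<bar>f s - f t\<bar> \<le> K * \<bar>s - t\<bar>"
    and eq: "\<And>\<phi>. C1c \<Omega> \<phi> \<Longrightarrow> (\<integral>x. FA F (g x) \<bullet> grad \<phi> x \<partial>lborel) = (\<integral>x. f (u x) * \<phi> x \<partial>lborel)"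
    and r: "r > 0" "cball x0 (4 * r) \<subseteq> \<Omega>"
  obtains C where "C \<ge> 0" "\<And>y. norm y \<le> r \<Longrightarrow>
     n2 (\<lambda>x. indicat_real (cball x0 r) x *\<^sub>R (FA F (g (x + y)) - FA F (g x))) \<le> C * (norm y)\<^sup>2"
proof -
  note Lu = H0_D(1,2)[OF H]
  note [measurable] = L2_measurable[OF Lu(1)] L2_measurable[OF Lu(2)]
  have fc: "continuous_on UNIV f"
    by (rule lipschitz_on_continuous_on[of K]) (use f in \<open>auto simp: lipschitz_on_def dist_real_def\<close>)
  then have [measurable]: "f \<in> borel_measurable borel" by (rule borel_measurable_continuous_onI)
  define B where "B x = FA F (g x)" for x
  have LB: "L2 B" unfolding B_def
    by (rule L2_dominated[OF Lu(2), where C=L]) (use L(2)[of _ 0] in auto)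
  note [measurable] = L2_measurable[OF LB]
  obtain C' and \<rho> :: "real \<Rightarrow> real^'n \<Rightarrow> real" where \<rho>: "\<And>h. h > 0 \<Longrightarrow> C1c UNIV (\<rho> h)"
    "\<And>h x. \<rho> h x \<ge> 0" "\<And>h x. h > 0 \<Longrightarrow> h \<le> norm x \<Longrightarrow> \<rho> h x = 0" "\<And>h x. h > 0 \<Longrightarrow> norm x < h \<Longrightarrow> \<rho> h x > 0"
    using mollifier_family by (metis (no_types))
  define S where "S = cball x0 (2 * r)"
  \<comment> \<open>A mollifier centred at \<open>x0\<close> serves as cutoff: it vanishes outside
    radius \<open>2 * r\<close> and, being positive inside, has a positive minimum \<open>m0\<close>
    on the ball of radius \<open>r\<close>.\<close>
  define \<eta> where "\<eta> x = \<rho> (2 * r) (x0 - x)" for x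
  have \<eta>: "C1c S \<eta>"
    unfolding \<eta>_def S_def by (rule C1c_reflect(1)[OF \<rho>(1) \<rho>(3)]) (use r in auto)
  obtain M where M: "M \<ge> 0" "\<And>x. \<bar>\<eta> x\<bar> \<le> M" "\<And>x. norm (grad \<eta> x) \<le> M" using C1c_bounded[OF \<eta>] by blast
  have "\<exists>x\<in>cball x0 r. \<forall>y\<in>cball x0 r. \<eta> x \<le> \<eta> y"
    by (rule continuous_attains_inf) (use r C1c_continuous[OF \<eta>] in \<open>auto elim: continuous_on_subset\<close>)
  then obtain xm where xm: "xm \<in> cball x0 r" "\<And>y. y \<in> cball x0 r \<Longrightarrow> \<eta> xm \<le> \<eta> y" by blast
  define m0 where "m0 = \<eta> xm"
  have m0: "m0 > 0" "\<And>y. y \<in> cball x0 r \<Longrightarrow> m0 \<le> \<eta> y"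
    using xm \<rho>(4)[of "2 * r" "x0 - xm"] r by (auto simp: m0_def \<eta>_def dist_norm)
  define e where "e x = \<eta> x * \<eta> x" for x
  have e: "C1c S e" "grad e = (\<lambda>x. (2 * \<eta> x) *\<^sub>R grad \<eta> x)"
    unfolding e_def using C1c_mult[OF \<eta> \<eta>] by (simp_all only: mult_2 scaleR_left_distrib)
  have e_nn: "e x \<ge> 0" "e x \<le> M\<^sup>2" for x
    using mult_mono[OF M(2)[of x] M(2)[of x]] M(1) by (auto simp: e_def power2_eq_square)
  note [measurable] = C1c_measurable[OF e(1)] C1c_measurable[OF \<eta>]
  obtain Me where Me: "\<And>x. \<bar>e x\<bar> \<le> Me" "\<And>x. norm (grad e x) \<le> Me" using C1c_bounded[OF e(1)] by metis
  obtain \<psi> where \<psi>: "\<And>k. C1c \<Omega> (\<psi> k)" "L2lim \<psi> u" "L2lim (\<lambda>k. grad (\<psi> k)) g" using H0_seq[OF H] by blast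
  note L\<psi> = C1c_L2[OF \<psi>(1)]
  \<comment> \<open>The first summand is the residue of Young's inequality for the term with
    \<open>grad e\<close>, the second comes from the Lipschitz bound of \<open>f\<close>.\<close>
  define C2 where "C2 = 2 * L\<^sup>2 * M\<^sup>2 / c + K * M\<^sup>2"
  have C2: "C2 \<ge> 0" using c(1) f(1) by (simp add: C2_def)
  define C where "C = L\<^sup>2 / m0\<^sup>2 * (2 / c * C2 * n2 g)"
  have "C \<ge> 0" using c(1) C2 by (simp add: C_def)
  moreover have "n2 (\<lambda>x. indicat_real (cball x0 r) x *\<^sub>R (FA F (g (x + y)) - FA F (g x))) \<le> C * (norm y)\<^sup>2" if y: "norm y \<le> r" for y
  proof -
    define D where "D x = B (x + y) - B x" for x
    define w where "w x = u (x + y) - u x" for x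
    define W where "W x = g (x + y) - g x" for x
    define Df where "Df x = f (u (x + y)) - f (u x)" for x
    have LD: "L2 D" "L2 w" "L2 W" unfolding D_def[abs_def] w_def[abs_def] W_def[abs_def]
      by (intro L2_diff L2_translate LB Lu)+
    note [measurable] = L2_measurable[OF LD(1)] L2_measurable[OF LD(2)] L2_measurable[OF LD(3)]
    have LDf: "L2 Df" by (rule L2_dominated[OF LD(2), where C=K]) (use f(2) in \<open>auto simp: Df_def[abs_def] w_def\<close>)
    have DW: "norm (D x) \<le> L * norm (W x)" "D x \<bullet> W x \<ge> c * (norm (W x))\<^sup>2" for x
      unfolding D_def W_def B_def using L(2) c(2) by auto
    have Dfw: "\<bar>Df x\<bar> \<le> K * \<bar>w x\<bar>" for x unfolding Df_def w_def using f(2) by auto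
    \<comment> \<open>Support radius \<open>2 * r\<close> plus a shift of length at most
      \<open>r\<close> stays within \<open>4 * r\<close>.\<close>
    have S\<Omega>: "S \<subseteq> \<Omega>" "(\<lambda>x. x - (- y)) ` S \<subseteq> \<Omega>"
    proof -
      show "S \<subseteq> \<Omega>" using r by (auto simp: S_def subset_iff)
      show "(\<lambda>x. x - (- y)) ` S \<subseteq> \<Omega>"
      proof safe
        fix x assume "x \<in> S"
        then have "dist x0 (x + y) \<le> 2 * r + r" using y norm_triangle_ineq4[of "x0 - x" y] by (simp add: S_def dist_norm algebra_simps)
        then show "x - (- y) \<in> \<Omega>" using r by (auto simp: subset_iff)
      qed
    qed
    have diffeq: "(\<integral>x. D x \<bullet> grad \<phi> x \<partial>lborel) = (\<integral>x. Df x * \<phi> x \<partial>lborel)" if \<phi>: "C1c S \<phi>" for \<phi>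
    proof -
      note L\<phi> = C1c_L2[OF \<phi>] and [measurable] = C1c_measurable[OF \<phi>]
      have s: "C1c \<Omega> (\<lambda>x. \<phi> (x + - y))" "grad (\<lambda>x. \<phi> (x + - y)) = (\<lambda>x. grad \<phi> (x + - y))"
        using C1c_translate[OF \<phi>, of "- y"] C1c_mono S\<Omega>(2) by blast+
      have "(\<integral>x. B (x + y) \<bullet> grad \<phi> x \<partial>lborel) = (\<integral>x. B x \<bullet> grad (\<lambda>x. \<phi> (x + - y)) x \<partial>lborel)"
        unfolding s(2) using integral_translate[of "\<lambda>x. B x \<bullet> grad \<phi> (x + - y)" y] by simp
      also have "\<dots> = (\<integral>x. f (u x) * \<phi> (x + - y) \<partial>lborel)" using eq[OF s(1)] by (simp add: B_def)
      also have "\<dots> = (\<integral>x. f (u (x + y)) * \<phi> x \<partial>lborel)"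
        using integral_translate[of "\<lambda>x. f (u x) * \<phi> (x + - y)" y] by simp
      finally have 1: "(\<integral>x. B (x + y) \<bullet> grad \<phi> x \<partial>lborel) = (\<integral>x. f (u (x + y)) * \<phi> x \<partial>lborel)" .
      have 2: "(\<integral>x. B x \<bullet> grad \<phi> x \<partial>lborel) = (\<integral>x. f (u x) * \<phi> x \<partial>lborel)"
        using eq[OF C1c_mono[OF \<phi> S\<Omega>(1)]] by (simp add: B_def)
      have i: "integrable lborel (\<lambda>x. f (h x) * \<phi> x)" if "L2 h" for h
      proof -
        have "L2 (\<lambda>x. f (h x) - f 0)"
          by (rule L2_dominated[OF that, where C=K]) (use f(2)[of _ 0] L2_measurable[OF that] in auto)
        from L2_mult_integrable[OF this L\<phi>(1)] L\<phi>(3)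
        have "integrable lborel (\<lambda>x. (f (h x) - f 0) * \<phi> x + f 0 * \<phi> x)" by auto
        then show ?thesis by (simp add: algebra_simps)
      qed
      have "(\<integral>x. D x \<bullet> grad \<phi> x \<partial>lborel) = (\<integral>x. B (x + y) \<bullet> grad \<phi> x \<partial>lborel) - (\<integral>x. B x \<bullet> grad \<phi> x \<partial>lborel)"
        unfolding D_def inner_diff_left
        by (intro Bochner_Integration.integral_diff L2_inner_integrable L2_translate LB L\<phi>)
      also have "\<dots> = (\<integral>x. Df x * \<phi> x \<partial>lborel)" unfolding 1 2 Df_def left_diff_distrib
        by (intro Bochner_Integration.integral_diff[symmetric] i L2_translate Lu)
      finally show ?thesis .
    qed
    \<comment> \<open>\<open>w\<close> is not C^1, so the increments of the approximants are
      inserted. They may leave the domain, but their product with the cutoff is supported in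
      \<open>S\<close>.\<close>
    define d where "d k x = \<psi> k (x + y) - \<psi> k x" for k x
    have d: "C1c UNIV (d k)" "grad (d k) = (\<lambda>x. grad (\<psi> k) (x + y) - grad (\<psi> k) x)" for k
    proof -
      have t: "C1c UNIV (\<lambda>x. \<psi> k (x + y))" using C1c_translate(1)[OF \<psi>(1)] C1c_mono by blast
      have p: "C1c UNIV (\<psi> k)" using \<psi>(1) C1c_mono by blast
      show "C1c UNIV (d k)" "grad (d k) = (\<lambda>x. grad (\<psi> k) (x + y) - grad (\<psi> k) x)"
        unfolding d_def[abs_def] using C1c_diff[OF t p] C1c_translate(2)[OF \<psi>(1)] by auto
    qed
    have limd: "L2lim d w" "L2lim (\<lambda>k. grad (d k)) W"
      unfolding d(2) unfolding d_def[abs_def] w_def[abs_def] W_def[abs_def]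
      by (intro L2lim_diff L2lim_translate \<psi> L2_translate L\<psi> Lu)+
    note Ld = C1c_L2[OF d(1)]
    have LDge: "L2 (\<lambda>x. D x \<bullet> grad e x)"
    proof (rule L2_dominated[OF LD(1), where C=Me])
      show "norm (D x \<bullet> grad e x) \<le> Me * norm (D x)" for x
        using order_trans[OF Cauchy_Schwarz_ineq2[of "D x" "grad e x"] mult_left_mono[OF Me(2)[of x] norm_ge_zero[of "D x"]]]
        by (simp add: mult.commute)
    qed measurable
    have LeD: "L2 (\<lambda>x. e x *\<^sub>R D x)" by (rule L2_bounded_scaleR[OF LD(1) _ Me(1)]) measurable
    have LeDf: "L2 (\<lambda>x. e x * Df x)" using L2_bounded_scaleR[OF LDf _ Me(1)] by simp
    have idk: "(\<integral>x. (D x \<bullet> grad e x) * d k x \<partial>lborel) + (\<integral>x. (e x *\<^sub>R D x) \<bullet> grad (d k) x \<partial>lborel) = (\<integral>x. (e x * Df x) * d k x \<partial>lborel)" for k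
    proof -
      note p = C1c_mult[OF d(1)[of k] e(1)]
      have "(\<integral>x. (D x \<bullet> grad e x) * d k x \<partial>lborel) + (\<integral>x. (e x *\<^sub>R D x) \<bullet> grad (d k) x \<partial>lborel)
        = (\<integral>x. (D x \<bullet> grad e x) * d k x + (e x *\<^sub>R D x) \<bullet> grad (d k) x \<partial>lborel)"
        by (intro Bochner_Integration.integral_add[symmetric] L2_mult_integrable L2_inner_integrable LDge LeD Ld)
      also have "\<dots> = (\<integral>x. D x \<bullet> grad (\<lambda>x. d k x * e x) x \<partial>lborel)"
        unfolding p(2) by (simp add: inner_add_right mult.commute)
      also have "\<dots> = (\<integral>x. Df x * (d k x * e x) \<partial>lborel)" by (rule diffeq[OF p(1)])
      finally show ?thesis by (simp add: mult_ac)
    qed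
    have id: "(\<integral>x. (D x \<bullet> grad e x) * w x \<partial>lborel) + (\<integral>x. (e x *\<^sub>R D x) \<bullet> W x \<partial>lborel) = (\<integral>x. (e x * Df x) * w x \<partial>lborel)"
    proof (rule LIMSEQ_unique)
      show "(\<lambda>k. (\<integral>x. (D x \<bullet> grad e x) * d k x \<partial>lborel) + (\<integral>x. (e x *\<^sub>R D x) \<bullet> grad (d k) x \<partial>lborel)) \<longlonglongrightarrow>
         (\<integral>x. (D x \<bullet> grad e x) * w x \<partial>lborel) + (\<integral>x. (e x *\<^sub>R D x) \<bullet> W x \<partial>lborel)"
        by (intro tendsto_add L2lim_mult L2lim_inner L2lim_const limd LDge LeD Ld LD)
      show "(\<lambda>k. (\<integral>x. (D x \<bullet> grad e x) * d k x \<partial>lborel) + (\<integral>x. (e x *\<^sub>R D x) \<bullet> grad (d k) x \<partial>lborel)) \<longlonglongrightarrow>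
         (\<integral>x. (e x * Df x) * w x \<partial>lborel)"
        unfolding idk by (intro L2lim_mult L2lim_const limd LeDf Ld LD)
    qed
    have LeW: "L2 (\<lambda>x. \<eta> x *\<^sub>R W x)" by (rule L2_bounded_scaleR[OF LD(3) _ M(2)]) measurable
    have nW: "(norm (\<eta> x *\<^sub>R W x))\<^sup>2 = e x * (norm (W x))\<^sup>2" for x
      by (simp add: e_def power_mult_distrib power2_eq_square)
    define I where "I = n2 (\<lambda>x. \<eta> x *\<^sub>R W x)"
    have "c * I = (\<integral>x. c * (norm (\<eta> x *\<^sub>R W x))\<^sup>2 \<partial>lborel)" by (simp add: I_def n2_def)
    also have "\<dots> \<le> (\<integral>x. (e x *\<^sub>R D x) \<bullet> W x \<partial>lborel)"
    proof (rule integral_mono[OF _ L2_inner_integrable[OF LeD LD(3)]])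
      show "c * (norm (\<eta> x *\<^sub>R W x))\<^sup>2 \<le> (e x *\<^sub>R D x) \<bullet> W x" for x
        using mult_left_mono[OF DW(2)[of x] e_nn(1)[of x]] by (simp only: nW) (simp add: mult_ac)
    qed (use L2_integrable[OF LeW] in auto)
    also have "\<dots> = (\<integral>x. (e x * Df x) * w x - (D x \<bullet> grad e x) * w x \<partial>lborel)"
      using id by (subst Bochner_Integration.integral_diff[OF L2_mult_integrable[OF LeDf LD(2)] L2_mult_integrable[OF LDge LD(2)]]) simp
    also have "\<dots> \<le> (\<integral>x. C2 * (norm (w x))\<^sup>2 + (c / 2) * (norm (\<eta> x *\<^sub>R W x))\<^sup>2 \<partial>lborel)"
    proof (rule integral_mono)
      show "integrable lborel (\<lambda>x. (e x * Df x) * w x - (D x \<bullet> grad e x) * w x)"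
        by (intro Bochner_Integration.integrable_diff L2_mult_integrable LeDf LDge LD)
      show "integrable lborel (\<lambda>x. C2 * (norm (w x))\<^sup>2 + (c / 2) * (norm (\<eta> x *\<^sub>R W x))\<^sup>2)"
        using L2_integrable[OF LeW] L2_integrable[OF LD(2)] by auto
      fix x
      have "(e x * Df x) * w x \<le> \<bar>e x\<bar> * \<bar>Df x\<bar> * \<bar>w x\<bar>"
        using abs_ge_self[of "(e x * Df x) * w x"] by (simp add: abs_mult)
      also have "\<dots> \<le> M\<^sup>2 * (K * \<bar>w x\<bar>) * \<bar>w x\<bar>"
        using e_nn[of x] Dfw[of x] f(1) by (intro mult_mono mult_nonneg_nonneg) auto
      finally have 1: "(e x * Df x) * w x \<le> K * M\<^sup>2 * (w x)\<^sup>2" by (simp add: power2_eq_square mult_ac flip: abs_mult)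
      define a b where "a = \<bar>\<eta> x\<bar> * norm (W x)" and "b = 2 * L * M * \<bar>w x\<bar>"
      have "- ((D x \<bullet> grad e x) * w x) \<le> \<bar>D x \<bullet> grad e x\<bar> * \<bar>w x\<bar>"
        using abs_ge_minus_self[of "(D x \<bullet> grad e x) * w x"] by (simp add: abs_mult)
      also have "\<dots> \<le> (norm (D x) * norm (grad e x)) * \<bar>w x\<bar>"
        by (intro mult_right_mono Cauchy_Schwarz_ineq2) auto
      also have "\<dots> \<le> ((L * norm (W x)) * (2 * \<bar>\<eta> x\<bar> * M)) * \<bar>w x\<bar>"
        using DW(1)[of x] M(3)[of x] L(1) by (intro mult_right_mono mult_mono) (auto simp: e(2) abs_mult intro!: mult_left_mono)
      also have "\<dots> = a * b" by (simp add: a_def b_def)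
      \<comment> \<open>Young's inequality with weight \<open>c\<close>: half of the left-hand side
        \<open>c * I\<close> is returned and absorbed.\<close>
      also have "a * b \<le> c / 2 * a\<^sup>2 + b\<^sup>2 / (2 * c)"
        using zero_le_power2[of "c * a - b"] c(1) by (simp add: field_simps power2_eq_square)
      also have "b\<^sup>2 / (2 * c) = 2 * L\<^sup>2 * M\<^sup>2 / c * (w x)\<^sup>2" using c(1) by (simp add: b_def power_mult_distrib)
      finally have "- ((D x \<bullet> grad e x) * w x) \<le> c / 2 * (norm (\<eta> x *\<^sub>R W x))\<^sup>2 + 2 * L\<^sup>2 * M\<^sup>2 / c * (w x)\<^sup>2"
        by (simp add: a_def)
      with 1 show "(e x * Df x) * w x - (D x \<bullet> grad e x) * w x \<le> C2 * (norm (w x))\<^sup>2 + (c / 2) * (norm (\<eta> x *\<^sub>R W x))\<^sup>2"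
        by (simp add: C2_def distrib_right)
    qed
    also have "\<dots> = C2 * n2 w + (c / 2) * I"
      using L2_integrable[OF LeW] L2_integrable[OF LD(2)] by (simp add: n2_def I_def)
    finally have "(c / 2) * I \<le> C2 * n2 w" by simp
    also have "\<dots> \<le> C2 * ((norm y)\<^sup>2 * n2 g)"
      unfolding w_def[abs_def] by (intro mult_left_mono H0_translation_estimate[OF H] C2)
    finally have I: "I \<le> 2 / c * C2 * n2 g * (norm y)\<^sup>2" using c(1) by (simp add: field_simps)
    have "n2 (\<lambda>x. indicat_real (cball x0 r) x *\<^sub>R D x) \<le> (L / m0)\<^sup>2 * I"
      unfolding I_def
    proof (rule n2_dominated[OF LeW])
      fix x
      show "norm (indicat_real (cball x0 r) x *\<^sub>R D x) \<le> L / m0 * norm (\<eta> x *\<^sub>R W x)"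
      proof (cases "x \<in> cball x0 r")
        case True
        have "norm (D x) * m0 \<le> (L * norm (W x)) * \<eta> x" using m0 True DW(1)[of x] L(1) by (intro mult_mono) auto
        then have "norm (D x) \<le> L * norm (W x) * \<eta> x / m0" using m0(1) by (simp add: pos_le_divide_eq)
        moreover have "\<bar>\<eta> x\<bar> = \<eta> x" using m0(1) m0(2)[OF True] by simp
        ultimately show ?thesis using True by (simp add: mult_ac)
      qed (use L(1) m0(1) in auto)
    qed
    also have "\<dots> \<le> (L / m0)\<^sup>2 * (2 / c * C2 * n2 g * (norm y)\<^sup>2)" by (intro mult_left_mono I) auto
    also have "\<dots> = C * (norm y)\<^sup>2" by (simp add: C_def power_divide)
    finally show ?thesis unfolding D_def B_def .
  qed
  ultimately show thesis by (rule that)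
qed

end

section \<open>The divergence on the zero set of a vector field\<close>

lemma conv_integral:
  fixes \<psi> :: "real^'n \<Rightarrow> real"
  assumes \<psi>: "integrable lborel \<psi>" "\<And>x. \<psi> x \<ge> 0" and \<rho>: "C1c UNIV \<rho>" "\<And>x. \<rho> x \<ge> 0" "(\<integral>x. \<rho> x \<partial>lborel) = 1"
    and i: "integrable lborel (conv \<rho> \<psi>)"
  shows "(\<integral>x. conv \<rho> \<psi> x \<partial>lborel) = (\<integral>x. \<psi> x \<partial>lborel)"
proof -
  have [measurable]: "\<psi> \<in> borel_measurable borel" using \<psi>(1) by (auto dest: borel_measurable_integrable)
  note [measurable] = C1c_measurable[OF \<rho>(1)]
  obtain M where M: "\<And>x. \<bar>\<rho> x\<bar> \<le> M" using C1c_bounded[OF \<rho>(1)] by metis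
  have nn: "conv \<rho> \<psi> x \<ge> 0" for x by (intro conv_nonneg \<rho> \<psi>)
  have "ennreal (\<integral>x. conv \<rho> \<psi> x \<partial>lborel) = (\<integral>\<^sup>+x. ennreal (conv \<rho> \<psi> x) \<partial>lborel)"
    by (rule nn_integral_eq_integral[symmetric, OF i]) (rule AE_I2, rule nn)
  also have "\<dots> = (\<integral>\<^sup>+x. \<integral>\<^sup>+y. ennreal (\<rho> (x - y) * \<psi> y) \<partial>lborel \<partial>lborel)"
  proof (rule nn_integral_cong)
    fix x
    show "ennreal (conv \<rho> \<psi> x) = (\<integral>\<^sup>+y. ennreal (\<rho> (x - y) * \<psi> y) \<partial>lborel)"
      using nn_integral_eq_integral[OF conv_integrable_vec[OF \<psi>(1) C1c_measurable(1)[OF \<rho>(1)] M, of x]] \<rho>(2) \<psi>(2)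
      by (simp add: conv_def)
  qed
  also have "\<dots> = (\<integral>\<^sup>+y. \<integral>\<^sup>+x. ennreal (\<rho> (x - y) * \<psi> y) \<partial>lborel \<partial>lborel)"
    by (rule lborel_pair.Fubini') simp
  also have "\<dots> = (\<integral>\<^sup>+y. ennreal (\<psi> y) \<partial>lborel)"
  proof (rule nn_integral_cong)
    fix y
    have "(\<integral>\<^sup>+x. ennreal (\<rho> (x - y) * \<psi> y) \<partial>lborel) = (\<integral>\<^sup>+x. ennreal (\<rho> (x + - y)) \<partial>lborel) * ennreal (\<psi> y)"
      by (simp add: ennreal_mult \<rho>(2) \<psi>(2) nn_integral_multc)
    also have "(\<integral>\<^sup>+x. ennreal (\<rho> (x + - y)) \<partial>lborel) = (\<integral>\<^sup>+x. ennreal (\<rho> x) \<partial>lborel)"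
      by (rule nn_integral_translate) simp
    also have "\<dots> = 1" using nn_integral_eq_integral[OF C1c_L2(3)[OF \<rho>(1)]] \<rho>(2,3) by simp
    finally show "(\<integral>\<^sup>+x. ennreal (\<rho> (x - y) * \<psi> y) \<partial>lborel) = ennreal (\<psi> y)" by simp
  qed
  also have "\<dots> = ennreal (\<integral>x. \<psi> x \<partial>lborel)"
    by (rule nn_integral_eq_integral[OF \<psi>(1)]) (use \<psi>(2) in auto)
  finally have "ennreal (\<integral>x. conv \<rho> \<psi> x \<partial>lborel) = ennreal (\<integral>x. \<psi> x \<partial>lborel)" .
  moreover have "0 \<le> (\<integral>x. conv \<rho> \<psi> x \<partial>lborel)" "0 \<le> (\<integral>x. \<psi> x \<partial>lborel)" by (simp_all add: nn \<psi>(2))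
  ultimately show ?thesis by simp
qed

text \<open>The gradient of the kernel has integral 0, so the constant \<open>\<psi> x\<close> may
  be subtracted. This expresses the gradient of a mollification by increments of a function that
  need not be differentiable.\<close>

lemma conv_grad_increment:
  fixes \<psi> :: "real^'n \<Rightarrow> real"
  assumes \<psi>: "integrable lborel \<psi>" and \<rho>: "C1c UNIV \<rho>"
  shows "integrable lborel (\<lambda>y. (\<psi> (x - y) - \<psi> x) *\<^sub>R grad \<rho> y)"
    "grad (conv \<rho> \<psi>) x = (\<integral>y. (\<psi> (x - y) - \<psi> x) *\<^sub>R grad \<rho> y \<partial>lborel)"
proof -
  have [measurable]: "\<psi> \<in> borel_measurable borel" using \<psi>(1) by (auto dest: borel_measurable_integrable)
  note [measurable] = C1c_measurable[OF \<rho>(1)]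
  obtain M where M: "\<And>x. norm (grad \<rho> x) \<le> M" using C1c_bounded[OF \<rho>(1)] by metis
  have i1: "integrable lborel (\<lambda>y. \<psi> (x - y) *\<^sub>R grad \<rho> y)"
    using conv_integrable[OF \<psi> C1c_measurable(2)[OF \<rho>] M, of x]
      integrable_reflect_lborel[of "\<lambda>y. \<psi> (x - y) *\<^sub>R grad \<rho> y" x] by simp
  have i2: "integrable lborel (\<lambda>y. \<psi> x *\<^sub>R grad \<rho> y)" using C1c_L2(4)[OF \<rho>] by simp
  show "integrable lborel (\<lambda>y. (\<psi> (x - y) - \<psi> x) *\<^sub>R grad \<rho> y)"
    unfolding scaleR_diff_left by (intro Bochner_Integration.integrable_diff i1 i2)
  have "(\<integral>y. grad \<rho> y \<partial>lborel) \<bullet> v = 0" for v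
    using integral_grad_zero[OF \<rho>, of v] C1c_L2(4)[OF \<rho>] by simp
  then have z: "(\<integral>y. grad \<rho> y \<partial>lborel) = 0" by (metis inner_eq_zero_iff)
  have "grad (conv \<rho> \<psi>) x = (\<integral>y. \<psi> y *\<^sub>R grad \<rho> (x - y) \<partial>lborel)" by (rule conv_grad(1)[OF \<psi> \<rho>])
  also have "\<dots> = (\<integral>y. \<psi> (x - y) *\<^sub>R grad \<rho> y \<partial>lborel)"
    using integral_reflect_lborel[of "\<lambda>y. \<psi> (x - y) *\<^sub>R grad \<rho> y" x] by simp
  also have "\<dots> = (\<integral>y. (\<psi> (x - y) - \<psi> x) *\<^sub>R grad \<rho> y \<partial>lborel)"
    unfolding scaleR_diff_left using i1 i2 z by simp
  finally show "grad (conv \<rho> \<psi>) x = (\<integral>y. (\<psi> (x - y) - \<psi> x) *\<^sub>R grad \<rho> y \<partial>lborel)" .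
qed

text \<open>If \<open>norm a \<le> 2 * \<epsilon>\<close>, the slope \<open>1 / \<epsilon>\<close>
  of the truncation is compensated by the factor \<open>norm a\<close>. Otherwise the truncation
  vanishes at \<open>a\<close>, and a nonzero value at \<open>b\<close> forces a jump of at least
  \<open>\<epsilon>\<close>, so the quadratic term suffices. The linear term excludes
  \<open>a = 0\<close>, which is what later makes its measure factor tend to 0.\<close>

lemma truncation_increment:
  fixes a b :: "'a::euclidean_space"
  assumes "\<epsilon> > 0"
  shows "norm a * \<bar>max 0 (1 - norm b / \<epsilon>) - max 0 (1 - norm a / \<epsilon>)\<bar>
    \<le> 2 * (norm (b - a) * (if 0 < norm a \<and> norm a \<le> 2 * \<epsilon> then 1 else 0) + (norm (b - a))\<^sup>2 / \<epsilon>)"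
proof -
  define \<theta> where "\<theta> s = max 0 (1 - s / \<epsilon>)" for s
  have rhs: "norm (b - a) * (if 0 < norm a \<and> norm a \<le> 2 * \<epsilon> then 1 else 0) + (norm (b - a))\<^sup>2 / \<epsilon> \<ge> 0" using assms by simp
  have "norm a * \<bar>\<theta> (norm b) - \<theta> (norm a)\<bar> \<le> 2 * (norm (b - a) * (if 0 < norm a \<and> norm a \<le> 2 * \<epsilon> then 1 else 0) + (norm (b - a))\<^sup>2 / \<epsilon>)"
  proof (cases "norm a = 0")
    case True then show ?thesis using assms by simp
  next
    case a0: False
    show ?thesis
    proof (cases "norm a \<le> 2 * \<epsilon>")
      case True
      have "\<bar>\<theta> (norm b) - \<theta> (norm a)\<bar> \<le> \<bar>norm b / \<epsilon> - norm a / \<epsilon>\<bar>" by (auto simp: \<theta>_def)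
      also have "\<dots> = \<bar>norm b - norm a\<bar> / \<epsilon>" using assms by (simp flip: diff_divide_distrib)
      also have "\<dots> \<le> norm (b - a) / \<epsilon>" using assms by (intro divide_right_mono norm_triangle_ineq3) auto
      finally have "norm a * \<bar>\<theta> (norm b) - \<theta> (norm a)\<bar> \<le> (2 * \<epsilon>) * (norm (b - a) / \<epsilon>)"
        using True assms by (intro mult_mono) auto
      also have "\<dots> = 2 * norm (b - a)" using assms by simp
      finally have "norm a * \<bar>\<theta> (norm b) - \<theta> (norm a)\<bar> \<le> 2 * norm (b - a)" .
      moreover have "(norm (b - a))\<^sup>2 / \<epsilon> \<ge> 0" using assms by simp
      ultimately have "norm a * \<bar>\<theta> (norm b) - \<theta> (norm a)\<bar> \<le> 2 * (norm (b - a) * 1 + (norm (b - a))\<^sup>2 / \<epsilon>)" by argo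
      then show ?thesis using True a0 by simp
    next
      case False
      then have ta: "\<theta> (norm a) = 0" using assms by (simp add: \<theta>_def field_simps)
      show ?thesis
      proof (cases "norm b \<ge> \<epsilon>")
        case True
        then have "\<theta> (norm b) = 0" using assms by (simp add: \<theta>_def)
        then show ?thesis using ta rhs by simp
      next
        case b: False
        have d: "norm a \<le> norm (b - a) + norm b" using norm_triangle_ineq4[of b "b - a"] by simp
        then have d2: "norm a \<le> 2 * norm (b - a)" "\<epsilon> \<le> norm (b - a)" using False b by auto
        have "norm a * \<bar>\<theta> (norm b) - \<theta> (norm a)\<bar> \<le> norm a * 1"
          using assms by (intro mult_left_mono) (auto simp: ta, auto simp: \<theta>_def)
        also have "\<dots> \<le> 2 * (norm (b - a) * 1)" using d2 by simp
        also have "\<dots> \<le> 2 * (norm (b - a) * (norm (b - a) / \<epsilon>))"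
          using d2 assms by (intro mult_left_mono) auto
        finally show ?thesis using False by (simp add: power2_eq_square)
      qed
    qed
  qed
  then show ?thesis by (simp add: \<theta>_def)
qed

lemma truncation_le: "\<epsilon> > 0 \<Longrightarrow> t \<ge> 0 \<Longrightarrow> t * max 0 (1 - t / \<epsilon>) \<le> (\<epsilon>::real)"
proof (cases "t \<ge> \<epsilon>")
  case False
  assume "\<epsilon> > 0" "t \<ge> 0"
  then have "t * max 0 (1 - t / \<epsilon>) \<le> \<epsilon> * 1" using False by (intro mult_mono) auto
  then show ?thesis by simp
qed simp

text \<open>A vector field whose increments are controlled in \<open>L\<^sup>2\<close> (hence of class \<open>W\<^sup>1\<^sup>,\<^sup>2\<close>) has vanishing
  divergence almost everywhere on its zero set; the weak derivative itself is never constructed.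
  The test function is a mollification of a cutoff times \<open>max 0 (1 - \<bar>B\<bar> / \<epsilon>)\<close>.\<close>

lemma zero_set_null:
  fixes \<Omega> :: "(real^'n) set" and B :: "real^'n \<Rightarrow> real^'n" and b :: "real^'n \<Rightarrow> real"
  assumes LB: "L2 B" and b: "b \<in> borel_measurable borel" "\<And>x. \<bar>b x\<bar> \<le> b1" and b0: "b0 > 0" "AE x in lborel. x \<in> \<Omega> \<longrightarrow> b0 \<le> b x"
    and eq: "\<And>\<phi>. C1c \<Omega> \<phi> \<Longrightarrow> (\<integral>x. B x \<bullet> grad \<phi> x \<partial>lborel) = (\<integral>x. b x * \<phi> x \<partial>lborel)"
    and r: "r > 0" "cball x0 r \<subseteq> \<Omega>"
    and C: "C \<ge> 0" "\<And>y. norm y \<le> r \<Longrightarrow> n2 (\<lambda>x. indicat_real (cball x0 r) x *\<^sub>R (B (x + y) - B x)) \<le> C * (norm y)\<^sup>2"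
  shows "AE x in lborel. x \<in> ball x0 (r / 2) \<longrightarrow> B x \<noteq> 0"
proof -
  note [measurable] = L2_measurable[OF LB] b(1)
  obtain C\<rho> and \<rho> :: "real \<Rightarrow> real^'n \<Rightarrow> real" where \<rho>: "C\<rho> > 0" "\<And>h. h > 0 \<Longrightarrow> smooth (\<rho> h)" "\<And>h. h > 0 \<Longrightarrow> C1c UNIV (\<rho> h)"
    "\<And>h x. \<rho> h x \<ge> 0" "\<And>h x. h > 0 \<Longrightarrow> h \<le> norm x \<Longrightarrow> \<rho> h x = 0" "\<And>h x. h > 0 \<Longrightarrow> norm x < h \<Longrightarrow> \<rho> h x > 0" 
    "\<And>h. h > 0 \<Longrightarrow> (\<integral>x. \<rho> h x \<partial>lborel) = 1" "\<And>h. h > 0 \<Longrightarrow> (\<integral>x. norm (grad (\<rho> h) x) \<partial>lborel) \<le> C\<rho> / h"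
    using mollifier_family by blast
  define Q where "Q = cball x0 r"
  have Qb [measurable]: "Q \<in> sets borel" by (simp add: Q_def)
  define V where "V = measure lborel Q"
  have V: "V \<ge> 0" by (simp add: V_def)
  define \<zeta> where "\<zeta> x = \<rho> (r / 2) (x0 - x)" for x
  have r2: "r / 2 > 0" using r by simp
  have \<zeta>: "C1c (cball x0 (r / 2)) \<zeta>"
    unfolding \<zeta>_def by (rule C1c_reflect(1)[OF \<rho>(3) \<rho>(5)]) (use r in auto)
  note [measurable] = C1c_measurable[OF \<zeta>]
  have \<zeta>nn: "\<zeta> x \<ge> 0" for x using \<rho>(4) by (simp add: \<zeta>_def)
  have \<zeta>off: "\<zeta> x = 0" if "x \<notin> cball x0 (r / 2)" for x by (rule C1c_zero_off(1)[OF \<zeta> that])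
  have \<zeta>pos: "\<zeta> x > 0" if "x \<in> ball x0 (r / 2)" for x using that \<rho>(6)[OF r2, of "x0 - x"] by (simp add: \<zeta>_def dist_norm)
  obtain M where M: "M \<ge> 0" "\<And>x. \<bar>\<zeta> x\<bar> \<le> M" "\<And>x. norm (grad \<zeta> x) \<le> M" using C1c_bounded[OF \<zeta>] by blast
  have M': "\<bar>\<zeta> x - \<zeta> y\<bar> \<le> M * norm (x - y)" for x y by (rule C1c_Lipschitz[OF \<zeta> M(3)])
  define E where "E \<epsilon> = {x \<in> Q. 0 < norm (B x) \<and> norm (B x) \<le> 2 * \<epsilon>}" for \<epsilon>
  have Eb [measurable]: "E \<epsilon> \<in> sets borel" for \<epsilon> unfolding E_def by measurable
  define m where "m \<epsilon> = measure lborel (E \<epsilon>)" for \<epsilon>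
  define J where "J = (\<integral>x. \<zeta> x * indicat_real {x. B x = 0} x \<partial>lborel)"
  \<comment> \<open>Every term on the right tends to 0 with \<open>\<epsilon>\<close>, whereas the
    left-hand side does not involve \<open>\<epsilon>\<close>.\<close>
  have main: "b0 * J \<le> C\<rho> * (2 * M * (sqrt C * sqrt (m \<epsilon>) + C * \<epsilon>) + M * \<epsilon> * V)" if \<epsilon>: "\<epsilon> > 0" for \<epsilon>
  proof -
    \<comment> \<open>A mollification radius of order \<open>\<epsilon>\<^sup>2\<close> turns the
      quadratic error \<open>C * h\<^sup>2 / \<epsilon>\<close> into at most
      \<open>C * h * \<epsilon>\<close>.\<close>
    define h where "h = min (r / 2) (\<epsilon>\<^sup>2)"
    have h: "h > 0" "h \<le> r / 2" "h \<le> \<epsilon>\<^sup>2" using r \<epsilon> by (auto simp: h_def)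
    define \<theta> where "\<theta> s = max 0 (1 - s / \<epsilon>)" for s
    have \<theta>: "0 \<le> \<theta> s" "s \<ge> 0 \<Longrightarrow> \<theta> s \<le> 1" for s using \<epsilon> by (auto simp: \<theta>_def)
    have [measurable]: "\<theta> \<in> borel_measurable borel" unfolding \<theta>_def by measurable
    define \<psi> where "\<psi> x = \<zeta> x * \<theta> (norm (B x))" for x
    have [measurable]: "\<psi> \<in> borel_measurable borel" unfolding \<psi>_def by measurable
    have \<psi>nn: "\<psi> x \<ge> 0" for x using \<zeta>nn \<theta> by (simp add: \<psi>_def)
    have \<psi>M: "norm (\<psi> x) \<le> M" for x
      using mult_mono[of "\<zeta> x" M "\<theta> (norm (B x))" 1] M(1) M(2)[of x] \<theta>[of "norm (B x)"] \<psi>nn[of x] by (simp add: \<psi>_def)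
    have \<psi>off: "\<psi> x = 0" if "x \<notin> cball x0 (r / 2)" for x using \<zeta>off[OF that] by (simp add: \<psi>_def)
    have i\<psi>: "integrable lborel \<psi>"
      by (rule L2_bounded_compact_support(2)[OF _ compact_cball \<psi>off \<psi>M]) measurable
    define \<phi> where "\<phi> = conv (\<rho> h) \<psi>"
    have \<phi>off: "\<phi> x = 0" if "x \<notin> Q" for x unfolding \<phi>_def
    proof (rule conv_zero_off[OF \<rho>(5)[OF h(1)]])
      show "\<psi> y = 0" if "dist x y < h" for y
      proof (rule \<psi>off, rule notI)
        assume "y \<in> cball x0 (r / 2)"
        then have "dist x0 x \<le> r" using that h(2) dist_triangle[of x0 x y] by (simp add: dist_commute)
        then show False using \<open>x \<notin> Q\<close> by (simp add: Q_def)
      qed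
    qed
    have \<phi>: "C1c \<Omega> \<phi>"
      by (rule C1cI(1)[OF conv_grad(3)[OF i\<psi> \<rho>(3)[OF h(1)], folded \<phi>_def] conv_grad(2)[OF i\<psi> \<rho>(3)[OF h(1)], folded \<phi>_def], where K=Q])
        (use r(2) \<phi>off in \<open>auto simp: Q_def\<close>)
    note [measurable] = C1c_measurable[OF \<phi>] C1c_measurable[OF \<rho>(3)[OF h(1)]]
    have \<phi>nn: "\<phi> x \<ge> 0" for x unfolding \<phi>_def by (intro conv_nonneg \<rho> \<psi>nn)
    have ib: "integrable lborel (\<lambda>x. b x * \<phi> x)"
      by (rule integrable_dominated_real[where g="\<lambda>x. b1 * norm (\<phi> x)"])
        (use C1c_L2(3)[OF \<phi>] b(2) in \<open>auto simp: abs_mult intro!: mult_right_mono\<close>)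
    \<comment> \<open>On the zero set the truncation equals 1, so \<open>\<psi>\<close> dominates
      the cutoff there. Mollification keeps the integral of \<open>\<psi>\<close>, and the lower
      bound \<open>b0\<close> of the right-hand side gives the rest.\<close>
    have "b0 * J \<le> b0 * (\<integral>x. \<psi> x \<partial>lborel)"
      unfolding J_def
    proof (intro mult_left_mono integral_mono)
      show "integrable lborel (\<lambda>x. \<zeta> x * indicat_real {x. B x = 0} x)"
        by (rule integrable_dominated_real[OF integrable_norm[OF C1c_L2(3)[OF \<zeta>]]]) (auto simp: indicator_def)
      show "\<zeta> x * indicat_real {x. B x = 0} x \<le> \<psi> x" for x using \<psi>nn[of x] by (auto simp: indicator_def \<psi>_def \<theta>_def)
    qed (use i\<psi> b0 in auto)
    also have "(\<integral>x. \<psi> x \<partial>lborel) = (\<integral>x. \<phi> x \<partial>lborel)"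
      unfolding \<phi>_def by (rule conv_integral[OF i\<psi> \<psi>nn \<rho>(3)[OF h(1)] \<rho>(4) \<rho>(7)[OF h(1)], symmetric])
        (use C1c_L2(3)[OF \<phi>] in \<open>simp add: \<phi>_def\<close>)
    also have "b0 * (\<integral>x. \<phi> x \<partial>lborel) = (\<integral>x. b0 * \<phi> x \<partial>lborel)" by simp
    also have "\<dots> \<le> (\<integral>x. b x * \<phi> x \<partial>lborel)"
    proof (rule integral_mono_AE[OF _ ib])
      show "AE x in lborel. b0 * \<phi> x \<le> b x * \<phi> x"
        using b0(2)
      proof eventually_elim
        case (elim x)
        show ?case
        proof (cases "x \<in> \<Omega>")
          case True then show ?thesis using elim \<phi>nn by (intro mult_right_mono) auto
        qed (simp add: C1c_zero_off[OF \<phi>])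
      qed
    qed (use C1c_L2(3)[OF \<phi>] in simp)
    also have "\<dots> = (\<integral>x. B x \<bullet> grad \<phi> x \<partial>lborel)" by (rule eq[OF \<phi>, symmetric])
    finally have lower: "b0 * J \<le> (\<integral>x. B x \<bullet> grad \<phi> x \<partial>lborel)" .
    \<comment> \<open>The increments of \<open>\<psi>\<close>, weighted by
      \<open>norm (B x)\<close>, have integral at most \<open>h * T\<close>; this factor
      \<open>h\<close> cancels against the growth \<open>C\<rho> / h\<close> of the kernel's
      gradient.\<close>
    define T where "T = 2 * M * (sqrt C * sqrt (m \<epsilon>) + C * \<epsilon>) + M * \<epsilon> * V"
    have T: "T \<ge> 0" using M(1) C(1) \<epsilon> V by (simp add: T_def m_def)
    have inc: "(\<integral>\<^sup>+x. ennreal (norm (B x) * \<bar>\<psi> (x - y) - \<psi> x\<bar>) \<partial>lborel) \<le> ennreal (h * T)" if y: "norm y \<le> h" for y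
    proof -
      define \<delta> where "\<delta> x = indicat_real Q x *\<^sub>R (B (x + - y) - B x)" for x
      have L\<delta>: "L2 \<delta>" unfolding \<delta>_def
        by (rule L2_bounded_scaleR[OF L2_diff[OF L2_translate(1)[OF LB] LB], where C=1]) auto
      have n\<delta>: "n2 \<delta> \<le> C * (norm y)\<^sup>2" unfolding \<delta>_def Q_def using C(2)[of "- y"] y h(2) r(1) by simp
      have LE: "L2 (indicat_real (E \<epsilon>))"
        by (rule L2_bounded_compact_support(1)[OF _ compact_cball[of x0 r], where M=1]) (auto simp: E_def Q_def indicator_def)
      have nE: "n2 (indicat_real (E \<epsilon>)) = m \<epsilon>"
      proof -
        have "(\<lambda>x. (norm (indicat_real (E \<epsilon>) x))\<^sup>2) = indicat_real (E \<epsilon>)" by (auto simp: indicator_def)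
        then show ?thesis unfolding n2_def m_def by simp
      qed
      define G where "G x = 2 * M * (norm (\<delta> x) * indicat_real (E \<epsilon>) x + (norm (\<delta> x))\<^sup>2 / \<epsilon>) + M * norm y * \<epsilon> * indicat_real Q x" for x
      have pw: "norm (B x) * \<bar>\<psi> (x - y) - \<psi> x\<bar> \<le> G x" for x
      proof (cases "x \<in> Q")
        case False
        then have far: "dist x0 x > r" by (simp add: Q_def)
        then have "x \<notin> cball x0 (r / 2)" using r by simp
        moreover have "x - y \<notin> cball x0 (r / 2)"
          using far y h(2) norm_triangle_ineq4[of "x0 - (x - y)" y] by (auto simp: dist_norm)
        ultimately have "\<psi> (x - y) - \<psi> x = 0" using \<psi>off by simp
        moreover have "G x \<ge> 0" using M(1) \<epsilon> by (simp add: G_def)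
        ultimately show ?thesis by simp
      next
        case True
        have \<delta>: "\<delta> x = B (x - y) - B x" using True by (simp add: \<delta>_def)
        have ind: "(if 0 < norm (B x) \<and> norm (B x) \<le> 2 * \<epsilon> then 1 else 0) = indicat_real (E \<epsilon>) x"
          using True by (simp add: E_def indicator_def)
        \<comment> \<open>Discrete product rule: the change of the truncation is handled by
          \<open>truncation_increment\<close>, the change of the cutoff by its Lipschitz bound and
          the smallness of \<open>norm (B x) * \<theta> (norm (B x))\<close>.\<close>
        have "\<psi> (x - y) - \<psi> x = \<zeta> (x - y) * (\<theta> (norm (B (x - y))) - \<theta> (norm (B x))) + (\<zeta> (x - y) - \<zeta> x) * \<theta> (norm (B x))"
          by (simp add: \<psi>_def algebra_simps)
        then have "\<bar>\<psi> (x - y) - \<psi> x\<bar> \<le> \<zeta> (x - y) * \<bar>\<theta> (norm (B (x - y))) - \<theta> (norm (B x))\<bar> + \<bar>\<zeta> (x - y) - \<zeta> x\<bar> * \<theta> (norm (B x))"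
          using abs_triangle_ineq[of "\<zeta> (x - y) * (\<theta> (norm (B (x - y))) - \<theta> (norm (B x)))" "(\<zeta> (x - y) - \<zeta> x) * \<theta> (norm (B x))"]
            \<zeta>nn[of "x - y"] \<theta>(1)[of "norm (B x)"] by (simp add: abs_mult)
        then have "norm (B x) * \<bar>\<psi> (x - y) - \<psi> x\<bar> \<le> norm (B x) * (\<zeta> (x - y) * \<bar>\<theta> (norm (B (x - y))) - \<theta> (norm (B x))\<bar> + \<bar>\<zeta> (x - y) - \<zeta> x\<bar> * \<theta> (norm (B x)))"
          by (intro mult_left_mono) auto
        also have "\<dots> = \<zeta> (x - y) * (norm (B x) * \<bar>\<theta> (norm (B (x - y))) - \<theta> (norm (B x))\<bar>) + \<bar>\<zeta> (x - y) - \<zeta> x\<bar> * (norm (B x) * \<theta> (norm (B x)))"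
          by (simp add: algebra_simps)
        also have "\<dots> \<le> M * (2 * (norm (\<delta> x) * indicat_real (E \<epsilon>) x + (norm (\<delta> x))\<^sup>2 / \<epsilon>)) + (M * norm y) * \<epsilon>"
        proof (rule add_mono[OF mult_mono mult_mono])
          show "norm (B x) * \<bar>\<theta> (norm (B (x - y))) - \<theta> (norm (B x))\<bar> \<le> 2 * (norm (\<delta> x) * indicat_real (E \<epsilon>) x + (norm (\<delta> x))\<^sup>2 / \<epsilon>)"
            using truncation_increment[OF \<epsilon>, of "B x" "B (x - y)"] unfolding ind \<theta>_def \<delta> .
          show "\<zeta> (x - y) \<le> M" using M(2)[of "x - y"] by simp
          show "\<bar>\<zeta> (x - y) - \<zeta> x\<bar> \<le> M * norm y" using M'[of "x - y" x] by simp
          show "norm (B x) * \<theta> (norm (B x)) \<le> \<epsilon>" unfolding \<theta>_def by (rule truncation_le[OF \<epsilon>]) simp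
        qed (use M(1) \<theta>(1) \<zeta>nn in \<open>auto intro!: mult_nonneg_nonneg\<close>)
        also have "\<dots> = G x" using True by (simp add: G_def)
        finally show ?thesis .
      qed
      note i1 = L2_mult_integrable[OF L2_norm[OF L\<delta>] LE] and i2 = L2_integrable[OF L\<delta>]
        and i3 = integrable_indicator_compact[OF compact_cball[of x0 r], folded Q_def]
      have iG: "integrable lborel G" unfolding G_def using i1 i2 i3 by auto
      have "(\<integral>\<^sup>+x. ennreal (norm (B x) * \<bar>\<psi> (x - y) - \<psi> x\<bar>) \<partial>lborel) \<le> (\<integral>\<^sup>+x. ennreal (G x) \<partial>lborel)"
        by (intro nn_integral_mono ennreal_leI pw)
      also have "\<dots> = ennreal (\<integral>x. G x \<partial>lborel)"
        by (rule nn_integral_eq_integral[OF iG]) (use M(1) \<epsilon> in \<open>auto simp: G_def\<close>)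
      also have "(\<integral>x. G x \<partial>lborel) = 2 * M * ((\<integral>x. norm (\<delta> x) * indicat_real (E \<epsilon>) x \<partial>lborel) + n2 \<delta> / \<epsilon>) + M * norm y * \<epsilon> * V"
        unfolding G_def using i1 i2 i3 by (simp add: n2_def V_def)
      also have "\<dots> \<le> 2 * M * (sqrt C * h * sqrt (m \<epsilon>) + C * h * \<epsilon>) + M * h * \<epsilon> * V"
      proof (intro add_mono mult_left_mono mult_right_mono)
        have "(\<integral>x. norm (\<delta> x) * indicat_real (E \<epsilon>) x \<partial>lborel) \<le> sqrt (n2 (\<lambda>x. norm (\<delta> x))) * sqrt (n2 (indicat_real (E \<epsilon>)))"
          using L2_Cauchy_Schwarz_abs[OF L2_norm[OF L\<delta>] LE] by simp
        also have "n2 (\<lambda>x. norm (\<delta> x)) = n2 \<delta>" by (simp add: n2_def)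
        also have "sqrt (n2 \<delta>) \<le> sqrt C * h"
        proof -
          have "sqrt (n2 \<delta>) \<le> sqrt (C * (norm y)\<^sup>2)" using n\<delta> by simp
          also have "\<dots> = sqrt C * norm y" by (simp add: real_sqrt_mult)
          also have "\<dots> \<le> sqrt C * h" using y C(1) by (intro mult_left_mono) auto
          finally show ?thesis .
        qed
        finally show "(\<integral>x. norm (\<delta> x) * indicat_real (E \<epsilon>) x \<partial>lborel) \<le> sqrt C * h * sqrt (m \<epsilon>)"
          by (simp add: nE mult_right_mono m_def)
        have "n2 \<delta> / \<epsilon> \<le> C * h\<^sup>2 / \<epsilon>"
          using n\<delta> y C(1) \<epsilon> by (intro divide_right_mono order_trans[OF n\<delta>] mult_left_mono power_mono) auto
        also have "\<dots> = C * h * (h / \<epsilon>)" by (simp add: power2_eq_square)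
        also have "\<dots> \<le> C * h * \<epsilon>"
          using h \<epsilon> C(1) by (intro mult_left_mono) (auto simp: field_simps power2_eq_square)
        finally show "n2 \<delta> / \<epsilon> \<le> C * h * \<epsilon>" .
      qed (use M(1) y \<epsilon> V in auto)
      also have "\<dots> = h * T" by (simp add: T_def algebra_simps)
      finally show ?thesis by (simp add: ennreal_leI)
    qed
    have iBg: "integrable lborel (\<lambda>x. B x \<bullet> grad \<phi> x)" by (rule L2_inner_integrable[OF LB C1c_L2(2)[OF \<phi>]])
    have goff: "grad (\<rho> h) y = 0" if "norm y > h" for y
      by (rule grad_zero_off[of "cball 0 h"]) (use \<rho>(5)[OF h(1)] that in auto)
    have "ennreal (norm (\<integral>x. B x \<bullet> grad \<phi> x \<partial>lborel)) \<le> (\<integral>\<^sup>+x. ennreal (norm (B x \<bullet> grad \<phi> x)) \<partial>lborel)"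
      by (rule integral_norm_bound_ennreal[OF iBg])
    also have "\<dots> \<le> (\<integral>\<^sup>+x. \<integral>\<^sup>+y. ennreal (norm (B x) * \<bar>\<psi> (x - y) - \<psi> x\<bar> * norm (grad (\<rho> h) y)) \<partial>lborel \<partial>lborel)"
    proof (rule nn_integral_mono)
      fix x
      note ci = conv_grad_increment[OF i\<psi> \<rho>(3)[OF h(1)], of x, folded \<phi>_def]
      have "ennreal (norm (B x \<bullet> grad \<phi> x)) \<le> ennreal (norm (B x)) * ennreal (norm (grad \<phi> x))"
        by (simp add: Cauchy_Schwarz_ineq2 ennreal_leI flip: ennreal_mult)
      also have "\<dots> \<le> ennreal (norm (B x)) * (\<integral>\<^sup>+y. ennreal (norm ((\<psi> (x - y) - \<psi> x) *\<^sub>R grad (\<rho> h) y)) \<partial>lborel)"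
        unfolding ci(2) by (intro mult_left_mono integral_norm_bound_ennreal ci(1)) auto
      also have "\<dots> = (\<integral>\<^sup>+y. ennreal (norm (B x)) * ennreal (norm ((\<psi> (x - y) - \<psi> x) *\<^sub>R grad (\<rho> h) y)) \<partial>lborel)"
        by (rule nn_integral_cmult[symmetric]) measurable
      also have "\<dots> = (\<integral>\<^sup>+y. ennreal (norm (B x) * \<bar>\<psi> (x - y) - \<psi> x\<bar> * norm (grad (\<rho> h) y)) \<partial>lborel)"
        by (intro nn_integral_cong) (simp add: mult.assoc flip: ennreal_mult)
      finally show "ennreal (norm (B x \<bullet> grad \<phi> x)) \<le> (\<integral>\<^sup>+y. ennreal (norm (B x) * \<bar>\<psi> (x - y) - \<psi> x\<bar> * norm (grad (\<rho> h) y)) \<partial>lborel)" .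
    qed
    also have "\<dots> = (\<integral>\<^sup>+y. \<integral>\<^sup>+x. ennreal (norm (B x) * \<bar>\<psi> (x - y) - \<psi> x\<bar> * norm (grad (\<rho> h) y)) \<partial>lborel \<partial>lborel)"
      by (rule lborel_pair.Fubini') simp
    also have "\<dots> \<le> (\<integral>\<^sup>+y. ennreal (h * T) * ennreal (norm (grad (\<rho> h) y)) \<partial>lborel)"
    proof (rule nn_integral_mono)
      fix y
      show "(\<integral>\<^sup>+x. ennreal (norm (B x) * \<bar>\<psi> (x - y) - \<psi> x\<bar> * norm (grad (\<rho> h) y)) \<partial>lborel) \<le> ennreal (h * T) * ennreal (norm (grad (\<rho> h) y))"
      proof (cases "norm y \<le> h")
        case True
        have "(\<integral>\<^sup>+x. ennreal (norm (B x) * \<bar>\<psi> (x - y) - \<psi> x\<bar> * norm (grad (\<rho> h) y)) \<partial>lborel)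
          = (\<integral>\<^sup>+x. ennreal (norm (B x) * \<bar>\<psi> (x - y) - \<psi> x\<bar>) \<partial>lborel) * ennreal (norm (grad (\<rho> h) y))"
          by (subst nn_integral_multc[symmetric]) (auto simp: ennreal_mult)
        also have "\<dots> \<le> ennreal (h * T) * ennreal (norm (grad (\<rho> h) y))" by (intro mult_right_mono inc[OF True]) auto
        finally show ?thesis .
      qed (simp add: goff)
    qed
    also have "\<dots> = ennreal (h * T) * ennreal (\<integral>y. norm (grad (\<rho> h) y) \<partial>lborel)"
      using nn_integral_eq_integral[OF integrable_norm[OF C1c_L2(4)[OF \<rho>(3)[OF h(1)]]]]
      by (simp add: nn_integral_cmult)
    also have "\<dots> = ennreal (h * T * (\<integral>y. norm (grad (\<rho> h) y) \<partial>lborel))"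
      using h(1) T by (simp add: ennreal_mult)
    finally have "norm (\<integral>x. B x \<bullet> grad \<phi> x \<partial>lborel) \<le> h * T * (\<integral>y. norm (grad (\<rho> h) y) \<partial>lborel)"
      using h(1) T by (subst (asm) ennreal_le_iff) auto
    also have "\<dots> \<le> h * T * (C\<rho> / h)" using h(1) T by (intro mult_left_mono \<rho>(8)) auto
    also have "\<dots> = C\<rho> * T" using h(1) by simp
    finally show ?thesis using lower by (simp add: T_def)
  qed
  \<comment> \<open>No point lies in all the sets: where \<open>B x = 0\<close> it lies in none, and
    otherwise \<open>2 * \<epsilon>\<close> eventually drops below
    \<open>norm (B x)\<close>.\<close>
  have mlim: "(\<lambda>k. m (inverse (real (Suc k)))) \<longlonglongrightarrow> 0"
  proof -
    have "(\<lambda>k. \<integral>x. indicat_real (E (inverse (real (Suc k)))) x \<partial>lborel) \<longlonglongrightarrow> (\<integral>x. 0 \<partial>(lborel::(real^'n) measure))"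
    proof (rule integral_dominated_convergence[where w="indicat_real Q"])
      show "integrable lborel (indicat_real Q)" unfolding Q_def by (rule integrable_indicator_compact) simp
      show "AE x in lborel. norm (indicat_real (E (inverse (real (Suc k)))) x) \<le> indicat_real Q x" for k
        by (auto simp: E_def indicator_def)
      show "AE x in lborel. (\<lambda>k. indicat_real (E (inverse (real (Suc k)))) x) \<longlonglongrightarrow> 0"
      proof (intro AE_I2 tendsto_eventually)
        fix x
        show "\<forall>\<^sub>F k in sequentially. indicat_real (E (inverse (real (Suc k)))) x = 0"
        proof (cases "norm (B x) = 0")
          case True then show ?thesis by (simp add: E_def)
        next
          case False
          then have "norm (B x) / 2 > 0" by simp
          from order_tendstoD(2)[OF LIMSEQ_inverse_real_of_nat this] show ?thesis
            by eventually_elim (auto simp: E_def indicator_def)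
        qed
      qed
    qed auto
    then show ?thesis by (simp add: m_def)
  qed
  have "b0 * J \<le> C\<rho> * (2 * M * (sqrt C * sqrt 0 + C * 0) + M * 0 * V)"
  proof (rule LIMSEQ_le_const)
    show "(\<lambda>k. C\<rho> * (2 * M * (sqrt C * sqrt (m (inverse (real (Suc k)))) + C * inverse (real (Suc k))) + M * inverse (real (Suc k)) * V))
      \<longlonglongrightarrow> C\<rho> * (2 * M * (sqrt C * sqrt 0 + C * 0) + M * 0 * V)"
      by (intro tendsto_intros mlim LIMSEQ_inverse_real_of_nat)
    show "\<exists>N. \<forall>k\<ge>N. b0 * J \<le> C\<rho> * (2 * M * (sqrt C * sqrt (m (inverse (real (Suc k)))) + C * inverse (real (Suc k))) + M * inverse (real (Suc k)) * V)"
      using main by auto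
  qed
  then have "J \<le> 0" using b0(1) by (simp add: mult_le_0_iff)
  moreover have iJ: "integrable lborel (\<lambda>x. \<zeta> x * indicat_real {x. B x = 0} x)"
    by (rule integrable_dominated_real[OF integrable_norm[OF C1c_L2(3)[OF \<zeta>]]]) (auto simp: indicator_def)
  moreover have nn: "\<zeta> x * indicat_real {x. B x = 0} x \<ge> 0" for x using \<zeta>nn by simp
  moreover have "J \<ge> 0" unfolding J_def by (simp add: \<zeta>nn)
  ultimately have "J = 0" by simp
  then have "AE x in lborel. \<zeta> x * indicat_real {x. B x = 0} x = 0"
    unfolding J_def using integral_nonneg_eq_0_iff_AE[OF iJ] nn by simp
  then show ?thesis
  proof eventually_elim
    case (elim x)
    then show ?case using \<zeta>pos[of x] by (auto simp: indicator_def)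
  qed
qed

context finsler begin

text \<open>Since \<open>FA F 0 = 0\<close>, it is enough that \<open>FA F (g x)\<close> is nonzero.
  Each point of the domain has a ball where this holds almost everywhere, and by Lindelof countably
  many of these balls suffice.\<close>

theorem gradient_nonzero_AE:
  fixes \<Omega> :: "(real^'n) set" and c L K :: real and f :: "real \<Rightarrow> real"
  assumes \<Omega>: "open \<Omega>" and H: "H0 \<Omega> u g"
    and c: "c > 0" "\<And>\<xi> \<eta>. (FA F \<xi> - FA F \<eta>) \<bullet> (\<xi> - \<eta>) \<ge> c * (norm (\<xi> - \<eta>))\<^sup>2"
    and L: "L > 0" "\<And>\<xi> \<eta>. norm (FA F \<xi> - FA F \<eta>) \<le> L * norm (\<xi> - \<eta>)"
    and f: "K \<ge> 0" "\<And>s t. \<bar>f s - f t\<bar> \<le> K * \<bar>s - t\<bar>" "\<And>s. \<bar>f s\<bar> \<le> b1"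
    and eq: "\<And>\<phi>. C1c \<Omega> \<phi> \<Longrightarrow> (\<integral>x. FA F (g x) \<bullet> grad \<phi> x \<partial>lborel) = (\<integral>x. f (u x) * \<phi> x \<partial>lborel)"
    and b0: "b0 > 0" "AE x in lborel. x \<in> \<Omega> \<longrightarrow> b0 \<le> f (u x)"
  shows "AE x in lborel. x \<in> \<Omega> \<longrightarrow> g x \<noteq> 0"
proof -
  note Lu = H0_D(1,2)[OF H]
  note [measurable] = L2_measurable[OF Lu(1)] L2_measurable[OF Lu(2)]
  have fc: "continuous_on UNIV f"
    by (rule lipschitz_on_continuous_on[of K]) (use f in \<open>auto simp: lipschitz_on_def dist_real_def\<close>)
  then have [measurable]: "f \<in> borel_measurable borel" by (rule borel_measurable_continuous_onI)
  have LB: "L2 (\<lambda>x. FA F (g x))"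
    by (rule L2_dominated[OF Lu(2), where C=L]) (use L(2)[of _ 0] in auto)
  have loc: "\<exists>r>0. AE x in lborel. x \<in> ball x0 r \<longrightarrow> FA F (g x) \<noteq> 0" if x0: "x0 \<in> \<Omega>" for x0
  proof -
    obtain s where s: "s > 0" "cball x0 s \<subseteq> \<Omega>" using \<Omega> x0 open_contains_cball by blast
    define r where "r = s / 4"
    have r: "r > 0" "cball x0 (4 * r) \<subseteq> \<Omega>" using s by (auto simp: r_def)
    obtain C where C: "C \<ge> 0" "\<And>y. norm y \<le> r \<Longrightarrow>
       n2 (\<lambda>x. indicat_real (cball x0 r) x *\<^sub>R (FA F (g (x + y)) - FA F (g x))) \<le> C * (norm y)\<^sup>2"
      using increment_estimate[OF \<Omega> H c L f(1,2) eq r] by blast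
    have sub: "cball x0 r \<subseteq> \<Omega>" using r by (auto simp: subset_iff)
    have "AE x in lborel. x \<in> ball x0 (r / 2) \<longrightarrow> FA F (g x) \<noteq> 0"
      by (rule zero_set_null[OF LB _ _ b0 eq r(1) sub C]) (use f(3) in auto)
    then show ?thesis using r(1) by (intro exI[of _ "r / 2"]) auto
  qed
  then have "\<forall>x0\<in>\<Omega>. \<exists>r. r > 0 \<and> (AE x in lborel. x \<in> ball x0 r \<longrightarrow> FA F (g x) \<noteq> 0)" by blast
  from bchoice[OF this] obtain r
    where "\<forall>x0\<in>\<Omega>. r x0 > 0 \<and> (AE x in lborel. x \<in> ball x0 (r x0) \<longrightarrow> FA F (g x) \<noteq> 0)" by (rule exE)
  then have r: "\<And>x. x \<in> \<Omega> \<Longrightarrow> r x > 0" "\<And>x0. x0 \<in> \<Omega> \<Longrightarrow> AE x in lborel. x \<in> ball x0 (r x0) \<longrightarrow> FA F (g x) \<noteq> 0"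
    by simp_all
  define \<F> where "\<F> = (\<lambda>x. ball x (r x)) ` \<Omega>"
  obtain \<F>' where F': "\<F>' \<subseteq> \<F>" "countable \<F>'" "\<Union>\<F>' = \<Union>\<F>" using Lindelof[of \<F>] by (auto simp: \<F>_def)
  have "\<forall>U\<in>\<F>'. AE x in lborel. x \<in> U \<longrightarrow> FA F (g x) \<noteq> 0" using F'(1) r(2) by (auto simp: \<F>_def)
  then have "AE x in lborel. \<forall>U\<in>\<F>'. x \<in> U \<longrightarrow> FA F (g x) \<noteq> 0" by (subst AE_ball_countable[OF F'(2)])
  then show ?thesis
  proof eventually_elim
    case (elim x)
    show ?case
    proof
      assume x: "x \<in> \<Omega>"
      then have "x \<in> ball x (r x)" using r(1) by simp
      then have "x \<in> \<Union>\<F>" using x unfolding \<F>_def by blast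
      then have "FA F (g x) \<noteq> 0" using elim F'(3) by blast
      then show "g x \<noteq> 0" by auto
    qed
  qed
qed

end

section \<open>The exponential nonlinearity\<close>

definition trunc_exp :: "real \<Rightarrow> real \<Rightarrow> real" where "trunc_exp M s = exp (min s M)"
text \<open>The primitive of \<open>trunc_exp M\<close>: the exponential continued by its tangent at
  \<open>M\<close>. The constant -1 makes it vanish at 0 when \<open>M \<ge> 0\<close>, so that it
  is integrable along functions vanishing off the domain.\<close>

definition trunc_exp_int :: "real \<Rightarrow> real \<Rightarrow> real" where
  "trunc_exp_int M s = (if s \<le> M then exp s else exp M * (1 + s - M)) - 1"

lemma trunc_exp_bounds: "0 < trunc_exp M s" "trunc_exp M s \<le> exp M" "trunc_exp M s \<le> exp s"
  by (auto simp: trunc_exp_def)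

lemma trunc_exp_Lipschitz: "\<bar>trunc_exp M s - trunc_exp M t\<bar> \<le> exp M * \<bar>s - t\<bar>"
proof -
  have *: "exp a - exp b \<le> exp M * (a - b)" if "b \<le> a" "a \<le> M" for a b :: real
  proof -
    have "exp a * (1 + (b - a)) \<le> exp a * exp (b - a)" by (intro mult_left_mono exp_ge_add_one_self) auto
    then have "exp a - exp b \<le> exp a * (a - b)" by (simp add: algebra_simps flip: exp_add)
    also have "\<dots> \<le> exp M * (a - b)" using that by (intro mult_right_mono) auto
    finally show ?thesis .
  qed
  have **: "\<bar>trunc_exp M s - trunc_exp M t\<bar> \<le> exp M * \<bar>s - t\<bar>" if "t \<le> s" for s t
  proof -
    have m: "min t M \<le> min s M" "min s M \<le> M" "min s M - min t M \<le> s - t" using that by auto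
    have "exp (min s M) - exp (min t M) \<le> exp M * (min s M - min t M)" by (rule *[OF m(1,2)])
    also have "\<dots> \<le> exp M * (s - t)" using m(3) by (intro mult_left_mono) auto
    finally show ?thesis using m(1) that by (simp add: trunc_exp_def)
  qed
  show ?thesis using **[of s t] **[of t s] by (cases "t \<le> s") (auto simp: abs_minus_commute)
qed

lemma trunc_exp_int_0: "M \<ge> 0 \<Longrightarrow> trunc_exp_int M 0 = 0"
  by (simp add: trunc_exp_int_def)

text \<open>The supporting line at \<open>s\<close> is the tangent of the exponential at
  \<open>min s M\<close>; tangents taken at points up to \<open>M\<close> stay below both the
  exponential and its linear continuation.\<close>

lemma trunc_exp_int_convex: "trunc_exp_int M t \<ge> trunc_exp_int M s + trunc_exp M s * (t - s)"
proof -
  have tangent: "exp a * (1 + t - a) \<le> (if t \<le> M then exp t else exp M * (1 + t - M))" if "a \<le> M" for a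
  proof (cases "t \<le> M")
    case True
    have "exp a * (1 + (t - a)) \<le> exp a * exp (t - a)" by (intro mult_left_mono exp_ge_add_one_self) auto
    then show ?thesis using True by (simp add: algebra_simps flip: exp_add)
  next
    case False
    have "exp a * (1 + (M - a)) \<le> exp a * exp (M - a)" by (intro mult_left_mono exp_ge_add_one_self) auto
    then have 1: "exp a * (1 + (M - a)) \<le> exp M" by (simp flip: exp_add)
    have "exp a * (t - M) \<le> exp M * (t - M)" using False that by (intro mult_right_mono) auto
    with 1 show ?thesis using False by (simp add: algebra_simps)
  qed
  have "(if s \<le> M then exp s else exp M * (1 + s - M)) + trunc_exp M s * (t - s) = exp (min s M) * (1 + t - min s M)"
    by (auto simp: trunc_exp_def min_def algebra_simps)
  then show ?thesis using tangent[of "min s M"] by (simp add: trunc_exp_int_def)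
qed

text \<open>Convexity used at \<open>s\<close> and at \<open>t\<close> puts the remainder between 0
  and \<open>(trunc_exp M t - trunc_exp M s) * (t - s)\<close>.\<close>

lemma trunc_exp_int_quadratic:
  "\<bar>trunc_exp_int M t - trunc_exp_int M s - trunc_exp M s * (t - s)\<bar> \<le> exp M * (t - s)\<^sup>2"
proof -
  have "trunc_exp_int M t - trunc_exp_int M s - trunc_exp M s * (t - s) \<le> (trunc_exp M t - trunc_exp M s) * (t - s)"
    using trunc_exp_int_convex[of M t s] by (simp add: algebra_simps)
  also have "\<dots> \<le> \<bar>trunc_exp M t - trunc_exp M s\<bar> * \<bar>t - s\<bar>" by (simp flip: abs_mult)
  also have "\<dots> \<le> (exp M * \<bar>t - s\<bar>) * \<bar>t - s\<bar>" by (intro mult_right_mono trunc_exp_Lipschitz) auto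
  also have "\<dots> = exp M * (t - s)\<^sup>2" by (simp add: power2_eq_square flip: abs_mult)
  finally show ?thesis using trunc_exp_int_convex[of M s t] by simp
qed

section \<open>Comparison with supersolutions and the explicit barrier\<close>

context finsler begin

lemma FA_L2:
  assumes "\<And>\<xi> \<eta>. norm (FA F \<xi> - FA F \<eta>) \<le> L * norm (\<xi> - \<eta>)" "L2 h"
  shows "L2 (\<lambda>x::real^'n. FA F (h x))"
  by (rule L2_dominated[OF assms(2), where C=L]) (use L2_measurable[OF assms(2)] assms(1)[of _ 0] in auto)

text \<open>Subtracting \<open>min (v x) 0\<close> from both functions makes the first stay in
  W_0^{1,2} and the second nonnegative, as \<open>weak_comparison\<close> requires, while their
  difference and the difference of their gradients remain the same.\<close>

lemma solution_le_supersolution: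
  fixes \<Omega> :: "(real^'n) set" and c L K R :: real and f :: "real \<Rightarrow> real"
  assumes \<Omega>: "open \<Omega>" and R: "\<And>x. x \<in> \<Omega> \<Longrightarrow> norm x \<le> R" "R > 0"
    and c: "c > 0" "\<And>\<xi> \<eta>. (FA F \<xi> - FA F \<eta>) \<bullet> (\<xi> - \<eta>) \<ge> c * (norm (\<xi> - \<eta>))\<^sup>2"
    and L: "\<And>\<xi> \<eta>. norm (FA F \<xi> - FA F \<eta>) \<le> L * norm (\<xi> - \<eta>)"
    and f: "K \<ge> 0" "\<And>s t. \<bar>f s - f t\<bar> \<le> K * \<bar>s - t\<bar>" "K * (4 * R\<^sup>2) \<le> c / 8"
    and H: "H0 \<Omega> u g"
    and eq: "\<And>\<phi>. C1c \<Omega> \<phi> \<Longrightarrow> (\<integral>x. FA F (g x) \<bullet> grad \<phi> x \<partial>lborel) = (\<integral>x. f (u x) * \<phi> x \<partial>lborel)"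
    and v: "L2 v" "L2 gv" "\<And>x. x \<notin> \<Omega> \<Longrightarrow> v x = 0" "\<And>x. x \<notin> \<Omega> \<Longrightarrow> gv x = 0"
    and wv: "\<And>\<phi> i. C1c \<Omega> \<phi> \<Longrightarrow> (\<integral>x. v x * grad \<phi> x $ i \<partial>lborel) = - (\<integral>x. gv x $ i * \<phi> x \<partial>lborel)"
    and m: "H0 \<Omega> (\<lambda>x. min (v x) 0) h"
    and super: "\<And>\<psi>. test_fun \<Omega> \<psi> \<Longrightarrow> (\<And>x. \<psi> x \<ge> 0) \<Longrightarrow> (\<integral>x. FA F (gv x) \<bullet> grad \<psi> x \<partial>lborel) \<ge> (\<integral>x. f (v x) * \<psi> x \<partial>lborel)"
  shows "AE x in lborel. u x \<le> v x"
proof -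
  note Lu = H0_D(1,2)[OF H] and Lm = H0_D(1,2)[OF m]
  have fc: "continuous_on UNIV f"
    by (rule lipschitz_on_continuous_on[of K]) (use f in \<open>auto simp: lipschitz_on_def dist_real_def\<close>)
  then have [measurable]: "f \<in> borel_measurable borel" by (rule borel_measurable_continuous_onI)
  note [measurable] = L2_measurable[OF Lu(1)] L2_measurable[OF v(1)]
  define b where "b x = f (u x) - f (v x)" for x
  have Lb: "L2 b" by (rule L2_dominated[OF L2_diff[OF Lu(1) v(1)], where C=K]) (use f(2) in \<open>auto simp: b_def[abs_def]\<close>)
  define D where "D x = FA F (g x) - FA F (gv x)" for x
  have LA: "L2 (\<lambda>x. FA F (g x))" "L2 (\<lambda>x. FA F (gv x))" by (rule FA_L2[OF L Lu(2)], rule FA_L2[OF L v(2)])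
  have LD: "L2 D" unfolding D_def by (rule L2_diff[OF LA])
  have ineq: "(\<integral>x. D x \<bullet> grad \<phi> x \<partial>lborel) \<le> (\<integral>x. b x * \<phi> x \<partial>lborel)" if \<phi>: "C1c \<Omega> \<phi>" and nn: "\<And>x. \<phi> x \<ge> 0" for \<phi>
  proof (rule L2lim_extend_test[OF \<Omega> LD Lb \<phi>])
    fix \<psi> assume t: "test_fun \<Omega> \<psi>" and "(\<forall>x. \<phi> x \<ge> 0) \<longrightarrow> (\<forall>x. \<psi> x \<ge> 0)"
    then have pn: "\<psi> x \<ge> 0" for x using nn by blast
    note C = test_fun_C1c[OF t] note L\<psi> = C1c_L2[OF C]
    have i: "integrable lborel (\<lambda>x. f (h x) * \<psi> x)" if "L2 h" for h
    proof -
      have "L2 (\<lambda>x. f (h x) - f 0)"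
        by (rule L2_dominated[OF that, where C=K]) (use f(2)[of _ 0] L2_measurable[OF that] in auto)
      from L2_mult_integrable[OF this L\<psi>(1)] L\<psi>(3)
      have "integrable lborel (\<lambda>x. (f (h x) - f 0) * \<psi> x + f 0 * \<psi> x)" by auto
      then show ?thesis by (simp add: algebra_simps)
    qed
    have "(\<integral>x. D x \<bullet> grad \<psi> x \<partial>lborel) = (\<integral>x. FA F (g x) \<bullet> grad \<psi> x \<partial>lborel) - (\<integral>x. FA F (gv x) \<bullet> grad \<psi> x \<partial>lborel)"
      unfolding D_def inner_diff_left by (intro Bochner_Integration.integral_diff L2_inner_integrable LA L\<psi>)
    also have "\<dots> \<le> (\<integral>x. f (u x) * \<psi> x \<partial>lborel) - (\<integral>x. f (v x) * \<psi> x \<partial>lborel)"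
      using eq[OF C] super[OF t pn] by simp
    also have "\<dots> = (\<integral>x. b x * \<psi> x \<partial>lborel)"
      unfolding b_def left_diff_distrib by (intro Bochner_Integration.integral_diff[symmetric] i Lu v)
    finally show "(\<integral>x. D x \<bullet> grad \<psi> x \<partial>lborel) \<le> (\<integral>x. b x * \<psi> x \<partial>lborel)" .
  qed
  have "AE x in lborel. u x - min (v x) 0 \<le> v x - min (v x) 0"
  proof (rule weak_comparison[OF \<Omega> R H0_diff[OF H m] _ _ _ _ _ _ LD Lb ineq c(1) _ f(1) _ f(3)])
    show "L2 (\<lambda>x. v x - min (v x) 0)" "L2 (\<lambda>x. gv x - h x)" by (intro L2_diff v Lm)+
    show "0 \<le> v x - min (v x) 0" for x by simp
    show "v x - min (v x) 0 = 0" if "x \<notin> \<Omega>" for x using v(3)[OF that] by simp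
    show "gv x - h x = 0" if "x \<notin> \<Omega>" for x using v(4)[OF that] H0_D(4)[OF m that] by simp
    fix \<phi> i assume \<phi>: "C1c \<Omega> \<phi>"
    note L\<phi> = C1c_L2[OF \<phi>]
    have "(\<integral>y. (v y - min (v y) 0) * grad \<phi> y $ i \<partial>lborel) = (\<integral>y. v y * grad \<phi> y $ i \<partial>lborel) - (\<integral>y. min (v y) 0 * grad \<phi> y $ i \<partial>lborel)"
      unfolding left_diff_distrib by (intro Bochner_Integration.integral_diff L2_mult_integrable L2_nth v Lm L\<phi>)
    also have "\<dots> = - ((\<integral>y. gv y $ i * \<phi> y \<partial>lborel) - (\<integral>y. h y $ i * \<phi> y \<partial>lborel))"
      unfolding wv[OF \<phi>] H0_weak_grad[OF m \<phi>] by simp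
    also have "(\<integral>y. gv y $ i * \<phi> y \<partial>lborel) - (\<integral>y. h y $ i * \<phi> y \<partial>lborel) = (\<integral>y. (gv y - h y) $ i * \<phi> y \<partial>lborel)"
      unfolding vector_minus_component left_diff_distrib
      by (intro Bochner_Integration.integral_diff[symmetric] L2_mult_integrable L2_nth v Lm L\<phi>)
    finally show "(\<integral>y. (v y - min (v y) 0) * grad \<phi> y $ i \<partial>lborel) = - (\<integral>y. (gv y - h y) $ i * \<phi> y \<partial>lborel)" .
  next
    show "AE x in lborel. c * (norm (g x - h x - (gv x - h x)))\<^sup>2 \<le> D x \<bullet> (g x - h x - (gv x - h x))"
      using c(2) by (simp add: D_def)
    show "AE x in lborel. v x - min (v x) 0 < u x - min (v x) 0 \<longrightarrow> b x \<le> K * (u x - min (v x) 0 - (v x - min (v x) 0))"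
    proof (intro AE_I2 impI)
      fix x assume "v x - min (v x) 0 < u x - min (v x) 0"
      then show "b x \<le> K * (u x - min (v x) 0 - (v x - min (v x) 0))"
        using f(2)[of "u x" "v x"] by (simp add: b_def abs_le_iff)
    qed
  qed
  then show ?thesis by eventually_elim simp
qed

text \<open>Comparison of \<open>- u\<close> with 0: the sign of \<open>f\<close> already gives the
  inequality with zero right-hand side, so \<open>K = 0\<close> works.\<close>

lemma solution_nonneg:
  fixes \<Omega> :: "(real^'n) set" and c L R :: real and f :: "real \<Rightarrow> real"
  assumes \<Omega>: "open \<Omega>" and R: "\<And>x. x \<in> \<Omega> \<Longrightarrow> norm x \<le> R" "R > 0"
    and c: "c > 0" "\<And>\<xi> \<eta>. (FA F \<xi> - FA F \<eta>) \<bullet> (\<xi> - \<eta>) \<ge> c * (norm (\<xi> - \<eta>))\<^sup>2"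
    and L: "\<And>\<xi> \<eta>. norm (FA F \<xi> - FA F \<eta>) \<le> L * norm (\<xi> - \<eta>)"
    and f: "\<And>s. f s \<ge> 0"
    and H: "H0 \<Omega> u g"
    and eq: "\<And>\<phi>. C1c \<Omega> \<phi> \<Longrightarrow> (\<integral>x. FA F (g x) \<bullet> grad \<phi> x \<partial>lborel) = (\<integral>x. f (u x) * \<phi> x \<partial>lborel)"
  shows "AE x in lborel. 0 \<le> u x"
proof -
  have LA: "L2 (\<lambda>x. - FA F (g x))" by (rule L2_minus[OF FA_L2[OF L H0_D(2)[OF H]]])
  have "AE x in lborel. - u x \<le> (\<lambda>x. 0) x"
  proof (rule weak_comparison[OF \<Omega> R H0_minus[OF H] L2_zero _ _ _ _ _ LA L2_zero _ c(1), where K=0 and gq="\<lambda>x. 0"])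
    fix \<phi> assume \<phi>: "C1c \<Omega> \<phi>" "\<And>x. 0 \<le> \<phi> x"
    have "0 \<le> (\<integral>x. f (u x) * \<phi> x \<partial>lborel)" by (simp add: f \<phi>(2))
    then show "(\<integral>x. (- FA F (g x)) \<bullet> grad \<phi> x \<partial>lborel) \<le> (\<integral>x. 0 * \<phi> x \<partial>lborel)" using eq[OF \<phi>(1)] by simp
  next
    show "AE x in lborel. c * (norm (- g x - 0))\<^sup>2 \<le> (- FA F (g x)) \<bullet> (- g x - 0)" using c(2)[of _ 0] by simp
  qed (use c(1) in auto)
  then show ?thesis by eventually_elim simp
qed

text \<open>The field \<open>(- 2 * (x \<bullet> e)) *\<^sub>R e\<close> is the gradient of
  \<open>R\<^sup>2 - (x \<bullet> e)\<^sup>2\<close>. It takes values in one line, where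
  \<open>FA F\<close> is linear, so integration by parts gives a constant divergence, evaluated by
  \<open>FA F e \<bullet> e = (F e)\<^sup>2\<close>.\<close>

lemma quadratic_barrier:
  fixes \<Omega> :: "(real^'n) set"
  assumes e: "norm e = 1" and \<psi>: "C1c \<Omega> \<psi>"
  shows "(\<integral>x. FA F (indicat_real \<Omega> x *\<^sub>R ((- 2 * (x \<bullet> e)) *\<^sub>R e)) \<bullet> grad \<psi> x \<partial>lborel) = 2 * (F e)\<^sup>2 * (\<integral>x. \<psi> x \<partial>lborel)"
proof -
  have D: "((\<lambda>x. - 2 * (x \<bullet> e)) has_derivative (\<lambda>h. ((- 2) *\<^sub>R e) \<bullet> h)) (at x)" for x
    by (auto intro!: derivative_eq_intros simp: inner_commute)
  have "(\<integral>x. FA F (indicat_real \<Omega> x *\<^sub>R ((- 2 * (x \<bullet> e)) *\<^sub>R e)) \<bullet> grad \<psi> x \<partial>lborel) = (\<integral>x. (- 2 * (x \<bullet> e)) * (grad \<psi> x \<bullet> FA F e) \<partial>lborel)"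
  proof (rule Bochner_Integration.integral_cong[OF refl])
    fix x
    show "FA F (indicat_real \<Omega> x *\<^sub>R ((- 2 * (x \<bullet> e)) *\<^sub>R e)) \<bullet> grad \<psi> x = (- 2 * (x \<bullet> e)) * (grad \<psi> x \<bullet> FA F e)"
    proof (cases "x \<in> \<Omega>")
      case True
      then show ?thesis by (simp only: indicator_simps scaleR_one FA_scale) (simp add: inner_commute)
    qed (simp add: C1c_zero_off[OF \<psi>])
  qed
  also have "\<dots> = - (\<integral>x. \<psi> x * (((- 2) *\<^sub>R e) \<bullet> FA F e) \<partial>lborel)"
    by (rule integration_by_parts[OF D _ \<psi>]) auto
  also have "\<dots> = 2 * (F e)\<^sup>2 * (\<integral>x. \<psi> x \<partial>lborel)"
    using FA_inner_self[of e] by (simp add: inner_commute)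
  finally show ?thesis .
qed

end

lemma set_integral_FA:
  assumes "C1c \<Omega> \<phi>"
  shows "(LINT x:\<Omega>|lborel. F (g x) * (Fgrad F (g x) \<bullet> grad \<phi> x)) = (\<integral>x. FA F (indicat_real \<Omega> x *\<^sub>R g x) \<bullet> grad \<phi> x \<partial>lborel)"
  unfolding set_lebesgue_integral_def
  by (rule Bochner_Integration.integral_cong) (auto simp: FA_def indicator_def C1c_zero_off[OF assms])

section \<open>Small parameters: minimality, regularity and stability\<close>

theorem theorem1p1:
  fixes F :: "real^'n::finite \<Rightarrow> real" and \<Omega> :: "(real^'n) set"
  assumes "CARD('n) \<ge> 2"
    and "open \<Omega>" and "connected \<Omega>" and "bounded \<Omega>" and "\<Omega> \<noteq> {}"
    and "finsler_norm F"
  shows "\<exists>lam0 > 0. \<forall>lam. 0 < lam \<and> lam < lam0 \<longrightarrow>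
           (\<exists>u g. minimal_solution F \<Omega> lam u g \<and> regular_sol \<Omega> u \<and> stable_sol F \<Omega> lam u g)"
proof -
  interpret finsler F by unfold_locales fact
  have \<Omega>: "open \<Omega>" by fact
  have [measurable]: "\<Omega> \<in> sets borel" using \<Omega> by auto
  obtain c where c: "c > 0" "\<And>\<xi> V. \<xi> \<noteq> 0 \<Longrightarrow> DA \<xi> V V \<ge> c * (norm V)\<^sup>2" using DA_lower by blast
  obtain L where L: "L > 0" "\<And>\<xi> h V. \<xi> \<noteq> 0 \<Longrightarrow> \<bar>DA \<xi> h V\<bar> \<le> L * norm h * norm V" using DA_upper by blast
  note mono = FA_strongly_monotone[OF c(2)] and lip = FA_Lipschitz[OF L(2) less_imp_le[OF L(1)]]
  obtain R where R: "R > 0" "\<And>x. x \<in> \<Omega> \<Longrightarrow> norm x \<le> R" using \<open>bounded \<Omega>\<close> bounded_pos by metis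
  define e :: "real^'n" where "e = axis undefined 1"
  have e: "norm e = 1" by (simp add: e_def)
  have Fe: "(F e)\<^sup>2 > 0" using F_pos[of e] e by force
  \<comment> \<open>An upper bound for the barrier
    \<open>R\<^sup>2 - (x \<bullet> e)\<^sup>2\<close>; it has to be fixed before
    \<open>lam0\<close>.\<close>
  define M where "M = R\<^sup>2"
  have M: "M \<ge> 0" by (simp add: M_def)
  \<comment> \<open>The first entry makes the barrier a supersolution, the second gives
    \<open>K * (4 * R\<^sup>2) \<le> c / 8\<close>.\<close>
  define lam0 where "lam0 = min (2 * (F e)\<^sup>2 / exp M) (c / (8 * (4 * R\<^sup>2) * exp M))"
  have lam0: "lam0 > 0" using Fe c(1) R(1) by (simp add: lam0_def)
  have "\<exists>u g. minimal_solution F \<Omega> lam u g \<and> regular_sol \<Omega> u \<and> stable_sol F \<Omega> lam u g" if lam: "0 < lam" "lam < lam0" for lam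
  proof -
    define K where "K = lam * exp M"
    have K: "K \<ge> 0" "K \<le> 2 * (F e)\<^sup>2" "K * (4 * R\<^sup>2) \<le> c / 8"
    proof -
      show "K \<ge> 0" using lam by (simp add: K_def)
      have "lam \<le> 2 * (F e)\<^sup>2 / exp M" "lam \<le> c / (8 * (4 * R\<^sup>2) * exp M)" using lam(2) by (auto simp: lam0_def)
      then show "K \<le> 2 * (F e)\<^sup>2" "K * (4 * R\<^sup>2) \<le> c / 8" using R(1) by (auto simp: K_def field_simps)
    qed
    define f where "f s = lam * trunc_exp M s" for s
    define \<Phi> where "\<Phi> s = lam * trunc_exp_int M s" for s
    have f: "\<bar>f s - f t\<bar> \<le> K * \<bar>s - t\<bar>" "f s \<ge> 0" "f s \<le> K" "\<bar>f s\<bar> \<le> K" for s t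
    proof -
      have "\<bar>f s - f t\<bar> = lam * \<bar>trunc_exp M s - trunc_exp M t\<bar>" using lam(1) by (simp add: f_def abs_mult flip: right_diff_distrib)
      also have "\<dots> \<le> lam * (exp M * \<bar>s - t\<bar>)" using lam(1) by (intro mult_left_mono trunc_exp_Lipschitz) auto
      finally show "\<bar>f s - f t\<bar> \<le> K * \<bar>s - t\<bar>" by (simp add: K_def)
      show "f s \<ge> 0" "f s \<le> K" "\<bar>f s\<bar> \<le> K"
        using lam(1) trunc_exp_bounds[where M=M and s=s] by (auto simp: f_def K_def abs_mult)
    qed
    have \<Phi>: "\<Phi> 0 = 0" "\<bar>\<Phi> t - \<Phi> s - f s * (t - s)\<bar> \<le> K * (t - s)\<^sup>2" for s t
    proof -
      show "\<Phi> 0 = 0" by (simp add: \<Phi>_def trunc_exp_int_0[OF M])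
      have "\<Phi> t - \<Phi> s - f s * (t - s) = lam * (trunc_exp_int M t - trunc_exp_int M s - trunc_exp M s * (t - s))"
        by (simp add: \<Phi>_def f_def algebra_simps)
      then have "\<bar>\<Phi> t - \<Phi> s - f s * (t - s)\<bar> = lam * \<bar>trunc_exp_int M t - trunc_exp_int M s - trunc_exp M s * (t - s)\<bar>"
        using lam(1) by (simp add: abs_mult)
      also have "\<dots> \<le> lam * (exp M * (t - s)\<^sup>2)" using lam(1) by (intro mult_left_mono trunc_exp_int_quadratic) auto
      finally show "\<bar>\<Phi> t - \<Phi> s - f s * (t - s)\<bar> \<le> K * (t - s)\<^sup>2" by (simp add: K_def)
    qed
    obtain u g where H: "H0 \<Omega> u g"
      and eq: "\<And>\<phi>. C1c \<Omega> \<phi> \<Longrightarrow> (\<integral>x. FA F (g x) \<bullet> grad \<phi> x \<partial>lborel) = (\<integral>x. f (u x) * \<phi> x \<partial>lborel)"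
      using semilinear_existence[OF \<Omega> R(2,1) c(1) mono L(1) lip \<Phi> f(1) K(1,3)] by blast
    note Lu = H0_D(1,2)[OF H]
    note [measurable] = L2_measurable[OF Lu(1)] L2_measurable[OF Lu(2)]
    have u0: "AE x in lborel. 0 \<le> u x" by (rule solution_nonneg[OF \<Omega> R(2,1) c(1) mono lip f(2) H eq])
    \<comment> \<open>Nonnegativity of \<open>u\<close> and of \<open>M\<close> keeps the truncated
      exponential at least 1; this is the positive lower bound that excludes critical
      points.\<close>
    have lower: "AE x in lborel. x \<in> \<Omega> \<longrightarrow> lam \<le> f (u x)"
      using u0
    proof eventually_elim
      case (elim x)
      have "1 \<le> trunc_exp M (u x)" using elim M by (simp add: trunc_exp_def)
      then show ?case using mult_left_mono[of 1 "trunc_exp M (u x)" lam] lam(1) by (simp add: f_def)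
    qed
    have gnz: "AE x in lborel. x \<in> \<Omega> \<longrightarrow> g x \<noteq> 0"
      by (rule gradient_nonzero_AE[OF \<Omega> H c(1) mono L(1) lip K(1) f(1) f(4) eq lam(1) lower])
    note compare = solution_le_supersolution[OF \<Omega> R(2,1) c(1) mono lip K(1) f(1) K(3) H eq]
    have uM: "AE x in lborel. x \<in> \<Omega> \<longrightarrow> u x \<le> M"
    proof -
      define w where "w x = indicat_real \<Omega> x * (R\<^sup>2 - (x \<bullet> e)\<^sup>2)" for x
      define gw where "gw x = indicat_real \<Omega> x *\<^sub>R ((- 2 * (x \<bullet> e)) *\<^sub>R e)" for x
      have xe: "\<bar>x \<bullet> e\<bar> \<le> R" if "x \<in> \<Omega>" for x
        using Cauchy_Schwarz_ineq2[of x e] e R(2)[OF that] by simp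
      have w0: "0 \<le> R\<^sup>2 - (x \<bullet> e)\<^sup>2" if "x \<in> \<Omega>" for x
        using power_mono[OF xe[OF that], of 2] by simp
      have wnn: "w x \<ge> 0" "w x \<le> M" for x using w0[of x] M by (auto simp: w_def indicator_def M_def)
      have "AE x in lborel. u x \<le> w x"
      proof (rule compare[where gv=gw and h="\<lambda>x. 0"])
        show "L2 w"
          by (rule L2_bounded_compact_support(1)[OF _ compact_cball[of 0 R], where M=M])
            (use wnn R(2) in \<open>auto simp: w_def[abs_def] indicator_def\<close>)
        show "L2 gw"
          by (rule L2_bounded_compact_support(1)[OF _ compact_cball[of 0 R], where M="2 * R"])
            (use xe e R in \<open>auto simp: gw_def[abs_def] indicator_def abs_mult\<close>)
        show "w x = 0" "gw x = 0" if "x \<notin> \<Omega>" for x using that by (auto simp: w_def gw_def)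
        show "H0 \<Omega> (\<lambda>x. min (w x) 0) (\<lambda>x. 0)" using wnn H0_zero by (simp add: min_absorb2)
      next
        fix \<phi> :: "real^'n \<Rightarrow> real" and i assume \<phi>: "C1c \<Omega> \<phi>"
        have D: "((\<lambda>x. R\<^sup>2 - (x \<bullet> e)\<^sup>2) has_derivative (\<lambda>h. ((- 2 * (x \<bullet> e)) *\<^sub>R e) \<bullet> h)) (at x)" for x
          by (auto intro!: derivative_eq_intros simp: inner_commute)
        have "(\<integral>x. w x * grad \<phi> x $ i \<partial>lborel) = (\<integral>x. (R\<^sup>2 - (x \<bullet> e)\<^sup>2) * (grad \<phi> x \<bullet> axis i 1) \<partial>lborel)"
          by (rule Bochner_Integration.integral_cong) (auto simp: w_def inner_axis indicator_def C1c_zero_off[OF \<phi>])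
        also have "\<dots> = - (\<integral>x. \<phi> x * (((- 2 * (x \<bullet> e)) *\<^sub>R e) \<bullet> axis i 1) \<partial>lborel)"
          by (rule integration_by_parts[OF D _ \<phi>]) (intro continuous_intros)
        also have "(\<integral>x. \<phi> x * (((- 2 * (x \<bullet> e)) *\<^sub>R e) \<bullet> axis i 1) \<partial>lborel) = (\<integral>x. gw x $ i * \<phi> x \<partial>lborel)"
          by (rule Bochner_Integration.integral_cong) (auto simp: gw_def inner_axis indicator_def C1c_zero_off[OF \<phi>])
        finally show "(\<integral>x. w x * grad \<phi> x $ i \<partial>lborel) = - (\<integral>x. gw x $ i * \<phi> x \<partial>lborel)" .
      next
        fix \<psi> assume t: "test_fun \<Omega> \<psi>" and nn: "\<And>x. \<psi> x \<ge> 0"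
        note C = test_fun_C1c[OF t]
        \<comment> \<open>The truncated nonlinearity never exceeds \<open>K\<close>, which is at
          most the constant \<open>2 * (F e)\<^sup>2\<close> produced by the barrier.\<close>
        have "(\<integral>x. f (w x) * \<psi> x \<partial>lborel) \<le> (\<integral>x. 2 * (F e)\<^sup>2 * \<psi> x \<partial>lborel)"
          by (rule integral_mono_AE') (use C1c_L2(3)[OF C] nn f(2,3) K(2) in \<open>auto intro!: AE_I2 mult_right_mono order_trans[OF f(3)]\<close>)
        also have "\<dots> = (\<integral>x. FA F (gw x) \<bullet> grad \<psi> x \<partial>lborel)"
          unfolding gw_def quadratic_barrier[OF e C] by simp
        finally show "(\<integral>x. f (w x) * \<psi> x \<partial>lborel) \<le> (\<integral>x. FA F (gw x) \<bullet> grad \<psi> x \<partial>lborel)" .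
      qed
      then show ?thesis by eventually_elim (use wnn(2) order_trans in blast)
    qed
    \<comment> \<open>Below \<open>M\<close> the truncation is inactive, so \<open>u\<close> solves
      the original problem.\<close>
    have fu: "AE x in lborel. x \<in> \<Omega> \<longrightarrow> f (u x) = lam * exp (u x)"
      using uM by eventually_elim (auto simp: f_def trunc_exp_def)
    have Iu: "indicat_real \<Omega> x *\<^sub>R g x = g x" for x using H0_D(4)[OF H, of x] by (auto simp: indicator_def)
    have sol: "weak_solution F \<Omega> lam u g"
      unfolding weak_solution_def
    proof (intro conjI allI impI)
      show "W012 \<Omega> u g" by (rule H0_W012[OF \<Omega> H])
      show "L1_loc \<Omega> (\<lambda>x. exp (u x))"
        unfolding L1_loc_def set_integrable_def
      proof (intro allI impI)
        fix S assume S: "compact S \<and> S \<subseteq> \<Omega>"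
        then have [measurable]: "S \<in> sets borel" using borel_compact by blast
        show "integrable lborel (\<lambda>x. indicat_real S x *\<^sub>R exp (u x))"
        proof (rule Bochner_Integration.integrable_bound)
          show "integrable lborel (\<lambda>x. exp M * indicat_real S x)" using S integrable_indicator_compact by auto
          show "AE x in lborel. norm (indicat_real S x *\<^sub>R exp (u x)) \<le> norm (exp M * indicat_real S x)"
            using uM by eventually_elim (use S in \<open>auto simp: indicator_def\<close>)
        qed measurable
      qed
      fix \<phi> assume t: "test_fun \<Omega> \<phi>"
      note C = test_fun_C1c[OF t] and [measurable] = C1c_measurable[OF test_fun_C1c[OF t]]
      have "(LINT x:\<Omega>|lborel. F (g x) * (Fgrad F (g x) \<bullet> grad \<phi> x)) = (\<integral>x. f (u x) * \<phi> x \<partial>lborel)"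
        unfolding set_integral_FA[OF C] Iu by (rule eq[OF C])
      also have "\<dots> = (\<integral>x. lam * (exp (u x) * \<phi> x) \<partial>lborel)"
      proof (rule integral_cong_AE)
        show "AE x in lborel. f (u x) * \<phi> x = lam * (exp (u x) * \<phi> x)"
          using fu
        proof eventually_elim
          case (elim x) then show ?case using C1c_zero_off(1)[OF C, of x] by (cases "x \<in> \<Omega>") auto
        qed
      qed (simp_all add: f_def trunc_exp_def)
      also have "\<dots> = lam * (LINT x:\<Omega>|lborel. exp (u x) * \<phi> x)"
        by (subst set_integral_zero_off) (use C1c_zero_off(1)[OF C] in auto)
      finally show "(LINT x:\<Omega>|lborel. F (g x) * (Fgrad F (g x) \<bullet> grad \<phi> x)) = lam * (LINT x:\<Omega>|lborel. exp (u x) * \<phi> x)" .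
    qed
    have minimal: "AE x in lborel. x \<in> \<Omega> \<longrightarrow> u x \<le> v x" if v: "supersolution F \<Omega> lam v" for v
    proof -
      obtain gv h where W: "W12 \<Omega> v gv" and loc: "L1_loc \<Omega> (\<lambda>x. exp (v x))" and
        sup: "\<And>\<phi>. test_fun \<Omega> \<phi> \<Longrightarrow> (\<And>x. \<phi> x \<ge> 0) \<Longrightarrow>
          (LINT x:\<Omega>|lborel. F (gv x) * (Fgrad F (gv x) \<bullet> grad \<phi> x)) \<ge> lam * (LINT x:\<Omega>|lborel. exp (v x) * \<phi> x)"
        and m: "W012 \<Omega> (\<lambda>x. min (v x) 0) h" using v unfolding supersolution_def by blast
      note Lv = W12_L2[OF \<Omega> W]
      note [measurable] = L2_measurable[OF Lv(1)]
      have wg: "weak_grad \<Omega> v gv" using W by (simp add: W12_def)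
      have "AE x in lborel. u x \<le> indicat_real \<Omega> x * v x"
      \<comment> \<open>As \<open>trunc_exp M s \<le> exp s\<close>, a supersolution of the original
        problem is one of the truncated problem; hence comparison applies although
        \<open>exp (v x)\<close> is not Lipschitz in \<open>v x\<close>.\<close>
      proof (rule compare[where gv="\<lambda>x. indicat_real \<Omega> x *\<^sub>R gv x" and h="\<lambda>x. indicat_real \<Omega> x *\<^sub>R h x"])
        show "L2 (\<lambda>x. indicat_real \<Omega> x * v x)" "L2 (\<lambda>x. indicat_real \<Omega> x *\<^sub>R gv x)" by (rule Lv)+
        fix \<phi> :: "real^'n \<Rightarrow> real" and i assume "C1c \<Omega> \<phi>"
        then show "(\<integral>x. indicat_real \<Omega> x * v x * grad \<phi> x $ i \<partial>lborel) = - (\<integral>x. (indicat_real \<Omega> x *\<^sub>R gv x) $ i * \<phi> x \<partial>lborel)"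
          by (rule weak_grad_C1c[OF \<Omega> wg Lv])
      next
        have "(\<lambda>x. indicat_real \<Omega> x * min (v x) 0) = (\<lambda>x. min (indicat_real \<Omega> x * v x) 0)" by (auto simp: indicator_def)
        then show "H0 \<Omega> (\<lambda>x. min (indicat_real \<Omega> x * v x) 0) (\<lambda>x. indicat_real \<Omega> x *\<^sub>R h x)" using W012_H0[OF \<Omega> m] by simp
        fix \<psi> assume t: "test_fun \<Omega> \<psi>" and nn: "\<And>x. \<psi> x \<ge> 0"
        note C = test_fun_C1c[OF t]
        note [measurable] = C1c_measurable[OF C]
        obtain N where N: "\<And>x. \<bar>\<psi> x\<bar> \<le> N" using C1c_bounded[OF C] by metis
        obtain S where S: "compact S" "S \<subseteq> \<Omega>" "\<And>x. x \<notin> S \<Longrightarrow> \<psi> x = 0" using C1c_supportE[OF C] by metis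
        \<comment> \<open>\<open>exp (v x)\<close> is only locally integrable, so it is paired with
          the test function through the compact support \<open>S\<close>.\<close>
        have iS: "integrable lborel (\<lambda>x. indicat_real S x * exp (v x))"
          using loc S(1,2) by (auto simp: L1_loc_def set_integrable_def)
        have mS [measurable]: "(\<lambda>x. indicat_real S x * exp (v x)) \<in> borel_measurable borel"
          using borel_measurable_integrable[OF iS] by simp
        have ie: "integrable lborel (\<lambda>x. indicat_real S x * exp (v x) * \<psi> x)"
        proof (rule integrable_dominated_real[where g="\<lambda>x. N * norm (indicat_real S x * exp (v x))"])
          show "integrable lborel (\<lambda>x. N * norm (indicat_real S x * exp (v x)))" using integrable_norm[OF iS] by simp
          show "norm (indicat_real S x * exp (v x) * \<psi> x) \<le> N * norm (indicat_real S x * exp (v x))" for x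
            using mult_right_mono[OF N[of x], of "norm (indicat_real S x * exp (v x))"] by (simp add: abs_mult mult.commute)
        qed measurable
        have "(\<integral>x. f (indicat_real \<Omega> x * v x) * \<psi> x \<partial>lborel) \<le> (\<integral>x. lam * (indicat_real S x * exp (v x) * \<psi> x) \<partial>lborel)"
        proof (rule integral_mono_AE')
          show "integrable lborel (\<lambda>x. lam * (indicat_real S x * exp (v x) * \<psi> x))" using ie by simp
          show "AE x in lborel. f (indicat_real \<Omega> x * v x) * \<psi> x \<le> lam * (indicat_real S x * exp (v x) * \<psi> x)"
          proof (intro AE_I2)
            fix x
            show "f (indicat_real \<Omega> x * v x) * \<psi> x \<le> lam * (indicat_real S x * exp (v x) * \<psi> x)"
            proof (cases "x \<in> S")
              case True
              then have "x \<in> \<Omega>" using S(2) by blast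
              have "lam * trunc_exp M (v x) * \<psi> x \<le> lam * exp (v x) * \<psi> x"
                using lam(1) nn trunc_exp_bounds(3) by (intro mult_right_mono mult_left_mono) auto
              then show ?thesis using True \<open>x \<in> \<Omega>\<close> by (simp add: f_def)
            qed (simp add: S(3))
          qed
          show "AE x in lborel. 0 \<le> lam * (indicat_real S x * exp (v x) * \<psi> x)" using lam(1) nn by simp
        qed
        also have "\<dots> = lam * (LINT x:\<Omega>|lborel. exp (v x) * \<psi> x)"
        proof -
          have "(LINT x:\<Omega>|lborel. exp (v x) * \<psi> x) = (\<integral>x. exp (v x) * \<psi> x \<partial>lborel)"
            by (rule set_integral_zero_off) (simp add: C1c_zero_off(1)[OF C])
          also have "\<dots> = (\<integral>x. indicat_real S x * exp (v x) * \<psi> x \<partial>lborel)"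
            by (rule Bochner_Integration.integral_cong) (use S(3) in \<open>auto simp: indicator_def\<close>)
          finally show ?thesis by simp
        qed
        also have "\<dots> \<le> (LINT x:\<Omega>|lborel. F (gv x) * (Fgrad F (gv x) \<bullet> grad \<psi> x))" by (rule sup[OF t nn])
        also have "\<dots> = (\<integral>x. FA F (indicat_real \<Omega> x *\<^sub>R gv x) \<bullet> grad \<psi> x \<partial>lborel)" by (rule set_integral_FA[OF C])
        finally show "(\<integral>x. f (indicat_real \<Omega> x * v x) * \<psi> x \<partial>lborel) \<le> (\<integral>x. FA F (indicat_real \<Omega> x *\<^sub>R gv x) \<bullet> grad \<psi> x \<partial>lborel)" .
      qed auto
      then show ?thesis by eventually_elim auto
    qed
    have regular: "regular_sol \<Omega> u"
      unfolding regular_sol_def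
    proof
      show "set_borel_measurable lborel \<Omega> (\<lambda>x. exp (u x))" unfolding set_borel_measurable_def by measurable
      have "AE x in lborel. x \<in> \<Omega> \<longrightarrow> exp (u x) \<le> exp M" using uM by eventually_elim simp
      then show "\<exists>C. AE x in lborel. x \<in> \<Omega> \<longrightarrow> exp (u x) \<le> C" by blast
    qed
    have stable: "stable_sol F \<Omega> lam u g"
      unfolding stable_sol_def Let_def
    proof (intro allI impI)
      fix \<phi> assume t: "test_fun \<Omega> \<phi>"
      note C = test_fun_C1c[OF t] note L\<phi> = C1c_L2[OF C] and [measurable] = C1c_measurable[OF C]
      define I where "I x = (Fgrad F (g x) \<bullet> grad \<phi> x)\<^sup>2 + F (g x) * (grad \<phi> x \<bullet> (Fhess F (g x) *v grad \<phi> x)) - lam * exp (u x) * (\<phi> x)\<^sup>2" for x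
      have Ieq: "I x = DA (g x) (grad \<phi> x) (grad \<phi> x) - lam * exp (u x) * (\<phi> x)\<^sup>2" for x
        by (simp add: I_def DA_def power2_eq_square)
      have DAb: "\<bar>DA (g x) (grad \<phi> x) (grad \<phi> x)\<bar> \<le> L * (norm (grad \<phi> x))\<^sup>2" for x
      proof (cases "g x = 0")
        case True then show ?thesis using L(1) by (simp add: DA_def)
      next
        case False
        then show ?thesis using L(2)[OF False, of "grad \<phi> x" "grad \<phi> x"] by (simp add: power2_eq_square mult.assoc)
      qed
      have [measurable]: "(\<lambda>x. Fhess F (g x) $ i) \<in> borel_measurable borel" for i
        by (rule borel_measurable_continuous_on[where f="\<lambda>M. M $ i"])
          (auto intro: linear_continuous_on bounded_linear_vec_nth)
      have hm: "(\<lambda>x. grad \<phi> x \<bullet> (Fhess F (g x) *v grad \<phi> x)) = (\<lambda>x. \<Sum>i\<in>UNIV. grad \<phi> x $ i * (Fhess F (g x) $ i \<bullet> grad \<phi> x))"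
        by (rule ext) (simp only: inner_vec_def[of "grad \<phi> _" "_ *v _"] matrix_vector_mul_component inner_real_def)
      have [measurable]: "(\<lambda>x. grad \<phi> x \<bullet> (Fhess F (g x) *v grad \<phi> x)) \<in> borel_measurable borel"
        unfolding hm by measurable
      have [measurable]: "I \<in> borel_measurable borel" unfolding I_def by measurable
      have IM: "AE x in lborel. x \<in> \<Omega> \<longrightarrow> lam * exp (u x) * (\<phi> x)\<^sup>2 \<le> K * (\<phi> x)\<^sup>2"
        using uM by eventually_elim (use lam(1) in \<open>auto simp: K_def intro!: mult_right_mono\<close>)
      note s1 = L2_integrable[OF L\<phi>(1)] and s2 = L2_integrable[OF L\<phi>(2)]
      have int: "integrable lborel (\<lambda>x. indicat_real \<Omega> x *\<^sub>R I x)"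
      proof (rule Bochner_Integration.integrable_bound)
        show "integrable lborel (\<lambda>x. L * (norm (grad \<phi> x))\<^sup>2 + K * (norm (\<phi> x))\<^sup>2)" using s1 s2 by simp
        show "AE x in lborel. norm (indicat_real \<Omega> x *\<^sub>R I x) \<le> norm (L * (norm (grad \<phi> x))\<^sup>2 + K * (norm (\<phi> x))\<^sup>2)"
          using IM
        proof eventually_elim
          case (elim x)
          have nn: "L * (norm (grad \<phi> x))\<^sup>2 + K * (norm (\<phi> x))\<^sup>2 \<ge> 0" using L(1) K(1) by simp
          show ?case
          proof (cases "x \<in> \<Omega>")
            case True
            have "0 \<le> lam * exp (u x) * (\<phi> x)\<^sup>2" using lam(1) by simp
            then have "\<bar>I x\<bar> \<le> L * (norm (grad \<phi> x))\<^sup>2 + K * (\<phi> x)\<^sup>2" using elim True DAb[of x] by (simp add: Ieq)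
            then show ?thesis using True nn by simp
          qed (use nn in simp)
        qed
      qed measurable
      \<comment> \<open>By the choice of \<open>lam0\<close> the bracket is at least
        \<open>7 * c / 8\<close>: ellipticity outweighs the zero-order term after Poincare.\<close>
      have "0 \<le> (c - K * (4 * R\<^sup>2)) * n2 (grad \<phi>)" using K(3) c(1) by (intro mult_nonneg_nonneg) auto
      also have "\<dots> = c * n2 (grad \<phi>) - K * (4 * R\<^sup>2 * n2 (grad \<phi>))" by (simp add: algebra_simps)
      also have "\<dots> \<le> c * n2 (grad \<phi>) - K * n2 \<phi>" using Poincare[OF C R(2,1)] K(1) by (simp add: mult_left_mono)
      also have "\<dots> = (\<integral>x. c * (norm (grad \<phi> x))\<^sup>2 - K * (norm (\<phi> x))\<^sup>2 \<partial>lborel)" using s1 s2 by (simp add: n2_def)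
      also have "\<dots> \<le> (\<integral>x. indicat_real \<Omega> x *\<^sub>R I x \<partial>lborel)"
      proof (rule integral_mono_AE[OF _ int])
        show "integrable lborel (\<lambda>x. c * (norm (grad \<phi> x))\<^sup>2 - K * (norm (\<phi> x))\<^sup>2)" using s1 s2 by simp
        show "AE x in lborel. c * (norm (grad \<phi> x))\<^sup>2 - K * (norm (\<phi> x))\<^sup>2 \<le> indicat_real \<Omega> x *\<^sub>R I x"
          using IM gnz
        proof eventually_elim
          case (elim x)
          show ?case
          proof (cases "x \<in> \<Omega>")
            case True
            \<comment> \<open>At critical points \<open>DA\<close> is 0 by the default values and
              the ellipticity bound would fail; they form a null set.\<close>
            then have "g x \<noteq> 0" using elim by simp
            from c(2)[OF this, of "grad \<phi> x"] elim True show ?thesis by (simp add: Ieq)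
          qed (simp add: C1c_zero_off[OF C])
        qed
      qed
      finally have "0 \<le> (\<integral>x. indicat_real \<Omega> x *\<^sub>R I x \<partial>lborel)" .
      with int show "set_integrable lborel \<Omega> (\<lambda>x. (Fgrad F (g x) \<bullet> grad \<phi> x)\<^sup>2 + F (g x) * (grad \<phi> x \<bullet> (Fhess F (g x) *v grad \<phi> x)) - lam * exp (u x) * (\<phi> x)\<^sup>2) \<and>
        0 \<le> (LINT x:\<Omega>|lborel. (Fgrad F (g x) \<bullet> grad \<phi> x)\<^sup>2 + F (g x) * (grad \<phi> x \<bullet> (Fhess F (g x) *v grad \<phi> x)) - lam * exp (u x) * (\<phi> x)\<^sup>2)"
        unfolding set_integrable_def set_lebesgue_integral_def I_def by simp
    qed
    show ?thesis unfolding minimal_solution_def using sol minimal regular stable by blast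
  qed
  then show ?thesis using lam0 by blast
qed

end
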